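(* Let $M$ be a closed oriented 3-manifold and let $\xi_0,\xi_1$ be two (positive) contact structures on $M$ which are connected by a $\sigma$-deformation. Then $\xi_0$ and $\xi_1$ are isotopic.
   Context: A positive contact structure (positive confoliation) on an oriented 3-manifold is a smooth plane field $\xi$ locally of the form $\ker\alpha$ with $\alpha\wedge d\alpha>0$ ($\alpha\wedge d\alpha\ge 0$); it is contact at a point if $\alpha\wedge d\alpha>0$ there. All contact structures and confoliations are positive. A $\sigma$-confoliation on $M$ is a confoliation $\xi$ for which there is a smooth compact surface $F\subset M$ (possibly empty), called the maximal integral surface of $\xi$, such that (1) $F$ is everywhere tangent to $\xi$; (2) $\xi$ is contact on $M-F$; (3) each connected component of $F$ has nonempty boundary. A $\sigma$-deformation is a smooth 1-parameter family $\xi_t$, $t\in[a,b]$, of plane fields on $M$ such that each $\xi_t$ is a $\sigma$-confoliation, with maximal integral surface $F_t$, and there exist a 1-parameter family $h_t$, $t\in[a,b]$, of diffeomorphisms of $M$, a partition of $[a,b]$ into finitely many nontrivial disjoint consecutive subintervals $I_1,\dots,I_k$, and compact smooth surfaces $\Sigma_1,\dots,\Sigma_k$ in $M$ such that: (1) $h_t(F_t)=\Sigma_j$ for each $t\in\mathrm{int}(I_j)$; (2) for $1\le j\le k-1$ the surfaces $\Sigma_j,\Sigma_{j+1}$ are distinct and one is contained in the other; (3) the closure of the difference (larger minus smaller) of $\Sigma_j,\Sigma_{j+1}$ is a compact surface with piecewise smooth boundary; (4) each component of the larger of $\Sigma_j,\Sigma_{j+1}$ is obtained from the smaller by attaching 1-handles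 and adding 0-handles. The family connects $\xi_a$ and $\xi_b$. Two contact structures $\xi_0,\xi_1$ are isotopic if there is a smooth 1-parameter family $\phi_t$, $t\in[0,1]$, of diffeomorphisms of $M$ with $\phi_0=\mathrm{id}$ and $(\phi_1)_*(\xi_0)=\xi_1$. *)

theory Defs
  imports "HOL-Analysis.Analysis"
begin

section \<open>Smooth functions\<close>

primrec Ck_on :: "nat \<Rightarrow> 'a set \<Rightarrow> ('a::real_normed_vector \<Rightarrow> 'b::real_normed_vector) \<Rightarrow> bool" where
  "Ck_on 0 U f \<longleftrightarrow> continuous_on U f"
| "Ck_on (Suc k) U f \<longleftrightarrow> (\<forall>x\<in>U. f differentiable (at x)) \<and>
     (\<forall>v. Ck_on k U (\<lambda>x. frechet_derivative f (at x) v))"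

text \<open>Smoothness on an arbitrary set: local extendability to a \<open>C\<^sup>\<infinity>\<close> function on an open
  set. On open sets this is the usual notion; it is needed for families parametrized by a
  closed interval.\<close>

definition smooth_on :: "'a set \<Rightarrow> ('a::real_normed_vector \<Rightarrow> 'b::real_normed_vector) \<Rightarrow> bool" where
  "smooth_on S f \<longleftrightarrow> (\<forall>x\<in>S. \<exists>U g. open U \<and> x \<in> U \<and> (\<forall>k. Ck_on k U g) \<and>
     (\<forall>y\<in>U \<inter> S. g y = f y))"

section \<open>Closed oriented 3-manifolds\<close>

type_synonym 'p chart = "'p set \<times> ('p \<Rightarrow> real^3)"

abbreviation dom_ch :: "'p chart \<Rightarrow> 'p set" where "dom_ch c \<equiv> fst c"
abbreviation map_ch :: "'p chart \<Rightarrow> 'p \<Rightarrow> real^3" where "map_ch c \<equiv> snd c"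
abbreviation img_ch :: "'p chart \<Rightarrow> (real^3) set" where "img_ch c \<equiv> snd c ` fst c"
abbreviation inv_ch :: "'p chart \<Rightarrow> real^3 \<Rightarrow> 'p" where "inv_ch c \<equiv> inv_into (fst c) (snd c)"

record 'p manifold3 =
  mtop :: "'p topology"
  atlas :: "'p chart set"

abbreviation points :: "'p manifold3 \<Rightarrow> 'p set" where "points M \<equiv> topspace (mtop M)"

definition is_chart :: "'p topology \<Rightarrow> 'p chart \<Rightarrow> bool" where
  "is_chart X c \<longleftrightarrow> openin X (dom_ch c) \<and> open (img_ch c) \<and>
     homeomorphic_map (subtopology X (dom_ch c)) (top_of_set (img_ch c)) (map_ch c)"

definition transition :: "'p chart \<Rightarrow> 'p chart \<Rightarrow> real^3 \<Rightarrow> real^3" where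
  "transition c d = map_ch d \<circ> inv_ch c"

definition oriented_compatible :: "'p chart \<Rightarrow> 'p chart \<Rightarrow> bool" where
  "oriented_compatible c d \<longleftrightarrow>
     smooth_on (map_ch c ` (dom_ch c \<inter> dom_ch d)) (transition c d) \<and>
     (\<forall>x \<in> map_ch c ` (dom_ch c \<inter> dom_ch d).
        det (matrix (frechet_derivative (transition c d) (at x))) > 0)"

text \<open>The atlas is the maximal oriented one, so its charts are precisely the positively oriented
  smooth charts. Second countability is automatic, since the space is compact and locally
  Euclidean. Connectedness is not required.\<close>

definition closed_oriented_3manifold :: "'p manifold3 \<Rightarrow> bool" where
  "closed_oriented_3manifold M \<longleftrightarrow>
     Hausdorff_space (mtop M) \<and> compact_space (mtop M) \<and>
     points M = (\<Union>c\<in>atlas M. dom_ch c) \<and>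
     (\<forall>c\<in>atlas M. is_chart (mtop M) c) \<and>
     (\<forall>c\<in>atlas M. \<forall>d\<in>atlas M. oriented_compatible c d) \<and>
     (\<forall>c. is_chart (mtop M) c \<and>
          (\<forall>d\<in>atlas M. oriented_compatible c d \<and> oriented_compatible d c) \<longrightarrow> c \<in> atlas M)"

definition charts_at :: "'p manifold3 \<Rightarrow> 'p \<Rightarrow> 'p chart set" where
  "charts_at M p = {c \<in> atlas M. p \<in> dom_ch c}"

subsection \<open>Smooth maps and diffeomorphisms\<close>

definition smooth_family_of_maps :: "'p manifold3 \<Rightarrow> real set \<Rightarrow> (real \<Rightarrow> 'p \<Rightarrow> 'p) \<Rightarrow> bool" where
  "smooth_family_of_maps M T h \<longleftrightarrow>
     continuous_map (prod_topology (top_of_set T) (mtop M)) (mtop M) (\<lambda>(t, p). h t p) \<and>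
     (\<forall>c\<in>atlas M. \<forall>d\<in>atlas M.
        smooth_on {(t, x). t \<in> T \<and> x \<in> img_ch c \<and> h t (inv_ch c x) \<in> dom_ch d}
          (\<lambda>(t, x). map_ch d (h t (inv_ch c x))))"

definition smooth_map :: "'p manifold3 \<Rightarrow> ('p \<Rightarrow> 'p) \<Rightarrow> bool" where
  "smooth_map M f \<longleftrightarrow>
     continuous_map (mtop M) (mtop M) f \<and>
     (\<forall>c\<in>atlas M. \<forall>d\<in>atlas M.
        smooth_on {x. x \<in> img_ch c \<and> f (inv_ch c x) \<in> dom_ch d}
          (\<lambda>x. map_ch d (f (inv_ch c x))))"

definition diffeomorphism :: "'p manifold3 \<Rightarrow> ('p \<Rightarrow> 'p) \<Rightarrow> bool" where
  "diffeomorphism M f \<longleftrightarrow> bij_betw f (points M) (points M) \<and>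
     smooth_map M f \<and> smooth_map M (inv_into (points M) f)"

definition smooth_family_of_diffeos :: "'p manifold3 \<Rightarrow> real set \<Rightarrow> (real \<Rightarrow> 'p \<Rightarrow> 'p) \<Rightarrow> bool" where
  "smooth_family_of_diffeos M T h \<longleftrightarrow>
     smooth_family_of_maps M T h \<and> (\<forall>t\<in>T. diffeomorphism M (h t))"

section \<open>Tangent vectors and plane fields\<close>

text \<open>A tangent vector at \<open>p\<close> is the family of its coordinate vectors in all charts around \<open>p\<close>,
  related by the derivatives of the transition maps. It is set to 0 at all other charts, so that
  equality of tangent vectors is equality of functions.\<close>

type_synonym 'p tangent_vector = "'p chart \<Rightarrow> real^3"

definition tangent_space :: "'p manifold3 \<Rightarrow> 'p \<Rightarrow> 'p tangent_vector set" where
  "tangent_space M p =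
     {v. (\<forall>c\<in>charts_at M p. \<forall>d\<in>charts_at M p.
            v d = frechet_derivative (transition c d) (at (map_ch c p)) (v c)) \<and>
         (\<forall>c. c \<notin> charts_at M p \<longrightarrow> v c = 0)}"

text \<open>The choice of the source chart is immaterial by the chain rule.\<close>

definition differential ::
  "'p manifold3 \<Rightarrow> ('p \<Rightarrow> 'p) \<Rightarrow> 'p \<Rightarrow> 'p tangent_vector \<Rightarrow> 'p tangent_vector" where
  "differential M f p v = (\<lambda>d. if d \<in> charts_at M (f p) then
       (let c = (SOME c. c \<in> charts_at M p) in
          frechet_derivative (map_ch d \<circ> f \<circ> inv_ch c) (at (map_ch c p)) (v c))
     else 0)"

type_synonym 'p field = "'p \<Rightarrow> 'p tangent_vector set"

definition in_chart :: "'p chart \<Rightarrow> 'p tangent_vector set \<Rightarrow> (real^3) set" where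
  "in_chart c P = (\<lambda>v. v c) ` P"

definition plane_field :: "'p manifold3 \<Rightarrow> 'p field \<Rightarrow> bool" where
  "plane_field M \<xi> \<longleftrightarrow> (\<forall>p\<in>points M. \<xi> p \<subseteq> tangent_space M p \<and>
     (\<forall>c\<in>charts_at M p. subspace (in_chart c (\<xi> p)) \<and> dim (in_chart c (\<xi> p)) = 2))"

definition pushforward :: "'p manifold3 \<Rightarrow> ('p \<Rightarrow> 'p) \<Rightarrow> 'p field \<Rightarrow> 'p field" where
  "pushforward M f \<xi> q =
     (let p = inv_into (points M) f q in differential M f p ` \<xi> p)"

subsection \<open>Defining 1-forms\<close>

text \<open>A 1-form in coordinates is a function \<open>\<alpha> :: real^3 \<Rightarrow> ((real^3) \<Rightarrow>\<^sub>L real)\<close>. Its exterior derivative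
  on constant vector fields is \<open>d\<alpha>(u,v) = u(\<alpha>(v)) - v(\<alpha>(u))\<close>.\<close>

definition ext_deriv :: "(real^3 \<Rightarrow> ((real^3) \<Rightarrow>\<^sub>L real)) \<Rightarrow> real^3 \<Rightarrow> real^3 \<Rightarrow> real^3 \<Rightarrow> real" where
  "ext_deriv \<alpha> x u v =
     blinfun_apply (frechet_derivative \<alpha> (at x) u) v - blinfun_apply (frechet_derivative \<alpha> (at x) v) u"

text \<open>The coefficient of \<open>\<alpha> \<and> d\<alpha>\<close> with respect to \<open>dx\<^sub>1 \<and> dx\<^sub>2 \<and> dx\<^sub>3\<close>. As the charts of the atlas are
  positively oriented, its sign is the sign of \<open>\<alpha> \<and> d\<alpha>\<close>.\<close>

definition wedge_d :: "(real^3 \<Rightarrow> ((real^3) \<Rightarrow>\<^sub>L real)) \<Rightarrow> real^3 \<Rightarrow> real" where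
  "wedge_d \<alpha> x =
     (let e1 = axis 1 1; e2 = axis 2 1; e3 = axis 3 1 in
        blinfun_apply (\<alpha> x) e1 * ext_deriv \<alpha> x e2 e3 +
        blinfun_apply (\<alpha> x) e2 * ext_deriv \<alpha> x e3 e1 +
        blinfun_apply (\<alpha> x) e3 * ext_deriv \<alpha> x e1 e2)"

definition local_form ::
  "'p field \<Rightarrow> 'p chart \<Rightarrow> (real^3) set \<Rightarrow> (real^3 \<Rightarrow> ((real^3) \<Rightarrow>\<^sub>L real)) \<Rightarrow> bool" where
  "local_form \<xi> c W \<alpha> \<longleftrightarrow> open W \<and> W \<subseteq> img_ch c \<and> smooth_on W \<alpha> \<and>
     (\<forall>x\<in>W. in_chart c (\<xi> (inv_ch c x)) = {v. blinfun_apply (\<alpha> x) v = 0})"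

section \<open>Contact structures and confoliations\<close>

definition smooth_plane_field :: "'p manifold3 \<Rightarrow> 'p field \<Rightarrow> bool" where
  "smooth_plane_field M \<xi> \<longleftrightarrow> plane_field M \<xi> \<and>
     (\<forall>p\<in>points M. \<exists>c\<in>charts_at M p. \<exists>W \<alpha>. map_ch c p \<in> W \<and> local_form \<xi> c W \<alpha>)"

definition contact_structure :: "'p manifold3 \<Rightarrow> 'p field \<Rightarrow> bool" where
  "contact_structure M \<xi> \<longleftrightarrow> smooth_plane_field M \<xi> \<and>
     (\<forall>p\<in>points M. \<exists>c\<in>charts_at M p. \<exists>W \<alpha>. map_ch c p \<in> W \<and> local_form \<xi> c W \<alpha> \<and>
        (\<forall>x\<in>W. wedge_d \<alpha> x > 0))"

definition confoliation :: "'p manifold3 \<Rightarrow> 'p field \<Rightarrow> bool" where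
  "confoliation M \<xi> \<longleftrightarrow> smooth_plane_field M \<xi> \<and>
     (\<forall>p\<in>points M. \<exists>c\<in>charts_at M p. \<exists>W \<alpha>. map_ch c p \<in> W \<and> local_form \<xi> c W \<alpha> \<and>
        (\<forall>x\<in>W. wedge_d \<alpha> x \<ge> 0))"

definition contact_at :: "'p manifold3 \<Rightarrow> 'p field \<Rightarrow> 'p \<Rightarrow> bool" where
  "contact_at M \<xi> p \<longleftrightarrow>
     (\<exists>c\<in>charts_at M p. \<exists>W \<alpha>. map_ch c p \<in> W \<and> local_form \<xi> c W \<alpha> \<and> wedge_d \<alpha> (map_ch c p) > 0)"

definition smooth_family_of_plane_fields ::
  "'p manifold3 \<Rightarrow> real \<Rightarrow> real \<Rightarrow> (real \<Rightarrow> 'p field) \<Rightarrow> bool" where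
  "smooth_family_of_plane_fields M a b \<xi> \<longleftrightarrow>
     (\<forall>t\<in>{a..b}. plane_field M (\<xi> t)) \<and>
     (\<forall>t\<in>{a..b}. \<forall>p\<in>points M. \<exists>c\<in>charts_at M p. \<exists>W (\<alpha> :: real \<times> (real^3) \<Rightarrow> ((real^3) \<Rightarrow>\<^sub>L real)).
        (t, map_ch c p) \<in> W \<and> openin (top_of_set ({a..b} \<times> img_ch c)) W \<and> smooth_on W \<alpha> \<and>
        (\<forall>(s, x)\<in>W. in_chart c (\<xi> s (inv_ch c x)) = {v. blinfun_apply (\<alpha> (s, x)) v = 0}))"

section \<open>Surfaces\<close>

definition interior_slice :: "'p manifold3 \<Rightarrow> 'p set \<Rightarrow> 'p \<Rightarrow> 'p chart \<Rightarrow> bool" where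
  "interior_slice M F p c \<longleftrightarrow> c \<in> charts_at M p \<and>
     map_ch c ` (dom_ch c \<inter> F) = img_ch c \<inter> {x. x $ 3 = 0}"

definition boundary_slice :: "'p manifold3 \<Rightarrow> 'p set \<Rightarrow> 'p \<Rightarrow> 'p chart \<Rightarrow> bool" where
  "boundary_slice M F p c \<longleftrightarrow> c \<in> charts_at M p \<and> map_ch c p $ 2 = 0 \<and>
     map_ch c ` (dom_ch c \<inter> F) = img_ch c \<inter> {x. x $ 3 = 0 \<and> x $ 2 \<ge> 0}"

definition compact_surface :: "'p manifold3 \<Rightarrow> 'p set \<Rightarrow> bool" where
  "compact_surface M F \<longleftrightarrow> compactin (mtop M) F \<and>
     (\<forall>p\<in>F. \<exists>c. interior_slice M F p c \<or> boundary_slice M F p c)"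

definition surface_tangent_plane :: "'p manifold3 \<Rightarrow> 'p set \<Rightarrow> 'p \<Rightarrow> 'p tangent_vector set" where
  "surface_tangent_plane M F p = {v \<in> tangent_space M p.
     \<forall>c. interior_slice M F p c \<or> boundary_slice M F p c \<longrightarrow> v c $ 3 = 0}"

text \<open>Topological surfaces with boundary. For a smooth compact surface, the boundary below
  consists of the points with a boundary slice chart, by invariance of domain.\<close>

definition half_plane_chart :: "'p topology \<Rightarrow> 'p set \<Rightarrow> 'p \<Rightarrow> ('p \<Rightarrow> real^2) \<Rightarrow> bool" where
  "half_plane_chart X D p g \<longleftrightarrow>
     (\<exists>V. p \<in> V \<and> openin (subtopology X D) V \<and>
          openin (top_of_set {x. x $ 2 \<ge> 0}) (g ` V) \<and>
          homeomorphic_map (subtopology X V) (top_of_set (g ` V)) g)"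

definition topological_surface :: "'p topology \<Rightarrow> 'p set \<Rightarrow> bool" where
  "topological_surface X D \<longleftrightarrow> D \<subseteq> topspace X \<and> (\<forall>p\<in>D. \<exists>g. half_plane_chart X D p g)"

definition surface_boundary :: "'p topology \<Rightarrow> 'p set \<Rightarrow> 'p set" where
  "surface_boundary X D = {p\<in>D. \<exists>g. half_plane_chart X D p g \<and> g p $ 2 = 0}"

definition smooth_arc :: "'p manifold3 \<Rightarrow> 'p set \<Rightarrow> bool" where
  "smooth_arc M C \<longleftrightarrow>
     (\<exists>\<gamma> :: real \<Rightarrow> 'p. C = \<gamma> ` {0..1} \<and> inj_on \<gamma> {0..1} \<and>
        continuous_map (top_of_set {0..1}) (mtop M) \<gamma> \<and>
        (\<forall>c\<in>atlas M. smooth_on {t\<in>{0..1}. \<gamma> t \<in> dom_ch c} (map_ch c \<circ> \<gamma>) \<and>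
           (\<forall>t\<in>{0..1}. \<gamma> t \<in> dom_ch c \<longrightarrow>
              vector_derivative (map_ch c \<circ> \<gamma>) (at t within {0..1}) \<noteq> 0)))"

text \<open>Corners of the boundary are not restricted to any local model. In particular cusps are
  allowed: if \<open>S \<subseteq> L\<close> are smooth surfaces, then at a point where their boundary curves separate
  these curves are tangent, so \<open>L - S\<close> has a corner of angle 0 there.
  Since the boundary is a closed 1-manifold, being a finite union of smooth embedded arcs means
  that each of its components is a piecewise smooth simple closed curve.\<close>

definition compact_surface_pw_smooth_boundary :: "'p manifold3 \<Rightarrow> 'p set \<Rightarrow> bool" where
  "compact_surface_pw_smooth_boundary M D \<longleftrightarrow>
     compactin (mtop M) D \<and> topological_surface (mtop M) D \<and>
     (\<forall>p\<in>D. \<exists>c\<in>charts_at M p. map_ch c ` (dom_ch c \<inter> D) \<subseteq> {x. x $ 3 = 0}) \<and>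
     (\<exists>\<C>. finite \<C> \<and> (\<forall>C\<in>\<C>. smooth_arc M C) \<and> surface_boundary (mtop M) D = \<Union>\<C>)"

text \<open>\<open>attach_handles X S L\<close>: the set \<open>L\<close> is obtained from the subset \<open>S\<close> by finitely many steps,
  each of which adds a disjoint closed disc (0-handle) or a band \<open>[0,1] \<times> [0,1]\<close> that is glued along
  \<open>{0,1} \<times> [0,1]\<close> to the boundary (1-handle).\<close>

inductive attach_handles :: "'p topology \<Rightarrow> 'p set \<Rightarrow> 'p set \<Rightarrow> bool" for X S where
  start: "attach_handles X S S"
| zero_handle: "attach_handles X S T \<Longrightarrow>
     embedding_map (top_of_set (cball (0::real^2) 1)) X e \<Longrightarrow>
     e ` cball 0 1 \<inter> T = {} \<Longrightarrow>
     attach_handles X S (T \<union> e ` cball 0 1)"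
| one_handle: "attach_handles X S T \<Longrightarrow>
     embedding_map (top_of_set ({0..1::real} \<times> {0..1::real})) X e \<Longrightarrow>
     e ` ({0..1} \<times> {0..1}) \<inter> T = e ` ({0, 1} \<times> {0..1}) \<Longrightarrow>
     e ` ({0, 1} \<times> {0..1}) \<subseteq> surface_boundary X T \<Longrightarrow>
     attach_handles X S (T \<union> e ` ({0..1} \<times> {0..1}))"

section \<open>\<open>\<sigma>\<close>-confoliations and \<open>\<sigma>\<close>-deformations\<close>

text \<open>Such an \<open>F\<close> is unique: it is the set of points where \<open>\<xi>\<close> is not contact.\<close>

definition maximal_integral_surface :: "'p manifold3 \<Rightarrow> 'p field \<Rightarrow> 'p set \<Rightarrow> bool" where
  "maximal_integral_surface M \<xi> F \<longleftrightarrow>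
     compact_surface M F \<and>
     (\<forall>p\<in>F. \<xi> p = surface_tangent_plane M F p) \<and>
     (\<forall>p\<in>points M - F. contact_at M \<xi> p) \<and>
     (\<forall>C\<in>connected_components_of (subtopology (mtop M) F).
        C \<inter> surface_boundary (mtop M) F \<noteq> {})"

definition sigma_confoliation :: "'p manifold3 \<Rightarrow> 'p field \<Rightarrow> bool" where
  "sigma_confoliation M \<xi> \<longleftrightarrow> confoliation M \<xi> \<and> (\<exists>F. maximal_integral_surface M \<xi> F)"

text \<open>The last clause says that the subintervals are disjoint and consecutive; their endpoints may
  belong to either of the adjacent subintervals.\<close>

definition interval_partition :: "real \<Rightarrow> real \<Rightarrow> nat \<Rightarrow> (nat \<Rightarrow> real set) \<Rightarrow> bool" where
  "interval_partition a b k I \<longleftrightarrow>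
     (\<Union>j\<in>{1..k}. I j) = {a..b} \<and>
     (\<forall>j\<in>{1..k}. is_interval (I j) \<and> interior (I j) \<noteq> {}) \<and>
     (\<forall>i\<in>{1..k}. \<forall>j\<in>{1..k}. i < j \<longrightarrow> (\<forall>x\<in>I i. \<forall>y\<in>I j. x < y))"

text \<open>\<open>L\<close> is the larger and \<open>S\<close> the smaller of two consecutive surfaces of a deformation.\<close>

definition handle_extension :: "'p manifold3 \<Rightarrow> 'p set \<Rightarrow> 'p set \<Rightarrow> bool" where
  "handle_extension M S L \<longleftrightarrow> S \<subset> L \<and>
     compact_surface_pw_smooth_boundary M (mtop M closure_of (L - S)) \<and>
     (\<forall>C\<in>connected_components_of (subtopology (mtop M) L). attach_handles (mtop M) (S \<inter> C) C)"

definition sigma_deformation ::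
  "'p manifold3 \<Rightarrow> real \<Rightarrow> real \<Rightarrow> (real \<Rightarrow> 'p field) \<Rightarrow> bool" where
  "sigma_deformation M a b \<xi> \<longleftrightarrow> a < b \<and>
     smooth_family_of_plane_fields M a b \<xi> \<and>
     (\<forall>t\<in>{a..b}. sigma_confoliation M (\<xi> t)) \<and>
     (\<exists>F h k I S.
        (\<forall>t\<in>{a..b}. maximal_integral_surface M (\<xi> t) (F t)) \<and>
        smooth_family_of_diffeos M {a..b} h \<and>
        interval_partition a b k I \<and>
        (\<forall>j\<in>{1..k}. compact_surface M (S j)) \<and>
        (\<forall>j\<in>{1..k}. \<forall>t\<in>interior (I j). h t ` F t = S j) \<and>
        (\<forall>j\<in>{1..<k}. handle_extension M (S j) (S (Suc j)) \<or> handle_extension M (S (Suc j)) (S j)))"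

definition connected_by_sigma_deformation :: "'p manifold3 \<Rightarrow> 'p field \<Rightarrow> 'p field \<Rightarrow> bool" where
  "connected_by_sigma_deformation M \<xi>0 \<xi>1 \<longleftrightarrow>
     (\<exists>a b \<xi>. sigma_deformation M a b \<xi> \<and> (\<forall>p\<in>points M. \<xi> a p = \<xi>0 p \<and> \<xi> b p = \<xi>1 p))"

definition isotopic :: "'p manifold3 \<Rightarrow> 'p field \<Rightarrow> 'p field \<Rightarrow> bool" where
  "isotopic M \<xi>0 \<xi>1 \<longleftrightarrow>
     (\<exists>\<phi>. smooth_family_of_diffeos M {0..1} \<phi> \<and>
        (\<forall>p\<in>points M. \<phi> 0 p = p) \<and>
        (\<forall>p\<in>points M. pushforward M (\<phi> 1) \<xi>0 p = \<xi>1 p))"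

end

theory Submission
  imports Defs
begin

text \<open>
  If \<open>\<xi> = ker \<alpha>\<close> and \<open>E\<close> is an endomorphism field of the tangent bundle, then
  \<open>{v. v + s E v \<in> \<xi>}\<close> is the kernel of \<open>\<alpha> + s \<beta>\<close> with \<open>\<beta> = \<alpha> \<circ> E\<close>, and
  \<open>\<alpha> \<and> d\<alpha>\<close> changes to first order in \<open>s\<close> by \<open>\<alpha> \<and> d\<beta> + \<beta> \<and> d\<alpha>\<close>. For a
  \<open>\<sigma>\<close>-confoliation there is an \<open>E\<close> that makes this first order term positive along the maximal
  integral surface \<open>F\<close>: a rapidly decaying radial bump times a rotation gives positivity on a ball of
  \<open>F\<close> except near its centre; starting with centres just outside \<open>F\<close>, at the boundary, positivity
  spreads over every component. Positivity is an open condition in the time parameter, and the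
  condition on \<open>E\<close> is convex, so a partition of the time interval yields a continuous family \<open>E\<^sub>t\<close>
  and an \<open>s\<^sub>1 > 0\<close> such that the deformed plane fields are contact for all \<open>t\<close> and \<open>0 < s \<le> s\<^sub>1\<close>.
  The path \<open>(a, 0), (a, s\<^sub>1), (b, s\<^sub>1), (b, 0)\<close> in the \<open>(t, s)\<close>-plane therefore consists of contact
  structures, and nearby contact structures are isotopic by Gray's argument, applied in one chart at a
  time.
\<close>


section \<open>Smooth functions\<close>

text \<open>A plane field need not be coorientable, so adding a global 1-form makes no sense. An
  endomorphism field avoids this: \<alpha> \<circ> E picks up the same local factor as \<alpha>, and
  the first order term picks up its square, so the sign of that term is well defined. The obstacle
  is this sign along F. In slice coordinates \<alpha> is a multiple of dx3 there, and the term
  consists of d\<beta> on F plus terms that do not differentiate \<beta>. When \<alpha> is closed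
  near an oriented closed F, Stokes' theorem forbids positivity; this is where boundary on each
  component matters. The bump is exp(-L/m), with m = R^2 - r^2 at distance r from the centre. Its
  derivative with respect to m is L/m^2 times its value, so a large L outweighs every
  undifferentiated term, except near the centre, where the radial derivative vanishes. A centre off
  F does no harm; a centre on F is repaired by adding a large multiple of an endomorphism already
  positive there. The surfaces F may change abruptly with t, so positivity is required at the points
  where the plane field is not contact. In this form it persists for nearby t.\<close>

lemma Ck_on_cong:
  assumes "open U" "\<And>x. x \<in> U \<Longrightarrow> f x = g x" "Ck_on k U f"
  shows "Ck_on k U g"
  using assms
proof (induction k arbitrary: f g)
  case 0
  then show ?case by (metis Ck_on.simps(1) continuous_on_cong)
next
  case (Suc k)
  have eq: "frechet_derivative f (at x) = frechet_derivative g (at x)" if "x \<in> U" for x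
    using frechet_derivative_transform_within_open[of f x U g] Suc.prems that by auto
  have "g differentiable (at x)" if "x \<in> U" for x
    using Suc.prems that has_derivative_transform_within_open[of f "frechet_derivative f (at x)" x UNIV U g]
    by (metis Ck_on.simps(2) differentiableI frechet_derivative_works)
  moreover have "Ck_on k U (\<lambda>x. frechet_derivative g (at x) v)" for v
    by (rule Suc.IH[of "\<lambda>x. frechet_derivative f (at x) v"]) (use Suc.prems eq in auto)
  ultimately show ?case by simp
qed

lemma Ck_on_subset: "Ck_on k U f \<Longrightarrow> V \<subseteq> U \<Longrightarrow> Ck_on k V f"
  by (induction k arbitrary: f) (auto intro: continuous_on_subset)

lemma Ck_on_continuous: "Ck_on k U f \<Longrightarrow> continuous_on U f"
  by (cases k) (auto simp: continuous_at_imp_continuous_on differentiable_imp_continuous_within)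

lemma Ck_on_local:
  assumes "\<And>x. x \<in> U \<Longrightarrow> \<exists>V. open V \<and> x \<in> V \<and> Ck_on k V f"
  shows "Ck_on k U f"
  using assms
proof (induction k arbitrary: f)
  case 0
  then have "isCont f x" if "x \<in> U" for x
    using that by (metis Ck_on.simps(1) continuous_on_eq_continuous_at)
  then show ?case by (simp add: continuous_at_imp_continuous_on)
next
  case (Suc k)
  then show ?case by fastforce
qed

lemma Ck_on_SucD: "Ck_on (Suc k) U f \<Longrightarrow> Ck_on k U f"
proof (induction k arbitrary: f)
  case 0
  then show ?case by (metis Ck_on.simps(1) Ck_on_continuous)
next
  case (Suc k)
  then show ?case by (metis Ck_on.simps(2))
qed

text \<open>Inductions on \<open>k\<close> need an explicit derivative formula.
  \<open>frechet_derivative\<close> is a choice that agrees with \<open>f'\<close> at the points of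
  \<open>U\<close>; openness of \<open>U\<close> then transfers smoothness from one to the
  other.\<close>

lemma Ck_on_SucI:
  assumes "open U" "\<And>x. x \<in> U \<Longrightarrow> (f has_derivative f' x) (at x)"
    "\<And>v. Ck_on k U (\<lambda>x. f' x v)"
  shows "Ck_on (Suc k) U f"
proof -
  have "frechet_derivative f (at x) = f' x" if "x \<in> U" for x
    using assms(2) that frechet_derivative_at by metis
  then have "Ck_on k U (\<lambda>x. frechet_derivative f (at x) v)" for v
    using Ck_on_cong[OF assms(1) _ assms(3)[of v]] by auto
  then show ?thesis using assms(2) by (auto simp: differentiable_def)
qed

lemma Ck_on_SucE:
  assumes "Ck_on (Suc k) U f" "x \<in> U"
  shows "(f has_derivative frechet_derivative f (at x)) (at x)"
  using assms frechet_derivative_works by auto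

lemma Ck_on_const: "open U \<Longrightarrow> Ck_on k U (\<lambda>x. c)"
proof (induction k arbitrary: c)
  case (Suc k)
  then show ?case by (intro Ck_on_SucI[where f'="\<lambda>x v. 0"]) auto
qed auto

lemma Ck_on_linear_comp:
  assumes "bounded_linear L" "open U" "Ck_on k U f"
  shows "Ck_on k U (\<lambda>x. L (f x))"
  using assms(3)
proof (induction k arbitrary: f)
  case 0
  then show ?case using assms(1) by (auto intro: bounded_linear.continuous_on)
next
  case (Suc k)
  show ?case
    by (rule Ck_on_SucI[where f'="\<lambda>x v. L (frechet_derivative f (at x) v)"])
      (use Suc assms Ck_on_SucE[OF Suc.prems] in \<open>auto intro: bounded_linear.has_derivative\<close>)
qed

lemma Ck_on_id: "open U \<Longrightarrow> Ck_on k U (\<lambda>x. x)"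
  by (cases k) (auto intro!: Ck_on_SucI[where f'="\<lambda>x v. v"] Ck_on_const simp: continuous_on_id)

lemma Ck_on_linear: "bounded_linear L \<Longrightarrow> open U \<Longrightarrow> Ck_on k U L"
  using Ck_on_linear_comp[OF _ _ Ck_on_id] .

lemma Ck_on_add:
  assumes "open U" "Ck_on k U f" "Ck_on k U g"
  shows "Ck_on k U (\<lambda>x. f x + g x)"
  using assms(2,3)
proof (induction k arbitrary: f g)
  case 0
  then show ?case by (auto intro: continuous_intros)
next
  case (Suc k)
  show ?case
    by (rule Ck_on_SucI[where f'="\<lambda>x v. frechet_derivative f (at x) v + frechet_derivative g (at x) v"])
      (use Suc assms Ck_on_SucE[OF Suc.prems(1)] Ck_on_SucE[OF Suc.prems(2)] in
        \<open>auto intro!: derivative_intros\<close>)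
qed

lemma Ck_on_bilinear:
  assumes "bounded_bilinear B" "open U" "Ck_on k U f" "Ck_on k U g"
  shows "Ck_on k U (\<lambda>x. B (f x) (g x))"
  using assms(3,4)
proof (induction k arbitrary: f g)
  case 0
  then show ?case using assms(1) by (auto intro: bounded_bilinear.continuous_on)
next
  case (Suc k)
  have fg: "Ck_on k U f" "Ck_on k U g" using Suc.prems Ck_on_SucD by auto
  show ?case
    by (rule Ck_on_SucI[where f'="\<lambda>x v. B (f x) (frechet_derivative g (at x) v) + B (frechet_derivative f (at x) v) (g x)"])
     (use Suc assms fg Ck_on_SucE[OF Suc.prems(1)] Ck_on_SucE[OF Suc.prems(2)] in
        \<open>auto intro!: Ck_on_add bounded_bilinear.FDERIV\<close>)
qed

lemma Ck_on_sum:
  assumes "open U" "\<And>i. i \<in> I \<Longrightarrow> Ck_on k U (f i)"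
  shows "Ck_on k U (\<lambda>x. \<Sum>i\<in>I. f i x)"
  using assms(2)
  by (induction I rule: infinite_finite_induct) (auto intro: Ck_on_const Ck_on_add assms(1))

lemma linear_basis_sum:
  fixes L :: "'a::euclidean_space \<Rightarrow> 'b::real_vector"
  assumes "linear L"
  shows "L v = (\<Sum>i\<in>Basis. (v \<bullet> i) *\<^sub>R L i)"
  by (metis (no_types, lifting) assms euclidean_representation linear_scale linear_sum sum.cong)

text \<open>The chain rule yields g'(f x) applied to a vector that moves with x. Expanding this
  vector in \<open>Basis\<close> leaves g'(f x) i with fixed i, to which the induction hypothesis
  applies; hence the Euclidean middle space.\<close>

lemma Ck_on_compose:
  fixes f :: "'a::real_normed_vector \<Rightarrow> 'b::euclidean_space"
  assumes "open U" "open V" "Ck_on k U f" "Ck_on k V g" "f ` U \<subseteq> V"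
  shows "Ck_on k U (\<lambda>x. g (f x))"
  using assms(3-5)
proof (induction k arbitrary: g)
  case 0
  then show ?case by (auto intro: continuous_on_compose2)
next
  case (Suc k)
  let ?f' = "\<lambda>x. frechet_derivative f (at x)" and ?g' = "\<lambda>y. frechet_derivative g (at y)"
  have fk: "Ck_on k U f" using Suc.prems Ck_on_SucD by blast
  have lin: "linear (?g' (f x))" if "x \<in> U" for x
    using Suc.prems that by (metis Ck_on_SucE has_derivative_linear image_subset_iff)
  have der: "((\<lambda>x. g (f x)) has_derivative (\<lambda>v. ?g' (f x) (?f' x v))) (at x)" if "x \<in> U" for x
    using has_derivative_compose[OF Ck_on_SucE[OF Suc.prems(1) that], of g "?g' (f x)"]
      Ck_on_SucE[OF Suc.prems(2)] that Suc.prems(3) by auto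
  have "Ck_on k U (\<lambda>x. ?g' (f x) (?f' x v))" for v
  proof (rule Ck_on_cong[OF assms(1)])
    show "Ck_on k U (\<lambda>x. \<Sum>i\<in>Basis. (?f' x v \<bullet> i) *\<^sub>R ?g' (f x) i)"
      using Suc.prems fk assms(1) Suc.IH[of "\<lambda>y. ?g' y _"]
      by (intro Ck_on_sum Ck_on_bilinear[OF bounded_bilinear_scaleR]
          Ck_on_linear_comp[OF bounded_linear_inner_left]) auto
    show "(\<Sum>i\<in>Basis. (?f' x v \<bullet> i) *\<^sub>R ?g' (f x) i) = ?g' (f x) (?f' x v)" if "x \<in> U" for x
      using linear_basis_sum[OF lin[OF that], symmetric] .
  qed
  then show ?case using Ck_on_SucI[OF assms(1) der] by blast
qed

text \<open>Openness is bundled in, so that a single fact supplies the neighbourhoods needed to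
  differentiate and to replace functions by equal ones.\<close>

definition Cinf :: "'a set \<Rightarrow> ('a::real_normed_vector \<Rightarrow> 'b::real_normed_vector) \<Rightarrow> bool" where
  "Cinf U f \<longleftrightarrow> open U \<and> (\<forall>k. Ck_on k U f)"

lemma Cinf_open: "Cinf U f \<Longrightarrow> open U"
  by (simp add: Cinf_def)

lemma Cinf_cong: "Cinf U f \<Longrightarrow> (\<And>x. x \<in> U \<Longrightarrow> f x = g x) \<Longrightarrow> Cinf U g"
  unfolding Cinf_def using Ck_on_cong by blast

lemma Cinf_subset: "Cinf U f \<Longrightarrow> open V \<Longrightarrow> V \<subseteq> U \<Longrightarrow> Cinf V f"
  unfolding Cinf_def using Ck_on_subset by blast

lemma Cinf_local:
  assumes "\<And>x. x \<in> U \<Longrightarrow> \<exists>V. x \<in> V \<and> Cinf V f" "open U"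
  shows "Cinf U f"
  unfolding Cinf_def using assms Ck_on_local[of U _ f] unfolding Cinf_def by metis

lemma Cinf_continuous: "Cinf U f \<Longrightarrow> continuous_on U f"
  by (auto simp: Cinf_def intro: Ck_on_continuous)

lemma Cinf_has_derivative:
  "Cinf U f \<Longrightarrow> x \<in> U \<Longrightarrow> (f has_derivative frechet_derivative f (at x)) (at x)"
  unfolding Cinf_def using Ck_on_SucE by blast

lemma Cinf_derivative: "Cinf U f \<Longrightarrow> Cinf U (\<lambda>x. frechet_derivative f (at x) v)"
  unfolding Cinf_def by (metis Ck_on.simps(2))

named_theorems cinf_intros

lemma Cinf_const [cinf_intros]: "open U \<Longrightarrow> Cinf U (\<lambda>x. c)"
  by (simp add: Cinf_def Ck_on_const)

lemma Cinf_id [cinf_intros]: "open U \<Longrightarrow> Cinf U (\<lambda>x. x)"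
  by (simp add: Cinf_def Ck_on_id)

lemma Cinf_linear_comp: "bounded_linear L \<Longrightarrow> Cinf U f \<Longrightarrow> Cinf U (\<lambda>x. L (f x))"
  by (simp add: Cinf_def Ck_on_linear_comp)

lemma Cinf_bilinear: "bounded_bilinear B \<Longrightarrow> Cinf U f \<Longrightarrow> Cinf U g \<Longrightarrow> Cinf U (\<lambda>x. B (f x) (g x))"
  by (simp add: Cinf_def Ck_on_bilinear)

lemma Cinf_add [cinf_intros]: "Cinf U f \<Longrightarrow> Cinf U g \<Longrightarrow> Cinf U (\<lambda>x. f x + g x)"
  by (simp add: Cinf_def Ck_on_add)

lemma Cinf_sum [cinf_intros]:
  "open U \<Longrightarrow> (\<And>i. i \<in> I \<Longrightarrow> Cinf U (f i)) \<Longrightarrow> Cinf U (\<lambda>x. \<Sum>i\<in>I. f i x)"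
  by (simp add: Cinf_def Ck_on_sum)

lemma Cinf_compose:
  fixes f :: "'a::real_normed_vector \<Rightarrow> 'b::euclidean_space"
  shows "Cinf U f \<Longrightarrow> Cinf V g \<Longrightarrow> f ` U \<subseteq> V \<Longrightarrow> Cinf U (\<lambda>x. g (f x))"
  unfolding Cinf_def using Ck_on_compose by blast

lemma Cinf_compose_UNIV:
  fixes f :: "'a::real_normed_vector \<Rightarrow> 'b::euclidean_space"
  shows "Cinf UNIV g \<Longrightarrow> Cinf U f \<Longrightarrow> Cinf U (\<lambda>x. g (f x))"
  using Cinf_compose by blast

lemmas Cinf_scaleR [cinf_intros] = Cinf_bilinear[OF bounded_bilinear_scaleR]
lemmas Cinf_inner [cinf_intros] = Cinf_bilinear[OF bounded_bilinear_inner]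
lemmas Cinf_mult [cinf_intros] = Cinf_bilinear[OF bounded_bilinear_mult]
lemmas Cinf_minus [cinf_intros] = Cinf_linear_comp[OF bounded_linear_minus[OF bounded_linear_ident]]
lemmas Cinf_fst [cinf_intros] = Cinf_linear_comp[OF bounded_linear_fst]
lemmas Cinf_snd [cinf_intros] = Cinf_linear_comp[OF bounded_linear_snd]
lemmas Cinf_vec_nth [cinf_intros] = Cinf_linear_comp[OF bounded_linear_vec_nth]

lemma Cinf_diff [cinf_intros]: "Cinf U f \<Longrightarrow> Cinf U g \<Longrightarrow> Cinf U (\<lambda>x. f x - g x)"
  using Cinf_add[OF _ Cinf_minus, of U f g] by simp

lemma Cinf_Pair [cinf_intros]:
  assumes "Cinf U f" "Cinf U g"
  shows "Cinf U (\<lambda>x. (f x, g x))"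
proof -
  have "Cinf U (\<lambda>x. (f x, 0) + (0, g x))"
    using assms
    by (intro Cinf_add Cinf_linear_comp[of "\<lambda>x. (x, 0)"] Cinf_linear_comp[of "\<lambda>x. (0, x)"])
      (auto intro: bounded_linear_Pair bounded_linear_ident bounded_linear_zero)
  then show ?thesis by simp
qed

lemma Cinf_componentwise:
  fixes f :: "'a::real_normed_vector \<Rightarrow> real^'n"
  assumes "open U" "\<And>i. Cinf U (\<lambda>x. f x $ i)"
  shows "Cinf U f"
proof -
  have "Cinf U (\<lambda>x. \<Sum>i\<in>UNIV. (f x $ i) *\<^sub>R axis i (1::real))"
    using assms by (intro Cinf_sum Cinf_scaleR Cinf_const) auto
  then show ?thesis
    by (rule Cinf_cong) (simp add: vec_eq_iff axis_def if_distrib cong: if_cong)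
qed

lemma Ck_on_inverse:
  fixes f :: "'a::real_normed_vector \<Rightarrow> real"
  assumes "open U" "Ck_on k U f" "\<And>x. x \<in> U \<Longrightarrow> f x \<noteq> 0"
  shows "Ck_on k U (\<lambda>x. inverse (f x))"
  using assms(2)
proof (induction k)
  case 0
  then show ?case using assms(3) by (auto intro: continuous_intros)
next
  case (Suc k)
  have fk: "Ck_on k U f" using Suc.prems Ck_on_SucD by blast
  show ?case
  proof (rule Ck_on_SucI[where f'="\<lambda>x v. - (inverse (f x) * frechet_derivative f (at x) v * inverse (f x))"])
    show "((\<lambda>x. inverse (f x)) has_derivative
        (\<lambda>v. - (inverse (f x) * frechet_derivative f (at x) v * inverse (f x)))) (at x)" if "x \<in> U" for x
      using Deriv.has_derivative_inverse[OF assms(3)[OF that] Ck_on_SucE[OF Suc.prems that]] by simp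
    show "Ck_on k U (\<lambda>x. - (inverse (f x) * frechet_derivative f (at x) v * inverse (f x)))" for v
      using Suc fk assms(1)
      by (intro Ck_on_linear_comp[OF bounded_linear_minus[OF bounded_linear_ident]]
        Ck_on_bilinear[OF bounded_bilinear_mult]) auto
  qed (use assms in auto)
qed

lemma Cinf_inverse:
  fixes f :: "'a::real_normed_vector \<Rightarrow> real"
  shows "Cinf U f \<Longrightarrow> (\<And>x. x \<in> U \<Longrightarrow> f x \<noteq> 0) \<Longrightarrow> Cinf U (\<lambda>x. inverse (f x))"
  by (auto simp: Cinf_def Ck_on_inverse)

lemma Cinf_divide:
  fixes f :: "'a::real_normed_vector \<Rightarrow> real"
  shows "Cinf U f \<Longrightarrow> Cinf U g \<Longrightarrow> (\<And>x. x \<in> U \<Longrightarrow> g x \<noteq> 0) \<Longrightarrow> Cinf U (\<lambda>x. f x / g x)"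
  unfolding divide_inverse by (intro Cinf_mult Cinf_inverse)

text \<open>\<open>Cinf_derivative\<close> covers constant directions only; the moving direction
  \<open>v x\<close> is expanded in \<open>Basis\<close>.\<close>

lemma Cinf_derivative_varying:
  fixes f :: "'a::euclidean_space \<Rightarrow> 'b::real_normed_vector"
  assumes "Cinf U f" "Cinf V g" "Cinf V v" "g ` V \<subseteq> U"
  shows "Cinf V (\<lambda>x. frechet_derivative f (at (g x)) (v x))"
proof -
  have "Cinf V (\<lambda>x. \<Sum>i\<in>Basis. (v x \<bullet> i) *\<^sub>R frechet_derivative f (at (g x)) i)"
    using assms Cinf_open[OF assms(2)]
    by (intro cinf_intros Cinf_compose[OF assms(2) Cinf_derivative[OF assms(1)]]) auto
  then show ?thesis
  proof (rule Cinf_cong)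
    fix x assume "x \<in> V"
    then have "linear (frechet_derivative f (at (g x)))"
      using assms Cinf_has_derivative[OF assms(1), of "g x"] has_derivative_linear by blast
    then show "(\<Sum>i\<in>Basis. (v x \<bullet> i) *\<^sub>R frechet_derivative f (at (g x)) i)
      = frechet_derivative f (at (g x)) (v x)"
      using linear_basis_sum by metis
  qed
qed

lemma smooth_on_open_iff: "open U \<Longrightarrow> smooth_on U f \<longleftrightarrow> Cinf U f"
proof
  assume U: "open U" and "smooth_on U f"
  show "Cinf U f"
  proof (rule Cinf_local[OF _ U])
    fix x assume "x \<in> U"
    then obtain V g where V: "open V" "x \<in> V" "\<forall>k. Ck_on k V g" "\<forall>y\<in>V \<inter> U. g y = f y"
      using \<open>smooth_on U f\<close> unfolding smooth_on_def by blast
    then have "Cinf (V \<inter> U) g"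
      using U by (auto simp: Cinf_def intro: Ck_on_subset)
    then show "\<exists>V. x \<in> V \<and> Cinf V f"
      using V \<open>x \<in> U\<close> Cinf_cong[of "V \<inter> U" g f] by auto
  qed
qed (auto simp: smooth_on_def Cinf_def)

lemma Cinf_smooth_on: "Cinf U f \<Longrightarrow> S \<subseteq> U \<Longrightarrow> smooth_on S f"
  unfolding smooth_on_def Cinf_def by blast


section \<open>Differentiability from continuous partial derivatives\<close>

text \<open>The mean value inequality for \<open>f t - t *\<^sub>R c\<close>, whose derivative is
  \<open>f' t - c\<close>. It measures how far an increment deviates from a predicted one.\<close>

lemma vector_mean_value:
  fixes f :: "real \<Rightarrow> 'b::real_normed_vector"
  assumes "\<And>t. t \<in> {0..1} \<Longrightarrow> (f has_vector_derivative f' t) (at t)"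
    "\<And>t. t \<in> {0..1} \<Longrightarrow> norm (f' t - c) \<le> e"
  shows "norm (f 1 - f 0 - c) \<le> e"
proof -
  let ?g = "\<lambda>t. f t - t *\<^sub>R c"
  have "norm (?g 1 - ?g 0) \<le> e * norm (1 - 0 :: real)"
  proof (rule differentiable_bound[of "{0..1}" ?g "\<lambda>t h. h *\<^sub>R (f' t - c)"])
    fix t :: real assume t: "t \<in> {0..1}"
    have "(?g has_vector_derivative (f' t - c)) (at t within {0..1})"
    proof (rule has_vector_derivative_diff)
      show "(f has_vector_derivative f' t) (at t within {0..1})"
        by (rule has_vector_derivative_at_within[OF assms(1)[OF t]])
      show "((\<lambda>t. t *\<^sub>R c) has_vector_derivative c) (at t within {0..1})"
        unfolding has_vector_derivative_def
        by (rule has_derivative_scaleR_left[OF has_derivative_ident])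
    qed
    then show "(?g has_derivative (\<lambda>h. h *\<^sub>R (f' t - c))) (at t within {0..1})"
      by (simp add: has_vector_derivative_def)
    show "onorm (\<lambda>h. h *\<^sub>R (f' t - c)) \<le> e"
    proof (rule onorm_le)
      fix h show "norm (h *\<^sub>R (f' t - c)) \<le> e * norm h"
        using mult_right_mono[OF assms(2)[OF t], of "\<bar>h\<bar>"] by (simp add: mult.commute)
    qed
  qed auto
  then show ?thesis by (simp add: algebra_simps)
qed

text \<open>Along a fixed enumeration of the basis one moves from \<open>x\<close> to \<open>x + v\<close> in coordinate
  directions, each step being controlled by the mean value inequality.\<close>

lemma has_derivative_of_continuous_partials:
  fixes f :: "'a::euclidean_space \<Rightarrow> 'b::real_normed_vector"
  assumes U: "open U" "x \<in> U"
    and part: "\<And>y i. y \<in> U \<Longrightarrow> i \<in> Basis \<Longrightarrow>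
      ((\<lambda>t. f (y + t *\<^sub>R i)) has_vector_derivative g i y) (at 0)"
    and cont: "\<And>i. i \<in> Basis \<Longrightarrow> continuous_on U (g i)"
  shows "(f has_derivative (\<lambda>v. \<Sum>i\<in>Basis. (v \<bullet> i) *\<^sub>R g i x)) (at x)"
proof -
  let ?p = "\<lambda>S v. \<Sum>i\<in>S. (v \<bullet> i) *\<^sub>R i"
  have pn: "norm (?p S v) \<le> real DIM('a) * norm v" if "S \<subseteq> Basis" for S and v :: 'a
  proof -
    have "norm (?p S v) \<le> (\<Sum>i\<in>S. norm ((v \<bullet> i) *\<^sub>R i))" by (rule norm_sum)
    also have "\<dots> \<le> (\<Sum>i\<in>Basis. norm ((v \<bullet> i) *\<^sub>R i))"
      using that by (intro sum_mono2) auto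
    also have "\<dots> \<le> (\<Sum>i\<in>(Basis::'a set). norm v)"
      by (intro sum_mono) (simp add: Basis_le_norm)
    finally show ?thesis by simp
  qed
  have key: "\<exists>d>0. \<forall>v. norm v < d \<longrightarrow>
      norm (f (x + ?p S v) - f x - (\<Sum>i\<in>S. (v \<bullet> i) *\<^sub>R g i x)) \<le> real (card S) * (e * norm v)"
    if "S \<subseteq> Basis" "e > 0" for S e
    using finite_subset[OF that(1) finite_Basis] that(1)
  proof (induction S rule: finite_induct)
    case empty
    then show ?case by (auto intro!: exI[of _ 1])
  next
    case (insert i S)
    then have i: "i \<in> Basis" and S: "S \<subseteq> Basis" by auto
    obtain d where d: "d > 0" "\<forall>v. norm v < d \<longrightarrow>
      norm (f (x + ?p S v) - f x - (\<Sum>i\<in>S. (v \<bullet> i) *\<^sub>R g i x)) \<le> real (card S) * (e * norm v)"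
      using insert.IH[OF S] by (elim exE conjE)
    have "isCont (g i) x" using cont[OF i] U by (simp add: continuous_on_eq_continuous_at)
    then obtain r0 where r0: "r0 > 0" "\<And>y. dist y x < r0 \<Longrightarrow> dist (g i y) (g i x) < e"
      using \<open>e > 0\<close> unfolding continuous_at_eps_delta by blast
    obtain r1 where r1: "r1 > 0" "ball x r1 \<subseteq> U" using U open_contains_ball by blast
    define r where "r = min r0 r1"
    have r: "r > 0" using r0 r1 by (simp add: r_def)
    \<comment> \<open>Chosen so that (DIM + 1) * norm v is at most r / 2, which keeps the whole
      segment \<open>?h\<close> in the ball of radius r.\<close>
    define d' where "d' = min d (r / (2 * real DIM('a) + 2))"
    have d': "d' > 0" using d r by (simp add: d'_def)
    show ?case
    proof (intro exI[of _ d'] conjI allI impI d')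
      fix v :: 'a assume v: "norm v < d'"
      let ?h = "\<lambda>t. x + ?p S v + (t * (v \<bullet> i)) *\<^sub>R i"
      have hr: "dist (?h t) x < r" if "t \<in> {0..1}" for t
      proof -
        have "norm ((t * (v \<bullet> i)) *\<^sub>R i) \<le> 1 * norm v"
          using that i Basis_le_norm[OF i, of v] mult_mono[of "\<bar>t\<bar>" 1 "\<bar>v \<bullet> i\<bar>" "norm v"]
          by (simp add: abs_mult)
        moreover have "dist (?h t) x = norm (?p S v + (t * (v \<bullet> i)) *\<^sub>R i)"
          by (simp add: dist_norm add.assoc)
        ultimately have "dist (?h t) x \<le> (real DIM('a) + 1) * norm v"
          using norm_triangle_ineq[of "?p S v" "(t * (v \<bullet> i)) *\<^sub>R i"] pn[OF S, of v]
          by (simp add: algebra_simps)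
        also have "\<dots> \<le> (real DIM('a) + 1) * (r / (2 * real DIM('a) + 2))"
          using v by (intro mult_left_mono) (auto simp: d'_def)
        also have "\<dots> = r / 2" by (simp add: field_simps)
        finally show ?thesis using r by simp
      qed
      have hU: "?h t \<in> U" if "t \<in> {0..1}" for t
        using hr[OF that] r1 by (auto simp: r_def dist_commute subset_iff)
      have "norm (f (?h 1) - f (?h 0) - (v \<bullet> i) *\<^sub>R g i x) \<le> norm v * e"
      proof (rule vector_mean_value[where f'="\<lambda>t. (v \<bullet> i) *\<^sub>R g i (?h t)"])
        fix t :: real assume t: "t \<in> {0..1}"
        \<comment> \<open>Partial derivatives are given at parameter 0 of the line through each
          point; shifting and rescaling the parameter moves this to parameter t of
          \<open>?h\<close>.\<close>
        have "((\<lambda>s. (s - t) * (v \<bullet> i)) has_real_derivative (v \<bullet> i)) (at t)"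
          by (auto intro!: derivative_eq_intros)
        moreover have "((\<lambda>t'. f (?h t + t' *\<^sub>R i)) has_vector_derivative g i (?h t)) (at ((t - t) * (v \<bullet> i)))"
          using part[OF hU[OF t] i] by simp
        ultimately have "((\<lambda>t'. f (?h t + t' *\<^sub>R i)) \<circ> (\<lambda>s. (s - t) * (v \<bullet> i)) has_vector_derivative
            (v \<bullet> i) *\<^sub>R g i (?h t)) (at t)"
          by (intro vector_diff_chain_at) (auto simp: has_real_derivative_iff_has_vector_derivative)
        moreover have "(\<lambda>t'. f (?h t + t' *\<^sub>R i)) \<circ> (\<lambda>s. (s - t) * (v \<bullet> i)) = (\<lambda>s. f (?h s))"
          by (auto simp: fun_eq_iff algebra_simps)
        ultimately show "((\<lambda>s. f (?h s)) has_vector_derivative (v \<bullet> i) *\<^sub>R g i (?h t)) (at t)"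
          by simp
        have "norm ((v \<bullet> i) *\<^sub>R g i (?h t) - (v \<bullet> i) *\<^sub>R g i x) = \<bar>v \<bullet> i\<bar> * dist (g i (?h t)) (g i x)"
          by (simp add: dist_norm flip: scaleR_diff_right)
        also have "\<dots> \<le> norm v * e"
          using Basis_le_norm[OF i, of v] r0(2)[of "?h t"] hr[OF t] \<open>e > 0\<close>
          by (intro mult_mono) (auto simp: r_def intro: less_imp_le)
        finally show "norm ((v \<bullet> i) *\<^sub>R g i (?h t) - (v \<bullet> i) *\<^sub>R g i x) \<le> norm v * e" .
      qed
      moreover have "norm (f (x + ?p S v) - f x - (\<Sum>i\<in>S. (v \<bullet> i) *\<^sub>R g i x)) \<le> real (card S) * (e * norm v)"
        using d(2) v by (simp add: d'_def)
      ultimately have "norm ((f (?h 1) - f (?h 0) - (v \<bullet> i) *\<^sub>R g i x) +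
          (f (x + ?p S v) - f x - (\<Sum>i\<in>S. (v \<bullet> i) *\<^sub>R g i x))) \<le> norm v * e + real (card S) * (e * norm v)"
        by (rule norm_add_rule_thm)
      then show "norm (f (x + ?p (insert i S) v) - f x - (\<Sum>i\<in>insert i S. (v \<bullet> i) *\<^sub>R g i x))
          \<le> real (card (insert i S)) * (e * norm v)"
        using insert by (simp add: algebra_simps)
    qed
  qed
  show ?thesis
    unfolding has_derivative_at_alt
  proof (intro conjI allI impI)
    show "bounded_linear (\<lambda>v. \<Sum>i\<in>Basis. (v \<bullet> i) *\<^sub>R g i x)"
      by (intro bounded_linear_sum bounded_linear_compose[OF bounded_linear_scaleR_left]
          bounded_linear_inner_left)
    fix e :: real assume e: "e > 0"
    have p: "?p Basis v = v" for v :: 'a by (rule euclidean_representation)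
    have D: "real DIM('a) > 0" by simp
    obtain d where d: "d > 0" "\<forall>v. norm v < d \<longrightarrow>
      norm (f (x + v) - f x - (\<Sum>i\<in>Basis. (v \<bullet> i) *\<^sub>R g i x)) \<le> real DIM('a) * (e / real DIM('a) * norm v)"
      using key[OF order_refl divide_pos_pos[OF e D]] unfolding p by (elim exE conjE)
    have "norm (f y - f x - (\<Sum>i\<in>Basis. ((y - x) \<bullet> i) *\<^sub>R g i x)) \<le> e * norm (y - x)"
      if "norm (y - x) < d" for y
      using d(2)[rule_format, OF that] D by simp
    then show "\<exists>d>0. \<forall>y. norm (y - x) < d \<longrightarrow>
        norm (f y - f x - (\<Sum>i\<in>Basis. ((y - x) \<bullet> i) *\<^sub>R g i x)) \<le> e * norm (y - x)"
      using d(1) by blast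
  qed
qed

text \<open>Meant for solutions of differential equations, where the partial derivatives are found
  one at a time and total differentiability is not known beforehand.\<close>

lemma Ck_on_SucI_partials:
  fixes f :: "'a::euclidean_space \<Rightarrow> 'b::real_normed_vector"
  assumes "open U"
    and part: "\<And>y i. y \<in> U \<Longrightarrow> i \<in> Basis \<Longrightarrow>
      ((\<lambda>t. f (y + t *\<^sub>R i)) has_vector_derivative g i y) (at 0)"
    and g: "\<And>i. i \<in> Basis \<Longrightarrow> Ck_on k U (g i)"
  shows "Ck_on (Suc k) U f"
proof (rule Ck_on_SucI[OF assms(1), where f'="\<lambda>x v. \<Sum>i\<in>Basis. (v \<bullet> i) *\<^sub>R g i x"])
  fix x assume "x \<in> U"
  then show "(f has_derivative (\<lambda>v. \<Sum>i\<in>Basis. (v \<bullet> i) *\<^sub>R g i x)) (at x)"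
    using has_derivative_of_continuous_partials[of U x f g] assms(1) part Ck_on_continuous[OF g] by simp
next
  fix v
  show "Ck_on k U (\<lambda>x. \<Sum>i\<in>Basis. (v \<bullet> i) *\<^sub>R g i x)"
    by (intro Ck_on_sum Ck_on_linear_comp[where L="\<lambda>y. c *\<^sub>R y" for c, OF bounded_linear_scaleR_right] assms)
qed

lemma frechet_derivative_eq: "(f has_derivative f') (at x) \<Longrightarrow> frechet_derivative f (at x) = f'"
  using frechet_derivative_at by metis

lemma has_vector_derivative_along:
  assumes "(f has_derivative f') (at (x + t *\<^sub>R v))"
  shows "((\<lambda>s. f (x + s *\<^sub>R v)) has_vector_derivative f' v) (at t)"
proof -
  have B: "((\<lambda>s. x + s *\<^sub>R v) has_derivative (\<lambda>h. 0 + h *\<^sub>R v)) (at t)"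
    by (rule has_derivative_add[OF has_derivative_const has_derivative_scaleR_left[OF has_derivative_ident]])
  have A: "((\<lambda>s. f (x + s *\<^sub>R v)) has_derivative (\<lambda>h. f' (0 + h *\<^sub>R v))) (at t)"
    by (rule has_derivative_compose[OF B assms])
  have E: "(\<lambda>h. f' (0 + h *\<^sub>R v)) = (\<lambda>h. h *\<^sub>R f' v)"
    using linear_scale[OF has_derivative_linear[OF assms]] by (simp only: add_0)
  show ?thesis unfolding has_vector_derivative_def using A unfolding E .
qed

section \<open>Symmetry of second derivatives\<close>

text \<open>Two nested mean value estimates: along \<open>u\<close> for the difference of
  \<open>f\<close> in direction \<open>v\<close>, and along \<open>v\<close> for the derivative of
  \<open>f\<close> in direction \<open>u\<close>.\<close>

lemma second_difference:
  assumes f: "Cinf U f" and x: "x \<in> U" and e: "e > 0"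
  shows "\<exists>d>0. \<forall>h. 0 < h \<and> h < d \<longrightarrow>
    norm (f (x + h *\<^sub>R u + h *\<^sub>R v) - f (x + h *\<^sub>R u) - f (x + h *\<^sub>R v) + f x
      - h^2 *\<^sub>R frechet_derivative (\<lambda>y. frechet_derivative f (at y) u) (at x) v) \<le> h^2 * e"
proof -
  let ?G = "\<lambda>y. frechet_derivative f (at y) u"
  let ?H = "\<lambda>y. frechet_derivative ?G (at y) v"
  have G: "Cinf U ?G" and H: "Cinf U ?H" using f by (auto intro: Cinf_derivative)
  have "isCont ?H x"
    using Cinf_continuous[OF H] Cinf_open[OF f] x by (simp add: continuous_on_eq_continuous_at)
  then obtain r0 where r0: "r0 > 0" "\<And>y. dist y x < r0 \<Longrightarrow> dist (?H y) (?H x) < e"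
    using e unfolding continuous_at_eps_delta by blast
  obtain r1 where r1: "r1 > 0" "ball x r1 \<subseteq> U" using Cinf_open[OF f] x open_contains_ball by blast
  define r where "r = min r0 r1"
  have r: "r > 0" using r0 r1 by (simp add: r_def)
  \<comment> \<open>Makes every point of the parallelogram spanned by h u and h v lie within
    distance r of x.\<close>
  define d where "d = r / (norm u + norm v + 1)"
  have nz: "norm u + norm v + 1 > 0" by (smt (verit) norm_ge_zero)
  have d: "d > 0" using r nz by (simp add: d_def)
  show ?thesis
  proof (intro exI[of _ d] conjI allI impI d)
    fix h :: real assume h: "0 < h \<and> h < d"
    have near: "dist (x + (s * h) *\<^sub>R u + (t * h) *\<^sub>R v) x < r" if "s \<in> {0..1}" "t \<in> {0..1}" for s t
    proof -
      have "norm ((s * h) *\<^sub>R u + (t * h) *\<^sub>R v) \<le> (s * h) * norm u + (t * h) * norm v"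
        using norm_triangle_ineq[of "(s * h) *\<^sub>R u" "(t * h) *\<^sub>R v"] that h by (simp add: abs_mult)
      also have "\<dots> \<le> h * norm u + h * norm v"
        using that h by (intro add_mono mult_right_mono) auto
      also have "\<dots> \<le> h * (norm u + norm v + 1)" using h by (simp add: algebra_simps)
      also have "\<dots> < d * (norm u + norm v + 1)" using h nz by (intro mult_strict_right_mono) auto
      also have "\<dots> = r" using nz by (simp add: d_def)
      finally show ?thesis by (simp add: dist_norm add.assoc)
    qed
    have inU: "x + (s * h) *\<^sub>R u + (t * h) *\<^sub>R v \<in> U" if "s \<in> {0..1}" "t \<in> {0..1}" for s t
      using near[OF that] r1 by (auto simp: r_def dist_commute subset_iff)
    have inner: "norm (?G (x + (s * h) *\<^sub>R u + h *\<^sub>R v) - ?G (x + (s * h) *\<^sub>R u) - h *\<^sub>R ?H x) \<le> h * e"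
      if s: "s \<in> {0..1}" for s
    proof -
      let ?y = "x + (s * h) *\<^sub>R u"
      have "norm (?G (?y + 1 *\<^sub>R (h *\<^sub>R v)) - ?G (?y + 0 *\<^sub>R (h *\<^sub>R v)) - h *\<^sub>R ?H x) \<le> h * e"
      proof (rule vector_mean_value[where f'="\<lambda>t. frechet_derivative ?G (at (?y + t *\<^sub>R (h *\<^sub>R v))) (h *\<^sub>R v)"])
        fix t :: real assume t: "t \<in> {0..1}"
        have yU: "?y + t *\<^sub>R (h *\<^sub>R v) \<in> U" using inU[OF s t] by simp
        show "((\<lambda>t. ?G (?y + t *\<^sub>R (h *\<^sub>R v))) has_vector_derivative
            frechet_derivative ?G (at (?y + t *\<^sub>R (h *\<^sub>R v))) (h *\<^sub>R v)) (at t)"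
          by (rule has_vector_derivative_along[OF Cinf_has_derivative[OF G yU]])
        have "frechet_derivative ?G (at (?y + t *\<^sub>R (h *\<^sub>R v))) (h *\<^sub>R v) = h *\<^sub>R ?H (?y + t *\<^sub>R (h *\<^sub>R v))"
          using linear_scale[OF has_derivative_linear[OF Cinf_has_derivative[OF G yU]]] by simp
        moreover have "dist (?H (?y + t *\<^sub>R (h *\<^sub>R v))) (?H x) < e"
          using near[OF s t] by (intro r0(2)) (simp add: r_def)
        ultimately show "norm (frechet_derivative ?G (at (?y + t *\<^sub>R (h *\<^sub>R v))) (h *\<^sub>R v) - h *\<^sub>R ?H x) \<le> h * e"
          using h by (simp add: dist_norm flip: scaleR_diff_right)
      qed
      then show ?thesis by simp
    qed
    \<comment> \<open>\<open>?F 1 - ?F 0\<close> is the second difference; the derivative of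
      \<open>?F\<close> is h times an increment of \<open>?G\<close>, which \<open>inner\<close>
      controls.\<close>
    let ?F = "\<lambda>s. f (x + h *\<^sub>R v + s *\<^sub>R (h *\<^sub>R u)) - f (x + s *\<^sub>R (h *\<^sub>R u))"
    have "norm (?F 1 - ?F 0 - h^2 *\<^sub>R ?H x) \<le> h^2 * e"
    proof (rule vector_mean_value[where f'="\<lambda>s. frechet_derivative f (at (x + h *\<^sub>R v + s *\<^sub>R (h *\<^sub>R u))) (h *\<^sub>R u)
        - frechet_derivative f (at (x + s *\<^sub>R (h *\<^sub>R u))) (h *\<^sub>R u)"])
      fix s :: real assume s: "s \<in> {0..1}"
      have y1: "x + h *\<^sub>R v + s *\<^sub>R (h *\<^sub>R u) \<in> U" using inU[OF s, of 1] by (simp add: algebra_simps)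
      have y0: "x + s *\<^sub>R (h *\<^sub>R u) \<in> U" using inU[OF s, of 0] by (simp add: algebra_simps)
      show "(?F has_vector_derivative frechet_derivative f (at (x + h *\<^sub>R v + s *\<^sub>R (h *\<^sub>R u))) (h *\<^sub>R u)
        - frechet_derivative f (at (x + s *\<^sub>R (h *\<^sub>R u))) (h *\<^sub>R u)) (at s)"
        by (intro has_vector_derivative_diff has_vector_derivative_along Cinf_has_derivative[OF f] y0 y1)
      have "frechet_derivative f (at (x + h *\<^sub>R v + s *\<^sub>R (h *\<^sub>R u))) (h *\<^sub>R u)
        - frechet_derivative f (at (x + s *\<^sub>R (h *\<^sub>R u))) (h *\<^sub>R u) - h^2 *\<^sub>R ?H x =
        h *\<^sub>R (?G (x + (s * h) *\<^sub>R u + h *\<^sub>R v) - ?G (x + (s * h) *\<^sub>R u) - h *\<^sub>R ?H x)"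
        using linear_scale[OF has_derivative_linear[OF Cinf_has_derivative[OF f y1]]]
          linear_scale[OF has_derivative_linear[OF Cinf_has_derivative[OF f y0]]]
        by (simp add: algebra_simps power2_eq_square)
      then show "norm (frechet_derivative f (at (x + h *\<^sub>R v + s *\<^sub>R (h *\<^sub>R u))) (h *\<^sub>R u)
        - frechet_derivative f (at (x + s *\<^sub>R (h *\<^sub>R u))) (h *\<^sub>R u) - h^2 *\<^sub>R ?H x) \<le> h^2 * e"
        using mult_left_mono[OF inner[OF s], of h] h by (simp add: power2_eq_square mult.assoc)
    qed
    then show "norm (f (x + h *\<^sub>R u + h *\<^sub>R v) - f (x + h *\<^sub>R u) - f (x + h *\<^sub>R v) + f x
      - h^2 *\<^sub>R ?H x) \<le> h^2 * e"
      by (simp add: algebra_simps)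
  qed
qed

text \<open>The second difference is symmetric in \<open>u\<close> and \<open>v\<close>, and both
  iterated derivatives are its limit after division by h^2.\<close>

lemma second_derivative_symmetric:
  assumes f: "Cinf U f" and x: "x \<in> U"
  shows "frechet_derivative (\<lambda>y. frechet_derivative f (at y) u) (at x) v =
    frechet_derivative (\<lambda>y. frechet_derivative f (at y) v) (at x) u" (is "?a = ?b")
proof (rule ccontr)
  assume "?a \<noteq> ?b"
  \<comment> \<open>A quarter of the supposed gap: the two estimates together bound the gap by 2 e,
    which is half of it.\<close>
  define e where "e = norm (?a - ?b) / 4"
  have e: "e > 0" using \<open>?a \<noteq> ?b\<close> by (simp add: e_def)
  obtain d1 where d1: "d1 > 0" "\<forall>h. 0 < h \<and> h < d1 \<longrightarrow>
    norm (f (x + h *\<^sub>R u + h *\<^sub>R v) - f (x + h *\<^sub>R u) - f (x + h *\<^sub>R v) + f x - h^2 *\<^sub>R ?a) \<le> h^2 * e"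
    using second_difference[OF f x e, of u v] by (elim exE conjE)
  obtain d2 where d2: "d2 > 0" "\<forall>h. 0 < h \<and> h < d2 \<longrightarrow>
    norm (f (x + h *\<^sub>R v + h *\<^sub>R u) - f (x + h *\<^sub>R v) - f (x + h *\<^sub>R u) + f x - h^2 *\<^sub>R ?b) \<le> h^2 * e"
    using second_difference[OF f x e, of v u] by (elim exE conjE)
  define h where "h = min d1 d2 / 2"
  have h: "0 < h" "h < d1" "h < d2" using d1 d2 by (auto simp: h_def)
  let ?D = "f (x + h *\<^sub>R u + h *\<^sub>R v) - f (x + h *\<^sub>R u) - f (x + h *\<^sub>R v) + f x"
  have "norm (?D - h^2 *\<^sub>R ?a) \<le> h^2 * e" using d1 h by blast
  moreover have "norm (?D - h^2 *\<^sub>R ?b) \<le> h^2 * e"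
    using d2(2)[rule_format, of h] h by (simp add: algebra_simps)
  ultimately have "norm ((?D - h^2 *\<^sub>R ?b) - (?D - h^2 *\<^sub>R ?a)) \<le> h^2 * e + h^2 * e"
    using norm_triangle_ineq4[of "?D - h^2 *\<^sub>R ?b" "?D - h^2 *\<^sub>R ?a"] by linarith
  moreover have "(?D - h^2 *\<^sub>R ?b) - (?D - h^2 *\<^sub>R ?a) = h^2 *\<^sub>R (?a - ?b)"
    by (simp add: algebra_simps)
  ultimately have "h^2 * norm (?a - ?b) \<le> h^2 * (2 * e)" by (simp add: mult.commute)
  then have "norm (?a - ?b) \<le> 2 * e" using h by simp
  then show False using e by (simp add: e_def)
qed

section \<open>Bump and step functions\<close>

text \<open>The functions exp(-1/x) x^(-n), extended by 0. Differentiation maps this family into its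
  linear combinations, so one induction over all \<open>n\<close> at once proves smoothness.\<close>

definition bump_power :: "nat \<Rightarrow> real \<Rightarrow> real" where
  "bump_power n x = (if x > 0 then exp (- inverse x) * inverse x ^ n else 0)"

text \<open>On the right, substitute y = 1/x in y^n / exp y \<rightarrow> 0; on the left the
  function is zero.\<close>

lemma bump_power_tendsto_0: "(bump_power n \<longlongrightarrow> 0) (at 0)"
proof -
  have "((\<lambda>x::real. inverse x ^ n / exp (inverse x)) \<longlongrightarrow> 0) (at_right 0)"
    by (rule filterlim_compose[OF tendsto_power_div_exp_0 filterlim_inverse_at_top_right])
  then have "(bump_power n \<longlongrightarrow> 0) (at_right 0)"
    by (rule Lim_transform_eventually)
      (auto simp: bump_power_def eventually_at_right_less exp_minus divide_simps eventually_at_filter)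
  moreover have "(bump_power n \<longlongrightarrow> 0) (at_left 0)"
    by (rule Lim_transform_eventually[OF tendsto_const])
      (auto simp: bump_power_def eventually_at_filter)
  ultimately show ?thesis by (simp add: filterlim_split_at_real)
qed

lemma bump_power_deriv:
  "(bump_power n has_real_derivative bump_power (n + 2) x - real n * bump_power (n + 1) x) (at x)"
proof -
  consider "x > 0" | "x < 0" | "x = 0" by linarith
  then show ?thesis
  proof cases
    case 1
    have "((\<lambda>x. exp (- inverse x) * inverse x ^ n) has_real_derivative
        bump_power (n + 2) x - real n * bump_power (n + 1) x) (at x)"
    proof -
      let ?y = "inverse x"
      have i: "(inverse has_real_derivative - (?y ^ 2)) (at x)"
        using DERIV_inverse[of x UNIV] 1 by (simp add: power2_eq_square numeral_2_eq_2)
      have "((\<lambda>x. exp (- inverse x) * inverse x ^ n) has_real_derivative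
        exp (- ?y) * (real n * (- (?y ^ 2) * ?y ^ (n - Suc 0))) + exp (- ?y) * - (- (?y ^ 2)) * ?y ^ n) (at x)"
        by (rule DERIV_mult'[OF DERIV_fun_exp[OF DERIV_minus[OF i]] DERIV_power[OF i]])
      moreover have "exp (- ?y) * (real n * (- (?y ^ 2) * ?y ^ (n - Suc 0))) + exp (- ?y) * - (- (?y ^ 2)) * ?y ^ n
        = bump_power (n + 2) x - real n * bump_power (n + 1) x"
        using 1 by (cases n) (auto simp: bump_power_def power2_eq_square algebra_simps)
      ultimately show ?thesis by simp
    qed
    then show ?thesis
      by (rule has_field_derivative_transform_within_open[where S="{0<..}"])
        (use 1 in \<open>auto simp: bump_power_def\<close>)
  next
    case 2
    have "((\<lambda>x. 0) has_real_derivative bump_power (n + 2) x - real n * bump_power (n + 1) x) (at x)"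
      using 2 by (simp add: bump_power_def)
    then show ?thesis
      by (rule has_field_derivative_transform_within_open[where S="{..<0}"])
        (use 2 in \<open>auto simp: bump_power_def\<close>)
  next
    case 3
    \<comment> \<open>The difference quotient at 0 is \<open>bump_power (Suc n)\<close>
      itself.\<close>
    have "((\<lambda>h. (bump_power n (0 + h) - bump_power n 0) / h) \<longlongrightarrow> 0) (at 0)"
      by (rule Lim_transform_eventually[OF bump_power_tendsto_0[of "Suc n"]])
        (auto simp: bump_power_def eventually_at_filter divide_simps)
    then show ?thesis using 3 by (simp add: DERIV_def bump_power_def)
  qed
qed

lemma Cinf_bump_power: "Cinf UNIV (bump_power n)"
proof -
  have "Ck_on k UNIV (bump_power n)" for k
  proof (induction k arbitrary: n)
    case 0
    show ?case
      by (auto intro!: continuous_at_imp_continuous_on DERIV_isCont bump_power_deriv)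
  next
    case (Suc k)
    show ?case
    proof (rule Ck_on_SucI[where f'="\<lambda>x v. (bump_power (n + 2) x - real n * bump_power (n + 1) x) * v"])
      show "(bump_power n has_derivative (\<lambda>v. (bump_power (n + 2) x - real n * bump_power (n + 1) x) * v)) (at x)" for x
        using bump_power_deriv[of n x] by (simp add: has_field_derivative_def)
      show "Ck_on k UNIV (\<lambda>x. (bump_power (n + 2) x - real n * bump_power (n + 1) x) * v)" for v
      proof -
        have "Ck_on k UNIV (\<lambda>x. v * bump_power (n + 2) x + (- v * real n) * bump_power (n + 1) x)"
          by (intro Ck_on_add Ck_on_linear_comp[OF bounded_linear_mult_right] Suc.IH) auto
        then show ?thesis by (simp add: algebra_simps)
      qed
    qed auto
  qed
  then show ?thesis by (simp add: Cinf_def)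
qed

definition bump :: "real \<Rightarrow> real" where "bump = bump_power 0"

lemma bump_pos: "x > 0 \<Longrightarrow> bump x > 0" and bump_0: "x \<le> 0 \<Longrightarrow> bump x = 0" and bump_nonneg: "bump x \<ge> 0"
  by (auto simp: bump_def bump_power_def)

lemma bump_deriv: "(bump has_real_derivative bump_power 2 x) (at x)"
  using bump_power_deriv[of 0 x] by (simp add: bump_def numeral_2_eq_2)

lemma Cinf_bump: "Cinf UNIV bump"
  by (simp add: bump_def Cinf_bump_power)

definition step_fn :: "real \<Rightarrow> real" where "step_fn x = bump x / (bump x + bump (1 - x))"

lemma step_fn_denominator: "bump x + bump (1 - x) > 0"
  using bump_pos[of x] bump_pos[of "1 - x"] bump_nonneg[of x] bump_nonneg[of "1 - x"]
  by (cases "x > 0") auto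

lemma Cinf_step_fn: "Cinf UNIV step_fn"
  unfolding step_fn_def
  using order.strict_implies_not_eq[OF step_fn_denominator]
  by (intro Cinf_divide Cinf_add Cinf_bump Cinf_compose_UNIV[OF Cinf_bump] Cinf_diff Cinf_const Cinf_id)
    (metis open_UNIV)+

lemma step_fn_0: "x \<le> 0 \<Longrightarrow> step_fn x = 0"
  and step_fn_1: "x \<ge> 1 \<Longrightarrow> step_fn x = 1"
  and step_fn_range: "0 \<le> step_fn x" "step_fn x \<le> 1"
proof -
  show "x \<le> 0 \<Longrightarrow> step_fn x = 0" by (simp add: step_fn_def bump_0)
  show "x \<ge> 1 \<Longrightarrow> step_fn x = 1" using bump_pos[of x] by (simp add: step_fn_def bump_0)
  show "0 \<le> step_fn x" "step_fn x \<le> 1"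
    using step_fn_denominator[of x] bump_nonneg[of x] bump_nonneg[of "1 - x"]
    by (auto simp: step_fn_def)
qed

section \<open>Ordinary differential equations\<close>

text \<open>For t < 0 the interval is empty and the integral is 0. Since \<open>g\<close> vanishes
  at nonpositive times this agrees with the genuine primitive, and the derivative is two-sided at
  every t.\<close>

lemma integral_0_vector_derivative:
  fixes g :: "real \<Rightarrow> 'e::banach"
  assumes c: "continuous_on UNIV g" and z: "\<And>s. s \<le> 0 \<Longrightarrow> g s = 0"
  shows "((\<lambda>t. integral {0..t} g) has_vector_derivative g t) (at t)"
proof -
  \<comment> \<open>To the left of both 0 and t, so that one application of the fundamental theorem
    covers all signs of t.\<close>
  define b where "b = - (\<bar>t\<bar> + 1)"
  have ci: "g integrable_on {c..d}" for c d
    using integrable_continuous_real continuous_on_subset[OF c] by blast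
  have eq: "integral {b..s} g = integral {0..s} g" if "s \<ge> b" for s
  proof (cases "s \<ge> 0")
    case True
    have "integral {b..0} g = 0" by (rule integral_unique[OF has_integral_is_0]) (use z in auto)
    then show ?thesis
      using Henstock_Kurzweil_Integration.integral_combine[of b 0 s g] True ci by (auto simp: b_def)
  next
    case False
    have "integral {b..s} g = 0" by (rule integral_unique[OF has_integral_is_0]) (use z False in auto)
    then show ?thesis using False by simp
  qed
  have "((\<lambda>u. integral {b..u} g) has_vector_derivative g t) (at t within {b..\<bar>t\<bar> + 1})"
    by (rule integral_has_vector_derivative) (auto simp: b_def intro: continuous_on_subset[OF c])
  moreover have tb: "b < t" and "t \<in> interior {b..\<bar>t\<bar> + 1}" by (auto simp: b_def)
  ultimately have "((\<lambda>u. integral {b..u} g) has_vector_derivative g t) (at t)"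
    by (metis at_within_interior)
  then show ?thesis
    by (rule has_vector_derivative_transform_within_open[where S="{b<..}"]) (use eq tb in auto)
qed

text \<open>A fixed domain of integration makes continuity in the upper limit an instance of
  continuity in a parameter; \<open>max 0 t\<close> takes care of empty intervals.\<close>

lemma integral_0_scale:
  fixes g :: "real \<Rightarrow> 'e::banach"
  assumes c: "continuous_on UNIV g"
  shows "integral {0..t} g = max 0 t *\<^sub>R integral (cbox 0 1) (\<lambda>s. g (s * max 0 t))"
proof (cases "t > 0")
  case True
  have "(g has_integral integral {0..t} g) {0..t}"
    using integrable_continuous_real continuous_on_subset[OF c] by (blast intro: integrable_integral)
  from has_integral_stretch_real[OF this, of t] True
  have "((\<lambda>x. g (t * x)) has_integral (1 / t) *\<^sub>R integral {0..t} g) {0..1}"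
    by (simp add: image_divide_atLeastAtMost)
  then have "integral {0..1} (\<lambda>x. g (t * x)) = (1 / t) *\<^sub>R integral {0..t} g"
    by (rule integral_unique)
  then show ?thesis using True by (simp add: mult.commute max_def)
next
  case False
  then show ?thesis by (cases "t = 0") auto
qed

lemma continuous_on_integral_0:
  fixes g :: "real \<times> 'p::topological_space \<Rightarrow> 'e::banach"
  assumes c: "continuous_on UNIV g"
  shows "continuous_on UNIV (\<lambda>(t, p). integral {0..t} (\<lambda>s. g (s, p)))"
proof -
  have c1: "continuous_on UNIV (\<lambda>s. g (s, p))" for p
    by (intro continuous_on_compose2[OF c] continuous_intros) auto
  have "continuous_on (UNIV \<times> cbox 0 1) (\<lambda>(z, s::real). g (s * max 0 (fst z), snd z))"
    unfolding case_prod_beta by (intro continuous_on_compose2[OF c] continuous_intros) auto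
  then have "continuous_on UNIV (\<lambda>z. integral (cbox 0 1) (\<lambda>s::real. g (s * max 0 (fst z), snd z)))"
    by (rule integral_continuous_on_param)
  then have "continuous_on UNIV (\<lambda>z. max 0 (fst z) *\<^sub>R integral (cbox 0 1) (\<lambda>s::real. g (s * max 0 (fst z), snd z)))"
    by (intro continuous_intros)
  then show ?thesis
    by (rule back_subst[where P="continuous_on UNIV"]) (auto simp: integral_0_scale[OF c1] fun_eq_iff)
qed

text \<open>Picard iteration for w = exp(-2 L t) u. The weight makes the iteration a contraction
  with factor 1/2 on all times at once. The fixed point is sought among bounded continuous functions
  of (t, p) together, so continuity in the parameter comes with existence.\<close>

lemma ode_exists:
  fixes f :: "real \<times> 'p::metric_space \<Rightarrow> 'e::banach \<Rightarrow> 'e"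
  assumes cont: "continuous_on UNIV (\<lambda>(z, u). f z u)"
    and lip: "\<And>z u v. norm (f z u - f z v) \<le> L * norm (u - v)" and L: "L > 0"
    and bdd: "\<And>z. norm (f z 0) \<le> B"
    and zero: "\<And>s p u. s \<le> 0 \<Longrightarrow> f (s, p) u = 0"
  obtains u where "continuous_on UNIV u" "\<And>s p. s \<le> 0 \<Longrightarrow> u (s, p) = 0"
    "\<And>s p. ((\<lambda>s. u (s, p)) has_vector_derivative f (s, p) (u (s, p))) (at s)"
proof -
  let ?e = "\<lambda>t. exp (2 * L * t)"
  let ?g = "\<lambda>w z. f z (?e (fst z) *\<^sub>R apply_bcontfun w z)"
  let ?T = "\<lambda>w (t, p). exp (- (2 * L * t)) *\<^sub>R integral {0..t} (\<lambda>s. ?g w (s, p))"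
  have gc: "continuous_on UNIV (?g w)" for w :: "(real \<times> 'p) \<Rightarrow>\<^sub>C 'e"
  proof -
    have "continuous_on UNIV (\<lambda>z. (z, ?e (fst z) *\<^sub>R apply_bcontfun w z))"
      by (intro continuous_intros continuous_on_apply_bcontfun)
    from continuous_on_compose2[OF cont this] show ?thesis by simp
  qed
  have gc1: "continuous_on UNIV (\<lambda>s. ?g w (s, p))" for w :: "(real \<times> 'p) \<Rightarrow>\<^sub>C 'e" and p
    by (rule continuous_on_compose2[OF gc]) (auto intro!: continuous_intros)
  have gi: "(\<lambda>s. ?g w (s, p)) integrable_on {0..t}" for w :: "(real \<times> 'p) \<Rightarrow>\<^sub>C 'e" and p t
    by (rule integrable_continuous_real[OF continuous_on_subset[OF gc1]]) simp
  have ei: "((\<lambda>s. C * L * ?e s) has_integral C / 2 * (?e t - 1)) {0..t}" if "t \<ge> 0" for t C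
  proof -
    have "((\<lambda>s. C * L * ?e s) has_integral (C / 2 * ?e t - C / 2 * ?e 0)) {0..t}"
      by (rule fundamental_theorem_of_calculus[OF that])
        (use L in \<open>auto intro!: derivative_eq_intros simp flip: has_real_derivative_iff_has_vector_derivative\<close>)
    then show ?thesis by (simp add: algebra_simps)
  qed
  have Tc: "continuous_on UNIV (?T w)" for w :: "(real \<times> 'p) \<Rightarrow>\<^sub>C 'e"
    using continuous_on_integral_0[OF gc[of w]] unfolding case_prod_beta
    by (intro continuous_intros)
  have Tb: "norm (?T w (t, p)) \<le> B / (2 * L) + norm w / 2" for w :: "(real \<times> 'p) \<Rightarrow>\<^sub>C 'e" and t p
  proof (cases "t \<ge> 0")
    case True
    have bnd: "norm (?g w (s, p)) \<le> B + norm w * L * ?e s" for s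
    proof -
      have "norm (?g w (s, p)) \<le> norm (f (s, p) 0) + L * norm (?e s *\<^sub>R apply_bcontfun w (s, p))"
        using lip[of "(s, p)" "?e s *\<^sub>R apply_bcontfun w (s, p)" 0]
          norm_triangle_sub[of "?g w (s, p)" "f (s, p) 0"] by simp
      also have "\<dots> \<le> B + L * (?e s * norm w)"
        using bdd L norm_bounded[of w "(s, p)"] by (intro add_mono mult_left_mono) auto
      finally show ?thesis by (simp add: algebra_simps)
    qed
    have int: "((\<lambda>s. B + norm w * L * ?e s) has_integral (t * B + norm w / 2 * (?e t - 1))) {0..t}"
      using has_integral_const_real[of B 0 t] ei[OF True, of "norm w"] True
      by (intro has_integral_add) auto

    have "norm (integral {0..t} (\<lambda>s. ?g w (s, p))) \<le> integral {0..t} (\<lambda>s. B + norm w * L * ?e s)"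
      by (intro integral_norm_bound_integral gi has_integral_integrable[OF int] bnd)
    also have "\<dots> = t * B + norm w / 2 * (?e t - 1)" by (rule integral_unique[OF int])
    \<comment> \<open>The linear growth of t B is absorbed by 2 L t \<le> exp(2 L t).\<close>
    also have "\<dots> \<le> ?e t * (B / (2 * L)) + norm w / 2 * ?e t"
    proof (intro add_mono mult_left_mono)
      have "B \<ge> 0" using bdd[of undefined] norm_ge_zero order_trans by blast
      moreover have "2 * L * t \<le> ?e t" using exp_ge_add_one_self[of "2 * L * t"] by linarith
      ultimately have "2 * L * t * (B / (2 * L)) \<le> ?e t * (B / (2 * L))"
        using L by (intro mult_right_mono) auto
      then show "t * B \<le> ?e t * (B / (2 * L))" using L by (simp add: field_simps)
    qed auto
    finally have "norm (?T w (t, p)) \<le> exp (- (2 * L * t)) * (?e t * (B / (2 * L)) + norm w / 2 * ?e t)"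
      by (simp add: mult_left_mono)
    also have "\<dots> = B / (2 * L) + norm w / 2"
      by (simp add: exp_minus field_simps)
    finally show ?thesis .
  next
    case False
    have "B \<ge> 0" using bdd[of undefined] norm_ge_zero order_trans by blast
    then show ?thesis using False L by simp
  qed
  have Tin: "?T w \<in> bcontfun" for w :: "(real \<times> 'p) \<Rightarrow>\<^sub>C 'e"
  proof (rule bcontfun_normI[OF Tc])
    fix z :: "real \<times> 'p"
    obtain t p where "z = (t, p)" by fastforce
    then show "norm (?T w z) \<le> B / (2 * L) + norm w / 2" using Tb by simp
  qed
  define T where "T w = Bcontfun (?T w)" for w :: "(real \<times> 'p) \<Rightarrow>\<^sub>C 'e"
  have T: "apply_bcontfun (T w) = ?T w" for w :: "(real \<times> 'p) \<Rightarrow>\<^sub>C 'e"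
    unfolding T_def by (rule Bcontfun_inverse[OF Tin])
  have "dist (T w) (T w') \<le> 1/2 * dist w w'" for w w' :: "(real \<times> 'p) \<Rightarrow>\<^sub>C 'e"
  proof (rule dist_bound)
    fix z :: "real \<times> 'p"
    obtain t p where z: "z = (t, p)" by fastforce
    show "dist (apply_bcontfun (T w) z) (apply_bcontfun (T w') z) \<le> 1/2 * dist w w'"
    proof (cases "t \<ge> 0")
      case True
      have "norm (?g w (s, p) - ?g w' (s, p)) \<le> dist w w' * L * ?e s" for s
      proof -
        have "norm (?g w (s, p) - ?g w' (s, p)) \<le>
          L * norm (?e s *\<^sub>R apply_bcontfun w (s, p) - ?e s *\<^sub>R apply_bcontfun w' (s, p))"
          using lip by simp
        also have "\<dots> = L * (?e s * dist (apply_bcontfun w (s, p)) (apply_bcontfun w' (s, p)))"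
          by (simp add: dist_norm flip: scaleR_diff_right)
        also have "\<dots> \<le> L * (?e s * dist w w')"
          using L by (intro mult_left_mono dist_bounded) auto
        finally show ?thesis by (simp add: algebra_simps)
      qed
      then have "norm (integral {0..t} (\<lambda>s. ?g w (s, p) - ?g w' (s, p))) \<le> integral {0..t} (\<lambda>s. dist w w' * L * ?e s)"
        by (intro integral_norm_bound_integral integrable_diff gi has_integral_integrable[OF ei[OF True]])
      also have "\<dots> = dist w w' / 2 * (?e t - 1)" by (rule integral_unique[OF ei[OF True]])
      also have "\<dots> \<le> dist w w' / 2 * ?e t" by (intro mult_left_mono) auto
      finally have "exp (- (2 * L * t)) * norm (integral {0..t} (\<lambda>s. ?g w (s, p) - ?g w' (s, p)))
        \<le> exp (- (2 * L * t)) * (dist w w' / 2 * ?e t)" by (intro mult_left_mono) auto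
      also have "\<dots> = 1/2 * dist w w'" by (simp add: exp_minus field_simps)
      finally show ?thesis
        unfolding T z dist_norm prod.case integral_diff[OF gi gi]
        by (simp flip: scaleR_diff_right)
    qed (simp add: T z)
  qed
  then obtain w where w: "T w = w" using banach_fix_type[of "1/2" T] by auto
  define u where "u = (\<lambda>z. ?e (fst z) *\<^sub>R apply_bcontfun w z)"
  have ueq: "u (t, p) = integral {0..t} (\<lambda>s. f (s, p) (u (s, p)))" for t p
  proof -
    have "apply_bcontfun w (t, p) = exp (- (2 * L * t)) *\<^sub>R integral {0..t} (\<lambda>s. f (s, p) (u (s, p)))"
      using fun_cong[OF T[of w], of "(t, p)"] unfolding w u_def by simp
    then show ?thesis by (simp add: u_def[abs_def] exp_minus)
  qed
  show thesis
  proof (rule that[of u])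
    show "continuous_on UNIV u" unfolding u_def
      by (intro continuous_intros continuous_on_apply_bcontfun)
    show "u (s, p) = 0" if "s \<le> 0" for s p
      using that by (subst ueq) (cases "s = 0"; simp)
    show "((\<lambda>s. u (s, p)) has_vector_derivative f (s, p) (u (s, p))) (at s)" for s p
    proof -
      have "(\<lambda>t. integral {0..t} (\<lambda>s. ?g w (s, p))) = (\<lambda>t. u (t, p))"
        by (rule ext, subst ueq, simp add: u_def)
      moreover have "((\<lambda>t. integral {0..t} (\<lambda>s. ?g w (s, p))) has_vector_derivative ?g w (s, p)) (at s)"
        by (rule integral_0_vector_derivative[OF gc1]) (rule zero)
      ultimately show ?thesis by (simp add: u_def)
    qed
  qed
qed

text \<open>Gronwall's inequality in differential form: exp(-2 L s) |z s|^2 does not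
  increase.\<close>

lemma ode_zero:
  fixes z :: "real \<Rightarrow> 'e::real_inner"
  assumes d: "\<And>s. (z has_vector_derivative z' s) (at s)"
    and b: "\<And>s. norm (z' s) \<le> L * norm (z s)" and "z s0 = 0" "s0 \<le> s"
  shows "z s = 0"
proof -
  let ?N = "\<lambda>s. exp (- (2 * L * s)) * (z s \<bullet> z s)"
  have "?N s \<le> ?N s0"
  proof (rule DERIV_nonpos_imp_nonincreasing[OF \<open>s0 \<le> s\<close>])
    fix x
    have "((\<lambda>s. z s \<bullet> z s) has_vector_derivative z x \<bullet> z' x + z' x \<bullet> z x) (at x)"
      by (rule bounded_bilinear.has_vector_derivative[OF bounded_bilinear_inner d d])
    then have zz: "((\<lambda>s. z s \<bullet> z s) has_real_derivative 2 * (z x \<bullet> z' x)) (at x)"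
      by (simp add: has_real_derivative_iff_has_vector_derivative inner_commute)
    have ee: "((\<lambda>s. exp (- (2 * L * s))) has_real_derivative exp (- (2 * L * x)) * (- (2 * L))) (at x)"
      by (auto intro!: derivative_eq_intros)
    have "z x \<bullet> z' x \<le> norm (z x) * (L * norm (z x))"
      using norm_cauchy_schwarz[of "z x" "z' x"] mult_left_mono[OF b[of x], of "norm (z x)"] by simp
    then have "2 * (z x \<bullet> z' x) - 2 * L * (z x \<bullet> z x) \<le> 0"
      by (simp add: dot_square_norm power2_eq_square algebra_simps)
    then have "exp (- (2 * L * x)) * (2 * (z x \<bullet> z' x) - 2 * L * (z x \<bullet> z x)) \<le> 0"
      by (simp add: mult_nonneg_nonpos)
    then show "\<exists>y. DERIV ?N x :> y \<and> y \<le> 0"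
      using DERIV_mult'[OF ee zz] by (intro exI conjI) (assumption, simp add: algebra_simps)
  qed
  then have "z s \<bullet> z s \<le> 0" using \<open>z s0 = 0\<close> by (simp add: mult_le_0_iff)
  then show ?thesis by (metis inner_ge_zero inner_eq_zero_iff order_antisym)
qed

lemma linear_ode_unique:
  fixes u :: "real \<Rightarrow> 'e::real_inner"
  assumes "\<And>s. (u has_vector_derivative blinfun_apply (A s) (u s) + b s) (at s)"
    and "\<And>s. (v has_vector_derivative blinfun_apply (A s) (v s) + b s) (at s)"
    and A: "\<And>s. norm (A s) \<le> L" and "u s0 = v s0" "s0 \<le> s"
  shows "u s = v s"
proof -
  have "u s - v s = 0"
  proof (rule ode_zero[where z="\<lambda>s. u s - v s" and z'="\<lambda>s. blinfun_apply (A s) (u s - v s)"])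
    show "((\<lambda>s. u s - v s) has_vector_derivative blinfun_apply (A s) (u s - v s)) (at s)" for s
      using has_vector_derivative_diff[OF assms(1,2)] by (simp add: blinfun.diff_right)
    show "norm (blinfun_apply (A s) (u s - v s)) \<le> L * norm (u s - v s)" for s
      by (rule order_trans[OF norm_blinfun mult_right_mono[OF A]]) simp
  qed (use assms in auto)
  then show ?thesis by simp
qed

lemma linear_ode_exists:
  fixes A :: "real \<times> 'p::metric_space \<Rightarrow> 'e::banach \<Rightarrow>\<^sub>L 'e"
  assumes cont: "continuous_on UNIV A" "continuous_on UNIV b"
    and bdd: "\<And>z. norm (A z) \<le> L" "\<And>z. norm (b z) \<le> B"
    and zero: "\<And>s p. s \<le> 0 \<Longrightarrow> A (s, p) = 0" "\<And>s p. s \<le> 0 \<Longrightarrow> b (s, p) = 0"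
  obtains u where "continuous_on UNIV u" "\<And>s p. s \<le> 0 \<Longrightarrow> u (s, p) = 0"
    "\<And>s p. ((\<lambda>s. u (s, p)) has_vector_derivative blinfun_apply (A (s, p)) (u (s, p)) + b (s, p)) (at s)"
\<comment> \<open>The maximum with 1 provides the positive Lipschitz constant that
  \<open>ode_exists\<close> requires.\<close>
proof (rule ode_exists[of "\<lambda>z u. blinfun_apply (A z) u + b z" "max L 1" B])
  show "continuous_on UNIV (\<lambda>(z, u). blinfun_apply (A z) u + b z)"
    unfolding case_prod_beta
    by (intro continuous_intros continuous_on_compose2[OF cont(1)] continuous_on_compose2[OF cont(2)]) auto
  show "norm (blinfun_apply (A z) u + b z - (blinfun_apply (A z) v + b z)) \<le> max L 1 * norm (u - v)" for z u v
  proof -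
    have "norm (blinfun_apply (A z) (u - v)) \<le> max L 1 * norm (u - v)"
      using bdd(1)[of z] by (intro order_trans[OF norm_blinfun mult_right_mono]) auto
    then show ?thesis by (simp add: blinfun.diff_right)
  qed
qed (use bdd zero that in auto)

section \<open>Smooth dependence of linear equations on parameters\<close>

text \<open>\<open>H\<close> is the difference quotient written as an average of derivatives, which
  remains continuous at h = 0. The increment can therefore be treated as one more parameter of an
  equation.\<close>

lemma hadamard:
  fixes g :: "'z::real_normed_vector \<Rightarrow> 'c::banach" and v :: 'z
  assumes g: "Ck_on 1 UNIV g"
  defines "H \<equiv> \<lambda>(z, h). integral {0..1} (\<lambda>s. frechet_derivative g (at (z + (s * h) *\<^sub>R v)) v)"
  shows "continuous_on UNIV H" "g (z + h *\<^sub>R v) - g z = h *\<^sub>R H (z, h)"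
    "H (z, 0) = frechet_derivative g (at z) v"
proof -
  let ?D = "\<lambda>z. frechet_derivative g (at z) v"
  have c: "continuous_on UNIV ?D" using g by simp
  have "continuous_on (UNIV \<times> cbox 0 1) (\<lambda>(x, s::real). ?D (fst x + (s * snd x) *\<^sub>R v))"
    unfolding case_prod_beta by (intro continuous_intros continuous_on_compose2[OF c]) auto
  then have "continuous_on UNIV (\<lambda>x. integral (cbox 0 1) (\<lambda>s::real. ?D (fst x + (s * snd x) *\<^sub>R v)))"
    by (rule integral_continuous_on_param)
  then show "continuous_on UNIV H" by (simp add: H_def case_prod_beta)
  have d: "(g has_derivative frechet_derivative g (at y)) (at y)" for y
    using g Ck_on_SucE[of 0 UNIV g] by simp
  have "((\<lambda>s. h *\<^sub>R ?D (z + (s * h) *\<^sub>R v)) has_integral g (z + 1 *\<^sub>R (h *\<^sub>R v)) - g (z + 0 *\<^sub>R (h *\<^sub>R v))) {0..1}"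
  proof (rule fundamental_theorem_of_calculus)
    fix s :: real
    have "((\<lambda>s. g (z + s *\<^sub>R (h *\<^sub>R v))) has_vector_derivative
        frechet_derivative g (at (z + s *\<^sub>R (h *\<^sub>R v))) (h *\<^sub>R v)) (at s)"
      by (rule has_vector_derivative_along[OF d])
    then show "((\<lambda>s. g (z + s *\<^sub>R (h *\<^sub>R v))) has_vector_derivative h *\<^sub>R ?D (z + (s * h) *\<^sub>R v)) (at s within {0..1})"
      using linear_scale[OF has_derivative_linear[OF d]] by (simp add: has_vector_derivative_at_within)
  qed simp
  then show "g (z + h *\<^sub>R v) - g z = h *\<^sub>R H (z, h)"
    by (simp add: H_def has_integral_iff)
  show "H (z, 0) = ?D z" by (simp add: H_def)
qed

text \<open>Truncating the increment \<open>h\<close> keeps the coefficients of the difference quotient equation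
  globally bounded.\<close>

definition clamp1 :: "real \<Rightarrow> real" where "clamp1 h = max (-1) (min 1 h)"

lemma clamp1: "\<bar>clamp1 h\<bar> \<le> 1" "\<bar>h\<bar> \<le> 1 \<Longrightarrow> clamp1 h = h" "clamp1 0 = 0"
  by (auto simp: clamp1_def)

lemma continuous_on_clamp1 [continuous_intros]:
  "continuous_on S f \<Longrightarrow> continuous_on S (\<lambda>x. clamp1 (f x))"
  unfolding clamp1_def by (intro continuous_intros)

lemma bounded_clamp1:
  fixes \<beta> :: "'z::metric_space \<times> real \<Rightarrow> 'c::real_normed_vector"
  assumes c: "continuous_on UNIV \<beta>" and C: "compact C"
    and z: "\<And>z h. z \<notin> C \<Longrightarrow> \<bar>h\<bar> \<le> 1 \<Longrightarrow> \<beta> (z, h) = 0"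
  obtains B where "\<And>z h. norm (\<beta> (z, clamp1 h)) \<le> B"
proof -
  have "compact (\<beta> ` (C \<times> {-1..1}))"
    by (intro compact_continuous_image compact_Times C continuous_on_subset[OF c]) auto
  from compact_imp_bounded[OF this] obtain B where B: "\<forall>y\<in>\<beta> ` (C \<times> {-1..1}). norm y \<le> B"
    unfolding bounded_iff by (elim exE)
  have "norm (\<beta> (z, clamp1 h)) \<le> max B 0" for z h
  proof (cases "z \<in> C")
    case True
    then have "norm (\<beta> (z, clamp1 h)) \<le> B"
      using clamp1(1)[of h] by (intro B[rule_format] imageI) auto
    then show ?thesis by simp
  next
    case False
    then show ?thesis using z[OF False clamp1(1)] by simp
  qed
  then show thesis by (rule that)
qed

lemma compact_shift:
  fixes C :: "'z::real_normed_vector set"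
  assumes "compact C"
  shows "compact ((\<lambda>(z, h). z - h *\<^sub>R v) ` (C \<times> {-1..1::real}))"
  unfolding case_prod_beta by (intro compact_continuous_image compact_Times assms continuous_intros) auto

lemma frechet_derivative_outside_compact:
  fixes g :: "'z::real_normed_vector \<Rightarrow> 'c::real_normed_vector"
  assumes "compact C" "\<And>z. z \<notin> C \<Longrightarrow> g z = 0" "z \<notin> C"
  shows "frechet_derivative g (at z) = (\<lambda>v. 0)"
proof (rule frechet_derivative_eq, rule has_derivative_transform_within_open[OF has_derivative_const])
  show "open (- C)" using compact_imp_closed[OF assms(1)] by auto
  show "z \<in> - C" using assms by simp
  show "0 = g x" if "x \<in> - C" for x using assms that by simp
qed

lemma Ck_on_1: "Ck_on (Suc k) U f \<Longrightarrow> Ck_on 1 U f"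
  using Ck_on_continuous unfolding One_nat_def Ck_on.simps by blast

text \<open>\<open>w\<close> extends the difference quotient continuously to h = 0, and its value
  there is the limit.\<close>

lemma difference_quotient_derivative:
  fixes u :: "real \<times> 'p::real_normed_vector \<Rightarrow> 'e::real_normed_vector"
  assumes w: "continuous_on UNIV w"
    and q: "\<And>h. \<bar>h\<bar> \<le> 1 \<Longrightarrow> u (s, x + h *\<^sub>R v) - u (s, x) = h *\<^sub>R w (s, (x, h))"
  shows "((\<lambda>t. u (s, x + t *\<^sub>R v)) has_vector_derivative w (s, (x, 0))) (at 0)"
proof -
  have "continuous_on UNIV (\<lambda>h. w (s, (x, h)))"
    by (rule continuous_on_compose2[OF w]) (auto intro!: continuous_intros)
  then have "((\<lambda>h. w (s, (x, h))) \<longlongrightarrow> w (s, (x, 0))) (at 0)"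
    by (simp add: continuous_on_eq_continuous_at isCont_def)
  then have "((\<lambda>h. norm (w (s, (x, h)) - w (s, (x, 0)))) \<longlongrightarrow> 0) (at 0)"
    using LIM_zero tendsto_norm_zero by blast
  then have "((\<lambda>h. norm (u (s, x + (0 + h) *\<^sub>R v) - u (s, x + 0 *\<^sub>R v) - h *\<^sub>R w (s, (x, 0))) / norm h) \<longlongrightarrow> 0) (at 0)"
  proof (rule Lim_transform_within[where d=1])
    fix h :: real assume h: "0 < dist h 0" "dist h 0 < 1"
    then have "u (s, x + (0 + h) *\<^sub>R v) - u (s, x + 0 *\<^sub>R v) - h *\<^sub>R w (s, (x, 0))
      = h *\<^sub>R (w (s, (x, h)) - w (s, (x, 0)))"
      using q[of h] by (simp add: scaleR_diff_right)
    then show "norm (w (s, (x, h)) - w (s, (x, 0))) =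
        norm (u (s, x + (0 + h) *\<^sub>R v) - u (s, x + 0 *\<^sub>R v) - h *\<^sub>R w (s, (x, 0))) / norm h"
      using h by simp
  qed simp
  then show ?thesis
    unfolding has_vector_derivative_def has_derivative_at by (simp add: bounded_linear_scaleR_left)
qed

lemma Basis_real_prod: "i \<in> (Basis :: (real \<times> 'p::euclidean_space) set) \<Longrightarrow> i = (1, 0) \<or> (\<exists>v\<in>Basis. i = (0, v))"
  by (auto simp: Basis_prod_def)

text \<open>The time derivative is read off the equation; the remaining partial derivatives come
  from \<open>x\<close>. Together they are all the partial derivatives.\<close>

lemma Ck_on_SucI_ode:
  fixes u :: "real \<times> 'p::euclidean_space \<Rightarrow> 'e::real_normed_vector"
  assumes t: "\<And>s x. ((\<lambda>s. u (s, x)) has_vector_derivative f (s, x)) (at s)" "Ck_on k UNIV f"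
    and x: "\<And>v. v \<in> Basis \<Longrightarrow> \<exists>w. Ck_on k UNIV w \<and>
      (\<forall>s x. ((\<lambda>t. u (s, x + t *\<^sub>R v)) has_vector_derivative w (s, x)) (at 0))"
  shows "Ck_on (Suc k) UNIV u"
proof -
  obtain w where w: "\<And>v. v \<in> Basis \<Longrightarrow> Ck_on k UNIV (w v)"
      "\<And>v s x. v \<in> Basis \<Longrightarrow> ((\<lambda>t. u (s, x + t *\<^sub>R v)) has_vector_derivative w v (s, x)) (at 0)"
    using x by metis
  let ?g = "\<lambda>i. if i = (1, 0) then f else w (snd i)"
  show ?thesis
  proof (rule Ck_on_SucI_partials[where g="?g"])
    fix y :: "real \<times> 'p" and i :: "real \<times> 'p" assume i: "i \<in> Basis"
    obtain s p where y: "y = (s, p)" by fastforce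
    show "((\<lambda>t. u (y + t *\<^sub>R i)) has_vector_derivative ?g i y) (at 0)"
    proof (cases "i = (1, 0)")
      case True
      have "((\<lambda>t. s + t) has_vector_derivative 1) (at 0)"
        by (auto intro!: derivative_eq_intros)
      then have "((\<lambda>s. u (s, p)) \<circ> (\<lambda>t. s + t) has_vector_derivative 1 *\<^sub>R f (s, p)) (at 0)"
        by (rule vector_diff_chain_at) (simp add: t)
      then show ?thesis using True y by (simp add: o_def)
    next
      case False
      then show ?thesis using Basis_real_prod[OF i] w(2) y by auto
    qed
  next
    fix i :: "real \<times> 'p" assume "i \<in> Basis"
    then show "Ck_on k UNIV (?g i)" using Basis_real_prod w(1) t(2) by fastforce
  qed auto
qed

text \<open>With the increment h as an extra parameter, the difference quotient of \<open>u\<close>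
  in direction \<open>v\<close> solves a linear equation with continuous coefficients, also at h =
  0. Its value at h = 0 solves the formally differentiated equation, whose data are of class k, so
  the induction hypothesis applies to it.\<close>

lemma linear_ode_Ck:
  fixes A :: "real \<times> 'p::euclidean_space \<Rightarrow> 'e::euclidean_space \<Rightarrow>\<^sub>L 'e"
  assumes C: "compact C" "\<And>z. z \<in> C \<Longrightarrow> fst z > 0" and AC: "\<And>z. z \<notin> C \<Longrightarrow> A z = 0"
    and "Ck_on k UNIV A" "Ck_on k UNIV b" "\<And>z. z \<notin> C \<Longrightarrow> b z = 0"
    and "continuous_on UNIV u" "\<And>s p. s \<le> 0 \<Longrightarrow> u (s, p) = 0"
    and "\<And>s p. ((\<lambda>s. u (s, p)) has_vector_derivative blinfun_apply (A (s, p)) (u (s, p)) + b (s, p)) (at s)"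
  shows "Ck_on k UNIV u"
  using assms(4-)
proof (induction k arbitrary: b u)
  case 0
  then show ?case by simp
next
  case (Suc k)
  note bC = Suc.prems(3) and uc = Suc.prems(4) and u0 = Suc.prems(5) and ud = Suc.prems(6)
  have uk: "Ck_on k UNIV u"
    by (rule Suc.IH[OF Ck_on_SucD[OF Suc.prems(1)] Ck_on_SucD[OF Suc.prems(2)] bC uc u0 ud])
  have Ac: "continuous_on UNIV A" using Ck_on_continuous[OF Suc.prems(1)] .
  have "compact (A ` C)" by (intro compact_continuous_image continuous_on_subset[OF Ac] C) auto
  from compact_imp_bounded[OF this] obtain L0 where "\<forall>y\<in>A ` C. norm y \<le> L0"
    unfolding bounded_iff by (elim exE)
  then have L: "norm (A z) \<le> max L0 0" for z using AC[of z] by (cases "z \<in> C") (auto simp: le_max_iff_disj)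
  show ?case
  proof (rule Ck_on_SucI_ode[OF ud])
    show "Ck_on k UNIV (\<lambda>z. blinfun_apply (A z) (u z) + b z)"
      by (intro Ck_on_add Ck_on_bilinear[OF bounded_bilinear_blinfun_apply] uk
          Ck_on_SucD[OF Suc.prems(1)] Ck_on_SucD[OF Suc.prems(2)] open_UNIV)
  next
    fix v :: 'p
    let ?v = "(0, v) :: real \<times> 'p"
    define HA where "HA = (\<lambda>(z, h). integral {0..1} (\<lambda>s. frechet_derivative A (at (z + (s * h) *\<^sub>R ?v)) ?v))"
    define Hb where "Hb = (\<lambda>(z, h). integral {0..1} (\<lambda>s. frechet_derivative b (at (z + (s * h) *\<^sub>R ?v)) ?v))"
    note HA = hadamard[OF Ck_on_1[OF Suc.prems(1)], where v="?v", folded HA_def]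
    note Hb = hadamard[OF Ck_on_1[OF Suc.prems(2)], where v="?v", folded Hb_def]
    have DA0: "frechet_derivative A (at z) = (\<lambda>v. 0)" if "z \<notin> C" for z
      by (rule frechet_derivative_outside_compact[OF C(1) _ that]) (rule AC)
    have Db0: "frechet_derivative b (at z) = (\<lambda>v. 0)" if "z \<notin> C" for z
      by (rule frechet_derivative_outside_compact[OF C(1) _ that]) (rule bC)
    \<comment> \<open>What remains of the differenced equation after division by h, once the
      coefficient at the shifted point acts on the quotient.\<close>
    let ?b = "\<lambda>(z, h). blinfun_apply (HA (z, h)) (u z) + Hb (z, h)"
    \<comment> \<open>All points from which some shift by at most one unit of \<open>v\<close>
      reaches \<open>C\<close>; off this compact set \<open>?b\<close> vanishes.\<close>
    define C' where "C' = (\<lambda>(z, h). z - h *\<^sub>R ?v) ` (C \<times> {-1..1::real})"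
    have C': "compact C'" unfolding C'_def by (rule compact_shift[OF C(1)])
    have H0: "HA (z, h) = 0 \<and> Hb (z, h) = 0" if z: "\<And>s. s \<in> {0..1} \<Longrightarrow> z + (s * h) *\<^sub>R ?v \<notin> C" for z h
    proof -
      have dA: "frechet_derivative A (at (z + (s * h) *\<^sub>R ?v)) ?v = 0" if "s \<in> {0..1}" for s
        by (rule fun_cong[OF DA0[OF z[OF that]]])
      have db: "frechet_derivative b (at (z + (s * h) *\<^sub>R ?v)) ?v = 0" if "s \<in> {0..1}" for s
        by (rule fun_cong[OF Db0[OF z[OF that]]])
      have "integral {0..1} (\<lambda>s. frechet_derivative A (at (z + (s * h) *\<^sub>R ?v)) ?v) = integral {0..1} (\<lambda>s::real. 0)"
        by (rule integral_cong[OF dA])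
      moreover have "integral {0..1} (\<lambda>s. frechet_derivative b (at (z + (s * h) *\<^sub>R ?v)) ?v) = integral {0..1} (\<lambda>s::real. 0)"
        by (rule integral_cong[OF db])
      ultimately show ?thesis by (simp add: HA_def Hb_def)
    qed
    have b0: "?b (z, h) = 0" if "z \<notin> C'" "\<bar>h\<bar> \<le> 1" for z h
    proof -
      have "z + (s * h) *\<^sub>R ?v \<notin> C" if s: "s \<in> {0..1}" for s
      proof
        assume "z + (s * h) *\<^sub>R ?v \<in> C"
        moreover have "\<bar>s * h\<bar> \<le> 1" using s \<open>\<bar>h\<bar> \<le> 1\<close> by (simp add: abs_mult mult_le_one)
        ultimately have "(z + (s * h) *\<^sub>R ?v) - (s * h) *\<^sub>R ?v \<in> C'"
          unfolding C'_def by (intro image_eqI[of _ _ "(z + (s * h) *\<^sub>R ?v, s * h)"]) auto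
        then show False using \<open>z \<notin> C'\<close> by simp
      qed
      then show ?thesis using H0 by simp
    qed
    have bc: "continuous_on UNIV ?b"
    proof -
      have "continuous_on UNIV (\<lambda>zh. u (fst zh))" by (rule continuous_on_compose2[OF uc]) (auto intro: continuous_intros)
      then show ?thesis unfolding case_prod_beta prod.collapse
        by (intro continuous_intros HA(1) Hb(1))
    qed
    obtain B where B: "\<And>z h. norm (?b (z, clamp1 h)) \<le> B"
      using bounded_clamp1[OF bc C' b0] by blast
    let ?A' = "\<lambda>(s, (x, h)). A (s, x + clamp1 h *\<^sub>R v)"
    let ?b' = "\<lambda>(s, (x, h)). ?b ((s, x), clamp1 h)"
    obtain w where w: "continuous_on UNIV w" "\<And>s p. s \<le> 0 \<Longrightarrow> w (s, p) = 0"
      "\<And>s p. ((\<lambda>s. w (s, p)) has_vector_derivative blinfun_apply (?A' (s, p)) (w (s, p)) + ?b' (s, p)) (at s)"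
    proof (rule linear_ode_exists[of ?A' ?b' "max L0 0" B])
      show "continuous_on UNIV ?A'"
        unfolding case_prod_beta by (rule continuous_on_compose2[OF Ac]) (auto intro!: continuous_intros)
      have "continuous_on UNIV (\<lambda>q :: real \<times> 'p \<times> real. ((fst q, fst (snd q)), clamp1 (snd (snd q))))"
        by (intro continuous_intros)
      from continuous_on_compose2[OF bc this] show "continuous_on UNIV ?b'"
        by (simp add: case_prod_beta)
      show "norm (?A' z) \<le> max L0 0" for z using L by (simp add: case_prod_beta)
      show "norm (?b' z) \<le> B" for z using B[of "(fst z, fst (snd z))" "snd (snd z)"] by (simp add: case_prod_beta)
      show "?A' (s, p) = 0" if "s \<le> 0" for s p
        unfolding case_prod_beta using C(2)[of "(s, fst p + clamp1 (snd p) *\<^sub>R v)"] that by (auto intro: AC)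
      show "?b' (s, p) = 0" if "s \<le> 0" for s p
      proof -
        have "(s, fst p) + (\<sigma> * clamp1 (snd p)) *\<^sub>R ?v \<notin> C" for \<sigma>
          using C(2)[of "(s, fst p) + (\<sigma> * clamp1 (snd p)) *\<^sub>R ?v"] that by auto
        then show ?thesis using H0 by (simp add: case_prod_beta)
      qed
    qed auto
    have q: "u (s, x + h *\<^sub>R v) - u (s, x) = h *\<^sub>R w (s, (x, h))" if h: "\<bar>h\<bar> \<le> 1" for s x h
    proof (cases "s \<le> 0")
      case True
      then show ?thesis using u0 w(2) by simp
    next
      case False
      \<comment> \<open>Both sides solve the same linear equation with value 0 at time 0, so the
        continuous \<open>w\<close> really is the quotient.\<close>
      show ?thesis
      proof (rule linear_ode_unique[where A="\<lambda>s. A (s, x + h *\<^sub>R v)" and b="\<lambda>s. h *\<^sub>R ?b ((s, x), h)"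
            and u="\<lambda>s. u (s, x + h *\<^sub>R v) - u (s, x)" and v="\<lambda>s. h *\<^sub>R w (s, (x, h))" and L="max L0 0" and ?s0.0=0])
        fix s
        have dA: "A (s, x + h *\<^sub>R v) - A (s, x) = h *\<^sub>R HA ((s, x), h)"
          using HA(2)[of "(s, x)" h] by simp
        have db: "b (s, x + h *\<^sub>R v) - b (s, x) = h *\<^sub>R Hb ((s, x), h)"
          using Hb(2)[of "(s, x)" h] by simp
        have "blinfun_apply (A (s, x + h *\<^sub>R v)) (u (s, x + h *\<^sub>R v)) + b (s, x + h *\<^sub>R v)
            - (blinfun_apply (A (s, x)) (u (s, x)) + b (s, x)) =
            blinfun_apply (A (s, x + h *\<^sub>R v)) (u (s, x + h *\<^sub>R v) - u (s, x))
            + (blinfun_apply (A (s, x + h *\<^sub>R v) - A (s, x)) (u (s, x)) + (b (s, x + h *\<^sub>R v) - b (s, x)))"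
          by (simp add: blinfun.diff_left blinfun.diff_right)
        also have "\<dots> = blinfun_apply (A (s, x + h *\<^sub>R v)) (u (s, x + h *\<^sub>R v) - u (s, x)) + h *\<^sub>R ?b ((s, x), h)"
          unfolding dA db by (simp add: blinfun.scaleR_left scaleR_add_right)
        finally show "((\<lambda>s. u (s, x + h *\<^sub>R v) - u (s, x)) has_vector_derivative
            blinfun_apply (A (s, x + h *\<^sub>R v)) (u (s, x + h *\<^sub>R v) - u (s, x)) + h *\<^sub>R ?b ((s, x), h)) (at s)"
          using has_vector_derivative_diff[OF ud[of "x + h *\<^sub>R v" s] ud[of x s]] by simp
        have "((\<lambda>s. h *\<^sub>R w (s, (x, h))) has_vector_derivative
            h *\<^sub>R (blinfun_apply (A (s, x + h *\<^sub>R v)) (w (s, (x, h))) + ?b ((s, x), h))) (at s)"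
          using bounded_linear.has_vector_derivative[OF bounded_linear_scaleR_right w(3)[of "(x, h)" s]] clamp1(2)[OF h] by simp
        then show "((\<lambda>s. h *\<^sub>R w (s, (x, h))) has_vector_derivative
            blinfun_apply (A (s, x + h *\<^sub>R v)) (h *\<^sub>R w (s, (x, h))) + h *\<^sub>R ?b ((s, x), h)) (at s)"
          by (simp add: blinfun.scaleR_right scaleR_add_right)
        show "norm (A (s, x + h *\<^sub>R v)) \<le> max L0 0" by (rule L)
      qed (use False u0 w(2) in auto)
    qed
    \<comment> \<open>At h = 0 the Hadamard averages become derivatives, and the equation for
      \<open>w\<close> becomes the differentiated one.\<close>
    let ?w = "\<lambda>(s, x). w (s, (x, 0))"
    have "Ck_on k UNIV ?w"
    proof (rule Suc.IH[of "\<lambda>z. blinfun_apply (frechet_derivative A (at z) ?v) (u z) + frechet_derivative b (at z) ?v"])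
      show "Ck_on k UNIV A" by (rule Ck_on_SucD[OF Suc.prems(1)])
      show "Ck_on k UNIV (\<lambda>z. blinfun_apply (frechet_derivative A (at z) ?v) (u z) + frechet_derivative b (at z) ?v)"
        using Suc.prems(1,2) uk
        by (intro Ck_on_add Ck_on_bilinear[OF bounded_bilinear_blinfun_apply] open_UNIV) auto
      show "continuous_on UNIV ?w"
        unfolding case_prod_beta by (rule continuous_on_compose2[OF w(1)]) (auto intro!: continuous_intros)
      show "((\<lambda>s. ?w (s, p)) has_vector_derivative blinfun_apply (A (s, p)) (?w (s, p)) +
          (blinfun_apply (frechet_derivative A (at (s, p)) ?v) (u (s, p)) + frechet_derivative b (at (s, p)) ?v)) (at s)" for s p
        using w(3)[of "(p, 0)" s] by (simp add: clamp1(3) HA(3) Hb(3))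
    qed (use DA0 Db0 w(2) in auto)
    then show "\<exists>w. Ck_on k UNIV w \<and> (\<forall>s x. ((\<lambda>t. u (s, x + t *\<^sub>R v)) has_vector_derivative w (s, x)) (at 0))"
      using difference_quotient_derivative[OF w(1) q] by (intro exI[of _ ?w]) simp
  qed
qed

section \<open>Flows of compactly supported time-dependent fields\<close>

definition rank1 :: "'e::euclidean_space \<Rightarrow> 'c::real_normed_vector \<Rightarrow> 'e \<Rightarrow>\<^sub>L 'c" where
  "rank1 j w = blinfun_scaleR_left w o\<^sub>L blinfun_inner_left j"

lemma rank1_apply: "blinfun_apply (rank1 j w) e = (e \<bullet> j) *\<^sub>R w"
  by (simp add: rank1_def)

lemma bounded_linear_rank1: "bounded_linear (rank1 j)"
  unfolding rank1_def
  by (rule bounded_linear_compose[OF bounded_bilinear.bounded_linear_left[OF bounded_bilinear_blinfun_compose]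
        bounded_linear_blinfun_scaleR_left])

text \<open>The Jacobian in the space variable as a bounded operator. Assembled from its values on
  \<open>Basis\<close>, it is visibly smooth in \<open>z\<close> with values in the operator
  space.\<close>

definition space_derivative :: "(real \<times> 'e::euclidean_space \<Rightarrow> 'c::real_normed_vector) \<Rightarrow> real \<times> 'e \<Rightarrow> 'e \<Rightarrow>\<^sub>L 'c" where
  "space_derivative X z = (\<Sum>j\<in>Basis. rank1 j (frechet_derivative X (at z) (0, j)))"

lemma space_derivative_apply:
  assumes "Cinf UNIV X"
  shows "blinfun_apply (space_derivative X z) e = frechet_derivative X (at z) (0, e)"
proof -
  have l: "linear (\<lambda>e. frechet_derivative X (at z) (0, e))"
  proof (rule linearI)
    note l0 = has_derivative_linear[OF Cinf_has_derivative[OF assms, of z]]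
    show "frechet_derivative X (at z) (0, a + b) = frechet_derivative X (at z) (0, a) + frechet_derivative X (at z) (0, b)" for a b
      using linear_add[OF l0, of "(0, a)" "(0, b)"] by simp
    show "frechet_derivative X (at z) (0, c *\<^sub>R a) = c *\<^sub>R frechet_derivative X (at z) (0, a)" for c a
      using linear_scale[OF l0, of c "(0, a)"] by simp
  qed
  show ?thesis
    unfolding linear_basis_sum[OF l, of e] by (simp add: space_derivative_def rank1_apply blinfun.sum_left)
qed

lemma Cinf_space_derivative: "Cinf UNIV X \<Longrightarrow> Cinf UNIV (space_derivative X)"
  unfolding space_derivative_def
  by (intro Cinf_sum Cinf_linear_comp[OF bounded_linear_rank1] Cinf_derivative open_UNIV)

text \<open>The mean Jacobian between two points. It turns the increment of a nonlinear field into a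
  linear map applied to \<open>b - a\<close>, so differences of solutions obey linear
  equations.\<close>

definition segment_average :: "(real \<times> 'e::euclidean_space \<Rightarrow> 'c::banach) \<Rightarrow> real \<times> 'e \<times> 'e \<Rightarrow> 'c" where
  "segment_average J = (\<lambda>(s, a, b). integral {0..1} (\<lambda>\<sigma>. J (s, a + \<sigma> *\<^sub>R (b - a))))"

lemma continuous_on_segment_average:
  assumes "continuous_on UNIV J"
  shows "continuous_on UNIV (segment_average J)"
proof -
  have "continuous_on (UNIV \<times> cbox 0 1)
     (\<lambda>(q :: real \<times> 'a \<times> 'a, \<sigma>::real). J (fst q, fst (snd q) + \<sigma> *\<^sub>R (snd (snd q) - fst (snd q))))"
    unfolding case_prod_beta by (rule continuous_on_compose2[OF assms]) (auto intro!: continuous_intros)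
  then have "continuous_on UNIV (\<lambda>q :: real \<times> 'a \<times> 'a.
      integral (cbox 0 1) (\<lambda>\<sigma>::real. J (fst q, fst (snd q) + \<sigma> *\<^sub>R (snd (snd q) - fst (snd q)))))"
    by (rule integral_continuous_on_param)
  then show ?thesis by (simp add: segment_average_def case_prod_beta)
qed

lemma segment_average_increment:
  fixes X :: "real \<times> 'e::euclidean_space \<Rightarrow> 'c::banach"
  assumes X: "Cinf UNIV X"
  shows "X (s, b) - X (s, a) = blinfun_apply (segment_average (space_derivative X) (s, a, b)) (b - a)"
proof -
  let ?J = "\<lambda>\<sigma>. space_derivative X (s, a + \<sigma> *\<^sub>R (b - a))"
  have "continuous_on UNIV ?J"
    by (rule continuous_on_compose2[OF Cinf_continuous[OF Cinf_space_derivative[OF X]]])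
      (auto intro!: continuous_intros)
  then have Ji: "?J integrable_on {0..1}"
    by (intro integrable_continuous_real) (rule continuous_on_subset, assumption, simp)
  have "X ((s, a) + 1 *\<^sub>R (0, b - a)) - X (s, a) =
      1 *\<^sub>R (\<lambda>(z, h). integral {0..1} (\<lambda>\<sigma>. frechet_derivative X (at (z + (\<sigma> * h) *\<^sub>R (0, b - a))) (0, b - a))) ((s, a), 1)"
    by (rule hadamard(2)) (use X in \<open>simp only: Cinf_def\<close>)
  then have "X (s, b) - X (s, a) = integral {0..1} (\<lambda>\<sigma>. blinfun_apply (?J \<sigma>) (b - a))"
    by (simp add: space_derivative_apply[OF X])
  also have "\<dots> = blinfun_apply (integral {0..1} ?J) (b - a)"
    using integral_linear[OF Ji bounded_bilinear.bounded_linear_left[OF bounded_bilinear_blinfun_apply], of "b - a"]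
    by (simp add: o_def)
  finally show ?thesis by (simp add: segment_average_def)
qed

lemma segment_average_bounded:
  fixes X :: "real \<times> 'e::euclidean_space \<Rightarrow> 'e"
  assumes X: "Cinf UNIV X" and C: "compact C" and XC: "\<And>z. z \<notin> C \<Longrightarrow> X z = 0"
  obtains L where "L > 0" "\<And>q. norm (segment_average (space_derivative X) q) \<le> L"
proof -
  let ?J = "space_derivative X" and ?G = "segment_average (space_derivative X)"
  have J: "Cinf UNIV ?J" by (rule Cinf_space_derivative[OF X])
  have J0: "?J z = 0" if "z \<notin> C" for z
    using frechet_derivative_outside_compact[of C X z] C XC that
    by (intro blinfun_eqI) (simp add: space_derivative_apply[OF X])
  have "compact (?J ` C)"
    by (intro compact_continuous_image continuous_on_subset[OF Cinf_continuous[OF J]] C) auto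
  from compact_imp_bounded[OF this] obtain L0 where "\<forall>y\<in>?J ` C. norm y \<le> L0"
    unfolding bounded_iff by (elim exE)
  then have JL: "norm (?J z) \<le> max L0 1" for z using J0[of z] by (cases "z \<in> C") (auto simp: le_max_iff_disj)
  have "norm (?G q) \<le> max L0 1" for q
  proof -
    have "norm (integral {0..1} (\<lambda>\<sigma>. ?J (fst q, fst (snd q) + \<sigma> *\<^sub>R (snd (snd q) - fst (snd q))))) \<le> max L0 1 * (1 - 0)"
      by (rule integral_bound) (auto intro!: JL continuous_intros continuous_on_compose2[OF Cinf_continuous[OF J]])
    then show ?thesis by (simp add: segment_average_def case_prod_beta)
  qed
  then show thesis by (intro that[of "max L0 1"]) auto
qed

lemma compact_support_lipschitz:
  fixes X :: "real \<times> 'e::euclidean_space \<Rightarrow> 'e"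
  assumes X: "Cinf UNIV X" and "compact C" "\<And>z. z \<notin> C \<Longrightarrow> X z = 0"
  obtains L where "L > 0" "\<And>s a b. norm (X (s, a) - X (s, b)) \<le> L * norm (a - b)"
proof -
  obtain L where L: "L > 0" "\<And>q. norm (segment_average (space_derivative X) q) \<le> L"
    using segment_average_bounded[OF assms] by blast
  have "norm (X (s, a) - X (s, b)) \<le> L * norm (a - b)" for s a b
    unfolding segment_average_increment[OF X]
    by (rule order_trans[OF norm_blinfun mult_right_mono[OF L(2)]]) simp
  then show thesis using L(1) that by simp
qed

text \<open>Existence is obtained for the displacement \<open>u\<close> from the initial point.
  Smoothness is a bootstrap: if the flow is of class k, then so is the coefficient of the
  variational equation, hence by \<open>linear_ode_Ck\<close> its solution, which is the space
  derivative of the flow. Support in positive times makes the flow the identity for s \<le>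
  0.\<close>

theorem flow_exists:
  fixes X :: "real \<times> 'e::euclidean_space \<Rightarrow> 'e"
  assumes X: "Cinf UNIV X" and C: "compact C" "\<And>z. z \<in> C \<Longrightarrow> fst z > 0"
    and XC: "\<And>z. z \<notin> C \<Longrightarrow> X z = 0"
  obtains \<phi> where "Cinf UNIV \<phi>" "\<And>s x. s \<le> 0 \<Longrightarrow> \<phi> (s, x) = x"
    "\<And>s x. x \<notin> snd ` C \<Longrightarrow> \<phi> (s, x) = x"
    "\<And>s x. ((\<lambda>s. \<phi> (s, x)) has_vector_derivative X (s, \<phi> (s, x))) (at s)"
proof -
  let ?J = "space_derivative X" and ?G = "segment_average (space_derivative X)"
  have J: "Cinf UNIV ?J" by (rule Cinf_space_derivative[OF X])
  have Gc: "continuous_on UNIV ?G" by (rule continuous_on_segment_average[OF Cinf_continuous[OF J]])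
  have J0: "?J z = 0" if "z \<notin> C" for z
    using frechet_derivative_outside_compact[of C X z] C(1) XC that
    by (intro blinfun_eqI) (simp add: space_derivative_apply[OF X])
  obtain L where Lpos: "L > 0" and GL: "\<And>q. norm (?G q) \<le> L"
    using segment_average_bounded[OF X C(1) XC] by blast
  have G0: "?G (s, a, b) = 0" if "s \<le> 0" for s a b
  proof -
    have "?J (s, y) = 0" for y using C(2)[of "(s, y)"] that by (intro J0) auto
    then show ?thesis by (simp add: segment_average_def)
  qed
  have lip: "norm (X (s, a) - X (s, b)) \<le> L * norm (a - b)" for s a b
    unfolding segment_average_increment[OF X]
    by (rule order_trans[OF norm_blinfun mult_right_mono[OF GL]]) simp
  have "compact (X ` C)"
    by (intro compact_continuous_image continuous_on_subset[OF Cinf_continuous[OF X]] C) auto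
  from compact_imp_bounded[OF this] obtain B0 where "\<forall>y\<in>X ` C. norm y \<le> B0"
    unfolding bounded_iff by (elim exE)
  then have XB: "norm (X z) \<le> max B0 0" for z using XC[of z] by (cases "z \<in> C") (auto simp: le_max_iff_disj)
  have Xneg: "X (s, y) = 0" if "s \<le> 0" for s y using C(2)[of "(s, y)"] that by (intro XC) auto
  obtain u where u: "continuous_on UNIV u" "\<And>s p. s \<le> 0 \<Longrightarrow> u (s, p) = 0"
    "\<And>s p. ((\<lambda>s. u (s, p)) has_vector_derivative X (s, p + u (s, p))) (at s)"
  proof (rule ode_exists[of "\<lambda>z w. X (fst z, snd z + w)" L "max B0 0"])
    show "continuous_on UNIV (\<lambda>(z, w). X (fst z, snd z + w))"
      unfolding case_prod_beta
      by (rule continuous_on_compose2[OF Cinf_continuous[OF X]]) (auto intro!: continuous_intros)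
    show "norm (X (fst z, snd z + v) - X (fst z, snd z + w)) \<le> L * norm (v - w)" for z v w
      using lip[of "fst z" "snd z + v" "snd z + w"] by simp
  qed (use XB Xneg Lpos in auto)
  define \<phi> where "\<phi> = (\<lambda>(s, x). x + u (s, x))"
  have \<phi>d: "((\<lambda>s. \<phi> (s, x)) has_vector_derivative X (s, \<phi> (s, x))) (at s)" for s x
    using has_vector_derivative_add[OF has_vector_derivative_const u(3)[of x s], of x] by (simp add: \<phi>_def)
  have \<phi>c: "continuous_on UNIV \<phi>"
    unfolding \<phi>_def case_prod_beta prod.collapse by (intro continuous_intros u(1))
  have fixed: "\<phi> (s, x) = x" if x: "x \<notin> snd ` C" for s x
  proof (cases "s \<le> 0")
    case False
    have X0: "X (s, x) = 0" for s using x by (intro XC) force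
    have "u (s, x) = 0"
    proof (rule ode_zero[where z="\<lambda>s. u (s, x)" and ?s0.0=0])
      show "((\<lambda>s. u (s, x)) has_vector_derivative X (s, x + u (s, x))) (at s)" for s by (rule u(3))
      show "norm (X (s, x + u (s, x))) \<le> L * norm (u (s, x))" for s
        using lip[of s "x + u (s, x)" x] X0 by simp
    qed (use False u in auto)
    then show ?thesis by (simp add: \<phi>_def)
  qed (simp add: \<phi>_def u)
  define C' where "C' = (fst ` C \<times> snd ` C) \<inter> {z. (fst z, \<phi> z) \<in> C}"
  have "closed ((\<lambda>z. (fst z, \<phi> z)) -` C)"
    by (intro closed_vimage compact_imp_closed C continuous_intros \<phi>c)
  then have "closed {z. (fst z, \<phi> z) \<in> C}" by (simp add: vimage_def)
  then have C': "compact C'"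
    unfolding C'_def by (intro compact_Int_closed compact_Times compact_continuous_image C continuous_intros)
  have C'2: "fst z > 0" if "z \<in> C'" for z using that C(2) by (auto simp: C'_def)
  let ?A = "\<lambda>z. ?J (fst z, \<phi> z)"
  have A0: "?A z = 0" if "z \<notin> C'" for z
  proof (cases "(fst z, \<phi> z) \<in> C")
    case True
    then have "snd z \<in> snd ` C" using fixed[of "snd z" "fst z"] by force
    moreover have "fst z \<in> fst ` C" using imageI[OF True, of fst] by simp
    ultimately show ?thesis using True that by (cases z) (auto simp: C'_def)
  qed (rule J0)
  have "Ck_on k UNIV u" for k
  proof (induction k)
    case 0
    then show ?case by (simp add: u(1))
  next
    case (Suc k)
    have \<phi>k: "Ck_on k UNIV \<phi>"
      unfolding \<phi>_def case_prod_beta prod.collapse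
      by (intro Ck_on_add Suc.IH Ck_on_linear bounded_linear_snd open_UNIV)
    have sk: "Ck_on k UNIV (\<lambda>z. (fst z, \<phi> z))"
    proof -
      have "Ck_on k UNIV (\<lambda>z. (fst z, 0) + (0, \<phi> z))"
        by (intro Ck_on_add Ck_on_linear_comp[OF bounded_linear_Pair[OF bounded_linear_zero bounded_linear_ident]]
            Ck_on_linear bounded_linear_Pair bounded_linear_fst bounded_linear_zero \<phi>k open_UNIV)
      then show ?thesis by simp
    qed
    have Ak: "Ck_on k UNIV ?A"
      using J by (intro Ck_on_compose[OF open_UNIV open_UNIV sk]) (auto simp: Cinf_def)
    show ?case
    proof (rule Ck_on_SucI_ode)
      show "((\<lambda>s. u (s, x)) has_vector_derivative X (fst (s, x), \<phi> (s, x))) (at s)" for s x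
        using u(3) by (simp add: \<phi>_def)
      show "Ck_on k UNIV (\<lambda>z. X (fst z, \<phi> z))"
        using X by (intro Ck_on_compose[OF open_UNIV open_UNIV sk]) (auto simp: Cinf_def)
    next
      fix v :: 'e
      let ?A' = "\<lambda>(s, (x, h)). ?G (s, \<phi> (s, x), \<phi> (s, x + h *\<^sub>R v))"
      let ?b' = "\<lambda>z. blinfun_apply (?A' z) v"
      have A'c: "continuous_on UNIV ?A'"
        unfolding case_prod_beta
        by (intro continuous_on_compose2[OF Gc] continuous_intros continuous_on_compose2[OF \<phi>c]) auto
      \<comment> \<open>The inhomogeneity \<open>?b'\<close> is there because increments of the flow
        are increments of \<open>u\<close> plus h v.\<close>
      obtain w where w: "continuous_on UNIV w" "\<And>s p. s \<le> 0 \<Longrightarrow> w (s, p) = 0"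
        "\<And>s p. ((\<lambda>s. w (s, p)) has_vector_derivative blinfun_apply (?A' (s, p)) (w (s, p)) + ?b' (s, p)) (at s)"
      proof (rule linear_ode_exists[of ?A' ?b' L "L * norm v"])
        show "continuous_on UNIV ?b'" by (intro continuous_intros A'c)
        show "norm (?A' z) \<le> L" for z using GL by (simp add: case_prod_beta)
        show "norm (?b' z) \<le> L * norm v" for z
          using GL by (intro order_trans[OF norm_blinfun mult_right_mono]) (auto simp: case_prod_beta)
      qed (use A'c G0 in \<open>auto simp: case_prod_beta\<close>)
      have q: "u (s, x + h *\<^sub>R v) - u (s, x) = h *\<^sub>R w (s, (x, h))" for s x h
      proof (cases "s \<le> 0")
        case False
        let ?a = "\<lambda>s. ?G (s, \<phi> (s, x), \<phi> (s, x + h *\<^sub>R v))"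
        show ?thesis
        proof (rule linear_ode_unique[where A="?a" and b="\<lambda>s. h *\<^sub>R blinfun_apply (?a s) v"
              and u="\<lambda>s. u (s, x + h *\<^sub>R v) - u (s, x)" and v="\<lambda>s. h *\<^sub>R w (s, (x, h))" and L=L and ?s0.0=0])
          fix s
          have "X (s, \<phi> (s, x + h *\<^sub>R v)) - X (s, \<phi> (s, x)) =
              blinfun_apply (?a s) (u (s, x + h *\<^sub>R v) - u (s, x)) + h *\<^sub>R blinfun_apply (?a s) v"
            unfolding segment_average_increment[OF X]
            by (simp add: \<phi>_def blinfun.add_right blinfun.diff_right blinfun.scaleR_right)
          then show "((\<lambda>s. u (s, x + h *\<^sub>R v) - u (s, x)) has_vector_derivative
            blinfun_apply (?a s) (u (s, x + h *\<^sub>R v) - u (s, x)) + h *\<^sub>R blinfun_apply (?a s) v) (at s)"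
            using has_vector_derivative_diff[OF u(3)[of "x + h *\<^sub>R v" s] u(3)[of x s]] by (simp add: \<phi>_def)
          have "((\<lambda>s. h *\<^sub>R w (s, (x, h))) has_vector_derivative
              h *\<^sub>R (blinfun_apply (?a s) (w (s, (x, h))) + blinfun_apply (?a s) v)) (at s)"
            using bounded_linear.has_vector_derivative[OF bounded_linear_scaleR_right w(3)[of "(x, h)" s]] by simp
          then show "((\<lambda>s. h *\<^sub>R w (s, (x, h))) has_vector_derivative
              blinfun_apply (?a s) (h *\<^sub>R w (s, (x, h))) + h *\<^sub>R blinfun_apply (?a s) v) (at s)"
            by (simp add: blinfun.scaleR_right scaleR_add_right)
        qed (use False u w GL in auto)
      qed (simp add: u(2) w(2))
      let ?w = "\<lambda>(s, x). w (s, (x, 0))"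
      have G1: "?G (s, a, a) = ?J (s, a)" for s a by (simp add: segment_average_def)
      have "Ck_on k UNIV ?w"
      proof (rule linear_ode_Ck[OF C' C'2 A0 Ak])
        show "Ck_on k UNIV (\<lambda>z. blinfun_apply (?A z) v)"
          by (intro Ck_on_linear_comp[OF bounded_bilinear.bounded_linear_left[OF bounded_bilinear_blinfun_apply]] Ak open_UNIV)
        show "continuous_on UNIV ?w"
          unfolding case_prod_beta by (rule continuous_on_compose2[OF w(1)]) (auto intro!: continuous_intros)
        show "((\<lambda>s. ?w (s, p)) has_vector_derivative
            blinfun_apply (?A (s, p)) (?w (s, p)) + blinfun_apply (?A (s, p)) v) (at s)" for s p
          using w(3)[of "(p, 0)" s] by (simp add: G1)
      qed (use A0 w(2) in auto)
      then show "\<exists>w. Ck_on k UNIV w \<and> (\<forall>s x. ((\<lambda>t. u (s, x + t *\<^sub>R v)) has_vector_derivative w (s, x)) (at 0))"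
        using difference_quotient_derivative[OF w(1) q] by (intro exI[of _ ?w]) simp
    qed
  qed
  then have "Cinf UNIV u" by (simp add: Cinf_def)
  then have "Cinf UNIV \<phi>"
    unfolding \<phi>_def case_prod_beta prod.collapse by (intro Cinf_add Cinf_snd Cinf_id open_UNIV)
  moreover have "\<phi> (s, x) = x" if "s \<le> 0" for s x using u(2)[OF that] by (simp add: \<phi>_def)
  ultimately show thesis using fixed \<phi>d by (rule that)
qed

section \<open>Gray's argument in coordinate space\<close>

text \<open>Backward times reduce to forward ones by reversing time.\<close>

lemma ode_zero_global:
  fixes z :: "real \<Rightarrow> 'e::real_inner"
  assumes d: "\<And>s. (z has_vector_derivative z' s) (at s)"
    and b: "\<And>s. norm (z' s) \<le> L * norm (z s)" and z0: "z s0 = 0"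
  shows "z s = 0"
proof (cases "s0 \<le> s")
  case True
  then show ?thesis using ode_zero[of z z' L s0 s] assms by blast
next
  case False
  have "z (- (- s)) = 0"
  proof (rule ode_zero[where z="\<lambda>s. z (- s)" and z'="\<lambda>s. - z' (- s)" and L=L and ?s0.0="- s0"])
    fix r
    have "((\<lambda>r::real. - r) has_vector_derivative (- 1)) (at r)"
      by (auto intro!: derivative_eq_intros)
    from vector_diff_chain_at[OF this d]
    show "((\<lambda>s. z (- s)) has_vector_derivative - z' (- r)) (at r)" by (simp add: o_def)
    show "norm (- z' (- r)) \<le> L * norm (z (- r))" using b by simp
  qed (use z0 False in auto)
  then show ?thesis by simp
qed

text \<open>The inverse is the time-one map of the reversed field -X(1 - s, x). Support in times
  strictly between 0 and 1 lets \<open>flow_exists\<close> apply to both fields.\<close>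

lemma flow_time1:
  fixes X :: "real \<times> 'e::euclidean_space \<Rightarrow> 'e"
  assumes X: "Cinf UNIV X" and C: "compact C" "\<And>z. z \<in> C \<Longrightarrow> 0 < fst z \<and> fst z < 1"
    and XC: "\<And>z. z \<notin> C \<Longrightarrow> X z = 0"
  obtains \<phi> \<Psi> where "Cinf UNIV \<phi>" "\<And>s x. s \<le> 0 \<Longrightarrow> \<phi> (s, x) = x"
    "\<And>s x. x \<notin> snd ` C \<Longrightarrow> \<phi> (s, x) = x"
    "\<And>s x. ((\<lambda>s. \<phi> (s, x)) has_vector_derivative X (s, \<phi> (s, x))) (at s)"
    "Cinf UNIV \<Psi>" "\<And>x. \<Psi> (\<phi> (1, x)) = x" "\<And>x. \<phi> (1, \<Psi> x) = x"
proof -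
  have C0: "0 < fst z" if "z \<in> C" for z using C(2)[OF that] by simp
  obtain \<phi> where \<phi>: "Cinf UNIV \<phi>" "\<And>s x. s \<le> 0 \<Longrightarrow> \<phi> (s, x) = x" "\<And>s x. x \<notin> snd ` C \<Longrightarrow> \<phi> (s, x) = x"
    "\<And>s x. ((\<lambda>s. \<phi> (s, x)) has_vector_derivative X (s, \<phi> (s, x))) (at s)"
    by (rule flow_exists[OF X C(1) C0 XC]) auto
  let ?Y = "\<lambda>z. - X (1 - fst z, snd z)" and ?C = "(\<lambda>z. (1 - fst z, snd z)) ` C"
  have Y: "Cinf UNIV ?Y"
    by (intro Cinf_minus Cinf_compose_UNIV[OF X] cinf_intros open_UNIV)
  have C': "compact ?C" by (intro compact_continuous_image C continuous_intros)
  have YC: "?Y z = 0" if "z \<notin> ?C" for z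
  proof -
    have "(1 - fst z, snd z) \<notin> C"
    proof
      assume "(1 - fst z, snd z) \<in> C"
      then have "(1 - fst (1 - fst z, snd z), snd (1 - fst z, snd z)) \<in> ?C" by (rule imageI)
      then show False using that by simp
    qed
    then show ?thesis using XC by simp
  qed
  have C'0: "0 < fst z" if "z \<in> ?C" for z using that C(2) by auto
  obtain \<psi> where \<psi>: "Cinf UNIV \<psi>" "\<And>s x. s \<le> 0 \<Longrightarrow> \<psi> (s, x) = x"
      "\<And>s x. x \<notin> snd ` ?C \<Longrightarrow> \<psi> (s, x) = x"
      "\<And>s x. ((\<lambda>s. \<psi> (s, x)) has_vector_derivative ?Y (s, \<psi> (s, x))) (at s)"
    by (rule flow_exists[OF Y C' C'0 YC]) auto
  obtain L where "L > 0" and L: "\<And>s a b. norm (X (s, a) - X (s, b)) \<le> L * norm (a - b)"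
    by (rule compact_support_lipschitz[OF X C(1) XC]) auto
  have rev: "((\<lambda>r. f (1 - r)) has_vector_derivative - f') (at s)"
    if "(f has_vector_derivative f') (at (1 - s))" for f :: "real \<Rightarrow> 'e" and f' s
  proof -
    have "((\<lambda>r::real. 1 - r) has_vector_derivative (- 1)) (at s)"
      by (auto intro!: derivative_eq_intros)
    from vector_diff_chain_at[OF this that] show ?thesis by (simp add: o_def)
  qed
  have 1: "\<psi> (1, \<phi> (1, x)) = x" for x
  proof -
    have "\<psi> (1, \<phi> (1, x)) - \<phi> (1 - 1, x) = 0"
    proof (rule ode_zero_global[where z="\<lambda>s. \<psi> (s, \<phi> (1, x)) - \<phi> (1 - s, x)" and L=L and ?s0.0=0])
      show "((\<lambda>s. \<psi> (s, \<phi> (1, x)) - \<phi> (1 - s, x)) has_vector_derivative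
         ?Y (s, \<psi> (s, \<phi> (1, x))) - - X (1 - s, \<phi> (1 - s, x))) (at s)" for s
        by (intro has_vector_derivative_diff \<psi>(4) rev \<phi>(4))
      show "norm (?Y (s, \<psi> (s, \<phi> (1, x))) - - X (1 - s, \<phi> (1 - s, x))) \<le>
          L * norm (\<psi> (s, \<phi> (1, x)) - \<phi> (1 - s, x))" for s
        using L[of "1 - s" "\<phi> (1 - s, x)" "\<psi> (s, \<phi> (1, x))"] by (simp add: norm_minus_commute)
    qed (simp add: \<psi>(2))
    then show ?thesis by (simp add: \<phi>(2))
  qed
  have 2: "\<phi> (1, \<psi> (1, x)) = x" for x
  proof -
    have "\<phi> (1, \<psi> (1, x)) - \<psi> (1 - 1, x) = 0"
    proof (rule ode_zero_global[where z="\<lambda>s. \<phi> (s, \<psi> (1, x)) - \<psi> (1 - s, x)" and L=L and ?s0.0=0])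
      show "((\<lambda>s. \<phi> (s, \<psi> (1, x)) - \<psi> (1 - s, x)) has_vector_derivative
         X (s, \<phi> (s, \<psi> (1, x))) - - ?Y (1 - s, \<psi> (1 - s, x))) (at s)" for s
        by (intro has_vector_derivative_diff \<psi>(4) rev \<phi>(4))
      show "norm (X (s, \<phi> (s, \<psi> (1, x))) - - ?Y (1 - s, \<psi> (1 - s, x))) \<le>
          L * norm (\<phi> (s, \<psi> (1, x)) - \<psi> (1 - s, x))" for s
        using L[of s "\<phi> (s, \<psi> (1, x))" "\<psi> (1 - s, x)"] by simp
    qed (simp add: \<phi>(2))
    then show ?thesis by (simp add: \<psi>(2))
  qed
  have "Cinf UNIV (\<lambda>x. \<psi> (1, x))"
    by (intro Cinf_compose_UNIV[OF \<psi>(1)] cinf_intros open_UNIV)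
  with \<phi> show thesis using 1 2 by (rule that)
qed

section \<open>Curl as exterior derivative, and Gray's vector field\<close>

text \<open>For a 1-form with coefficient vector a, the number d\<alpha>(u, v) is the inner product
  of the curl with u \<times> v; \<open>curl_of_cross\<close> is this identity.\<close>

definition curl_of :: "(real^3 \<Rightarrow> real^3) \<Rightarrow> real^3" where
  "curl_of D = vector [D (axis 2 1) $ 3 - D (axis 3 1) $ 2,
    D (axis 3 1) $ 1 - D (axis 1 1) $ 3, D (axis 1 1) $ 2 - D (axis 2 1) $ 1]"

definition curl :: "(real^3 \<Rightarrow> real^3) \<Rightarrow> real^3 \<Rightarrow> real^3" where
  "curl a x = curl_of (frechet_derivative a (at x))"

lemma linear_axis3:
  fixes D :: "real^3 \<Rightarrow> 'b::real_vector"
  assumes "linear D"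
  shows "D u = u $ 1 *\<^sub>R D (axis 1 1) + u $ 2 *\<^sub>R D (axis 2 1) + u $ 3 *\<^sub>R D (axis 3 1)"
proof -
  have "u = u $ 1 *\<^sub>R axis 1 1 + u $ 2 *\<^sub>R axis 2 1 + u $ 3 *\<^sub>R axis 3 1"
    by (simp add: vec_eq_iff forall_3 axis_def)
  then have "D u = D (u $ 1 *\<^sub>R axis 1 1 + u $ 2 *\<^sub>R axis 2 1 + u $ 3 *\<^sub>R axis 3 1)" by simp
  then show ?thesis by (simp only: linear_add[OF assms] linear_scale[OF assms])
qed

lemma inner_3: "(u::real^3) \<bullet> v = u $ 1 * v $ 1 + u $ 2 * v $ 2 + u $ 3 * v $ 3"
  by (simp add: inner_vec_def sum_3)

lemma cross3_components:
  "cross3 u v $ 1 = u $ 2 * v $ 3 - u $ 3 * v $ 2"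
  "cross3 u v $ 2 = u $ 3 * v $ 1 - u $ 1 * v $ 3"
  "cross3 u v $ 3 = u $ 1 * v $ 2 - u $ 2 * v $ 1"
  by (simp_all add: cross3_def)

lemma curl_of_cross:
  assumes "linear D"
  shows "D u \<bullet> v - D v \<bullet> u = curl_of D \<bullet> cross3 u v"
  unfolding linear_axis3[OF assms, of u] linear_axis3[OF assms, of v]
  by (simp add: inner_3 cross3_components curl_of_def algebra_simps)

lemma curl_of_add: "curl_of (\<lambda>v. D v + E v) = curl_of D + curl_of E"
  by (simp add: curl_of_def vec_eq_iff forall_3)

lemma curl_of_scaleR: "curl_of (\<lambda>v. c *\<^sub>R D v) = c *\<^sub>R curl_of D"
  by (simp add: curl_of_def vec_eq_iff forall_3 algebra_simps)

lemma Cinf_curl [cinf_intros]: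
  assumes "Cinf U a"
  shows "Cinf U (curl a)"
proof (rule Cinf_componentwise[OF Cinf_open[OF assms]])
  fix i :: 3
  have "Cinf U (\<lambda>x. frechet_derivative a (at x) v $ j)" for v j
    by (intro Cinf_vec_nth Cinf_derivative assms)
  note c = Cinf_diff[OF this this]
  show "Cinf U (\<lambda>x. curl a x $ i)"
    using exhaust_3[of i] by (elim disjE) (simp_all add: curl_def curl_of_def c)
qed

lemma bounded_bilinear_cross3: "bounded_bilinear cross3"
  unfolding bilinear_conv_bounded_bilinear[symmetric]
  by (rule bilinear_cross)

lemmas Cinf_cross3 [cinf_intros] = Cinf_bilinear[OF bounded_bilinear_cross3]

lemma curl_add_scaleR:
  assumes "a differentiable (at x)" "b differentiable (at x)"
  shows "curl (\<lambda>y. a y + q *\<^sub>R b y) x = curl a x + q *\<^sub>R curl b x"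
proof -
  have "((\<lambda>y. a y + q *\<^sub>R b y) has_derivative
      (\<lambda>v. frechet_derivative a (at x) v + q *\<^sub>R frechet_derivative b (at x) v)) (at x)"
    using assms by (intro has_derivative_add has_derivative_scaleR_right) (simp_all add: frechet_derivative_works)
  from frechet_derivative_eq[OF this] show ?thesis
    by (simp add: curl_def curl_of_add curl_of_scaleR)
qed

text \<open>The algebra behind Gray's vector field \<open>X = (a \<times> d) / (a \<cdot> c)\<close>, where \<open>c\<close> is the curl of
  \<open>a\<close> and \<open>d\<close> the time derivative: \<open>\<iota>\<^sub>X da + d\<close> is a multiple of \<open>a\<close>.\<close>

lemma gray_identity:
  fixes a c d w :: "real^3"
  assumes "a \<bullet> c \<noteq> 0"
  shows "d \<bullet> w + c \<bullet> cross3 ((1 / (a \<bullet> c)) *\<^sub>R cross3 a d) w = (c \<bullet> d) / (a \<bullet> c) * (a \<bullet> w)"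
proof -
  have "(a \<bullet> c) * (d \<bullet> w) + c \<bullet> cross3 (cross3 a d) w = (c \<bullet> d) * (a \<bullet> w)"
    by (simp add: inner_3 cross3_components algebra_simps)
  moreover have "cross3 ((1 / (a \<bullet> c)) *\<^sub>R cross3 a d) w = (1 / (a \<bullet> c)) *\<^sub>R cross3 (cross3 a d) w"
    by (simp add: cross_mult_left)
  ultimately show ?thesis using assms by (simp add: field_simps)
qed

lemma inner_cross3_self: "a \<bullet> cross3 a d = 0"
  by (simp add: inner_3 cross3_components algebra_simps)

lemma curl_of_linear_comb:
  "curl_of (\<lambda>v. frechet_derivative a (at x) v + q *\<^sub>R frechet_derivative b (at x) v) = curl a x + q *\<^sub>R curl b x"
  by (simp add: curl_def curl_of_add curl_of_scaleR)

lemma has_vector_derivative_along_0: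
  "(f has_derivative f') (at x) \<Longrightarrow> ((\<lambda>s. f (x + s *\<^sub>R v)) has_vector_derivative f' v) (at 0)"
  using has_vector_derivative_along[of f f' x 0 v] by simp

text \<open>Gray's field moves the kernels of a + q \<delta> along as q grows. The isotopy parameter
  t is a frozen coordinate of the flow that scales the final value of q, while the flow time s
  always runs from 0 to 1. So t = 0 gives the identity, t = 1 the full motion, and smoothness in t
  is smooth dependence on the initial point.\<close>

lemma gray_local:
  fixes a \<delta> :: "real^3 \<Rightarrow> real^3"
  assumes W: "compact K" "K \<subseteq> W" and a: "Cinf W a" and d: "Cinf W \<delta>"
    and dK: "\<And>x. x \<in> W \<Longrightarrow> x \<notin> K \<Longrightarrow> \<delta> x = 0"
    and pos: "\<And>q x. x \<in> W \<Longrightarrow> 0 \<le> q \<Longrightarrow> q \<le> 1 \<Longrightarrow>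
      (a x + q *\<^sub>R \<delta> x) \<bullet> (curl a x + q *\<^sub>R curl \<delta> x) > 0"
  obtains \<Phi> \<Psi> :: "real \<times> (real^3) \<Rightarrow> real^3" where
    "Cinf UNIV \<Phi>" "Cinf UNIV \<Psi>" "\<And>t x. \<Psi> (t, \<Phi> (t, x)) = x" "\<And>t x. \<Phi> (t, \<Psi> (t, x)) = x"
    "\<And>x. \<Phi> (0, x) = x" "\<And>t x. x \<notin> K \<Longrightarrow> \<Phi> (t, x) = x"
    "\<And>x v. x \<in> W \<Longrightarrow> a x \<bullet> v = 0 \<Longrightarrow>
      (a (\<Phi> (1, x)) + \<delta> (\<Phi> (1, x))) \<bullet> frechet_derivative (\<lambda>x. \<Phi> (1, x)) (at x) v = 0"
    "\<And>x. x \<in> W \<Longrightarrow> \<Phi> (1, x) \<in> W"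
proof -
  \<comment> \<open>Runs from 0 to 1 with derivative supported in [1/3, 2/3], which keeps the field
    away from the ends of the time interval.\<close>
  define \<theta> where "\<theta> = (\<lambda>s. step_fn (3 * s - 1))"
  define \<theta>' where "\<theta>' = (\<lambda>s. frechet_derivative \<theta> (at s) 1)"
  \<comment> \<open>Satisfies g 0 = 0 and g 1 = 1 and vanishes outside (0, 3), so the support is
    compact in the t direction as well.\<close>
  define g where "g = (\<lambda>t. step_fn t * step_fn (3 - t))"
  have \<theta>: "Cinf UNIV \<theta>"
    unfolding \<theta>_def by (intro Cinf_compose_UNIV[OF Cinf_step_fn] cinf_intros open_UNIV)
  have \<theta>'c: "Cinf UNIV \<theta>'" unfolding \<theta>'_def by (rule Cinf_derivative[OF \<theta>])
  have gc: "Cinf UNIV g"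
    unfolding g_def by (intro Cinf_mult Cinf_compose_UNIV[OF Cinf_step_fn] Cinf_diff Cinf_const Cinf_id open_UNIV)
  have \<theta>01: "0 \<le> \<theta> s \<and> \<theta> s \<le> 1" for s using step_fn_range by (simp add: \<theta>_def)
  have g01: "0 \<le> g t \<and> g t \<le> 1" for t using step_fn_range by (simp add: g_def mult_le_one)
  have g0: "g t = 0" if "t \<notin> {0<..<3}" for t using that step_fn_0 by (auto simp: g_def not_less)
  have g1: "g 1 = 1" by (simp add: g_def step_fn_1)
  have \<theta>'0: "\<theta>' s = 0" if "s \<notin> {1/3..2/3}" for s
  proof -
    have "(\<theta> has_derivative (\<lambda>h. 0)) (at s)"
    proof (cases "s < 1/3")
      case True
      show ?thesis
        by (rule has_derivative_transform_within_open[OF has_derivative_const open_lessThan[of "1/3"]])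
          (use True in \<open>auto simp: \<theta>_def step_fn_0\<close>)
    next
      case False
      then have s: "s \<in> {2/3<..}" using that by simp
      show ?thesis
        by (rule has_derivative_transform_within_open[OF has_derivative_const[of 1] open_greaterThan[of "2/3"]])
          (use s in \<open>auto simp: \<theta>_def step_fn_1\<close>)
    qed
    from frechet_derivative_eq[OF this] show ?thesis by (simp add: \<theta>'_def)
  qed
  let ?s = "\<lambda>z :: real \<times> real \<times> (real^3). fst z" and ?t = "\<lambda>z :: real \<times> real \<times> (real^3). fst (snd z)"
    and ?x = "\<lambda>z :: real \<times> real \<times> (real^3). snd (snd z)"
  define q where "q = (\<lambda>z. g (?t z) * \<theta> (?s z))"
  define A where "A = (\<lambda>z. a (?x z) + q z *\<^sub>R \<delta> (?x z))"
  define c where "c = (\<lambda>z. curl a (?x z) + q z *\<^sub>R curl \<delta> (?x z))"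
  define e where "e = (\<lambda>z. (g (?t z) * \<theta>' (?s z)) *\<^sub>R \<delta> (?x z))"
  \<comment> \<open>The first component 0 keeps t constant along the flow; the second is Gray's
    field for the path A with time derivative e.\<close>
  define X where "X = (\<lambda>z. (0::real, if ?x z \<in> W then (1 / (A z \<bullet> c z)) *\<^sub>R cross3 (A z) (e z) else 0))"
  define S where "S = {z. ?x z \<in> W}"
  have Wo: "open W" by (rule Cinf_open[OF a])
  have "open (?x -` W)" by (intro open_vimage Wo continuous_intros)
  then have So: "open S" by (simp add: S_def vimage_def)
  have q01: "0 \<le> q z \<and> q z \<le> 1" for z using g01 \<theta>01 by (simp add: q_def mult_le_one)
  have N: "A z \<bullet> c z > 0" if "z \<in> S" for z using that pos q01 by (simp add: S_def A_def c_def)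
  have cq: "Cinf S q"
    unfolding q_def by (intro Cinf_mult Cinf_compose_UNIV[OF gc] Cinf_compose_UNIV[OF \<theta>] cinf_intros So)
  have cx: "Cinf S ?x" by (intro cinf_intros So)
  have xS: "?x ` S \<subseteq> W" by (auto simp: S_def)
  have cA: "Cinf S A"
    unfolding A_def by (intro Cinf_add Cinf_scaleR cq Cinf_compose[OF cx a xS] Cinf_compose[OF cx d xS])
  have cc: "Cinf S c"
    unfolding c_def by (intro Cinf_add Cinf_scaleR cq Cinf_compose[OF cx Cinf_curl[OF a] xS]
        Cinf_compose[OF cx Cinf_curl[OF d] xS])
  have ce: "Cinf S e"
    unfolding e_def by (intro Cinf_scaleR Cinf_mult Cinf_compose_UNIV[OF gc] Cinf_compose_UNIV[OF \<theta>'c]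
        Cinf_compose[OF cx d xS] cinf_intros So)
  define C where "C = {1/3..2/3::real} \<times> {0..3::real} \<times> K"
  have C: "compact C" unfolding C_def by (intro compact_Times W compact_Icc)
  have C01: "0 < fst z \<and> fst z < 1" if "z \<in> C" for z using that by (auto simp: C_def)
  have sC: "snd ` C = {0..3} \<times> K" by (simp add: C_def)
  have XC: "X z = 0" if "z \<notin> C" for z
  proof -
    have "?s z \<notin> {1/3..2/3} \<or> ?t z \<notin> {0..3} \<or> ?x z \<notin> K" using that unfolding C_def mem_Times_iff by blast
    then have "?x z \<in> W \<Longrightarrow> e z = 0"
      using \<theta>'0[of "?s z"] g0[of "?t z"] dK[of "?x z"] by (auto simp: e_def)
    then show ?thesis by (simp add: X_def zero_prod_def)
  qed
  have XS: "Cinf S X"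
  proof (rule Cinf_cong)
    show "Cinf S (\<lambda>z. (0::real, (1 / (A z \<bullet> c z)) *\<^sub>R cross3 (A z) (e z)))"
      using N by (intro Cinf_Pair Cinf_const So Cinf_scaleR Cinf_divide Cinf_inner Cinf_cross3 cA cc ce) fastforce
  qed (auto simp: X_def S_def)
  have X: "Cinf UNIV X"
  proof (rule Cinf_local[OF _ open_UNIV])
    fix z
    have "Cinf (- C) X"
      by (rule Cinf_cong[OF Cinf_const[of _ 0]]) (use compact_imp_closed[OF C] XC in auto)
    moreover have "z \<in> S \<or> z \<in> - C" using W(2) by (auto simp: S_def C_def)
    ultimately show "\<exists>V. z \<in> V \<and> Cinf V X" using XS by blast
  qed
  obtain \<phi> \<psi> where \<phi>: "Cinf UNIV \<phi>" "\<And>s p. s \<le> 0 \<Longrightarrow> \<phi> (s, p) = p"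
    "\<And>s p. p \<notin> snd ` C \<Longrightarrow> \<phi> (s, p) = p"
    "\<And>s p. ((\<lambda>s. \<phi> (s, p)) has_vector_derivative X (s, \<phi> (s, p))) (at s)"
    and \<psi>: "Cinf UNIV \<psi>" "\<And>p. \<psi> (\<phi> (1, p)) = p" "\<And>p. \<phi> (1, \<psi> p) = p"
    by (rule flow_time1[OF X C C01 XC]) auto
  obtain L where "L > 0" and L: "\<And>s u v. norm (X (s, u) - X (s, v)) \<le> L * norm (u - v)"
    by (rule compact_support_lipschitz[OF X C XC]) auto
  \<comment> \<open>A trajectory passing through a point where the field vanishes at all times is
    constant.\<close>
  have rest: "\<phi> (r, p) = \<phi> (s, p)" if z: "\<And>r. X (r, \<phi> (s, p)) = 0" for r s p
  proof -
    have "\<phi> (r, p) - \<phi> (s, p) = 0"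
    proof (rule ode_zero_global[where z="\<lambda>r. \<phi> (r, p) - \<phi> (s, p)" and L=L and ?s0.0=s])
      show "((\<lambda>r. \<phi> (r, p) - \<phi> (s, p)) has_vector_derivative X (r, \<phi> (r, p)) - 0) (at r)" for r
        by (intro has_vector_derivative_diff \<phi>(4) has_vector_derivative_const)
      show "norm (X (r, \<phi> (r, p)) - 0) \<le> L * norm (\<phi> (r, p) - \<phi> (s, p))" for r
        using L[of r "\<phi> (r, p)" "\<phi> (s, p)"] z by simp
    qed simp
    then show ?thesis by simp
  qed
  have fst\<phi>: "fst (\<phi> (s, p)) = fst p" for s p
  proof -
    have "fst (\<phi> (s, p)) - fst p = 0"
    proof (rule ode_zero_global[where z="\<lambda>s. fst (\<phi> (s, p)) - fst p" and L=0 and ?s0.0=0])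
      show "((\<lambda>s. fst (\<phi> (s, p)) - fst p) has_vector_derivative fst (X (s, \<phi> (s, p))) - 0) (at s)" for s
        by (intro has_vector_derivative_diff has_vector_derivative_const
            bounded_linear.has_vector_derivative[OF bounded_linear_fst] \<phi>(4))
    qed (simp_all add: \<phi>(2) X_def)
    then show ?thesis by simp
  qed
  \<comment> \<open>Outside \<open>W\<close> the field is zero by definition, so by
    \<open>rest\<close> a trajectory that was ever outside has always been there.\<close>
  have stay: "snd (\<phi> (s, p)) \<in> W" if "snd p \<in> W" for s p
  proof (rule ccontr)
    assume n: "snd (\<phi> (s, p)) \<notin> W"
    have "\<phi> (0, p) = \<phi> (s, p)"
      by (rule rest) (use n in \<open>simp add: X_def zero_prod_def\<close>)
    then show False using n that \<phi>(2)[of 0 p] by simp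
  qed
  define \<Phi> where "\<Phi> = (\<lambda>p :: real \<times> (real^3). snd (\<phi> (1, p)))"
  define \<Psi> where "\<Psi> = (\<lambda>p :: real \<times> (real^3). snd (\<psi> p))"
  have \<Phi>eq: "\<phi> (1, (t, x)) = (t, \<Phi> (t, x))" for t x
    using fst\<phi>[of 1 "(t, x)"] by (simp add: \<Phi>_def prod_eq_iff)
  have \<Psi>eq: "\<psi> (t, x) = (t, \<Psi> (t, x))" for t x
    using fst\<phi>[of 1 "\<psi> (t, x)"] by (simp add: \<psi>(3) \<Psi>_def prod_eq_iff)
  show thesis
  proof (rule that[of \<Phi> \<Psi>])
    show "Cinf UNIV \<Phi>"
      unfolding \<Phi>_def by (intro Cinf_snd Cinf_compose_UNIV[OF \<phi>(1)] cinf_intros open_UNIV)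
    show "Cinf UNIV \<Psi>" unfolding \<Psi>_def by (intro Cinf_snd \<psi>)
    show "\<Psi> (t, \<Phi> (t, x)) = x" for t x using \<psi>(2)[of "(t, x)"] by (simp add: \<Phi>eq \<Psi>eq)
    show "\<Phi> (t, \<Psi> (t, x)) = x" for t x using \<psi>(3)[of "(t, x)"] by (simp add: \<Phi>eq \<Psi>eq)
    show "\<Phi> (t, x) = x" if "x \<notin> K" for t x
      using \<phi>(3)[of "(t, x)" 1] that by (simp add: \<Phi>_def sC)
    show "\<Phi> (0, x) = x" for x
    proof -
      have X0: "X (r, (0, y)) = 0" for r y using g0[of 0] by (simp add: X_def e_def zero_prod_def)
      have "\<phi> (1, (0, x)) = \<phi> (0, (0, x))" by (rule rest) (simp add: \<phi>(2) X0)
      then show ?thesis by (simp add: \<Phi>_def \<phi>(2))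
    qed
    show "\<Phi> (1, x) \<in> W" if "x \<in> W" for x using stay[of "(1, x)"] that by (simp add: \<Phi>_def)
    fix x v assume x: "x \<in> W" and av: "a x \<bullet> v = 0"
    let ?p = "(1::real, x)" and ?e = "(0::real, (0::real, v))"
    let ?z = "\<lambda>s. (s, \<phi> (s, ?p))"
    let ?Df = "\<lambda>s. frechet_derivative \<phi> (at (s, ?p)) ?e"
    let ?w = "\<lambda>s. snd (?Df s)"
    have zS: "?z s \<in> S" for s using stay[of ?p s] x by (simp add: S_def)
    have zd: "(?z has_vector_derivative (1, X (?z s))) (at s)" for s
      by (intro has_vector_derivative_Pair has_vector_derivative_id \<phi>(4))
    have \<phi>D: "(\<phi> has_derivative frechet_derivative \<phi> (at z)) (at z)" for z
      by (rule Cinf_has_derivative[OF \<phi>(1)]) simp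
    have along: "((\<lambda>r. \<phi> (s, (1, x + r *\<^sub>R v))) has_vector_derivative ?Df s) (at 0)" for s
      using has_vector_derivative_along[of \<phi> "frechet_derivative \<phi> (at (s, ?p))" "(s, ?p)" 0 ?e] \<phi>D by simp
    have fstD: "fst (?Df s) = 0" for s
    proof -
      have "((\<lambda>r. fst (\<phi> (s, (1, x + r *\<^sub>R v)))) has_vector_derivative fst (?Df s)) (at 0)"
        by (rule bounded_linear.has_vector_derivative[OF bounded_linear_fst along])
      then have "((\<lambda>r. 1) has_vector_derivative fst (?Df s)) (at (0::real))" by (simp add: fst\<phi>)
      then show ?thesis using vector_derivative_unique_at has_vector_derivative_const by blast
    qed
    have Deq: "?Df s = (0, ?w s)" for s using fstD by (simp add: prod_eq_iff)
    have w0: "?w 0 = v"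
    proof -
      have "((\<lambda>r. \<phi> (0, (1, x + r *\<^sub>R v))) has_vector_derivative (0, v)) (at 0)"
        unfolding \<phi>(2)[OF order_refl]
        by (intro has_vector_derivative_Pair has_vector_derivative_const)
          (auto intro!: derivative_eq_intros simp: has_vector_derivative_def)
      from vector_derivative_unique_at[OF along this] show ?thesis by simp
    qed
    \<comment> \<open>The variational equation: the time derivative of the space derivative of
      \<phi> is the space derivative of X along \<phi>, by symmetry of second derivatives.\<close>
    have wd: "(?w has_vector_derivative snd (frechet_derivative X (at (?z s)) (0, ?Df s))) (at s)" for s
    proof -
      have D10: "frechet_derivative \<phi> (at y) (1, 0) = X (fst y, \<phi> y)" for y
      proof -
        have h1: "((\<lambda>r. \<phi> (y + r *\<^sub>R (1, 0))) has_vector_derivative frechet_derivative \<phi> (at y) (1, 0)) (at 0)"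
          by (rule has_vector_derivative_along_0[OF \<phi>D])
        have h2: "((\<lambda>r. \<phi> (fst y + r, snd y)) has_vector_derivative X (fst y, \<phi> y)) (at 0)"
        proof -
          have "((\<lambda>r. fst y + r) has_vector_derivative 1) (at 0)"
            by (auto intro!: derivative_eq_intros)
          from vector_diff_chain_at[OF this, of "\<lambda>s. \<phi> (s, snd y)" "X (fst y, \<phi> y)"] \<phi>(4)[of "snd y" "fst y"]
          show ?thesis by (simp add: o_def)
        qed
        have h3: "(\<lambda>r. \<phi> (y + r *\<^sub>R (1, 0))) = (\<lambda>r. \<phi> (fst y + r, snd y))"
          by (rule ext, rule arg_cong[of _ _ \<phi>]) (simp add: prod_eq_iff)
        show ?thesis by (rule vector_derivative_unique_at[OF h1[unfolded h3] h2])
      qed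
      let ?F = "\<lambda>y. frechet_derivative \<phi> (at y) ?e"
      have F: "Cinf UNIV ?F" by (rule Cinf_derivative[OF \<phi>(1)])
      have "((\<lambda>r. ?F ((0, ?p) + r *\<^sub>R (1, 0))) has_vector_derivative
          frechet_derivative ?F (at ((0, ?p) + s *\<^sub>R (1, 0))) (1, 0)) (at s)"
        by (rule has_vector_derivative_along[OF Cinf_has_derivative[OF F]]) simp
      then have "(?Df has_vector_derivative frechet_derivative ?F (at (s, ?p)) (1, 0)) (at s)" by simp
      moreover have "frechet_derivative ?F (at (s, ?p)) (1, 0) =
          frechet_derivative (\<lambda>y. X (fst y, \<phi> y)) (at (s, ?p)) ?e"
        using second_derivative_symmetric[OF \<phi>(1), of "(s, ?p)" ?e "(1, 0)"] by (simp add: D10)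
      moreover have "frechet_derivative (\<lambda>y. X (fst y, \<phi> y)) (at (s, ?p)) =
          (\<lambda>h. frechet_derivative X (at (?z s)) (fst h, frechet_derivative \<phi> (at (s, ?p)) h))"
      proof (rule frechet_derivative_eq)
        have 1: "((\<lambda>y. (fst y, \<phi> y)) has_derivative (\<lambda>h. (fst h, frechet_derivative \<phi> (at (s, ?p)) h))) (at (s, ?p))"
          by (intro has_derivative_Pair has_derivative_fst has_derivative_ident \<phi>D)
        have 2: "(X has_derivative frechet_derivative X (at (?z s))) (at (fst (s, ?p), \<phi> (s, ?p)))"
          using Cinf_has_derivative[OF X, of "?z s"] by simp
        show "((\<lambda>y. X (fst y, \<phi> y)) has_derivative
          (\<lambda>h. frechet_derivative X (at (?z s)) (fst h, frechet_derivative \<phi> (at (s, ?p)) h))) (at (s, ?p))"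
          by (rule has_derivative_compose[OF 1 2])
      qed
      ultimately have "(?Df has_vector_derivative frechet_derivative X (at (?z s)) (0, ?Df s)) (at s)" by simp
      then show ?thesis by (rule bounded_linear.has_vector_derivative[OF bounded_linear_snd])
    qed
    let ?D = "\<lambda>z h. frechet_derivative a (at (?x z)) h + q z *\<^sub>R frechet_derivative \<delta> (at (?x z)) h"
    have aD: "(a has_derivative frechet_derivative a (at y)) (at y)" if "y \<in> W" for y
      by (rule Cinf_has_derivative[OF a that])
    have dD: "(\<delta> has_derivative frechet_derivative \<delta> (at y)) (at y)" if "y \<in> W" for y
      by (rule Cinf_has_derivative[OF d that])
    have Dlin: "linear (?D z)" if "z \<in> S" for z
      using that aD[THEN has_derivative_linear, of "?x z"] dD[THEN has_derivative_linear, of "?x z"]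
      by (auto simp: S_def intro!: linear_compose_add linear_compose_scale_right)
    have A_sx: "frechet_derivative A (at z) (r, (0, h)) = (r * g (?t z) * \<theta>' (?s z)) *\<^sub>R \<delta> (?x z) + ?D z h"
      if zS: "z \<in> S" for z r h
    proof -
      have y: "?x z \<in> W" using zS by (simp add: S_def)
      let ?c = "\<lambda>\<tau>. z + \<tau> *\<^sub>R (r, (0, h))"
      have "((\<lambda>\<tau>. A (?c \<tau>)) has_vector_derivative frechet_derivative A (at z) (r, (0, h))) (at 0)"
        by (rule has_vector_derivative_along_0[OF Cinf_has_derivative[OF cA zS]])
      moreover have "((\<lambda>\<tau>. A (?c \<tau>)) has_vector_derivative
          frechet_derivative a (at (?x z)) h + (q z *\<^sub>R frechet_derivative \<delta> (at (?x z)) h +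
            (g (?t z) * (r * \<theta>' (?s z))) *\<^sub>R \<delta> (?x z))) (at 0)"
      proof -
        have 1: "((\<lambda>\<tau>. a (?x z + \<tau> *\<^sub>R h)) has_vector_derivative frechet_derivative a (at (?x z)) h) (at 0)"
          by (rule has_vector_derivative_along_0[OF aD[OF y]])
        have 2: "((\<lambda>\<tau>. \<delta> (?x z + \<tau> *\<^sub>R h)) has_vector_derivative frechet_derivative \<delta> (at (?x z)) h) (at 0)"
          by (rule has_vector_derivative_along_0[OF dD[OF y]])
        have "((\<lambda>\<tau>. \<theta> (?s z + \<tau> *\<^sub>R r)) has_vector_derivative frechet_derivative \<theta> (at (?s z)) r) (at 0)"
          by (rule has_vector_derivative_along_0[OF Cinf_has_derivative[OF \<theta> UNIV_I]])
        moreover have "frechet_derivative \<theta> (at (?s z)) r = r * \<theta>' (?s z)"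
          using linear_scale[OF has_derivative_linear[OF Cinf_has_derivative[OF \<theta>, of "?s z"]], of r 1] by (simp add: \<theta>'_def)
        ultimately have 3: "((\<lambda>\<tau>. g (?t z) * \<theta> (?s z + \<tau> *\<^sub>R r)) has_real_derivative g (?t z) * (r * \<theta>' (?s z))) (at 0)"
          by (intro DERIV_cmult) (simp add: has_real_derivative_iff_has_vector_derivative)
        have "((\<lambda>\<tau>. a (?x z + \<tau> *\<^sub>R h) + (g (?t z) * \<theta> (?s z + \<tau> *\<^sub>R r)) *\<^sub>R \<delta> (?x z + \<tau> *\<^sub>R h)) has_vector_derivative
          frechet_derivative a (at (?x z)) h + ((g (?t z) * \<theta> (?s z + 0 *\<^sub>R r)) *\<^sub>R frechet_derivative \<delta> (at (?x z)) h +
            (g (?t z) * (r * \<theta>' (?s z))) *\<^sub>R \<delta> (?x z + 0 *\<^sub>R h))) (at 0)"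
          by (intro has_vector_derivative_add 1 has_vector_derivative_scaleR 2 3)
        then show ?thesis by (simp add: A_def q_def)
      qed
      ultimately have "frechet_derivative A (at z) (r, (0, h)) = frechet_derivative a (at (?x z)) h +
          (q z *\<^sub>R frechet_derivative \<delta> (at (?x z)) h + (g (?t z) * (r * \<theta>' (?s z))) *\<^sub>R \<delta> (?x z))"
        by (rule vector_derivative_unique_at)
      then show ?thesis by (simp add: mult.commute mult.left_commute)
    qed
    \<comment> \<open>The derivative of the identity A \<bullet> X = 0; it trades the derivative of
      X for the derivative of A.\<close>
    have AX: "frechet_derivative A (at z) h \<bullet> snd (X z) + A z \<bullet> snd (frechet_derivative X (at z) h) = 0"
      if zS: "z \<in> S" for z h
    proof -
      have XD: "((\<lambda>z. snd (X z)) has_derivative (\<lambda>h. snd (frechet_derivative X (at z) h))) (at z)"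
        by (intro has_derivative_snd Cinf_has_derivative[OF X] UNIV_I)
      have "((\<lambda>z. A z \<bullet> snd (X z)) has_derivative (\<lambda>h. A z \<bullet> snd (frechet_derivative X (at z) h)
          + frechet_derivative A (at z) h \<bullet> snd (X z))) (at z)"
        by (rule has_derivative_inner[OF Cinf_has_derivative[OF cA zS] XD])
      moreover have "((\<lambda>z. A z \<bullet> snd (X z)) has_derivative (\<lambda>h. 0)) (at z)"
        by (rule has_derivative_transform_within_open[OF has_derivative_const So zS])
          (auto simp: X_def S_def inner_cross3_self)
      ultimately have "(\<lambda>h. A z \<bullet> snd (frechet_derivative X (at z) h)
          + frechet_derivative A (at z) h \<bullet> snd (X z)) = (\<lambda>h. 0)"
        by (rule has_derivative_unique)
      from fun_cong[OF this, of h] show ?thesis by (simp add: add.commute)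
    qed
    let ?\<mu> = "\<lambda>z. (c z \<bullet> e z) / (A z \<bullet> c z)"
    \<comment> \<open>The moving form evaluated on the transported vector. It solves a scalar linear
      equation with initial value a x \<bullet> v = 0 and hence remains zero.\<close>
    let ?G = "\<lambda>s. A (?z s) \<bullet> ?w s"
    have Gd: "(?G has_vector_derivative ?\<mu> (?z s) * ?G s) (at s)" for s
    proof -
      let ?Z = "?z s"
      have Ad: "((\<lambda>s. A (?z s)) has_vector_derivative frechet_derivative A (at ?Z) (1, X ?Z)) (at s)"
        using vector_derivative_diff_chain_within[of ?z "(1, X ?Z)" s UNIV A "frechet_derivative A (at ?Z)"]
          zd[of s] has_derivative_at_withinI[OF Cinf_has_derivative[OF cA zS[of s]]] by (simp add: o_def)
      have "(?G has_vector_derivative A ?Z \<bullet> snd (frechet_derivative X (at ?Z) (0, ?Df s))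
          + frechet_derivative A (at ?Z) (1, X ?Z) \<bullet> ?w s) (at s)"
        by (rule bounded_bilinear.has_vector_derivative[OF bounded_bilinear_inner Ad wd])
      moreover have "A ?Z \<bullet> snd (frechet_derivative X (at ?Z) (0, ?Df s))
          + frechet_derivative A (at ?Z) (1, X ?Z) \<bullet> ?w s = ?\<mu> ?Z * ?G s"
      proof -
        have Xz: "X ?Z = (0, snd (X ?Z))" by (simp add: X_def)
        have sX: "snd (X ?Z) = (1 / (A ?Z \<bullet> c ?Z)) *\<^sub>R cross3 (A ?Z) (e ?Z)"
          using zS[of s] by (simp add: X_def S_def)
        have 1: "frechet_derivative A (at ?Z) (1, X ?Z) = e ?Z + ?D ?Z (snd (X ?Z))"
          using A_sx[OF zS, of s 1 "snd (X ?Z)"] Xz by (simp add: e_def)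
        have 2: "frechet_derivative A (at ?Z) (0, ?Df s) = ?D ?Z (?w s)"
          using A_sx[OF zS, of s 0 "?w s"] Deq[of s] by simp
        have "A ?Z \<bullet> snd (frechet_derivative X (at ?Z) (0, ?Df s)) = - (?D ?Z (?w s) \<bullet> snd (X ?Z))"
          using AX[OF zS[of s], of "(0, ?Df s)"] unfolding 2 by linarith
        then have "A ?Z \<bullet> snd (frechet_derivative X (at ?Z) (0, ?Df s)) + frechet_derivative A (at ?Z) (1, X ?Z) \<bullet> ?w s
          = e ?Z \<bullet> ?w s + (?D ?Z (snd (X ?Z)) \<bullet> ?w s - ?D ?Z (?w s) \<bullet> snd (X ?Z))"
          unfolding 1 by (simp add: inner_add_left)
        also have "\<dots> = e ?Z \<bullet> ?w s + c ?Z \<bullet> cross3 (snd (X ?Z)) (?w s)"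
          unfolding curl_of_cross[OF Dlin[OF zS[of s]]] curl_of_linear_comb c_def ..
        also have "\<dots> = ?\<mu> ?Z * ?G s"
          unfolding sX by (rule gray_identity) (use N[OF zS[of s]] in simp)
        finally show ?thesis .
      qed
      ultimately show ?thesis by simp
    qed
    \<comment> \<open>Off [1/3, 2/3] the factor vanishes together with e, so compactness of this
      interval gives a bound for all times.\<close>
    obtain B where B: "\<And>s. \<bar>?\<mu> (?z s)\<bar> \<le> B"
    proof -
      have "continuous_on S ?\<mu>"
        using N by (intro Cinf_continuous Cinf_divide Cinf_inner cA cc ce) fastforce
      then have "continuous_on {1/3..2/3} (\<lambda>s. ?\<mu> (?z s))"
        by (rule continuous_on_compose2)
          (use zS Cinf_continuous[OF \<phi>(1)] in \<open>auto intro!: continuous_intros continuous_on_compose2[OF Cinf_continuous[OF \<phi>(1)]]\<close>)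
      then have "compact ((\<lambda>s. ?\<mu> (?z s)) ` {1/3..2/3})" by (rule compact_continuous_image) simp
      from compact_imp_bounded[OF this] obtain B0 where B0: "\<forall>y\<in>(\<lambda>s. ?\<mu> (?z s)) ` {1/3..2/3}. norm y \<le> B0"
        unfolding bounded_iff by (elim exE)
      have "\<bar>?\<mu> (?z s)\<bar> \<le> max B0 0" for s
      proof (cases "s \<in> {1/3..2/3}")
        case True
        then have "norm (?\<mu> (?z s)) \<le> B0" using B0 by blast
        then show ?thesis by simp
      next
        case False
        then have "e (?z s) = 0" by (simp add: e_def \<theta>'0)
        then show ?thesis by simp
      qed
      then show thesis by (rule that)
    qed
    have "?G 1 = 0"
    proof (rule ode_zero_global[OF Gd, where L=B and ?s0.0=0])
      show "norm (?\<mu> (?z s) * ?G s) \<le> B * norm (?G s)" for s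
        using mult_right_mono[OF B[of s], of "\<bar>?G s\<bar>"] by (simp add: abs_mult)
      have "q (?z 0) = 0" by (simp add: q_def \<theta>_def step_fn_0)
      then show "?G 0 = 0" using av w0 by (simp add: A_def \<phi>(2))
    qed
    moreover have "q (?z 1) = 1" by (simp add: q_def \<theta>_def step_fn_1 fst\<phi> g1)
    moreover have "frechet_derivative (\<lambda>x. \<Phi> (1, x)) (at x) v = ?w 1"
    proof -
      have 1: "((\<lambda>x. (1::real, (1::real, x))) has_derivative (\<lambda>v. (0, (0, v)))) (at x)"
        by (intro has_derivative_Pair has_derivative_const has_derivative_ident)
      have "((\<lambda>x. \<Phi> (1, x)) has_derivative (\<lambda>v. snd (frechet_derivative \<phi> (at (1, ?p)) (0, (0, v))))) (at x)"
        unfolding \<Phi>_def by (intro has_derivative_snd has_derivative_compose[OF 1 \<phi>D])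
      from frechet_derivative_eq[OF this] show ?thesis by simp
    qed
    ultimately show "(a (\<Phi> (1, x)) + \<delta> (\<Phi> (1, x))) \<bullet> frechet_derivative (\<lambda>x. \<Phi> (1, x)) (at x) v = 0"
      by (simp add: A_def \<Phi>_def)
  qed
qed

section \<open>Charts and tangent vectors\<close>

lemma has_derivative_transition_chain:
  assumes "(f has_derivative f') (at x)" "(g has_derivative g') (at (f x))"
    "open U" "x \<in> U" "\<And>y. y \<in> U \<Longrightarrow> h y = g (f y)"
  shows "frechet_derivative h (at x) = (\<lambda>v. g' (f' v))"
proof (rule frechet_derivative_eq, rule has_derivative_transform_within_open)
  show "((\<lambda>y. g (f y)) has_derivative (\<lambda>v. g' (f' v))) (at x)"
    by (rule has_derivative_compose[OF assms(1,2)])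
qed (use assms in auto)

locale closed_manifold3 =
  fixes M :: "'p manifold3"
  assumes M: "closed_oriented_3manifold M"
begin

abbreviation DT :: "'p chart \<Rightarrow> 'p chart \<Rightarrow> real^3 \<Rightarrow> real^3 \<Rightarrow> real^3" where
  "DT c d x \<equiv> frechet_derivative (transition c d) (at x)"

lemma Hausdorff: "Hausdorff_space (mtop M)" and compact_M: "compact_space (mtop M)"
  and points_eq: "points M = (\<Union>c\<in>atlas M. dom_ch c)"
  using M by (auto simp: closed_oriented_3manifold_def)

lemma chart: "c \<in> atlas M \<Longrightarrow> is_chart (mtop M) c"
  and compatible: "c \<in> atlas M \<Longrightarrow> d \<in> atlas M \<Longrightarrow> oriented_compatible c d"
  using M by (auto simp: closed_oriented_3manifold_def)

lemma charts_atD: "c \<in> charts_at M p \<Longrightarrow> c \<in> atlas M" "c \<in> charts_at M p \<Longrightarrow> p \<in> dom_ch c"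
  and charts_atI: "c \<in> atlas M \<Longrightarrow> p \<in> dom_ch c \<Longrightarrow> c \<in> charts_at M p"
  by (auto simp: charts_at_def)

lemma chart_exists: "p \<in> points M \<Longrightarrow> \<exists>c. c \<in> charts_at M p"
  unfolding points_eq charts_at_def by auto

context
  fixes c assumes c: "c \<in> atlas M"
begin

lemma dom_open: "openin (mtop M) (dom_ch c)" and img_open: "open (img_ch c)"
  and chart_homeo: "homeomorphic_map (subtopology (mtop M) (dom_ch c)) (top_of_set (img_ch c)) (map_ch c)"
  using chart[OF c] by (auto simp: is_chart_def)

lemma dom_sub: "dom_ch c \<subseteq> points M" by (rule openin_subset[OF dom_open])

lemma topspace_dom: "topspace (subtopology (mtop M) (dom_ch c)) = dom_ch c"
  by (rule topspace_subtopology_subset[OF dom_sub])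

lemma chart_inj: "inj_on (map_ch c) (dom_ch c)"
  using homeomorphic_imp_injective_map[OF chart_homeo] by (simp only: topspace_dom)

lemma inv_map [simp]: "p \<in> dom_ch c \<Longrightarrow> inv_ch c (map_ch c p) = p"
  by (rule inv_into_f_f[OF chart_inj])

lemma map_inv: "x \<in> img_ch c \<Longrightarrow> map_ch c (inv_ch c x) = x"
  by (rule f_inv_into_f)

lemma inv_dom: "x \<in> img_ch c \<Longrightarrow> inv_ch c x \<in> dom_ch c"
  by (rule inv_into_into)

lemma continuous_map_chart: "continuous_map (subtopology (mtop M) (dom_ch c)) euclidean (map_ch c)"
  using homeomorphic_imp_continuous_map[OF chart_homeo] continuous_map_into_fulltopology by blast

lemma continuous_map_inv: "continuous_map (top_of_set (img_ch c)) (mtop M) (inv_ch c)"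
proof -
  obtain g where g: "homeomorphic_maps (subtopology (mtop M) (dom_ch c)) (top_of_set (img_ch c)) (map_ch c) g"
    using chart_homeo homeomorphic_map_maps by blast
  then have gc: "continuous_map (top_of_set (img_ch c)) (subtopology (mtop M) (dom_ch c)) g"
    by (simp add: homeomorphic_maps_def)
  have "g x = inv_ch c x" if "x \<in> img_ch c" for x
  proof -
    have "g x \<in> dom_ch c" using gc that topspace_dom by (auto simp: continuous_map_def)
    moreover have "map_ch c (g x) = x"
    proof -
      have "\<forall>y\<in>topspace (top_of_set (img_ch c)). map_ch c (g y) = y"
        using g unfolding homeomorphic_maps_def by blast
      then show ?thesis using that unfolding topspace_euclidean_subtopology by blast
    qed
    ultimately show ?thesis using inv_map by metis
  qed
  then have "continuous_map (top_of_set (img_ch c)) (subtopology (mtop M) (dom_ch c)) (inv_ch c)"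
    using continuous_map_eq[OF gc] by simp
  then show ?thesis by (rule continuous_map_into_fulltopology)
qed

lemma openin_chart_preimage: "open V \<Longrightarrow> openin (mtop M) {p \<in> dom_ch c. map_ch c p \<in> V}"
proof -
  assume "open V"
  then have "openin (subtopology (mtop M) (dom_ch c)) {p \<in> topspace (subtopology (mtop M) (dom_ch c)). map_ch c p \<in> V}"
    by (intro openin_continuous_map_preimage[OF continuous_map_chart]) simp
  then show ?thesis using openin_trans_full[OF _ dom_open] by (simp only: topspace_dom)
qed

lemma open_inv_preimage: "openin (mtop M) U \<Longrightarrow> open {x \<in> img_ch c. inv_ch c x \<in> U}"
proof -
  assume "openin (mtop M) U"
  then have "openin (top_of_set (img_ch c)) {x \<in> topspace (top_of_set (img_ch c)). inv_ch c x \<in> U}"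
    by (rule openin_continuous_map_preimage[OF continuous_map_inv])
  then show ?thesis using img_open openin_open_eq by auto
qed

text \<open>The complement of such an image is open, so that whatever is the identity or zero
  outside \<open>K\<close> can be pasted with its description in the chart.\<close>

lemma closedin_inv_image:
  assumes "compact K" "K \<subseteq> img_ch c"
  shows "closedin (mtop M) (inv_ch c ` K)" "inv_ch c ` K \<subseteq> dom_ch c"
proof -
  have "compactin (top_of_set (img_ch c)) K" using assms by (simp add: compactin_subtopology)
  from image_compactin[OF this continuous_map_inv]
  show "closedin (mtop M) (inv_ch c ` K)" by (rule compactin_imp_closedin[OF Hausdorff])
  show "inv_ch c ` K \<subseteq> dom_ch c" using assms(2) inv_dom by blast
qed

end

definition overlap :: "'p chart \<Rightarrow> 'p chart \<Rightarrow> (real^3) set" where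
  "overlap c d = {x \<in> img_ch c. inv_ch c x \<in> dom_ch d}"

lemma transition_eq: "transition c d x = map_ch d (inv_ch c x)"
  by (simp add: transition_def)

context
  fixes c d assumes c: "c \<in> atlas M" and d: "d \<in> atlas M"
begin

lemma overlap_open: "open (overlap c d)"
  unfolding overlap_def by (rule open_inv_preimage[OF c dom_open[OF d]])

lemma overlap_image: "map_ch c ` (dom_ch c \<inter> dom_ch d) = overlap c d"
proof
  show "map_ch c ` (dom_ch c \<inter> dom_ch d) \<subseteq> overlap c d"
    using inv_map[OF c] by (auto simp: overlap_def)
  show "overlap c d \<subseteq> map_ch c ` (dom_ch c \<inter> dom_ch d)"
  proof
    fix x assume "x \<in> overlap c d"
    then have x: "x \<in> img_ch c" "inv_ch c x \<in> dom_ch d" by (auto simp only: overlap_def)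
    show "x \<in> map_ch c ` (dom_ch c \<inter> dom_ch d)"
      by (rule image_eqI[of x "map_ch c" "inv_ch c x", OF map_inv[OF c x(1), symmetric]])
        (use inv_dom[OF c x(1)] x(2) in blast)
  qed
qed

lemma Cinf_transition: "Cinf (overlap c d) (transition c d)"
  using compatible[OF c d] smooth_on_open_iff[OF overlap_open] unfolding oriented_compatible_def overlap_image by blast

lemma det_DT: "x \<in> overlap c d \<Longrightarrow> det (matrix (DT c d x)) > 0"
  using compatible[OF c d] unfolding oriented_compatible_def overlap_image by blast

lemma transition_in: "x \<in> overlap c d \<Longrightarrow> transition c d x \<in> overlap d c"
  using inv_map[OF d] inv_dom[OF c] by (auto simp: overlap_def transition_eq)

lemma inv_transition: "x \<in> overlap c d \<Longrightarrow> inv_ch d (transition c d x) = inv_ch c x"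
  using inv_map[OF d] by (auto simp: overlap_def transition_eq)

lemma map_in_overlap: "p \<in> dom_ch c \<Longrightarrow> p \<in> dom_ch d \<Longrightarrow> map_ch c p \<in> overlap c d \<and> transition c d (map_ch c p) = map_ch d p"
  using inv_map[OF c] by (auto simp: overlap_def transition_eq)

lemma DT_has_derivative: "x \<in> overlap c d \<Longrightarrow> (transition c d has_derivative DT c d x) (at x)"
  by (rule Cinf_has_derivative[OF Cinf_transition])

lemma DT_linear: "x \<in> overlap c d \<Longrightarrow> linear (DT c d x)"
  using DT_has_derivative has_derivative_linear by blast

end

text \<open>The cocycle rule, by which coordinates given in one chart determine a consistent tangent
  vector.\<close>

lemma DT_chain:
  assumes "c \<in> charts_at M p" "d \<in> charts_at M p" "e \<in> charts_at M p"
  shows "DT d e (map_ch d p) (DT c d (map_ch c p) v) = DT c e (map_ch c p) v"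
proof -
  note A = assms[THEN charts_atD(1)] and P = assms[THEN charts_atD(2)]
  have x: "map_ch c p \<in> overlap c d \<inter> overlap c e" "transition c d (map_ch c p) = map_ch d p"
    using map_in_overlap[OF A(1,2) P(1,2)] map_in_overlap[OF A(1,3) P(1,3)] by auto
  have y: "map_ch d p \<in> overlap d e" using map_in_overlap[OF A(2,3) P(2,3)] by auto
  have "DT c e (map_ch c p) = (\<lambda>v. DT d e (map_ch d p) (DT c d (map_ch c p) v))"
  proof (rule has_derivative_transition_chain[where U="overlap c d \<inter> overlap c e" and f="transition c d"
        and g="transition d e" and f'="DT c d (map_ch c p)" and g'="DT d e (map_ch d p)"])
    show "(transition c d has_derivative DT c d (map_ch c p)) (at (map_ch c p))"
      using DT_has_derivative[OF A(1,2)] x by blast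
    show "(transition d e has_derivative DT d e (map_ch d p)) (at (transition c d (map_ch c p)))"
      using DT_has_derivative[OF A(2,3) y] x by simp
    show "open (overlap c d \<inter> overlap c e)" using overlap_open A by blast
    show "transition c e y = transition d e (transition c d y)" if "y \<in> overlap c d \<inter> overlap c e" for y
      using inv_transition[OF A(1,2), of y] that by (simp add: transition_eq[of d e] transition_eq[of c e])
  qed (use x in blast)
  then show ?thesis by simp
qed

lemma DT_self: "c \<in> charts_at M p \<Longrightarrow> DT c c (map_ch c p) v = v"
proof -
  assume "c \<in> charts_at M p"
  note A = charts_atD[OF this]
  have "DT c c (map_ch c p) = (\<lambda>v. v)"
  proof (rule frechet_derivative_eq, rule has_derivative_transform_within_open[OF has_derivative_ident img_open[OF A(1)]])
    show "map_ch c p \<in> img_ch c" using A(2) by blast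
    show "y = transition c c y" if "y \<in> img_ch c" for y
      using map_inv[OF A(1) that] by (simp add: transition_eq)
  qed
  then show ?thesis by simp
qed

lemma DT_inverse:
  assumes "c \<in> charts_at M p" "d \<in> charts_at M p"
  shows "DT d c (map_ch d p) (DT c d (map_ch c p) v) = v"
  using DT_chain[OF assms assms(1)] DT_self[OF assms(1)] by simp

text \<open>The tangent vector with coordinates \<open>w\<close> in \<open>c\<close>; the value 0 at
  charts not around \<open>p\<close> is required by \<open>tangent_space\<close>.\<close>

definition extend :: "'p chart \<Rightarrow> 'p \<Rightarrow> real^3 \<Rightarrow> 'p tangent_vector" where
  "extend c p w = (\<lambda>d. if d \<in> charts_at M p then DT c d (map_ch c p) w else 0)"

lemma extend_tangent: "c \<in> charts_at M p \<Longrightarrow> extend c p w \<in> tangent_space M p"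
  using DT_chain by (auto simp: tangent_space_def extend_def)

lemma extend_same: "c \<in> charts_at M p \<Longrightarrow> extend c p w c = w"
  by (simp add: extend_def DT_self)

lemma tangent_DT:
  "v \<in> tangent_space M p \<Longrightarrow> c \<in> charts_at M p \<Longrightarrow> d \<in> charts_at M p \<Longrightarrow> v d = DT c d (map_ch c p) (v c)"
  unfolding tangent_space_def by blast

lemma tangent_extend:
  assumes "v \<in> tangent_space M p" "c \<in> charts_at M p"
  shows "v = extend c p (v c)"
proof
  fix d
  show "v d = extend c p (v c) d"
  proof (cases "d \<in> charts_at M p")
    case True
    then show ?thesis unfolding extend_def using tangent_DT[OF assms True] by (simp only: if_True)
  next
    case False
    then have "v d = 0" using assms(1) unfolding tangent_space_def by blast
    with False show ?thesis by (simp add: extend_def)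
  qed
qed

lemma tangent_eqI:
  "v \<in> tangent_space M p \<Longrightarrow> w \<in> tangent_space M p \<Longrightarrow> c \<in> charts_at M p \<Longrightarrow> v c = w c \<Longrightarrow> v = w"
  using tangent_extend by metis

text \<open>A tangent vector is determined by its coordinates in one chart, so planes may be
  compared in any single chart.\<close>

lemma plane_eqI:
  assumes "P \<subseteq> tangent_space M p" "Q \<subseteq> tangent_space M p" "c \<in> charts_at M p" "in_chart c P = in_chart c Q"
  shows "P = Q"
proof -
  have *: "P \<subseteq> Q" if "P \<subseteq> tangent_space M p" "Q \<subseteq> tangent_space M p" "in_chart c P = in_chart c Q" for P Q
  proof
    fix v assume v: "v \<in> P"
    then have "v c \<in> in_chart c Q" using that(3) by (auto simp: in_chart_def)
    then obtain w where "w \<in> Q" "w c = v c" by (auto simp: in_chart_def)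
    then show "v \<in> Q" using tangent_eqI[of v p w c] v that assms(3) by auto
  qed
  show ?thesis using *[of P Q] *[of Q P] assms by auto
qed

lemma in_chart_change:
  assumes "P \<subseteq> tangent_space M p" "c \<in> charts_at M p" "d \<in> charts_at M p"
  shows "in_chart d P = DT c d (map_ch c p) ` in_chart c P"
  using tangent_DT[OF _ assms(2,3)] assms(1) by (force simp: in_chart_def image_image)

lemma mem_in_chart_change:
  assumes "P \<subseteq> tangent_space M p" "c \<in> charts_at M p" "d \<in> charts_at M p"
  shows "w \<in> in_chart c P \<longleftrightarrow> DT c d (map_ch c p) w \<in> in_chart d P"
proof
  show "w \<in> in_chart c P \<Longrightarrow> DT c d (map_ch c p) w \<in> in_chart d P"
    unfolding in_chart_change[OF assms] by (rule imageI)
  assume "DT c d (map_ch c p) w \<in> in_chart d P"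
  then have "DT d c (map_ch d p) (DT c d (map_ch c p) w) \<in> in_chart c P"
    unfolding in_chart_change[OF assms(1,3,2)] by (rule imageI)
  then show "w \<in> in_chart c P" by (simp add: DT_inverse[OF assms(2,3)])
qed

section \<open>Differentials of smooth maps\<close>

definition local_rep :: "('p \<Rightarrow> 'p) \<Rightarrow> 'p chart \<Rightarrow> 'p chart \<Rightarrow> real^3 \<Rightarrow> real^3" where
  "local_rep f c d = map_ch d \<circ> f \<circ> inv_ch c"

lemma rep_open:
  assumes "continuous_map (mtop M) (mtop M) f" "c \<in> atlas M" "d \<in> atlas M"
  shows "open {x \<in> img_ch c. f (inv_ch c x) \<in> dom_ch d}"
proof -
  have "continuous_map (top_of_set (img_ch c)) (mtop M) (f \<circ> inv_ch c)"
    by (rule continuous_map_compose[OF continuous_map_inv[OF assms(2)] assms(1)])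
  from openin_continuous_map_preimage[OF this dom_open[OF assms(3)]]
  show ?thesis using img_open[OF assms(2)] openin_open_eq by auto
qed

lemma smooth_map_iff:
  "smooth_map M f \<longleftrightarrow> continuous_map (mtop M) (mtop M) f \<and>
    (\<forall>c\<in>atlas M. \<forall>d\<in>atlas M. Cinf {x \<in> img_ch c. f (inv_ch c x) \<in> dom_ch d} (local_rep f c d))"
  using smooth_on_open_iff[OF rep_open] unfolding smooth_map_def local_rep_def o_def by blast

lemma rep_has_derivative:
  assumes "smooth_map M f" "c \<in> charts_at M p" "d \<in> charts_at M (f p)"
  shows "(local_rep f c d has_derivative frechet_derivative (local_rep f c d) (at (map_ch c p))) (at (map_ch c p))"
proof -
  note A = charts_atD[OF assms(2)] charts_atD[OF assms(3)]
  have "Cinf {x \<in> img_ch c. f (inv_ch c x) \<in> dom_ch d} (local_rep f c d)"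
    using assms(1) A unfolding smooth_map_iff by blast
  moreover have "map_ch c p \<in> {x \<in> img_ch c. f (inv_ch c x) \<in> dom_ch d}" using A by simp
  ultimately show ?thesis by (rule Cinf_has_derivative)
qed

lemma rep_chain:
  assumes "smooth_map M f" "smooth_map M g" "c \<in> charts_at M p" "d \<in> charts_at M (f p)" "e \<in> charts_at M (g (f p))"
  shows "frechet_derivative (local_rep (g \<circ> f) c e) (at (map_ch c p)) =
    (\<lambda>v. frechet_derivative (local_rep g d e) (at (map_ch d (f p))) (frechet_derivative (local_rep f c d) (at (map_ch c p)) v))"
proof (rule has_derivative_transition_chain[where U="{x \<in> img_ch c. f (inv_ch c x) \<in> dom_ch d}"
      and f="local_rep f c d" and g="local_rep g d e"
      and f'="frechet_derivative (local_rep f c d) (at (map_ch c p))"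
      and g'="frechet_derivative (local_rep g d e) (at (map_ch d (f p)))"])
  note A = charts_atD[OF assms(3)] charts_atD[OF assms(4)] charts_atD[OF assms(5)]
  show "(local_rep f c d has_derivative frechet_derivative (local_rep f c d) (at (map_ch c p))) (at (map_ch c p))"
    by (rule rep_has_derivative[OF assms(1,3,4)])
  have "local_rep f c d (map_ch c p) = map_ch d (f p)" using A by (simp add: local_rep_def)
  then show "(local_rep g d e has_derivative frechet_derivative (local_rep g d e) (at (map_ch d (f p)))) (at (local_rep f c d (map_ch c p)))"
    using rep_has_derivative[OF assms(2,4,5)] by simp
  show "open {x \<in> img_ch c. f (inv_ch c x) \<in> dom_ch d}"
    using rep_open assms(1) A unfolding smooth_map_iff by blast
  show "map_ch c p \<in> {x \<in> img_ch c. f (inv_ch c x) \<in> dom_ch d}" using A by simp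
  show "local_rep (g \<circ> f) c e y = local_rep g d e (local_rep f c d y)" if "y \<in> {x \<in> img_ch c. f (inv_ch c x) \<in> dom_ch d}" for y
    using that inv_map[OF A(3)] by (simp add: local_rep_def)
qed

lemma smooth_map_id: "smooth_map M (\<lambda>p. p)"
  unfolding smooth_map_iff
proof (intro conjI ballI)
  fix c d assume cd: "c \<in> atlas M" "d \<in> atlas M"
  have "{x \<in> img_ch c. inv_ch c x \<in> dom_ch d} = overlap c d" "local_rep (\<lambda>p. p) c d = transition c d"
    by (auto simp: overlap_def local_rep_def transition_def)
  then show "Cinf {x \<in> img_ch c. inv_ch c x \<in> dom_ch d} (local_rep (\<lambda>p. p) c d)"
    using Cinf_transition[OF cd] by simp
qed simp

text \<open>Frees \<open>differential\<close> from its arbitrarily chosen source chart: the chain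
  rule is applied with the identity as first map, whose local representative is a transition
  map.\<close>

lemma differential_chart:
  assumes f: "smooth_map M f" and c: "c \<in> charts_at M p" and d: "d \<in> charts_at M (f p)" and v: "v \<in> tangent_space M p"
  shows "differential M f p v d = frechet_derivative (local_rep f c d) (at (map_ch c p)) (v c)"
proof -
  define b where "b = (SOME c. c \<in> charts_at M p)"
  have b: "b \<in> charts_at M p" unfolding b_def by (rule someI[of "\<lambda>c. c \<in> charts_at M p", OF c])
  have "local_rep (\<lambda>p. p) b c = transition b c" by (auto simp: local_rep_def transition_def)
  then have "frechet_derivative (local_rep f b d) (at (map_ch b p)) =
    (\<lambda>v. frechet_derivative (local_rep f c d) (at (map_ch c p)) (DT b c (map_ch b p) v))"
    using rep_chain[OF smooth_map_id f b c d] by (simp add: o_def)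
  moreover have "differential M f p v d = frechet_derivative (local_rep f b d) (at (map_ch b p)) (v b)"
    using d by (simp add: differential_def b_def Let_def local_rep_def)
  ultimately show ?thesis using tangent_DT[OF v b c] by simp
qed

lemma differential_tangent:
  assumes f: "smooth_map M f" and p: "p \<in> points M" and v: "v \<in> tangent_space M p"
  shows "differential M f p v \<in> tangent_space M (f p)"
  unfolding tangent_space_def
proof (intro CollectI conjI ballI allI impI)
  obtain c where c: "c \<in> charts_at M p" using chart_exists[OF p] by blast
  fix d e assume de: "d \<in> charts_at M (f p)" "e \<in> charts_at M (f p)"
  have "local_rep (\<lambda>p. p) d e = transition d e" by (auto simp: local_rep_def transition_def)
  then show "differential M f p v e = DT d e (map_ch d (f p)) (differential M f p v d)"
    using rep_chain[OF f smooth_map_id c de] differential_chart[OF f c _ v] de by (simp add: o_def)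
next
  fix d assume "d \<notin> charts_at M (f p)"
  then show "differential M f p v d = 0" by (simp add: differential_def)
qed

lemma differential_comp:
  assumes f: "smooth_map M f" and g: "smooth_map M g" and fg: "smooth_map M (g \<circ> f)"
    and p: "p \<in> points M" and v: "v \<in> tangent_space M p"
  shows "differential M (g \<circ> f) p v = differential M g (f p) (differential M f p v)"
proof -
  have fp: "f p \<in> points M" and gfp: "g (f p) \<in> points M"
    using f g p unfolding smooth_map_iff continuous_map_def by auto
  obtain c d e where cde: "c \<in> charts_at M p" "d \<in> charts_at M (f p)" "e \<in> charts_at M (g (f p))"
    using chart_exists[OF p] chart_exists[OF fp] chart_exists[OF gfp] by (elim exE)
  note dt = differential_tangent[OF f p v]
  show ?thesis
  proof (rule tangent_eqI)
    show "differential M (g \<circ> f) p v \<in> tangent_space M (g (f p))"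
      using differential_tangent[OF fg p v] by simp
    show "differential M g (f p) (differential M f p v) \<in> tangent_space M (g (f p))"
      by (rule differential_tangent[OF g fp dt])
    show "e \<in> charts_at M (g (f p))" by fact
    show "differential M (g \<circ> f) p v e = differential M g (f p) (differential M f p v) e"
      using differential_chart[OF fg cde(1) _ v, of e] cde rep_chain[OF f g cde]
        differential_chart[OF g cde(2,3) dt] differential_chart[OF f cde(1,2) v] by simp
  qed
qed

end

section \<open>Isotopies of plane fields\<close>

context closed_manifold3
begin

definition motion_domain :: "(real \<Rightarrow> 'p \<Rightarrow> 'p) \<Rightarrow> 'p chart \<Rightarrow> 'p chart \<Rightarrow> (real \<times> (real^3)) set" where
  "motion_domain h c d = {(t, x). x \<in> img_ch c \<and> h t (inv_ch c x) \<in> dom_ch d}"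

text \<open>With all real times allowed the domains are open, and \<open>Cinf\<close> replaces
  one-sided smoothness at the ends of a time interval.\<close>

definition motion :: "(real \<Rightarrow> 'p \<Rightarrow> 'p) \<Rightarrow> bool" where
  "motion h \<longleftrightarrow> continuous_map (prod_topology euclidean (mtop M)) (mtop M) (\<lambda>(t, p). h t p) \<and>
    (\<forall>c\<in>atlas M. \<forall>d\<in>atlas M. Cinf (motion_domain h c d) (\<lambda>(t, x). map_ch d (h t (inv_ch c x))))"

lemma motion_domain_open:
  assumes h: "continuous_map (prod_topology euclidean (mtop M)) (mtop M) (\<lambda>(t, p). h t p)"
    and c: "c \<in> atlas M" and d: "d \<in> atlas M"
  shows "open (motion_domain h c d)"
proof -
  let ?U = "UNIV \<times> img_ch c :: (real \<times> (real^3)) set"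
  have f1: "continuous_map (top_of_set ?U) euclidean fst"
    by (simp add: continuous_on_fst continuous_on_id)
  have "continuous_map (top_of_set ?U) (top_of_set (img_ch c)) snd"
    by (auto simp: continuous_map_in_subtopology continuous_on_snd continuous_on_id)
  from continuous_map_compose[OF this continuous_map_inv[OF c]]
  have "continuous_map (top_of_set ?U) (prod_topology euclidean (mtop M)) (\<lambda>z. (fst z, inv_ch c (snd z)))"
    using f1 by (simp add: continuous_map_pairwise o_def)
  from continuous_map_compose[OF this h]
  have o: "openin (top_of_set ?U) {z \<in> topspace (top_of_set ?U). ((\<lambda>(t, p). h t p) \<circ> (\<lambda>z. (fst z, inv_ch c (snd z)))) z \<in> dom_ch d}"
    by (rule openin_continuous_map_preimage) (rule dom_open[OF d])
  have eq: "{z \<in> topspace (top_of_set ?U). ((\<lambda>(t, p). h t p) \<circ> (\<lambda>z. (fst z, inv_ch c (snd z)))) z \<in> dom_ch d} = motion_domain h c d"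
    by (auto simp: motion_domain_def)
  have oU: "open ?U" by (intro open_Times open_UNIV img_open[OF c])
  show ?thesis by (rule openin_open_trans[OF o[unfolded eq] oU])
qed

lemma motion_continuous: "motion h \<Longrightarrow> continuous_map (prod_topology euclidean (mtop M)) (mtop M) (\<lambda>(t, p). h t p)"
  and motion_Cinf: "motion h \<Longrightarrow> c \<in> atlas M \<Longrightarrow> d \<in> atlas M \<Longrightarrow> Cinf (motion_domain h c d) (\<lambda>(t, x). map_ch d (h t (inv_ch c x)))"
  by (auto simp: motion_def)

lemma motion_smooth_family:
  assumes "motion h"
  shows "smooth_family_of_maps M T h"
  unfolding smooth_family_of_maps_def
proof (intro conjI ballI)
  show "continuous_map (prod_topology (top_of_set T) (mtop M)) (mtop M) (\<lambda>(t, p). h t p)"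
    unfolding prod_topology_subtopology
    by (rule continuous_map_from_subtopology[OF motion_continuous[OF assms]])
  fix c d assume "c \<in> atlas M" "d \<in> atlas M"
  from motion_Cinf[OF assms this]
  show "smooth_on {(t, x). t \<in> T \<and> x \<in> img_ch c \<and> h t (inv_ch c x) \<in> dom_ch d} (\<lambda>(t, x). map_ch d (h t (inv_ch c x)))"
    by (rule Cinf_smooth_on) (auto simp: motion_domain_def)
qed

lemma motion_slice:
  assumes "motion h"
  shows "smooth_map M (h t)"
  unfolding smooth_map_iff
proof (intro conjI ballI)
  have "continuous_map (mtop M) (prod_topology euclidean (mtop M)) (\<lambda>p. (t, p))"
    by (simp add: continuous_map_pairwise o_def)
  from continuous_map_compose[OF this motion_continuous[OF assms]]
  have "continuous_map (mtop M) (mtop M) ((\<lambda>(t, p). h t p) \<circ> (\<lambda>p. (t, p)))" .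
  moreover have "(\<lambda>(t, p). h t p) \<circ> (\<lambda>p. (t, p)) = h t" by (rule ext) simp
  ultimately show hc: "continuous_map (mtop M) (mtop M) (h t)" by (rule back_subst)
  have op: "open {x \<in> img_ch c. h t (inv_ch c x) \<in> dom_ch d}" if "c \<in> atlas M" "d \<in> atlas M" for c d
    by (rule rep_open[OF hc that])
  fix c d assume cd: "c \<in> atlas M" "d \<in> atlas M"
  have "Cinf {x \<in> img_ch c. h t (inv_ch c x) \<in> dom_ch d} (\<lambda>x. (\<lambda>(t, x). map_ch d (h t (inv_ch c x))) (t, x))"
    by (rule Cinf_compose[OF _ motion_Cinf[OF assms cd]]) (auto simp: motion_domain_def intro!: cinf_intros op cd)
  then show "Cinf {x \<in> img_ch c. h t (inv_ch c x) \<in> dom_ch d} (local_rep (h t) c d)"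
    by (simp add: local_rep_def o_def)
qed

lemma smooth_map_points: "smooth_map M f \<Longrightarrow> p \<in> points M \<Longrightarrow> f p \<in> points M"
  unfolding smooth_map_iff continuous_map_def by (elim conjE) (rule funcset_mem)

lemma motion_points: "motion h \<Longrightarrow> p \<in> points M \<Longrightarrow> h t p \<in> points M"
  by (rule smooth_map_points[OF motion_slice])

lemma motion_compose:
  assumes f: "motion f" and g: "motion g"
  shows "motion (\<lambda>t p. g t (f t p))"
  unfolding motion_def
proof (intro conjI ballI)
  have "continuous_map (prod_topology euclidean (mtop M)) (prod_topology euclidean (mtop M)) (\<lambda>z. (fst z, (\<lambda>(t, p). f t p) z))"
    unfolding continuous_map_pairwise o_def fst_conv snd_conv
    by (intro conjI continuous_map_fst motion_continuous[OF f])
  from continuous_map_compose[OF this motion_continuous[OF g]]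
  have "continuous_map (prod_topology euclidean (mtop M)) (mtop M)
    ((\<lambda>(t, p). g t p) \<circ> (\<lambda>z. (fst z, (\<lambda>(t, p). f t p) z)))" .
  moreover have "(\<lambda>(t, p). g t p) \<circ> (\<lambda>z. (fst z, (\<lambda>(t, p). f t p) z)) = (\<lambda>(t, p). g t (f t p))"
    by (rule ext) (simp add: case_prod_beta)
  ultimately show cont: "continuous_map (prod_topology euclidean (mtop M)) (mtop M) (\<lambda>(t, p). g t (f t p))"
    by (rule back_subst)
  fix c e assume ce: "c \<in> atlas M" "e \<in> atlas M"
  show "Cinf (motion_domain (\<lambda>t p. g t (f t p)) c e) (\<lambda>(t, x). map_ch e (g t (f t (inv_ch c x))))"
  proof (rule Cinf_local[OF _ motion_domain_open[OF cont ce]])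
    fix z assume z: "z \<in> motion_domain (\<lambda>t p. g t (f t p)) c e"
    obtain t x where tx: "z = (t, x)" by fastforce
    have x: "x \<in> img_ch c" "g t (f t (inv_ch c x)) \<in> dom_ch e" using z by (auto simp: motion_domain_def tx)
    have "inv_ch c x \<in> points M" using inv_dom[OF ce(1) x(1)] dom_sub[OF ce(1)] by blast
    from chart_exists[OF motion_points[OF f this, of t]] obtain d where "d \<in> charts_at M (f t (inv_ch c x))" by (elim exE)
    note d = charts_atD[OF this]
    let ?F = "\<lambda>z. (fst z, (\<lambda>(t, x). map_ch d (f t (inv_ch c x))) z)"
    have F: "Cinf (motion_domain f c d) ?F"
      by (intro Cinf_Pair Cinf_fst Cinf_id motion_Cinf[OF f ce(1) d(1)] motion_domain_open[OF motion_continuous[OF f] ce(1) d(1)])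
    let ?V = "motion_domain f c d \<inter> ?F -` motion_domain g d e"
    have V: "open ?V"
      by (rule continuous_open_preimage[OF Cinf_continuous[OF F] Cinf_open[OF F] motion_domain_open[OF motion_continuous[OF g] d(1) ce(2)]])
    have zV: "z \<in> ?V" using x d(2) inv_map[OF d(1,2)] by (auto simp: motion_domain_def tx)
    have "Cinf ?V (\<lambda>z. (\<lambda>(t, y). map_ch e (g t (inv_ch d y))) (?F z))"
      by (rule Cinf_compose[OF Cinf_subset[OF F V] motion_Cinf[OF g d(1) ce(2)]]) auto
    then have "Cinf ?V (\<lambda>(t, x). map_ch e (g t (f t (inv_ch c x))))"
    proof (rule Cinf_cong)
      fix w assume "w \<in> ?V"
      then have "f (fst w) (inv_ch c (snd w)) \<in> dom_ch d" by (simp add: motion_domain_def case_prod_unfold)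
      then show "(\<lambda>(t, y). map_ch e (g t (inv_ch d y))) (?F w) = (\<lambda>(t, x). map_ch e (g t (f t (inv_ch c x)))) w"
        using inv_map[OF d(1)] by (simp add: case_prod_unfold)
    qed
    with zV show "\<exists>V. z \<in> V \<and> Cinf V (\<lambda>(t, x). map_ch e (g t (f t (inv_ch c x))))"
      by (intro exI conjI)
  qed
qed

definition tangential :: "'p field \<Rightarrow> bool" where
  "tangential \<xi> \<longleftrightarrow> (\<forall>p\<in>points M. \<xi> p \<subseteq> tangent_space M p)"

text \<open>The families are defined for all real times and the inverses \<open>\<Psi>\<^sub>t\<close> are part of the data, so that no
  separate diffeomorphism condition is needed.\<close>

definition isotopic_to :: "'p field \<Rightarrow> 'p field \<Rightarrow> bool" where
  "isotopic_to \<xi> \<xi>' \<longleftrightarrow> (\<exists>\<Phi> \<Psi>. motion \<Phi> \<and> motion \<Psi> \<and> (\<forall>t. \<forall>p\<in>points M. \<Psi> t (\<Phi> t p) = p \<and> \<Phi> t (\<Psi> t p) = p) \<and>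
    (\<forall>p\<in>points M. \<Phi> 0 p = p) \<and> (\<forall>p\<in>points M. differential M (\<Phi> 1) p ` \<xi> p = \<xi>' (\<Phi> 1 p)))"

text \<open>The two families are composed at equal times instead of being run one after the other,
  so no smoothing at a junction is needed.\<close>

lemma isotopic_to_trans:
  assumes "isotopic_to \<xi> \<xi>'" "isotopic_to \<xi>' \<xi>''" "tangential \<xi>"
  shows "isotopic_to \<xi> \<xi>''"
proof -
  obtain \<Phi> \<Psi> where 1: "motion \<Phi>" "motion \<Psi>" "\<forall>t. \<forall>p\<in>points M. \<Psi> t (\<Phi> t p) = p \<and> \<Phi> t (\<Psi> t p) = p"
    "\<forall>p\<in>points M. \<Phi> 0 p = p" "\<forall>p\<in>points M. differential M (\<Phi> 1) p ` \<xi> p = \<xi>' (\<Phi> 1 p)"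
    using assms(1) unfolding isotopic_to_def by (elim exE conjE)
  obtain \<Phi>' \<Psi>' where 2: "motion \<Phi>'" "motion \<Psi>'" "\<forall>t. \<forall>p\<in>points M. \<Psi>' t (\<Phi>' t p) = p \<and> \<Phi>' t (\<Psi>' t p) = p"
    "\<forall>p\<in>points M. \<Phi>' 0 p = p" "\<forall>p\<in>points M. differential M (\<Phi>' 1) p ` \<xi>' p = \<xi>'' (\<Phi>' 1 p)"
    using assms(2) unfolding isotopic_to_def by (elim exE conjE)
  have fc: "motion (\<lambda>t p. \<Phi>' t (\<Phi> t p))" by (rule motion_compose[OF 1(1) 2(1)])
  show ?thesis
    unfolding isotopic_to_def
  proof (intro exI conjI allI ballI)
    show "motion (\<lambda>t p. \<Phi>' t (\<Phi> t p))" by (rule fc)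
    show "motion (\<lambda>t p. \<Psi> t (\<Psi>' t p))" by (rule motion_compose[OF 2(2) 1(2)])
    fix p assume p: "p \<in> points M"
    show "\<Psi> t (\<Psi>' t (\<Phi>' t (\<Phi> t p))) = p" "\<Phi>' t (\<Phi> t (\<Psi> t (\<Psi>' t p))) = p" for t
      using 1(3) 2(3) p motion_points[OF 1(1) p] motion_points[OF 2(2) p] by simp_all
    show "\<Phi>' 0 (\<Phi> 0 p) = p" using 1(4) 2(4) p by simp
    have "differential M (\<lambda>p. \<Phi>' 1 (\<Phi> 1 p)) p v = differential M (\<Phi>' 1) (\<Phi> 1 p) (differential M (\<Phi> 1) p v)" if "v \<in> \<xi> p" for v
      using differential_comp[OF motion_slice[OF 1(1)] motion_slice[OF 2(1)], of 1 1] motion_slice[OF fc, of 1] p that assms(3)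
      unfolding tangential_def by (auto simp: o_def)
    then have "differential M (\<lambda>p. \<Phi>' 1 (\<Phi> 1 p)) p ` \<xi> p = differential M (\<Phi>' 1) (\<Phi> 1 p) ` (differential M (\<Phi> 1) p ` \<xi> p)"
      unfolding image_image by (rule image_cong[OF refl])
    also have "\<dots> = \<xi>'' (\<Phi>' 1 (\<Phi> 1 p))"
      using 1(5) 2(5) p motion_points[OF 1(1) p] by simp
    finally show "differential M (\<lambda>p. \<Phi>' 1 (\<Phi> 1 p)) p ` \<xi> p = \<xi>'' (\<Phi>' 1 (\<Phi> 1 p))" .
  qed
qed

lemma isotopic_to_isotopic:
  assumes "isotopic_to \<xi> \<xi>'" "\<And>p. p \<in> points M \<Longrightarrow> \<xi> p = \<eta> p" "\<And>p. p \<in> points M \<Longrightarrow> \<xi>' p = \<eta>' p"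
  shows "isotopic M \<eta> \<eta>'"
proof -
  obtain \<Phi> \<Psi> where 1: "motion \<Phi>" "motion \<Psi>" "\<forall>t. \<forall>p\<in>points M. \<Psi> t (\<Phi> t p) = p \<and> \<Phi> t (\<Psi> t p) = p"
    "\<forall>p\<in>points M. \<Phi> 0 p = p" "\<forall>p\<in>points M. differential M (\<Phi> 1) p ` \<xi> p = \<xi>' (\<Phi> 1 p)"
    using assms(1) unfolding isotopic_to_def by (elim exE conjE)
  have bij: "bij_betw (\<Phi> t) (points M) (points M)" for t
    by (rule bij_betw_byWitness[where f'="\<Psi> t"]) (use 1(3) motion_points[OF 1(1)] motion_points[OF 1(2)] in auto)
  have inv: "inv_into (points M) (\<Phi> t) p = \<Psi> t p" if "p \<in> points M" for t p
    using 1(3) that motion_points[OF 1(2) that]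
    by (intro inv_into_f_eq[OF bij_betw_imp_inj_on[OF bij]]) auto
  have "diffeomorphism M (\<Phi> t)" for t
    unfolding diffeomorphism_def
  proof (intro conjI)
    show "bij_betw (\<Phi> t) (points M) (points M)" by (rule bij)
    show "smooth_map M (\<Phi> t)" by (rule motion_slice[OF 1(1)])
    have \<Psi>: "smooth_map M (\<Psi> t)" by (rule motion_slice[OF 1(2)])
    show "smooth_map M (inv_into (points M) (\<Phi> t))"
      unfolding smooth_map_iff
    proof (intro conjI ballI)
      show "continuous_map (mtop M) (mtop M) (inv_into (points M) (\<Phi> t))"
        using \<Psi> unfolding smooth_map_iff by (elim conjE) (rule continuous_map_eq, assumption, simp add: inv)
      fix c d assume cd: "c \<in> atlas M" "d \<in> atlas M"
      have eq: "inv_into (points M) (\<Phi> t) (inv_ch c x) = \<Psi> t (inv_ch c x)" if "x \<in> img_ch c" for x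
        using inv[of "inv_ch c x"] inv_dom[OF cd(1) that] dom_sub[OF cd(1)] by blast
      then have set: "{x \<in> img_ch c. inv_into (points M) (\<Phi> t) (inv_ch c x) \<in> dom_ch d} = {x \<in> img_ch c. \<Psi> t (inv_ch c x) \<in> dom_ch d}"
        by auto
      have "Cinf {x \<in> img_ch c. \<Psi> t (inv_ch c x) \<in> dom_ch d} (local_rep (\<Psi> t) c d)"
        using \<Psi> cd unfolding smooth_map_iff by blast
      then show "Cinf {x \<in> img_ch c. inv_into (points M) (\<Phi> t) (inv_ch c x) \<in> dom_ch d} (local_rep (inv_into (points M) (\<Phi> t)) c d)"
        unfolding set by (rule Cinf_cong) (use eq in \<open>simp add: local_rep_def\<close>)
    qed
  qed
  then have "smooth_family_of_diffeos M {0..1} \<Phi>"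
    unfolding smooth_family_of_diffeos_def using motion_smooth_family[OF 1(1)] by blast
  moreover have "pushforward M (\<Phi> 1) \<eta> q = \<eta>' q" if q: "q \<in> points M" for q
  proof -
    have p: "\<Psi> 1 q \<in> points M" by (rule motion_points[OF 1(2) q])
    have "pushforward M (\<Phi> 1) \<eta> q = differential M (\<Phi> 1) (\<Psi> 1 q) ` \<xi> (\<Psi> 1 q)"
      by (simp add: pushforward_def Let_def inv[OF q] assms(2)[OF p])
    also have "\<dots> = \<xi>' q" using 1(3,5) p q by simp
    finally show ?thesis using assms(3)[OF q] by simp
  qed
  ultimately show ?thesis unfolding isotopic_def using 1(4) by blast
qed

section \<open>Transplanting maps from a chart to the manifold\<close>

definition transplant :: "'p chart \<Rightarrow> (real \<times> (real^3) \<Rightarrow> real^3) \<Rightarrow> real \<Rightarrow> 'p \<Rightarrow> 'p" where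
  "transplant c F t p = (if p \<in> dom_ch c then inv_ch c (F (t, map_ch c p)) else p)"

context
  fixes c K and F G :: "real \<times> (real^3) \<Rightarrow> real^3"
  assumes c: "c \<in> atlas M" and K: "compact K" "K \<subseteq> img_ch c"
    and F: "Cinf UNIV F" and GF: "\<And>t x. G (t, F (t, x)) = x" and FK: "\<And>t x. x \<notin> K \<Longrightarrow> F (t, x) = x"
begin

text \<open>A point mapped out of the chart image lands outside \<open>K\<close>, where
  \<open>F\<close> fixes everything; by injectivity it had never moved.\<close>

lemma transplant_img: "x \<in> img_ch c \<Longrightarrow> F (t, x) \<in> img_ch c"
proof (rule ccontr)
  assume x: "x \<in> img_ch c" and n: "F (t, x) \<notin> img_ch c"
  then have "F (t, F (t, x)) = F (t, x)" using FK K(2) by blast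
  then have "F (t, x) = x" using GF[of t "F (t, x)"] GF[of t x] by simp
  then show False using x n by simp
qed

lemma transplant_outside: "p \<notin> inv_ch c ` K \<Longrightarrow> transplant c F t p = p"
proof (cases "p \<in> dom_ch c")
  case True
  assume "p \<notin> inv_ch c ` K"
  then have "map_ch c p \<notin> K" using inv_map[OF c True] by (metis imageI)
  then show ?thesis using True FK inv_map[OF c True] by (simp add: transplant_def)
qed (simp add: transplant_def)

lemma transplant_inside: "x \<in> img_ch c \<Longrightarrow> transplant c F t (inv_ch c x) = inv_ch c (F (t, x))"
  by (simp add: transplant_def inv_dom[OF c] map_inv[OF c])

text \<open>Pasting over two open sets: the chart domain, and the complement of the closed image of
  \<open>K\<close>, where the map is the identity.\<close>

lemma transplant_continuous:
  "continuous_map (prod_topology euclidean (mtop M)) (mtop M) (\<lambda>(t, p). transplant c F t p)"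
proof (rule pasting_lemma[where I="UNIV :: bool set"
      and T="\<lambda>i. (UNIV :: real set) \<times> (if i then dom_ch c else points M - inv_ch c ` K)"
      and f="\<lambda>i (z :: real \<times> 'p). if i then inv_ch c (F (fst z, map_ch c (snd z))) else snd z"])
  have cl: "closedin (mtop M) (inv_ch c ` K)" by (rule closedin_inv_image[OF c K])
  fix i :: bool
  show "openin (prod_topology euclidean (mtop M)) (UNIV \<times> (if i then dom_ch c else points M - inv_ch c ` K))"
    using dom_open[OF c] cl by (auto simp: openin_prod_Times_iff)
  show "continuous_map (subtopology (prod_topology euclidean (mtop M)) (UNIV \<times> (if i then dom_ch c else points M - inv_ch c ` K)))
      (mtop M) (\<lambda>z. if i then inv_ch c (F (fst z, map_ch c (snd z))) else snd z)"
  proof (cases i)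
    case True
    let ?Y = "prod_topology (euclidean :: real topology) (subtopology (mtop M) (dom_ch c))"
    have "continuous_map ?Y euclidean (map_ch c \<circ> snd)"
      by (rule continuous_map_compose[OF continuous_map_snd continuous_map_chart[OF c]])
    then have "continuous_map ?Y (prod_topology euclidean euclidean) (\<lambda>z. (fst z, map_ch c (snd z)))"
      unfolding continuous_map_pairwise o_def fst_conv snd_conv by (intro conjI continuous_map_fst)
    then have "continuous_map ?Y euclidean (\<lambda>z. (fst z, map_ch c (snd z)))"
      unfolding prod_topology_euclidean .
    moreover have "continuous_map euclidean euclidean F" using Cinf_continuous[OF F] by simp
    ultimately have "continuous_map ?Y euclidean (F \<circ> (\<lambda>z. (fst z, map_ch c (snd z))))"
      by (rule continuous_map_compose)
    then have "continuous_map ?Y (top_of_set (img_ch c)) (\<lambda>z. F (fst z, map_ch c (snd z)))"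
      using transplant_img by (auto simp: continuous_map_in_subtopology o_def)
    from continuous_map_compose[OF this continuous_map_inv[OF c]]
    show ?thesis using True by (simp add: prod_topology_subtopology o_def)
  next
    case False
    then show ?thesis by (simp add: continuous_map_from_subtopology continuous_map_snd)
  qed
next
  fix i j :: bool and z :: "real \<times> 'p"
  assume "z \<in> topspace (prod_topology euclidean (mtop M)) \<inter> UNIV \<times> (if i then dom_ch c else points M - inv_ch c ` K)
      \<inter> UNIV \<times> (if j then dom_ch c else points M - inv_ch c ` K)"
  then have "\<not> (i \<longleftrightarrow> j) \<Longrightarrow> snd z \<in> dom_ch c \<and> snd z \<notin> inv_ch c ` K" by (auto split: if_splits)
  then have "\<not> (i \<longleftrightarrow> j) \<Longrightarrow> inv_ch c (F (fst z, map_ch c (snd z))) = snd z"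
    using transplant_outside[of "snd z" "fst z"] by (simp add: transplant_def)
  then show "(if i then inv_ch c (F (fst z, map_ch c (snd z))) else snd z) = (if j then inv_ch c (F (fst z, map_ch c (snd z))) else snd z)"
    by (cases i; cases j) auto
next
  fix z assume z: "z \<in> topspace (prod_topology (euclidean :: real topology) (mtop M))"
  show "\<exists>j. j \<in> UNIV \<and> z \<in> UNIV \<times> (if j then dom_ch c else points M - inv_ch c ` K) \<and>
      (case z of (t, p) \<Rightarrow> transplant c F t p) = (if j then inv_ch c (F (fst z, map_ch c (snd z))) else snd z)"
  proof (cases "snd z \<in> dom_ch c")
    case True
    then show ?thesis by (intro exI[of _ True]) (auto simp: transplant_def case_prod_beta mem_Times_iff)
  next
    case False
    then have "snd z \<notin> inv_ch c ` K" using closedin_inv_image(2)[OF c K] by blast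
    then show ?thesis using z False by (intro exI[of _ False]) (auto simp: transplant_def case_prod_beta mem_Times_iff)
  qed
qed

lemma transplant_motion: "motion (transplant c F)"
  unfolding motion_def
proof (intro conjI ballI)
  show "continuous_map (prod_topology euclidean (mtop M)) (mtop M) (\<lambda>(t, p). transplant c F t p)"
    by (rule transplant_continuous)
  fix d e assume de: "d \<in> atlas M" "e \<in> atlas M"
  show "Cinf (motion_domain (transplant c F) d e) (\<lambda>(t, x). map_ch e (transplant c F t (inv_ch d x)))"
  proof (rule Cinf_local[OF _ motion_domain_open[OF transplant_continuous de]])
    fix z assume z: "z \<in> motion_domain (transplant c F) d e"
    obtain t x where tx: "z = (t, x)" by fastforce
    have x: "x \<in> img_ch d" "transplant c F t (inv_ch d x) \<in> dom_ch e" using z by (auto simp: motion_domain_def tx)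
    show "\<exists>V. z \<in> V \<and> Cinf V (\<lambda>(t, x). map_ch e (transplant c F t (inv_ch d x)))"
    proof (cases "inv_ch d x \<in> dom_ch c")
      case True
      let ?P = "\<lambda>z :: real \<times> (real^3). F (fst z, transition d c (snd z))"
      have U: "open (UNIV \<times> overlap d c :: (real \<times> (real^3)) set)" by (intro open_Times open_UNIV overlap_open de c)
      have P: "Cinf (UNIV \<times> overlap d c) ?P"
        by (intro Cinf_compose_UNIV[OF F] Cinf_Pair Cinf_fst Cinf_id U
            Cinf_compose[OF Cinf_snd[OF Cinf_id[OF U]] Cinf_transition[OF de(1) c]]) auto
      let ?V = "(UNIV \<times> overlap d c) \<inter> ?P -` overlap c e"
      have V: "open ?V" by (rule continuous_open_preimage[OF Cinf_continuous[OF P] U overlap_open[OF c de(2)]])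
      have "Cinf ?V (\<lambda>z. transition c e (?P z))"
        by (rule Cinf_compose[OF Cinf_subset[OF P V] Cinf_transition[OF c de(2)]]) auto
      then have "Cinf ?V (\<lambda>(t, x). map_ch e (transplant c F t (inv_ch d x)))"
        by (rule Cinf_cong) (auto simp: transition_eq overlap_def transplant_def)
      moreover have "z \<in> ?V"
      proof -
        have y: "map_ch c (inv_ch d x) \<in> img_ch c" using True by blast
        have "transplant c F t (inv_ch d x) = inv_ch c (F (t, map_ch c (inv_ch d x)))"
          using True by (simp add: transplant_def)
        then show ?thesis using x True transplant_img[OF y, of t] by (simp add: tx overlap_def transition_eq)
      qed
      ultimately show ?thesis by (intro exI[of _ ?V] conjI)
    next
      case False
      let ?U = "{x \<in> img_ch d. inv_ch d x \<in> points M - inv_ch c ` K}"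
      let ?V = "UNIV \<times> (overlap d e \<inter> ?U) :: (real \<times> (real^3)) set"
      have "open ?U"
        by (rule open_inv_preimage[OF de(1)]) (rule openin_diff[OF openin_topspace closedin_inv_image(1)[OF c K]])
      then have V: "open ?V" by (intro open_Times open_UNIV open_Int overlap_open de)
      have "Cinf ?V (\<lambda>z. transition d e (snd z))"
        by (rule Cinf_compose[OF Cinf_snd[OF Cinf_id[OF V]] Cinf_transition[OF de]]) auto
      then have "Cinf ?V (\<lambda>(t, x). map_ch e (transplant c F t (inv_ch d x)))"
        by (rule Cinf_cong) (auto simp: transition_eq transplant_outside)
      moreover have "z \<in> ?V"
      proof -
        have "inv_ch d x \<in> points M" using inv_dom[OF de(1) x(1)] dom_sub[OF de(1)] by blast
        moreover have n: "inv_ch d x \<notin> inv_ch c ` K" using False closedin_inv_image(2)[OF c K] by blast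
        moreover have "inv_ch d x \<in> dom_ch e" using x(2) transplant_outside[OF n] by simp
        ultimately show ?thesis using x(1) by (simp add: tx overlap_def)
      qed
      ultimately show ?thesis by (intro exI[of _ ?V] conjI)
    qed
  qed
qed

end

lemma differential_identity_near:
  assumes f: "smooth_map M f" and U: "openin (mtop M) U" "p \<in> U" and fU: "\<And>q. q \<in> U \<Longrightarrow> f q = q"
    and v: "v \<in> tangent_space M p"
  shows "differential M f p v = v"
proof -
  have p: "p \<in> points M" using openin_subset[OF U(1)] U(2) by blast
  have fp: "f p = p" by (rule fU[OF U(2)])
  obtain c where c: "c \<in> charts_at M p" using chart_exists[OF p] by (elim exE)
  note A = charts_atD[OF c]
  have "frechet_derivative (local_rep f c c) (at (map_ch c p)) = (\<lambda>v. v)"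
  proof (rule frechet_derivative_eq, rule has_derivative_transform_within_open[OF has_derivative_ident open_inv_preimage[OF A(1) U(1)]])
    show "map_ch c p \<in> {x \<in> img_ch c. inv_ch c x \<in> U}" using A U(2) by simp
    show "x = local_rep f c c x" if "x \<in> {x \<in> img_ch c. inv_ch c x \<in> U}" for x
      using that fU map_inv[OF A(1)] by (simp add: local_rep_def)
  qed
  then have "differential M f p v c = v c"
    using differential_chart[OF f c _ v, of c] c fp by simp
  then show ?thesis
    using tangent_eqI[OF _ v c] differential_tangent[OF f p v] fp by simp
qed

text \<open>A 1-form \<open>\<alpha>\<close> in a chart is represented by its coefficient vector field \<open>a\<close>; the coefficient of
  \<open>\<alpha> \<and> d\<alpha>\<close> is then \<open>a \<bullet> curl a\<close>.\<close>

definition vector_form :: "'p field \<Rightarrow> 'p chart \<Rightarrow> (real^3) set \<Rightarrow> (real^3 \<Rightarrow> real^3) \<Rightarrow> bool" where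
  "vector_form \<xi> c W a \<longleftrightarrow> W \<subseteq> img_ch c \<and> Cinf W a \<and>
    (\<forall>x\<in>W. a x \<noteq> 0 \<and> in_chart c (\<xi> (inv_ch c x)) = {v. a x \<bullet> v = 0})"

text \<open>\<open>D\<close> is injective, so the image plane has the same dimension as the plane
  that contains it.\<close>

lemma hyperplane_image_eq:
  fixes a b :: "real^3"
  assumes "linear D" "\<And>v. G (D v) = v" "a \<noteq> 0" "b \<noteq> 0" "\<And>v. a \<bullet> v = 0 \<Longrightarrow> b \<bullet> D v = 0"
  shows "D ` {v. a \<bullet> v = 0} = {w. b \<bullet> w = 0}"
proof (rule subspace_dim_equal)
  have inj: "inj D" by (rule inj_on_inverseI[of _ G]) (rule assms(2))
  show "subspace (D ` {v. a \<bullet> v = 0})"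
    by (intro linear_subspace_image[OF assms(1)] subspace_hyperplane)
  show "subspace {w. b \<bullet> w = 0}" by (rule subspace_hyperplane)
  show "D ` {v. a \<bullet> v = 0} \<subseteq> {w. b \<bullet> w = 0}" using assms(5) by auto
  have "dim (D ` {v. a \<bullet> v = 0}) = dim {v. a \<bullet> v = 0}"
    by (rule dim_image_eq[OF assms(1)]) (rule inj_on_subset[OF inj subset_UNIV])
  then show "dim {w. b \<bullet> w = 0} \<le> dim (D ` {v. a \<bullet> v = 0})"
    using dim_hyperplane[OF assms(3)] dim_hyperplane[OF assms(4)] by simp
qed

text \<open>The maps of \<open>gray_local\<close> carried into the manifold. On the image of
  \<open>K\<close> the differential is compared with the kernels in the chart \<open>c\<close>;
  elsewhere both the map and the plane fields are unchanged.\<close>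

lemma isotopic_to_local_step:
  assumes c: "c \<in> atlas M" and T: "tangential \<xi>" "tangential \<xi>'"
    and K: "compact K" "K \<subseteq> W" and a: "vector_form \<xi> c W a" and a': "vector_form \<xi>' c W (\<lambda>x. a x + \<delta> x)"
    and d: "Cinf W \<delta>" and dK: "\<And>x. x \<in> W \<Longrightarrow> x \<notin> K \<Longrightarrow> \<delta> x = 0"
    and pos: "\<And>q x. x \<in> W \<Longrightarrow> 0 \<le> q \<Longrightarrow> q \<le> 1 \<Longrightarrow>
      (a x + q *\<^sub>R \<delta> x) \<bullet> (curl a x + q *\<^sub>R curl \<delta> x) > 0"
    and out: "\<And>p. p \<in> points M \<Longrightarrow> p \<notin> inv_ch c ` K \<Longrightarrow> \<xi> p = \<xi>' p"
  shows "isotopic_to \<xi> \<xi>'"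
proof -
  have aC: "Cinf W a" and W: "W \<subseteq> img_ch c" using a by (auto simp: vector_form_def)
  note KI = subset_trans[OF K(2) W]
  show ?thesis
  proof (rule gray_local[OF K aC d dK pos])
    fix \<Phi> \<Psi> :: "real \<times> (real^3) \<Rightarrow> real^3"
    assume F: "Cinf UNIV \<Phi>" and G: "Cinf UNIV \<Psi>" and GF: "\<And>t x. \<Psi> (t, \<Phi> (t, x)) = x" and FG: "\<And>t x. \<Phi> (t, \<Psi> (t, x)) = x"
      and F0: "\<And>x. \<Phi> (0, x) = x" and FK: "\<And>t x. x \<notin> K \<Longrightarrow> \<Phi> (t, x) = x"
      and ker: "\<And>x v. x \<in> W \<Longrightarrow> a x \<bullet> v = 0 \<Longrightarrow>
        (a (\<Phi> (1, x)) + \<delta> (\<Phi> (1, x))) \<bullet> frechet_derivative (\<lambda>x. \<Phi> (1, x)) (at x) v = 0"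
      and FW: "\<And>x. x \<in> W \<Longrightarrow> \<Phi> (1, x) \<in> W"
    have GK: "\<Psi> (t, x) = x" if "x \<notin> K" for t x using GF[of t x] FK[OF that, of t] by simp
    let ?\<Phi> = "transplant c \<Phi>" and ?\<Psi> = "transplant c \<Psi>"
    have tF: "\<Phi> (t, x) \<in> img_ch c" if "x \<in> img_ch c" for t x
      by (rule transplant_img[OF c K(1) KI F GF _ that]) (rule FK)
    have tG: "\<Psi> (t, x) \<in> img_ch c" if "x \<in> img_ch c" for t x
      by (rule transplant_img[OF c K(1) KI G FG _ that]) (rule GK)
    have fF: "motion ?\<Phi>" by (rule transplant_motion[OF c K(1) KI F GF]) (rule FK)
    have fG: "motion ?\<Psi>" by (rule transplant_motion[OF c K(1) KI G FG]) (rule GK)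
    show ?thesis
      unfolding isotopic_to_def
    proof (intro exI conjI allI ballI)
      show "motion ?\<Phi>" by (rule fF)
      show "motion ?\<Psi>" by (rule fG)
      fix p assume p: "p \<in> points M"
      show "?\<Psi> t (?\<Phi> t p) = p" for t
      proof (cases "p \<in> dom_ch c")
        case True
        then have x: "map_ch c p \<in> img_ch c" by blast
        show ?thesis using True inv_dom[OF c tF[OF x, of t]] map_inv[OF c tF[OF x, of t]] inv_map[OF c True]
          by (simp add: transplant_def GF)
      qed (simp add: transplant_def)
      show "?\<Phi> t (?\<Psi> t p) = p" for t
      proof (cases "p \<in> dom_ch c")
        case True
        then have x: "map_ch c p \<in> img_ch c" by blast
        show ?thesis using True inv_dom[OF c tG[OF x, of t]] map_inv[OF c tG[OF x, of t]] inv_map[OF c True]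
          by (simp add: transplant_def FG)
      qed (simp add: transplant_def)
      show "?\<Phi> 0 p = p" using inv_map[OF c] by (simp add: transplant_def F0)
      have sm: "smooth_map M (?\<Phi> 1)" by (rule motion_slice[OF fF])
      have qM: "?\<Phi> 1 p \<in> points M" by (rule motion_points[OF fF p])
      show "differential M (?\<Phi> 1) p ` \<xi> p = \<xi>' (?\<Phi> 1 p)"
      proof (cases "p \<in> inv_ch c ` K")
        case False
        have fixp: "?\<Phi> 1 q = q" if "q \<in> points M - inv_ch c ` K" for q
          by (rule transplant_outside[OF c K(1) KI F GF]) (use FK that in auto)
        have op: "openin (mtop M) (points M - inv_ch c ` K)"
          by (rule openin_diff[OF openin_topspace closedin_inv_image(1)[OF c K(1) KI]])
        have "differential M (?\<Phi> 1) p v = v" if "v \<in> \<xi> p" for v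
          by (rule differential_identity_near[OF sm op]) (use p False fixp that T(1) in \<open>auto simp: tangential_def\<close>)
        then have "differential M (?\<Phi> 1) p ` \<xi> p = \<xi> p" by simp
        then show ?thesis using out[OF p False] fixp p False by simp
      next
        case True
        then obtain x where x: "x \<in> K" "p = inv_ch c x" by blast
        then have xW: "x \<in> W" and xi: "x \<in> img_ch c" using K KI by auto
        have cp: "c \<in> charts_at M p" using x inv_dom[OF c xi] c by (auto intro: charts_atI)
        have mp: "map_ch c p = x" using map_inv[OF c xi] x by simp
        have q: "?\<Phi> 1 p = inv_ch c (\<Phi> (1, x))" using cp mp by (simp add: transplant_def charts_at_def)
        have yW: "\<Phi> (1, x) \<in> W" by (rule FW[OF xW])
        have yi: "\<Phi> (1, x) \<in> img_ch c" using yW W by blast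
        have cq: "c \<in> charts_at M (?\<Phi> 1 p)" using q inv_dom[OF c yi] c by (auto intro: charts_atI)
        let ?D = "frechet_derivative (\<lambda>x. \<Phi> (1, x)) (at x)"
        have D1: "Cinf UNIV (\<lambda>x. \<Phi> (1, x))" by (intro Cinf_compose_UNIV[OF F] cinf_intros open_UNIV)
        have G1: "Cinf UNIV (\<lambda>x. \<Psi> (1, x))" by (intro Cinf_compose_UNIV[OF G] cinf_intros open_UNIV)
        have inv: "frechet_derivative (\<lambda>x. \<Psi> (1, x)) (at (\<Phi> (1, x))) (?D v) = v" for v
        proof -
          have "((\<lambda>y. \<Psi> (1, \<Phi> (1, y))) has_derivative
              (\<lambda>v. frechet_derivative (\<lambda>x. \<Psi> (1, x)) (at (\<Phi> (1, x))) (?D v))) (at x)"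
            by (rule has_derivative_compose[OF Cinf_has_derivative[OF D1 UNIV_I] Cinf_has_derivative[OF G1 UNIV_I]])
          then have "((\<lambda>y. y) has_derivative
              (\<lambda>v. frechet_derivative (\<lambda>x. \<Psi> (1, x)) (at (\<Phi> (1, x))) (?D v))) (at x)" by (simp add: GF)
          from has_derivative_unique[OF this has_derivative_ident] show ?thesis by (rule fun_cong)
        qed
        have rep: "frechet_derivative (local_rep (?\<Phi> 1) c c) (at x) = ?D"
        proof (rule frechet_derivative_eq, rule has_derivative_transform_within_open[OF Cinf_has_derivative[OF D1 UNIV_I] img_open[OF c] xi])
          show "\<Phi> (1, y) = local_rep (?\<Phi> 1) c c y" if "y \<in> img_ch c" for y
          proof -
            have "?\<Phi> 1 (inv_ch c y) = inv_ch c (\<Phi> (1, y))"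
              by (rule transplant_inside[OF c K(1) KI F GF _ that]) (rule FK)
            then show ?thesis using map_inv[OF c tF[OF that, of 1]] by (simp add: local_rep_def)
          qed
        qed
        have T1: "\<xi> p \<subseteq> tangent_space M p" using T(1) p by (simp add: tangential_def)
        show ?thesis
        proof (rule plane_eqI[OF _ _ cq])
          show "differential M (?\<Phi> 1) p ` \<xi> p \<subseteq> tangent_space M (?\<Phi> 1 p)"
            using differential_tangent[OF sm p] T1 by blast
          show "\<xi>' (?\<Phi> 1 p) \<subseteq> tangent_space M (?\<Phi> 1 p)" using T(2) qM by (simp add: tangential_def)
          have "in_chart c (differential M (?\<Phi> 1) p ` \<xi> p) = (\<lambda>v. differential M (?\<Phi> 1) p v c) ` \<xi> p"
            by (simp add: in_chart_def image_image)
          also have "\<dots> = (\<lambda>v. ?D (v c)) ` \<xi> p"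
            using differential_chart[OF sm cp cq] T1 rep mp by (intro image_cong) auto
          also have "\<dots> = ?D ` in_chart c (\<xi> p)" by (simp add: in_chart_def image_image)
          also have "in_chart c (\<xi> p) = {v. a x \<bullet> v = 0}" using a xW x by (simp add: vector_form_def)
          also have "?D ` {v. a x \<bullet> v = 0} = {w. (a (\<Phi> (1, x)) + \<delta> (\<Phi> (1, x))) \<bullet> w = 0}"
          proof (rule hyperplane_image_eq[where G="frechet_derivative (\<lambda>x. \<Psi> (1, x)) (at (\<Phi> (1, x)))"])
            show "frechet_derivative (\<lambda>x. \<Psi> (1, x)) (at (\<Phi> (1, x))) (?D v) = v" for v by (rule inv)
            show "linear ?D" by (rule has_derivative_linear[OF Cinf_has_derivative[OF D1 UNIV_I]])
            show "a x \<noteq> 0" using a xW by (simp add: vector_form_def)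
            show "a (\<Phi> (1, x)) + \<delta> (\<Phi> (1, x)) \<noteq> 0" using a' yW by (simp add: vector_form_def)
          qed (rule ker[OF xW])
          also have "\<dots> = in_chart c (\<xi>' (?\<Phi> 1 p))" using a' yW q by (simp add: vector_form_def)
          finally show "in_chart c (differential M (?\<Phi> 1) p ` \<xi> p) = in_chart c (\<xi>' (?\<Phi> 1 p))" .
        qed
      qed
    qed
  qed
qed

end

section \<open>Pulling back forms, and convergence of forms\<close>

text \<open>The transpose of \<open>D\<close> applied to \<open>c\<close>, written by components so
  that it makes sense before linearity is known.\<close>

definition pull_covector :: "(real^3 \<Rightarrow> real^3) \<Rightarrow> real^3 \<Rightarrow> real^3" where
  "pull_covector D c = (\<chi> i. c \<bullet> D (axis i 1))"

lemma pull_covector_inner: "linear D \<Longrightarrow> pull_covector D c \<bullet> w = c \<bullet> D w"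
  unfolding linear_axis3[of D w] by (simp add: pull_covector_def inner_3[of _ w] inner_add_right)

lemma det_axis: "det (matrix D) = D (axis 1 1) \<bullet> cross3 (D (axis 2 1)) (D (axis 3 1))"
  by (simp add: det_3 matrix_def inner_3 cross3_components algebra_simps)

lemma triple_sum:
  "(b \<bullet> t1) * (c \<bullet> cross3 t2 t3) + (b \<bullet> t2) * (c \<bullet> cross3 t3 t1) + (b \<bullet> t3) * (c \<bullet> cross3 t1 t2)
    = (t1 \<bullet> cross3 t2 t3) * (b \<bullet> c)"
  by (simp add: inner_3 cross3_components algebra_simps)

text \<open>The rule d(f T*\<beta>) = df \<and> T*\<beta> + f T*d\<beta> in vector notation; the
  vector of inner products with cross products is the pullback of a 2-form.\<close>

lemma curl_pullback:
  fixes f :: "real^3 \<Rightarrow> real" and b T :: "real^3 \<Rightarrow> real^3"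
  assumes T: "Cinf U T" and x: "x \<in> U" and f: "(f has_derivative f') (at x)" and b: "(b has_derivative b') (at (T x))"
    and a: "\<And>y. y \<in> U \<Longrightarrow> a y = f y *\<^sub>R pull_covector (frechet_derivative T (at y)) (b (T y))"
  defines "t \<equiv> \<lambda>i. frechet_derivative T (at x) (axis i 1)"
  shows "curl a x = cross3 (\<chi> i. f' (axis i 1)) (pull_covector (frechet_derivative T (at x)) (b (T x))) +
    f x *\<^sub>R vector [curl_of b' \<bullet> cross3 (t 2) (t 3), curl_of b' \<bullet> cross3 (t 3) (t 1), curl_of b' \<bullet> cross3 (t 1) (t 2)]"
    and "a differentiable (at x)"
proof -
  let ?D = "\<lambda>y. frechet_derivative T (at y)"
  let ?E = "\<lambda>w u. frechet_derivative (\<lambda>y. ?D y w) (at x) u"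
  have overlap: "(T has_derivative ?D x) (at x)" by (rule Cinf_has_derivative[OF T x])
  let ?a' = "\<lambda>u. f' u *\<^sub>R pull_covector (?D x) (b (T x)) +
      f x *\<^sub>R (\<chi> i. b' (?D x u) \<bullet> ?D x (axis i 1) + b (T x) \<bullet> ?E (axis i 1) u)"
  have bT: "((\<lambda>y. b (T y)) has_derivative (\<lambda>u. b' (?D x u))) (at x)" by (rule has_derivative_compose[OF overlap b])
  have "((\<lambda>y. pull_covector (?D y) (b (T y))) has_derivative
      (\<lambda>u. \<chi> i. b' (?D x u) \<bullet> ?D x (axis i 1) + b (T x) \<bullet> ?E (axis i 1) u)) (at x)"
  proof (subst has_derivative_componentwise_within, rule ballI)
    fix j :: "real^3" assume "j \<in> Basis"
    then obtain i where j: "j = axis i 1" by (auto simp: Basis_vec_def)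
    have "((\<lambda>y. b (T y) \<bullet> ?D y (axis i 1)) has_derivative
        (\<lambda>u. b (T x) \<bullet> ?E (axis i 1) u + b' (?D x u) \<bullet> ?D x (axis i 1))) (at x)"
      by (rule has_derivative_inner[OF bT Cinf_has_derivative[OF Cinf_derivative[OF T] x]])
    then show "((\<lambda>y. pull_covector (?D y) (b (T y)) \<bullet> j) has_derivative
        (\<lambda>u. (\<chi> i. b' (?D x u) \<bullet> ?D x (axis i 1) + b (T x) \<bullet> ?E (axis i 1) u) \<bullet> j)) (at x)"
      by (simp add: j inner_axis pull_covector_def add.commute)
  qed
  from has_derivative_scaleR[OF f this]
  have "((\<lambda>y. f y *\<^sub>R pull_covector (?D y) (b (T y))) has_derivative ?a') (at x)" by (simp add: add.commute)
  then have ad: "(a has_derivative ?a') (at x)"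
    by (rule has_derivative_transform_within_open[OF _ Cinf_open[OF T] x]) (simp add: a)
  then show "a differentiable (at x)" by (rule differentiableI)
  have fr: "frechet_derivative a (at x) = ?a'" by (rule frechet_derivative_eq[OF ad])
  \<comment> \<open>This symmetry removes the second derivatives of \<open>T\<close> from the
    curl.\<close>
  have sym: "?E (axis i 1) (axis j 1) = ?E (axis j 1) (axis i 1)" for i j
    by (rule second_derivative_symmetric[OF T x])
  have bl: "linear b'" by (rule has_derivative_linear[OF b])
  have cb: "b' (t i) \<bullet> t j - b' (t j) \<bullet> t i = curl_of b' \<bullet> cross3 (t i) (t j)" for i j
    by (rule curl_of_cross[OF bl])
  have comp: "?a' (axis i 1) $ j - ?a' (axis j 1) $ i =
      f' (axis i 1) * pull_covector (?D x) (b (T x)) $ j - f' (axis j 1) * pull_covector (?D x) (b (T x)) $ i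
      + f x * (curl_of b' \<bullet> cross3 (t i) (t j))" for i j
    unfolding cb[symmetric] by (simp add: t_def sym[of i j] algebra_simps)
  show "curl a x = cross3 (\<chi> i. f' (axis i 1)) (pull_covector (?D x) (b (T x))) +
    f x *\<^sub>R vector [curl_of b' \<bullet> cross3 (t 2) (t 3), curl_of b' \<bullet> cross3 (t 3) (t 1), curl_of b' \<bullet> cross3 (t 1) (t 2)]"
    unfolding curl_def fr
    using comp[of 2 3] comp[of 3 1] comp[of 1 2]
    by (simp add: vec_eq_iff forall_3 curl_of_def cross3_components)
qed

text \<open>The coefficient of \<open>\<alpha> \<and> d\<beta> + \<beta> \<and> d\<alpha>\<close>; hence \<open>wedge2 a a\<close> is twice that of \<open>\<alpha> \<and> d\<alpha>\<close>.\<close>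

definition wedge2 :: "(real^3 \<Rightarrow> real^3) \<Rightarrow> (real^3 \<Rightarrow> real^3) \<Rightarrow> real^3 \<Rightarrow> real" where
  "wedge2 a b x = a x \<bullet> curl b x + b x \<bullet> curl a x"

text \<open>The terms containing df cancel, and the others give f^2 det. For an orientation
  preserving \<open>T\<close> and f \<noteq> 0 the factor is positive, so signs of
  \<open>wedge2\<close> do not depend on the chart or on the form.\<close>

lemma wedge2_pullback:
  fixes f :: "real^3 \<Rightarrow> real" and b1 b2 T :: "real^3 \<Rightarrow> real^3"
  assumes T: "Cinf U T" and x: "x \<in> U" and f: "f differentiable (at x)"
    and b: "b1 differentiable (at (T x))" "b2 differentiable (at (T x))"
    and a: "\<And>y. y \<in> U \<Longrightarrow> a1 y = f y *\<^sub>R pull_covector (frechet_derivative T (at y)) (b1 (T y))"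
      "\<And>y. y \<in> U \<Longrightarrow> a2 y = f y *\<^sub>R pull_covector (frechet_derivative T (at y)) (b2 (T y))"
  shows "wedge2 a1 a2 x = (f x)\<^sup>2 * det (matrix (frechet_derivative T (at x))) * wedge2 b1 b2 (T x)"
proof -
  let ?D = "frechet_derivative T (at x)"
  let ?g = "\<chi> i. frechet_derivative f (at x) (axis i 1)"
  let ?V = "\<lambda>c. vector [c \<bullet> cross3 (?D (axis 2 1)) (?D (axis 3 1)), c \<bullet> cross3 (?D (axis 3 1)) (?D (axis 1 1)),
      c \<bullet> cross3 (?D (axis 1 1)) (?D (axis 2 1))] :: real^3"
  note fD = f[unfolded frechet_derivative_works]
  have c1: "curl a1 x = cross3 ?g (pull_covector ?D (b1 (T x))) + f x *\<^sub>R ?V (curl b1 (T x))"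
    unfolding curl_def[of b1] by (rule curl_pullback(1)[OF T x fD b(1)[unfolded frechet_derivative_works] a(1)])
  have c2: "curl a2 x = cross3 ?g (pull_covector ?D (b2 (T x))) + f x *\<^sub>R ?V (curl b2 (T x))"
    unfolding curl_def[of b2] by (rule curl_pullback(1)[OF T x fD b(2)[unfolded frechet_derivative_works] a(2)])
  have tr: "pull_covector ?D p \<bullet> ?V c = det (matrix ?D) * (p \<bullet> c)" for p c
    unfolding det_axis triple_sum[symmetric] by (simp add: pull_covector_def inner_3[of "vec_lambda _"])
  have cr: "p \<bullet> cross3 ?g q + q \<bullet> cross3 ?g p = 0" for p q :: "real^3"
    by (simp add: inner_3 cross3_components algebra_simps)
  have "wedge2 a1 a2 x = f x * (pull_covector ?D (b1 (T x)) \<bullet> cross3 ?g (pull_covector ?D (b2 (T x))) + pull_covector ?D (b2 (T x)) \<bullet> cross3 ?g (pull_covector ?D (b1 (T x))))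
     + (f x)\<^sup>2 * (pull_covector ?D (b1 (T x)) \<bullet> ?V (curl b2 (T x)) + pull_covector ?D (b2 (T x)) \<bullet> ?V (curl b1 (T x)))"
    unfolding wedge2_def c1 c2 a(1)[OF x] a(2)[OF x]
    by (simp add: inner_add_right algebra_simps power2_eq_square)
  then show ?thesis unfolding cr tr by (simp add: wedge2_def algebra_simps)
qed

text \<open>As the point moves together with the parameter, this is locally uniform convergence of the values
  and of the first derivatives.\<close>

definition C1lim :: "'s filter \<Rightarrow> ('s \<Rightarrow> 'a::real_normed_vector \<Rightarrow> 'b::real_normed_vector) \<Rightarrow> ('a \<Rightarrow> 'b) \<Rightarrow> 'a \<Rightarrow> bool" where
  "C1lim F a a0 x \<longleftrightarrow> (\<forall>\<^sub>F z in F \<times>\<^sub>F nhds x. a (fst z) differentiable (at (snd z))) \<and> a0 differentiable (at x) \<and>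
    ((\<lambda>z. a (fst z) (snd z)) \<longlongrightarrow> a0 x) (F \<times>\<^sub>F nhds x) \<and>
    (\<forall>v. ((\<lambda>z. frechet_derivative (a (fst z)) (at (snd z)) v) \<longlongrightarrow> frechet_derivative a0 (at x) v) (F \<times>\<^sub>F nhds x))"

section \<open>Uniformity on compact sets and rules for limits of forms\<close>

lemma eventually_prodI:
  assumes "eventually P F" "open U" "x \<in> U" "\<And>s y. P s \<Longrightarrow> y \<in> U \<Longrightarrow> Q (s, y)"
  shows "eventually Q (F \<times>\<^sub>F nhds x)"
  unfolding eventually_prod_filter
  using assms eventually_nhds_in_open[OF assms(2,3)] by (intro exI[of _ P] exI[of _ "\<lambda>y. y \<in> U"]) auto

lemma eventually_prodE:
  assumes "eventually Q (F \<times>\<^sub>F nhds x)"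
  obtains P U where "eventually P F" "open U" "x \<in> U" "\<And>s y. P s \<Longrightarrow> y \<in> U \<Longrightarrow> Q (s, y)"
proof -
  obtain P R where P: "eventually P F" "eventually R (nhds x)" "\<And>s y. P s \<Longrightarrow> R y \<Longrightarrow> Q (s, y)"
    using assms unfolding eventually_prod_filter by blast
  obtain U where "open U" "x \<in> U" "\<forall>y\<in>U. R y" using P(2) unfolding eventually_nhds by blast
  then show thesis using that[of P U] P by blast
qed

text \<open>The tube lemma for an arbitrary filter: finitely many of the neighbourhoods cover
  \<open>K\<close>, and finitely many eventualities can be met together.\<close>

lemma eventually_on_compact:
  assumes K: "compact K" and e: "\<And>x. x \<in> K \<Longrightarrow> eventually Q (F \<times>\<^sub>F nhds x)"
  shows "\<forall>\<^sub>F s in F. \<forall>x\<in>K. Q (s, x)"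
proof -
  have "\<exists>P U. eventually P F \<and> open U \<and> x \<in> U \<and> (\<forall>s y. P s \<longrightarrow> y \<in> U \<longrightarrow> Q (s, y))" if "x \<in> K" for x
    using eventually_prodE[OF e[OF that]] by metis
  then obtain P U where PU: "\<And>x. x \<in> K \<Longrightarrow> eventually (P x) F" "\<And>x. x \<in> K \<Longrightarrow> open (U x)" "\<And>x. x \<in> K \<Longrightarrow> x \<in> U x"
    "\<And>x s y. x \<in> K \<Longrightarrow> P x s \<Longrightarrow> y \<in> U x \<Longrightarrow> Q (s, y)"
    by metis
  obtain D where D: "D \<subseteq> K" "finite D" "K \<subseteq> (\<Union>x\<in>D. U x)"
    by (rule compactE_image[OF K, of K U]) (use PU in auto)
  have "\<forall>\<^sub>F s in F. \<forall>x\<in>D. P x s"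
    by (rule eventually_ball_finite[OF D(2)]) (use PU D in auto)
  then show ?thesis
    by (rule eventually_mono) (use D PU(4) in blast)
qed

lemma C1lim_const: "Cinf U f \<Longrightarrow> x \<in> U \<Longrightarrow> C1lim F (\<lambda>s. f) f x"
proof -
  assume f: "Cinf U f" and x: "x \<in> U"
  have o: "open U" by (rule Cinf_open[OF f])
  have c: "((\<lambda>z. g (snd z)) \<longlongrightarrow> g x) (F \<times>\<^sub>F nhds x)" if "Cinf U g" for g :: "'a \<Rightarrow> 'b"
  proof -
    have "(g \<longlongrightarrow> g x) (at x)"
      using Cinf_continuous[OF that] o x by (simp add: continuous_on_eq_continuous_at isCont_def)
    then have "(g \<longlongrightarrow> g x) (nhds x)" by (simp add: tendsto_at_iff_tendsto_nhds)
    then show ?thesis by (rule filterlim_compose[OF _ filterlim_snd])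
  qed
  have d: "f differentiable (at y)" if "y \<in> U" for y
    using Cinf_has_derivative[OF f that] by (rule differentiableI)
  show ?thesis
    unfolding C1lim_def
  proof (intro conjI allI)
    show "\<forall>\<^sub>F z in F \<times>\<^sub>F nhds x. f differentiable (at (snd z))"
      by (rule eventually_prodI[where P="\<lambda>_. True", OF _ o x]) (auto intro: d)
    show "((\<lambda>z. frechet_derivative f (at (snd z)) v) \<longlongrightarrow> frechet_derivative f (at x) v) (F \<times>\<^sub>F nhds x)" for v
      by (rule c[OF Cinf_derivative[OF f]])
  qed (use c[OF f] d[OF x] in auto)
qed

lemma C1lim_cong:
  assumes a: "C1lim F a a0 x" and U: "open U" "x \<in> U" and e: "\<forall>\<^sub>F s in F. \<forall>y\<in>U. a s y = b s y"
    and e0: "\<And>y. y \<in> U \<Longrightarrow> a0 y = b0 y"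
  shows "C1lim F b b0 x"
proof -
  have tr: "f differentiable (at y) \<Longrightarrow> g differentiable (at y) \<and> frechet_derivative g (at y) = frechet_derivative f (at y)"
    if "\<forall>y\<in>U. f y = g y" "y \<in> U" for f g :: "'b \<Rightarrow> 'c" and y
  proof -
    assume "f differentiable (at y)"
    then have "(f has_derivative frechet_derivative f (at y)) (at y)" by (simp add: frechet_derivative_works)
    then have "(g has_derivative frechet_derivative f (at y)) (at y)"
      by (rule has_derivative_transform_within_open[OF _ U(1) that(2)]) (use that in auto)
    then show ?thesis using frechet_derivative_eq differentiableI by blast
  qed
  have ev: "\<forall>\<^sub>F z in F \<times>\<^sub>F nhds x. snd z \<in> U \<and> (\<forall>y\<in>U. a (fst z) y = b (fst z) y)"
    by (rule eventually_prodI[OF e U]) auto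
  note A = a[unfolded C1lim_def]
  have evd: "\<forall>\<^sub>F z in F \<times>\<^sub>F nhds x. a (fst z) differentiable (at (snd z))" using A by blast
  have x0: "a0 x = b0 x" "b0 differentiable (at x)" "frechet_derivative b0 (at x) = frechet_derivative a0 (at x)"
    using e0 U tr[of a0 b0 x] A by auto
  show ?thesis
    unfolding C1lim_def
  proof (intro conjI allI)
    show "\<forall>\<^sub>F z in F \<times>\<^sub>F nhds x. b (fst z) differentiable (at (snd z))"
      using eventually_conj[OF ev evd] by (rule eventually_mono) (use tr in blast)
    show "b0 differentiable (at x)" by (rule x0)
    have h1: "\<forall>\<^sub>F z in F \<times>\<^sub>F nhds x. a (fst z) (snd z) = b (fst z) (snd z)"
      using ev by (rule eventually_mono) blast
    have h2: "((\<lambda>z. a (fst z) (snd z)) \<longlongrightarrow> b0 x) (F \<times>\<^sub>F nhds x)"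
      using A x0(1) by simp
    show "((\<lambda>z. b (fst z) (snd z)) \<longlongrightarrow> b0 x) (F \<times>\<^sub>F nhds x)"
      by (rule Lim_transform_eventually[OF h2 h1])
    fix v
    have "((\<lambda>z. frechet_derivative (a (fst z)) (at (snd z)) v) \<longlongrightarrow> frechet_derivative b0 (at x) v) (F \<times>\<^sub>F nhds x)"
      using A x0(3) by simp
    moreover have "\<forall>\<^sub>F z in F \<times>\<^sub>F nhds x. frechet_derivative (a (fst z)) (at (snd z)) v = frechet_derivative (b (fst z)) (at (snd z)) v"
      using eventually_conj[OF ev evd] by (rule eventually_mono) (use tr in metis)
    ultimately show "((\<lambda>z. frechet_derivative (b (fst z)) (at (snd z)) v) \<longlongrightarrow> frechet_derivative b0 (at x) v) (F \<times>\<^sub>F nhds x)"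
      by (rule Lim_transform_eventually)
  qed
qed

lemma C1limI:
  assumes a: "\<forall>\<^sub>F z in F \<times>\<^sub>F nhds x. (a (fst z) has_derivative D z) (at (snd z))" and a0: "(a0 has_derivative D0) (at x)"
    and "((\<lambda>z. a (fst z) (snd z)) \<longlongrightarrow> a0 x) (F \<times>\<^sub>F nhds x)" and D: "\<And>v. ((\<lambda>z. D z v) \<longlongrightarrow> D0 v) (F \<times>\<^sub>F nhds x)"
  shows "C1lim F a a0 x"
  unfolding C1lim_def
proof (intro conjI allI)
  show "\<forall>\<^sub>F z in F \<times>\<^sub>F nhds x. a (fst z) differentiable (at (snd z))"
    using a by (rule eventually_mono) (rule differentiableI)
  show "a0 differentiable (at x)" using a0 by (rule differentiableI)
  fix v
  have "\<forall>\<^sub>F z in F \<times>\<^sub>F nhds x. D z v = frechet_derivative (a (fst z)) (at (snd z)) v"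
    using a by (rule eventually_mono) (simp add: frechet_derivative_eq)
  with D[of v] show "((\<lambda>z. frechet_derivative (a (fst z)) (at (snd z)) v) \<longlongrightarrow> frechet_derivative a0 (at x) v) (F \<times>\<^sub>F nhds x)"
    unfolding frechet_derivative_eq[OF a0] by (rule Lim_transform_eventually)
qed fact

lemma C1limD:
  assumes "C1lim F a a0 x"
  shows "\<forall>\<^sub>F z in F \<times>\<^sub>F nhds x. (a (fst z) has_derivative frechet_derivative (a (fst z)) (at (snd z))) (at (snd z))"
    "(a0 has_derivative frechet_derivative a0 (at x)) (at x)"
    "((\<lambda>z. a (fst z) (snd z)) \<longlongrightarrow> a0 x) (F \<times>\<^sub>F nhds x)"
    "((\<lambda>z. frechet_derivative (a (fst z)) (at (snd z)) v) \<longlongrightarrow> frechet_derivative a0 (at x) v) (F \<times>\<^sub>F nhds x)"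
  using assms by (auto simp: C1lim_def frechet_derivative_works)

lemma C1lim_bilinear:
  assumes B: "bounded_bilinear B" and a: "C1lim F a a0 x" and b: "C1lim F b b0 x"
  shows "C1lim F (\<lambda>s y. B (a s y) (b s y)) (\<lambda>y. B (a0 y) (b0 y)) x"
proof (rule C1limI)
  show "\<forall>\<^sub>F z in F \<times>\<^sub>F nhds x. ((\<lambda>y. B (a (fst z) y) (b (fst z) y)) has_derivative
      (\<lambda>v. B (a (fst z) (snd z)) (frechet_derivative (b (fst z)) (at (snd z)) v)
        + B (frechet_derivative (a (fst z)) (at (snd z)) v) (b (fst z) (snd z)))) (at (snd z))"
    using eventually_conj[OF C1limD(1)[OF a] C1limD(1)[OF b]]
    by (rule eventually_mono) (blast intro: bounded_bilinear.FDERIV[OF B])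
  show "((\<lambda>y. B (a0 y) (b0 y)) has_derivative
      (\<lambda>v. B (a0 x) (frechet_derivative b0 (at x) v) + B (frechet_derivative a0 (at x) v) (b0 x))) (at x)"
    by (rule bounded_bilinear.FDERIV[OF B C1limD(2)[OF a] C1limD(2)[OF b]])
qed (intro tendsto_add bounded_bilinear.tendsto[OF B] C1limD[OF a] C1limD[OF b])+

lemma C1lim_add:
  assumes a: "C1lim F a a0 x" and b: "C1lim F b b0 x"
  shows "C1lim F (\<lambda>s y. a s y + b s y) (\<lambda>y. a0 y + b0 y) x"
proof (rule C1limI)
  show "\<forall>\<^sub>F z in F \<times>\<^sub>F nhds x. ((\<lambda>y. a (fst z) y + b (fst z) y) has_derivative
      (\<lambda>v. frechet_derivative (a (fst z)) (at (snd z)) v + frechet_derivative (b (fst z)) (at (snd z)) v)) (at (snd z))"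
    using eventually_conj[OF C1limD(1)[OF a] C1limD(1)[OF b]]
    by (rule eventually_mono) (blast intro: has_derivative_add)
  show "((\<lambda>y. a0 y + b0 y) has_derivative
      (\<lambda>v. frechet_derivative a0 (at x) v + frechet_derivative b0 (at x) v)) (at x)"
    by (rule has_derivative_add[OF C1limD(2)[OF a] C1limD(2)[OF b]])
qed (intro tendsto_add C1limD[OF a] C1limD[OF b])+

lemma C1lim_linear:
  assumes L: "bounded_linear L" and a: "C1lim F a a0 x"
  shows "C1lim F (\<lambda>s y. L (a s y)) (\<lambda>y. L (a0 y)) x"
proof (rule C1limI)
  show "\<forall>\<^sub>F z in F \<times>\<^sub>F nhds x. ((\<lambda>y. L (a (fst z) y)) has_derivative
      (\<lambda>v. L (frechet_derivative (a (fst z)) (at (snd z)) v))) (at (snd z))"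
    using C1limD(1)[OF a] by (rule eventually_mono) (rule bounded_linear.has_derivative[OF L])
  show "((\<lambda>y. L (a0 y)) has_derivative (\<lambda>v. L (frechet_derivative a0 (at x) v))) (at x)"
    by (rule bounded_linear.has_derivative[OF L C1limD(2)[OF a]])
qed (intro bounded_linear.tendsto[OF L] C1limD[OF a])+

lemma C1lim_diff:
  assumes a: "C1lim F a a0 x" and b: "C1lim F b b0 x"
  shows "C1lim F (\<lambda>s y. a s y - b s y) (\<lambda>y. a0 y - b0 y) x"
  using C1lim_add[OF a C1lim_linear[OF bounded_linear_minus[OF bounded_linear_ident] b]] by simp

lemma C1lim_sum:
  assumes "finite I" "\<And>i. i \<in> I \<Longrightarrow> C1lim F (a i) (a0 i) x"
  shows "C1lim F (\<lambda>s y. \<Sum>i\<in>I. a i s y) (\<lambda>y. \<Sum>i\<in>I. a0 i y) x"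
  using assms
proof (induction I rule: finite_induct)
  case empty
  show ?case using C1lim_const[OF Cinf_const[OF open_UNIV, of 0]] by simp
next
  case (insert i I)
  then show ?case using C1lim_add[of F "a i" "a0 i" x] by simp
qed

lemma C1lim_inverse:
  fixes a :: "'s \<Rightarrow> 'a::real_normed_vector \<Rightarrow> real"
  assumes a: "C1lim F a a0 x" and 0: "a0 x \<noteq> 0"
  shows "C1lim F (\<lambda>s y. inverse (a s y)) (\<lambda>y. inverse (a0 y)) x"
proof (rule C1limI)
  have "\<forall>\<^sub>F z in F \<times>\<^sub>F nhds x. a (fst z) (snd z) \<noteq> 0"
    by (rule tendsto_imp_eventually_ne[OF C1limD(3)[OF a] 0])
  from eventually_conj[OF this C1limD(1)[OF a]]
  show "\<forall>\<^sub>F z in F \<times>\<^sub>F nhds x. ((\<lambda>y. inverse (a (fst z) y)) has_derivative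
      (\<lambda>v. - (inverse (a (fst z) (snd z)) * frechet_derivative (a (fst z)) (at (snd z)) v * inverse (a (fst z) (snd z))))) (at (snd z))"
    by (rule eventually_mono) (blast intro: Deriv.has_derivative_inverse)
  show "((\<lambda>y. inverse (a0 y)) has_derivative (\<lambda>v. - (inverse (a0 x) * frechet_derivative a0 (at x) v * inverse (a0 x)))) (at x)"
    by (rule Deriv.has_derivative_inverse[OF 0 C1limD(2)[OF a]])
qed (intro tendsto_minus tendsto_mult tendsto_inverse 0 C1limD[OF a])+

lemma C1lim_compose:
  fixes T :: "'a::euclidean_space \<Rightarrow> 'b::euclidean_space"
  assumes T: "Cinf U T" and x: "x \<in> U" and a: "C1lim F a a0 (T x)"
  shows "C1lim F (\<lambda>s y. a s (T y)) (\<lambda>y. a0 (T y)) x"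
proof (rule C1limI)
  have Tn: "filterlim T (nhds (T x)) (nhds x)"
    using Cinf_continuous[OF T] Cinf_open[OF T] x
    by (simp add: continuous_on_eq_continuous_at isCont_def tendsto_at_iff_tendsto_nhds)
  have m: "filterlim (\<lambda>z. (fst z, T (snd z))) (F \<times>\<^sub>F nhds (T x)) (F \<times>\<^sub>F nhds x)"
    by (intro filterlim_Pair filterlim_fst filterlim_compose[OF Tn filterlim_snd])
  let ?D = "\<lambda>y. frechet_derivative T (at y)"
  let ?A = "\<lambda>z. frechet_derivative (a (fst z)) (at (T (snd z)))"
  have evD: "\<forall>\<^sub>F z in F \<times>\<^sub>F nhds x. (a (fst z) has_derivative ?A z) (at (T (snd z)))"
    using filterlim_cong eventually_compose_filterlim[OF C1limD(1)[OF a] m] by simp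
  have evT: "\<forall>\<^sub>F z in F \<times>\<^sub>F nhds x. (T has_derivative ?D (snd z)) (at (snd z))"
    by (rule eventually_prodI[where P="\<lambda>_. True", OF _ Cinf_open[OF T] x]) (auto intro: Cinf_has_derivative[OF T])
  show "\<forall>\<^sub>F z in F \<times>\<^sub>F nhds x. ((\<lambda>y. a (fst z) (T y)) has_derivative (\<lambda>v. ?A z (?D (snd z) v))) (at (snd z))"
    using eventually_conj[OF evD evT] by (rule eventually_mono) (blast intro: has_derivative_compose)
  show "((\<lambda>y. a0 (T y)) has_derivative (\<lambda>v. frechet_derivative a0 (at (T x)) (?D x v))) (at x)"
    by (rule has_derivative_compose[OF Cinf_has_derivative[OF T x] C1limD(2)[OF a]])
  show "((\<lambda>z. a (fst z) (T (snd z))) \<longlongrightarrow> a0 (T x)) (F \<times>\<^sub>F nhds x)"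
    using filterlim_compose[OF C1limD(3)[OF a] m] by simp
  fix v
  \<comment> \<open>Derivatives converge on fixed vectors, but here the vector moves too; the
    expansion in \<open>Basis\<close> separates the two limits.\<close>
  have lim: "((\<lambda>z. \<Sum>i\<in>Basis. (?D (snd z) v \<bullet> i) *\<^sub>R ?A z i) \<longlongrightarrow>
      (\<Sum>i\<in>Basis. (?D x v \<bullet> i) *\<^sub>R frechet_derivative a0 (at (T x)) i)) (F \<times>\<^sub>F nhds x)"
  proof (intro tendsto_sum tendsto_scaleR tendsto_inner tendsto_const)
    show "((\<lambda>z. ?D (snd z) v) \<longlongrightarrow> ?D x v) (F \<times>\<^sub>F nhds x)"
      by (rule C1limD(4)[OF C1lim_const[OF T x]])
    show "((\<lambda>z. ?A z i) \<longlongrightarrow> frechet_derivative a0 (at (T x)) i) (F \<times>\<^sub>F nhds x)" for i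
      using filterlim_compose[OF C1limD(4)[OF a] m] by simp
  qed
  have l0: "(\<Sum>i\<in>Basis. (?D x v \<bullet> i) *\<^sub>R frechet_derivative a0 (at (T x)) i) = frechet_derivative a0 (at (T x)) (?D x v)"
    by (rule linear_basis_sum[OF has_derivative_linear[OF C1limD(2)[OF a]], symmetric])
  have "\<forall>\<^sub>F z in F \<times>\<^sub>F nhds x. (\<Sum>i\<in>Basis. (?D (snd z) v \<bullet> i) *\<^sub>R ?A z i) = ?A z (?D (snd z) v)"
    using evD by (rule eventually_mono) (rule linear_basis_sum[OF has_derivative_linear, symmetric])
  from Lim_transform_eventually[OF lim this]
  show "((\<lambda>z. ?A z (?D (snd z) v)) \<longlongrightarrow> frechet_derivative a0 (at (T x)) (?D x v)) (F \<times>\<^sub>F nhds x)"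
    unfolding l0 .
qed

lemma tendsto_curl:
  assumes "C1lim F a a0 x"
  shows "((\<lambda>z. curl (a (fst z)) (snd z)) \<longlongrightarrow> curl a0 x) (F \<times>\<^sub>F nhds x)"
proof (rule vec_tendstoI)
  fix i :: 3
  note l = tendsto_diff[OF tendsto_vec_nth[OF C1limD(4)[OF assms]] tendsto_vec_nth[OF C1limD(4)[OF assms]]]
  show "((\<lambda>z. curl (a (fst z)) (snd z) $ i) \<longlongrightarrow> curl a0 x $ i) (F \<times>\<^sub>F nhds x)"
    using exhaust_3[of i] by (elim disjE) (simp_all add: curl_def curl_of_def l)
qed

lemma tendsto_wedge2:
  assumes "C1lim F a a0 x" "C1lim F b b0 x"
  shows "((\<lambda>z. wedge2 (a (fst z)) (b (fst z)) (snd z)) \<longlongrightarrow> wedge2 a0 b0 x) (F \<times>\<^sub>F nhds x)"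
  unfolding wedge2_def
  by (intro tendsto_add tendsto_inner tendsto_curl assms C1limD(3)[OF assms(1)] C1limD(3)[OF assms(2)])

section \<open>Stability of contact structures\<close>

text \<open>The kernel determines a covector up to scale, and the value 1 on \<open>n\<close> fixes
  the scale; vectors are split along \<open>n\<close> and the kernel.\<close>

lemma covector_eq:
  fixes a b n :: "real^3"
  assumes "{v. a \<bullet> v = 0} = {v. b \<bullet> v = 0}" "a \<bullet> n = 1" "b \<bullet> n \<noteq> 0"
  shows "a = b /\<^sub>R (b \<bullet> n)"
proof (rule vector_eq_rdot[THEN iffD1], rule allI)
  fix v
  let ?w = "v - ((b \<bullet> v) / (b \<bullet> n)) *\<^sub>R n"
  have "b \<bullet> ?w = 0" using assms(3) by (simp add: inner_diff_right)
  then have "a \<bullet> ?w = 0" using assms(1) by blast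
  then have "a \<bullet> v = (b \<bullet> v) / (b \<bullet> n)" using assms(2) by (simp add: inner_diff_right)
  then show "a \<bullet> v = (b /\<^sub>R (b \<bullet> n)) \<bullet> v" by (simp add: divide_inverse mult.commute)
qed

context closed_manifold3
begin

text \<open>The normalisation \<open>\<alpha>(n) = 1\<close> makes the form unique and allows linear interpolation between the
  forms of two plane fields that are both transverse to \<open>n\<close>.\<close>

definition normal_form :: "'p field \<Rightarrow> 'p chart \<Rightarrow> real^3 \<Rightarrow> real^3 \<Rightarrow> real^3" where
  "normal_form \<xi> c n x = (THE a. a \<bullet> n = 1 \<and> in_chart c (\<xi> (inv_ch c x)) = {v. a \<bullet> v = 0})"

lemma normal_form_eq:
  assumes "in_chart c (\<xi> (inv_ch c x)) = {v. b \<bullet> v = 0}" "b \<bullet> n \<noteq> 0"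
  shows "normal_form \<xi> c n x = b /\<^sub>R (b \<bullet> n)" "normal_form \<xi> c n x \<bullet> n = 1"
    "in_chart c (\<xi> (inv_ch c x)) = {v. normal_form \<xi> c n x \<bullet> v = 0}"
proof -
  have k: "{v. (b /\<^sub>R (b \<bullet> n)) \<bullet> v = 0} = {v. b \<bullet> v = 0}" using assms(2) by auto
  show 1: "normal_form \<xi> c n x = b /\<^sub>R (b \<bullet> n)"
    unfolding normal_form_def
  proof (rule the_equality)
    show "(b /\<^sub>R (b \<bullet> n)) \<bullet> n = 1 \<and> in_chart c (\<xi> (inv_ch c x)) = {v. (b /\<^sub>R (b \<bullet> n)) \<bullet> v = 0}"
      using assms k by simp
    show "a = b /\<^sub>R (b \<bullet> n)" if "a \<bullet> n = 1 \<and> in_chart c (\<xi> (inv_ch c x)) = {v. a \<bullet> v = 0}" for a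
      using that assms by (intro covector_eq) auto
  qed
  show "normal_form \<xi> c n x \<bullet> n = 1" using assms(2) by (simp add: 1)
  show "in_chart c (\<xi> (inv_ch c x)) = {v. normal_form \<xi> c n x \<bullet> v = 0}" unfolding 1 k by (rule assms(1))
qed

lemma normal_form_zero: "normal_form \<xi> c n x \<bullet> n = 1 \<Longrightarrow> normal_form \<xi> c n x \<noteq> 0"
  by auto

lemma vector_form_pull:
  assumes v: "vector_form \<xi> d V b" and T: "tangential \<xi>" and c: "c \<in> atlas M" and d: "d \<in> atlas M"
  defines "W \<equiv> {x \<in> overlap c d. transition c d x \<in> V}"
  shows "vector_form \<xi> c W (\<lambda>x. pull_covector (DT c d x) (b (transition c d x)))"
    "open W" "W \<subseteq> overlap c d"
proof -
  have bV: "Cinf V b" and Vd: "V \<subseteq> img_ch d" using v by (auto simp: vector_form_def)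
  have "W = overlap c d \<inter> transition c d -` V" by (auto simp: W_def)
  then show W: "open W"
    using continuous_open_preimage[OF Cinf_continuous[OF Cinf_transition[OF c d]] overlap_open[OF c d] Cinf_open[OF bV]] by simp
  show WT: "W \<subseteq> overlap c d" by (auto simp: W_def)
  have T1: "Cinf W (transition c d)" by (rule Cinf_subset[OF Cinf_transition[OF c d] W WT])
  have bT: "Cinf W (\<lambda>x. b (transition c d x))"
    by (rule Cinf_compose[OF T1 bV]) (auto simp: W_def)
  show "vector_form \<xi> c W (\<lambda>x. pull_covector (DT c d x) (b (transition c d x)))"
    unfolding vector_form_def
  proof (intro conjI ballI)
    show "W \<subseteq> img_ch c" using WT by (auto simp: overlap_def)
    show "Cinf W (\<lambda>x. pull_covector (DT c d x) (b (transition c d x)))"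
    proof (rule Cinf_componentwise[OF W])
      show "Cinf W (\<lambda>x. pull_covector (DT c d x) (b (transition c d x)) $ i)" for i
        unfolding pull_covector_def using bT Cinf_derivative[OF T1] by (simp add: Cinf_inner)
    qed
    fix x assume x: "x \<in> W"
    then have xT: "x \<in> overlap c d" and xi: "x \<in> img_ch c" and y: "transition c d x \<in> V" using WT by (auto simp: W_def overlap_def)
    let ?p = "inv_ch c x"
    have cp: "c \<in> charts_at M ?p" by (rule charts_atI[OF c inv_dom[OF c xi]])
    have dp: "d \<in> charts_at M ?p" using xT d by (auto simp: overlap_def intro: charts_atI)
    have pM: "?p \<in> points M" using inv_dom[OF c xi] dom_sub[OF c] by blast
    have tp: "\<xi> ?p \<subseteq> tangent_space M ?p" using T pM by (simp add: tangential_def)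
    have lin: "linear (DT c d x)" by (rule DT_linear[OF c d xT])
    have "inv_ch d (transition c d x) = ?p" by (rule inv_transition[OF c d xT])
    then have pl: "in_chart d (\<xi> ?p) = {v. b (transition c d x) \<bullet> v = 0}" and bn: "b (transition c d x) \<noteq> 0"
      using v y by (auto simp: vector_form_def)
    have mp: "map_ch c ?p = x" by (rule map_inv[OF c xi])
    show "in_chart c (\<xi> ?p) = {v. pull_covector (DT c d x) (b (transition c d x)) \<bullet> v = 0}"
      using mem_in_chart_change[OF tp cp dp] pl mp by (auto simp: pull_covector_inner[OF lin])
    show "pull_covector (DT c d x) (b (transition c d x)) \<noteq> 0"
    proof
      assume z: "pull_covector (DT c d x) (b (transition c d x)) = 0"
      let ?w = "DT d c (map_ch d ?p) (b (transition c d x))"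
      have "b (transition c d x) \<bullet> DT c d x ?w = 0" using pull_covector_inner[OF lin, of "b (transition c d x)" ?w] z by simp
      then show False using DT_inverse[OF dp cp, of "b (transition c d x)"] mp bn by simp
    qed
  qed
qed

text \<open>Only some local forms near \<open>p\<close>, on a common domain, have to converge.
  \<open>converges_at_normal_form\<close> passes from them to the normalised forms in any chart at
  \<open>p\<close>.\<close>

definition converges_at :: "'s filter \<Rightarrow> ('s \<Rightarrow> 'p field) \<Rightarrow> 'p field \<Rightarrow> 'p \<Rightarrow> bool" where
  "converges_at F \<xi> \<xi>0 p \<longleftrightarrow> (\<exists>c\<in>charts_at M p. \<exists>W a a0. map_ch c p \<in> W \<and> vector_form \<xi>0 c W a0 \<and>
    (\<forall>\<^sub>F s in F. vector_form (\<xi> s) c W (a s)) \<and> (\<forall>x\<in>W. C1lim F a a0 x))"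

definition converges :: "'s filter \<Rightarrow> ('s \<Rightarrow> 'p field) \<Rightarrow> 'p field \<Rightarrow> bool" where
  "converges F \<xi> \<xi>0 \<longleftrightarrow> (\<forall>\<^sub>F s in F. tangential (\<xi> s)) \<and> tangential \<xi>0 \<and> (\<forall>p\<in>points M. converges_at F \<xi> \<xi>0 p)"

lemma vector_form_subset: "vector_form \<xi> c W a \<Longrightarrow> open V \<Longrightarrow> V \<subseteq> W \<Longrightarrow> vector_form \<xi> c V a"
  unfolding vector_form_def using Cinf_subset[of W a V] by blast

lemma vector_form_normal_form:
  assumes b: "vector_form \<xi> c V b" and n: "\<And>y. y \<in> V \<Longrightarrow> b y \<bullet> n \<noteq> 0"
  shows "vector_form \<xi> c V (normal_form \<xi> c n)" "\<And>y. y \<in> V \<Longrightarrow> normal_form \<xi> c n y = b y /\<^sub>R (b y \<bullet> n)" "\<And>y. y \<in> V \<Longrightarrow> normal_form \<xi> c n y \<bullet> n = 1"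
proof -
  have pl: "in_chart c (\<xi> (inv_ch c y)) = {v. b y \<bullet> v = 0}" if "y \<in> V" for y using b that by (simp add: vector_form_def)
  show e: "normal_form \<xi> c n y = b y /\<^sub>R (b y \<bullet> n)" if "y \<in> V" for y
    by (rule normal_form_eq(1)[of c \<xi> y "b y" n, OF pl[OF that] n[OF that]])
  show m: "normal_form \<xi> c n y \<bullet> n = 1" if "y \<in> V" for y
    by (rule normal_form_eq(2)[of c \<xi> y "b y" n, OF pl[OF that] n[OF that]])
  have k: "in_chart c (\<xi> (inv_ch c y)) = {v. normal_form \<xi> c n y \<bullet> v = 0}" if "y \<in> V" for y
    by (rule normal_form_eq(3)[of c \<xi> y "b y" n, OF pl[OF that] n[OF that]])
  have bV: "Cinf V b" using b by (simp add: vector_form_def)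
  have "Cinf V (\<lambda>y. inverse (b y \<bullet> n) *\<^sub>R b y)"
    by (intro Cinf_scaleR Cinf_inverse Cinf_inner Cinf_const bV Cinf_open[OF bV] n)
  then have "Cinf V (normal_form \<xi> c n)" by (rule Cinf_cong) (simp add: e)
  then show "vector_form \<xi> c V (normal_form \<xi> c n)"
    unfolding vector_form_def using b k normal_form_zero[OF m] by (auto simp: vector_form_def)
qed

text \<open>Normalising divides a pulled back form by its value on \<open>n\<close>. This value is
  nonzero in the limit at \<open>p\<close>, hence nonzero on a neighbourhood that serves eventually
  all parameters.\<close>

lemma converges_at_normal_form:
  assumes cv: "converges_at F \<xi> \<xi>0 p" and T: "\<forall>\<^sub>F s in F. tangential (\<xi> s)" "tangential \<xi>0"
    and c: "c \<in> charts_at M p" and n: "n \<notin> in_chart c (\<xi>0 p)"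
  obtains U where "open U" "map_ch c p \<in> U" "vector_form \<xi>0 c U (normal_form \<xi>0 c n)"
    "\<forall>\<^sub>F s in F. vector_form (\<xi> s) c U (normal_form (\<xi> s) c n) \<and> (\<forall>y\<in>U. normal_form (\<xi> s) c n y \<bullet> n = 1)"
    "\<And>y. y \<in> U \<Longrightarrow> normal_form \<xi>0 c n y \<bullet> n = 1"
    "\<And>y. y \<in> U \<Longrightarrow> C1lim F (\<lambda>s. normal_form (\<xi> s) c n) (normal_form \<xi>0 c n) y"
proof -
  obtain d W a a0 where dp: "d \<in> charts_at M p" and pW: "map_ch d p \<in> W" and a0: "vector_form \<xi>0 d W a0"
    and a: "\<forall>\<^sub>F s in F. vector_form (\<xi> s) d W (a s)" and lim: "\<forall>x\<in>W. C1lim F a a0 x"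
    using cv unfolding converges_at_def by (elim exE bexE conjE)
  note A = charts_atD[OF c] charts_atD[OF dp]
  let ?T = "transition c d"
  let ?b = "\<lambda>s x. pull_covector (DT c d x) (a s (?T x))" and ?bz = "\<lambda>x. pull_covector (DT c d x) (a0 (?T x))"
  let ?V = "{x \<in> overlap c d. ?T x \<in> W}"
  let ?x = "map_ch c p"
  have b0: "vector_form \<xi>0 c ?V ?bz" and Vo: "open ?V" by (rule vector_form_pull[OF a0 T(2) A(1,3)])+
  have b: "\<forall>\<^sub>F s in F. vector_form (\<xi> s) c ?V (?b s)"
    using eventually_conj[OF a T(1)] by (rule eventually_mono) (use vector_form_pull(1) A(1,3) in blast)
  have xV: "?x \<in> ?V" using map_in_overlap[OF A(1,3,2,4)] pW by simp
  have Cb0: "Cinf ?V ?bz" using b0 by (simp add: vector_form_def)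
  have blim: "C1lim F ?b ?bz y" if y: "y \<in> ?V" for y
  proof -
    have yT: "y \<in> overlap c d" and yW: "?T y \<in> W" using y by auto
    note TC = Cinf_transition[OF A(1,3)]
    have "C1lim F (\<lambda>s x. \<Sum>i\<in>UNIV. (a s (?T x) \<bullet> DT c d x (axis i 1)) *\<^sub>R axis i (1::real))
        (\<lambda>x. \<Sum>i\<in>UNIV. (a0 (?T x) \<bullet> DT c d x (axis i 1)) *\<^sub>R axis i (1::real)) y"
      by (intro C1lim_sum finite_UNIV C1lim_linear[OF bounded_linear_scaleR_left] C1lim_bilinear[OF bounded_bilinear_inner]
          C1lim_compose[OF TC yT] C1lim_const[OF Cinf_derivative[OF TC] yT] lim[rule_format, OF yW]) simp
    moreover have "(\<Sum>i\<in>UNIV. (u \<bullet> D (axis i 1)) *\<^sub>R axis i (1::real)) = pull_covector D u" for u and D :: "real^3 \<Rightarrow> real^3"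
      by (simp add: vec_eq_iff pull_covector_def axis_def if_distrib cong: if_cong)
    ultimately show ?thesis by simp
  qed
  have "?bz ?x \<bullet> n \<noteq> 0"
  proof
    assume z: "?bz ?x \<bullet> n = 0"
    have "in_chart c (\<xi>0 (inv_ch c ?x)) = {v. ?bz ?x \<bullet> v = 0}" using b0 xV unfolding vector_form_def by blast
    then show False using n z inv_map[OF A(1,2)] by simp
  qed
  have "\<forall>\<^sub>F z in F \<times>\<^sub>F nhds ?x. ?b (fst z) (snd z) \<bullet> n \<noteq> 0"
    by (rule tendsto_imp_eventually_ne[OF tendsto_inner[OF C1limD(3)[OF blim[OF xV]] tendsto_const]]) fact
  then obtain P U1 where U1: "eventually P F" "open U1" "?x \<in> U1" "\<And>s y. P s \<Longrightarrow> y \<in> U1 \<Longrightarrow> ?b (fst (s, y)) (snd (s, y)) \<bullet> n \<noteq> 0"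
    by (rule eventually_prodE) auto
  let ?U2 = "?V \<inter> (\<lambda>y. ?bz y \<bullet> n) -` (- {0})"
  have U2: "open ?U2"
    by (rule continuous_open_preimage[OF Cinf_continuous[OF Cinf_inner[OF Cb0 Cinf_const[OF Vo]]] Vo]) auto
  define U where "U = U1 \<inter> ?U2"
  have U: "open U" "U \<subseteq> ?V" "?x \<in> U" using U1 U2 xV \<open>?bz ?x \<bullet> n \<noteq> 0\<close> by (auto simp: U_def)
  have b0U: "vector_form \<xi>0 c U ?bz" by (rule vector_form_subset[OF b0 U(1,2)])
  have n0: "?bz y \<bullet> n \<noteq> 0" if "y \<in> U" for y using that by (auto simp: U_def)
  have ev: "\<forall>\<^sub>F s in F. vector_form (\<xi> s) c U (?b s) \<and> (\<forall>y\<in>U. ?b s y \<bullet> n \<noteq> 0)"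
    using eventually_conj[OF b U1(1)]
  proof (rule eventually_mono)
    fix s assume s: "vector_form (\<xi> s) c ?V (?b s) \<and> P s"
    then show "vector_form (\<xi> s) c U (?b s) \<and> (\<forall>y\<in>U. ?b s y \<bullet> n \<noteq> 0)"
      using vector_form_subset[OF _ U(1,2)] U1(4)[of s] by (auto simp: U_def)
  qed
  show thesis
  proof (rule that[OF U(1,3)])
    show "vector_form \<xi>0 c U (normal_form \<xi>0 c n)" by (rule vector_form_normal_form(1)[OF b0U n0])
    show "\<And>y. y \<in> U \<Longrightarrow> normal_form \<xi>0 c n y \<bullet> n = 1" by (rule vector_form_normal_form(3)[OF b0U n0])
    show "\<forall>\<^sub>F s in F. vector_form (\<xi> s) c U (normal_form (\<xi> s) c n) \<and> (\<forall>y\<in>U. normal_form (\<xi> s) c n y \<bullet> n = 1)"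
      using ev by (rule eventually_mono) (use vector_form_normal_form(1,3) in blast)
    have evn: "\<forall>\<^sub>F s in F. \<forall>y\<in>U. inverse (?b s y \<bullet> n) *\<^sub>R ?b s y = normal_form (\<xi> s) c n y"
      using ev
    proof (rule eventually_mono)
      fix s assume s: "vector_form (\<xi> s) c U (?b s) \<and> (\<forall>y\<in>U. ?b s y \<bullet> n \<noteq> 0)"
      show "\<forall>y\<in>U. inverse (?b s y \<bullet> n) *\<^sub>R ?b s y = normal_form (\<xi> s) c n y"
        using vector_form_normal_form(2)[of "\<xi> s" c U "?b s" n] s by simp
    qed
    fix y assume y: "y \<in> U"
    have "y \<in> ?V" using y U(2) by blast
    have "C1lim F (\<lambda>s y. ?b s y \<bullet> n) (\<lambda>y. ?bz y \<bullet> n) y"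
      by (rule C1lim_linear[OF bounded_linear_inner_left blim]) fact
    from C1lim_bilinear[OF bounded_bilinear_scaleR C1lim_inverse[OF this n0[OF y]] blim[OF \<open>y \<in> ?V\<close>]]
    have "C1lim F (\<lambda>s y. inverse (?b s y \<bullet> n) *\<^sub>R ?b s y) (\<lambda>y. inverse (?bz y \<bullet> n) *\<^sub>R ?bz y) y" .
    then show "C1lim F (\<lambda>s. normal_form (\<xi> s) c n) (normal_form \<xi>0 c n) y"
      by (rule C1lim_cong[OF _ U(1) y evn]) (simp add: vector_form_normal_form(2)[OF b0U n0])
  qed
qed

lemma vector_form_local:
  assumes "open W" "\<And>y. y \<in> W \<Longrightarrow> \<exists>V. y \<in> V \<and> vector_form \<xi> c V a"
  shows "vector_form \<xi> c W a"
  unfolding vector_form_def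
proof (intro conjI)
  show "W \<subseteq> img_ch c" using assms(2) unfolding vector_form_def by blast
  show "Cinf W a" using assms unfolding vector_form_def by (intro Cinf_local) blast+
  show "\<forall>x\<in>W. a x \<noteq> 0 \<and> in_chart c (\<xi> (inv_ch c x)) = {v. a x \<bullet> v = 0}"
    using assms(2) unfolding vector_form_def by blast
qed

lemma motion_id: "motion (\<lambda>t p. p)"
  unfolding motion_def
proof (intro conjI ballI)
  show c: "continuous_map (prod_topology euclidean (mtop M)) (mtop M) (\<lambda>(t :: real, p). p)"
    unfolding case_prod_beta' by (rule continuous_map_snd)
  fix c d assume cd: "c \<in> atlas M" "d \<in> atlas M"
  have "Cinf (motion_domain (\<lambda>t p. p) c d) (\<lambda>z. transition c d (snd z))"
    by (rule Cinf_compose[OF Cinf_snd[OF Cinf_id[OF motion_domain_open[OF c cd]]] Cinf_transition[OF cd]]) (auto simp: motion_domain_def overlap_def)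
  then show "Cinf (motion_domain (\<lambda>t p. p) c d) (\<lambda>(t, x). map_ch d (inv_ch c x))"
    by (rule Cinf_cong) (auto simp: transition_eq)
qed

lemma isotopic_to_refl: "tangential \<xi> \<Longrightarrow> isotopic_to \<xi> \<xi>"
  unfolding isotopic_to_def
proof (intro exI conjI allI ballI)
  assume T: "tangential \<xi>"
  fix p assume p: "p \<in> points M"
  have "differential M (\<lambda>p. p) p v = v" if "v \<in> \<xi> p" for v
    by (rule differential_identity_near[OF smooth_map_id openin_topspace p]) (use T p that in \<open>auto simp: tangential_def\<close>)
  then show "differential M (\<lambda>p. p) p ` \<xi> p = \<xi> p" by simp
qed (auto intro: motion_id)

lemma isotopic_to_cong:
  assumes "isotopic_to \<xi> \<xi>'" "\<And>p. p \<in> points M \<Longrightarrow> \<xi> p = \<eta> p" "\<And>p. p \<in> points M \<Longrightarrow> \<xi>' p = \<eta>' p"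
  shows "isotopic_to \<eta> \<eta>'"
proof -
  obtain \<Phi> \<Psi> where 1: "motion \<Phi>" "motion \<Psi>" "\<forall>t. \<forall>p\<in>points M. \<Psi> t (\<Phi> t p) = p \<and> \<Phi> t (\<Psi> t p) = p"
    "\<forall>p\<in>points M. \<Phi> 0 p = p" "\<forall>p\<in>points M. differential M (\<Phi> 1) p ` \<xi> p = \<xi>' (\<Phi> 1 p)"
    using assms(1) unfolding isotopic_to_def by (elim exE conjE)
  have "\<forall>p\<in>points M. differential M (\<Phi> 1) p ` \<eta> p = \<eta>' (\<Phi> 1 p)"
    using 1(5) assms(2,3) motion_points[OF 1(1)] by metis
  then show ?thesis unfolding isotopic_to_def using 1 by (intro exI conjI)
qed

section \<open>Interpolating two plane fields over a ball\<close>

text \<open>The squared distance keeps it smooth at the centre. The constant 25/4 = (5/2)^2 makes it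
  vanish from radius 5/2 R on; up to radius R the argument is at least 21/4 and the value is
  1.\<close>

definition cutoff :: "real^3 \<Rightarrow> real \<Rightarrow> real^3 \<Rightarrow> real" where
  "cutoff x0 R y = step_fn (25/4 - ((y - x0) \<bullet> (y - x0)) / R\<^sup>2)"

lemma Cinf_cutoff: "Cinf UNIV (cutoff x0 R)"
  unfolding cutoff_def
  by (intro Cinf_compose_UNIV[OF Cinf_step_fn] Cinf_diff Cinf_const open_UNIV
      Cinf_linear_comp[OF bounded_linear_divide] Cinf_inner Cinf_id)

lemma cutoff_1: "R > 0 \<Longrightarrow> y \<in> ball x0 R \<Longrightarrow> cutoff x0 R y = 1"
proof -
  assume R: "R > 0" and "y \<in> ball x0 R"
  then have "norm (y - x0) \<le> R" by (simp add: dist_norm norm_minus_commute)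
  then have "(norm (y - x0))\<^sup>2 \<le> R\<^sup>2" by (intro power_mono) auto
  then have "((y - x0) \<bullet> (y - x0)) / R\<^sup>2 \<le> 1" using R by (simp add: power2_norm_eq_inner)
  then show ?thesis unfolding cutoff_def by (intro step_fn_1) simp
qed

lemma cutoff_0: "R > 0 \<Longrightarrow> y \<notin> cball x0 (5/2 * R) \<Longrightarrow> cutoff x0 R y = 0"
proof -
  assume R: "R > 0" and "y \<notin> cball x0 (5/2 * R)"
  then have "5/2 * R \<le> norm (y - x0)" by (simp add: dist_norm norm_minus_commute)
  then have "(5/2 * R)\<^sup>2 \<le> (norm (y - x0))\<^sup>2" using R by (intro power_mono) auto
  then have "25/4 * R\<^sup>2 \<le> (y - x0) \<bullet> (y - x0)" by (simp add: power2_norm_eq_inner power_mult_distrib power_divide)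
  then have "25/4 \<le> ((y - x0) \<bullet> (y - x0)) / R\<^sup>2" using R by (simp add: field_simps)
  then show ?thesis unfolding cutoff_def by (intro step_fn_0) simp
qed

definition interp_form :: "'p chart \<Rightarrow> real^3 \<Rightarrow> real^3 \<Rightarrow> real \<Rightarrow> 'p field \<Rightarrow> 'p field \<Rightarrow> real^3 \<Rightarrow> real^3" where
  "interp_form c n x0 R \<zeta> \<eta> y = normal_form \<zeta> c n y + cutoff x0 R y *\<^sub>R (normal_form \<eta> c n y - normal_form \<zeta> c n y)"

definition interp :: "'p chart \<Rightarrow> real^3 \<Rightarrow> real^3 \<Rightarrow> real \<Rightarrow> 'p field \<Rightarrow> 'p field \<Rightarrow> 'p field" where
  "interp c n x0 R \<zeta> \<eta> p = (if p \<in> inv_ch c ` cball x0 (5/2 * R)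
     then {v \<in> tangent_space M p. interp_form c n x0 R \<zeta> \<eta> (map_ch c p) \<bullet> v c = 0} else \<zeta> p)"

lemma in_chart_kernel:
  assumes "c \<in> charts_at M p"
  shows "in_chart c {v \<in> tangent_space M p. L (v c)} = {w. L w}"
proof
  show "{w. L w} \<subseteq> in_chart c {v \<in> tangent_space M p. L (v c)}"
  proof
    fix w assume "w \<in> {w. L w}"
    then have "extend c p w \<in> {v \<in> tangent_space M p. L (v c)}"
      using extend_tangent[OF assms] extend_same[OF assms] by simp
    then have "(\<lambda>v. v c) (extend c p w) \<in> in_chart c {v \<in> tangent_space M p. L (v c)}"
      unfolding in_chart_def by (rule imageI)
    then show "w \<in> in_chart c {v \<in> tangent_space M p. L (v c)}" by (simp add: extend_same[OF assms])
  qed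
qed (auto simp: in_chart_def)

text \<open>Three nested radii are used: the new field is adopted on radius R, nothing changes
  beyond 5/2 R, and the normalised forms live on 3 R.\<close>

definition ball_chart :: "'p field \<Rightarrow> 'p chart \<Rightarrow> real^3 \<Rightarrow> real^3 \<Rightarrow> real \<Rightarrow> bool" where
  "ball_chart \<xi> c n x0 R \<longleftrightarrow> c \<in> atlas M \<and> R > 0 \<and> cball x0 (3 * R) \<subseteq> img_ch c \<and>
     (\<forall>y\<in>cball x0 (3 * R). n \<notin> in_chart c (\<xi> (inv_ch c y)))"

text \<open>Pointwise data on the compact ball of radius 3 R become uniform in the parameter by
  \<open>eventually_on_compact\<close>.\<close>

lemma converges_ball:
  assumes fc: "converges F \<zeta> \<xi>0" and b: "ball_chart \<xi>0 c n x0 R"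
  shows "\<forall>\<^sub>F s in F. vector_form (\<zeta> s) c (ball x0 (3 * R)) (normal_form (\<zeta> s) c n) \<and> (\<forall>y\<in>ball x0 (3 * R). normal_form (\<zeta> s) c n y \<bullet> n = 1)"
    and "\<And>y. y \<in> cball x0 (3 * R) \<Longrightarrow> C1lim F (\<lambda>s. normal_form (\<zeta> s) c n) (normal_form \<xi>0 c n) y"
    and "vector_form \<xi>0 c (ball x0 (3 * R)) (normal_form \<xi>0 c n)"
    and "\<And>y. y \<in> ball x0 (3 * R) \<Longrightarrow> normal_form \<xi>0 c n y \<bullet> n = 1"
proof -
  have c: "c \<in> atlas M" and img: "\<And>y. y \<in> cball x0 (3 * R) \<Longrightarrow> y \<in> img_ch c"
    and n: "\<And>y. y \<in> cball x0 (3 * R) \<Longrightarrow> n \<notin> in_chart c (\<xi>0 (inv_ch c y))"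
    using b by (auto simp: ball_chart_def)
  have T: "\<forall>\<^sub>F s in F. tangential (\<zeta> s)" "tangential \<xi>0" and cv: "\<And>p. p \<in> points M \<Longrightarrow> converges_at F \<zeta> \<xi>0 p"
    using fc by (auto simp: converges_def)
  let ?Q = "\<lambda>z. \<exists>V. snd z \<in> V \<and> vector_form (\<zeta> (fst z)) c V (normal_form (\<zeta> (fst z)) c n) \<and> normal_form (\<zeta> (fst z)) c n (snd z) \<bullet> n = 1"
  have key: "eventually ?Q (F \<times>\<^sub>F nhds y) \<and> C1lim F (\<lambda>s. normal_form (\<zeta> s) c n) (normal_form \<xi>0 c n) y \<and>
      (\<exists>V. y \<in> V \<and> vector_form \<xi>0 c V (normal_form \<xi>0 c n)) \<and> normal_form \<xi>0 c n y \<bullet> n = 1" if y: "y \<in> cball x0 (3 * R)" for y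
  proof -
    note yi = img[OF y]
    have p: "inv_ch c y \<in> points M" using inv_dom[OF c yi] dom_sub[OF c] by blast
    have cp: "c \<in> charts_at M (inv_ch c y)" by (rule charts_atI[OF c inv_dom[OF c yi]])
    have m: "map_ch c (inv_ch c y) = y" by (rule map_inv[OF c yi])
    show ?thesis
    proof (rule converges_at_normal_form[OF cv[OF p] T cp n[OF y]])
      fix U assume U: "open U" "map_ch c (inv_ch c y) \<in> U" "vector_form \<xi>0 c U (normal_form \<xi>0 c n)"
        and ev: "\<forall>\<^sub>F s in F. vector_form (\<zeta> s) c U (normal_form (\<zeta> s) c n) \<and> (\<forall>y\<in>U. normal_form (\<zeta> s) c n y \<bullet> n = 1)"
        and n0: "\<And>y. y \<in> U \<Longrightarrow> normal_form \<xi>0 c n y \<bullet> n = 1" and lim: "\<And>y. y \<in> U \<Longrightarrow> C1lim F (\<lambda>s. normal_form (\<zeta> s) c n) (normal_form \<xi>0 c n) y"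
      have yU: "y \<in> U" using U(2) m by simp
      have "eventually ?Q (F \<times>\<^sub>F nhds y)"
        by (rule eventually_prodI[OF ev U(1) yU]) auto
      then show ?thesis using lim[OF yU] U(3) yU n0[OF yU] by blast
    qed
  qed
  then show "\<And>y. y \<in> cball x0 (3 * R) \<Longrightarrow> C1lim F (\<lambda>s. normal_form (\<zeta> s) c n) (normal_form \<xi>0 c n) y" by blast
  have sub: "y \<in> cball x0 (3 * R)" if "y \<in> ball x0 (3 * R)" for y using that by auto
  show "\<And>y. y \<in> ball x0 (3 * R) \<Longrightarrow> normal_form \<xi>0 c n y \<bullet> n = 1" using key sub by blast
  show "vector_form \<xi>0 c (ball x0 (3 * R)) (normal_form \<xi>0 c n)" by (rule vector_form_local[OF open_ball]) (use key sub in blast)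
  have "\<forall>\<^sub>F s in F. \<forall>y\<in>cball x0 (3 * R). ?Q (s, y)"
    by (rule eventually_on_compact[OF compact_cball]) (use key in blast)
  then show "\<forall>\<^sub>F s in F. vector_form (\<zeta> s) c (ball x0 (3 * R)) (normal_form (\<zeta> s) c n) \<and> (\<forall>y\<in>ball x0 (3 * R). normal_form (\<zeta> s) c n y \<bullet> n = 1)"
  proof (rule eventually_mono)
    fix s assume q: "\<forall>y\<in>cball x0 (3 * R). ?Q (s, y)"
    have "vector_form (\<zeta> s) c (ball x0 (3 * R)) (normal_form (\<zeta> s) c n)"
    proof (rule vector_form_local[OF open_ball])
      fix y assume "y \<in> ball x0 (3 * R)"
      from q[rule_format, OF sub[OF this]]
      show "\<exists>V. y \<in> V \<and> vector_form (\<zeta> s) c V (normal_form (\<zeta> s) c n)" unfolding fst_conv snd_conv by blast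
    qed
    moreover have "\<forall>y\<in>ball x0 (3 * R). normal_form (\<zeta> s) c n y \<bullet> n = 1" using q sub by fastforce
    ultimately show "vector_form (\<zeta> s) c (ball x0 (3 * R)) (normal_form (\<zeta> s) c n) \<and> (\<forall>y\<in>ball x0 (3 * R). normal_form (\<zeta> s) c n y \<bullet> n = 1)" ..
  qed
qed


text \<open>Both families have the same limit, so the difference \<open>dl\<close> of their
  normalised forms tends to 0 with its first derivatives. Hence all forms between the two ends are
  eventually contact on the whole ball, and Gray's argument applies in both directions.\<close>

lemma interp_step:
  assumes b: "ball_chart \<xi>0 c n x0 R"
    and \<zeta>: "converges F \<zeta> \<xi>0" and \<eta>: "converges F \<eta> \<xi>0"
    and pos: "\<And>y. y \<in> cball x0 (3 * R) \<Longrightarrow> wedge2 (normal_form \<xi>0 c n) (normal_form \<xi>0 c n) y > 0"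
  defines "\<zeta>' \<equiv> \<lambda>s. interp c n x0 R (\<zeta> s) (\<eta> s)"
  shows "converges F \<zeta>' \<xi>0"
    and "\<forall>\<^sub>F s in F. isotopic_to (\<zeta> s) (\<zeta>' s) \<and> isotopic_to (\<zeta>' s) (\<zeta> s)"
    and "\<forall>\<^sub>F s in F. \<forall>p\<in>points M. p \<in> dom_ch c \<and> map_ch c p \<in> ball x0 R \<or> \<zeta> s p = \<eta> s p \<longrightarrow> \<zeta>' s p = \<eta> s p"
proof -
  let ?K = "cball x0 (5/2 * R)" and ?W = "ball x0 (3 * R)"
  let ?a = "\<lambda>s. normal_form (\<zeta> s) c n"
  define dl where "dl = (\<lambda>s y. cutoff x0 R y *\<^sub>R (normal_form (\<eta> s) c n y - normal_form (\<zeta> s) c n y))"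
  have c: "c \<in> atlas M" and R: "R > 0" and img: "cball x0 (3 * R) \<subseteq> img_ch c"
    using b by (auto simp: ball_chart_def)
  have KW: "?K \<subseteq> ?W" using R by auto
  have Wimg: "?W \<subseteq> img_ch c" using img ball_subset_cball by blast
  have Kimg: "?K \<subseteq> img_ch c" using KW Wimg by blast
  have T\<zeta>: "\<forall>\<^sub>F s in F. tangential (\<zeta> s)" and T\<eta>: "\<forall>\<^sub>F s in F. tangential (\<eta> s)" and T0: "tangential \<xi>0"
    using \<zeta> \<eta> by (auto simp: converges_def)
  note Z = converges_ball[OF \<zeta> b] and E = converges_ball[OF \<eta> b]
  have form: "interp_form c n x0 R (\<zeta> s) (\<eta> s) y = ?a s y + dl s y" for s y by (simp add: interp_form_def dl_def)
  have d0: "dl s y = 0" if "y \<notin> ?K" for s y using cutoff_0[OF R that] by (simp add: dl_def)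
  have memK: "inv_ch c y \<in> inv_ch c ` ?K \<longleftrightarrow> y \<in> ?K" if "y \<in> img_ch c" for y
  proof
    assume "inv_ch c y \<in> inv_ch c ` ?K"
    then obtain x where x: "x \<in> ?K" "inv_ch c y = inv_ch c x" by blast
    have xi: "x \<in> img_ch c" using x Kimg by blast
    have "y = map_ch c (inv_ch c y)" by (rule map_inv[OF c that, symmetric])
    also have "\<dots> = map_ch c (inv_ch c x)" by (rule arg_cong[OF x(2)])
    also have "\<dots> = x" by (rule map_inv[OF c xi])
    finally show "y \<in> ?K" using x(1) by blast
  qed (rule imageI)
  let ?G = "\<lambda>s. tangential (\<zeta> s) \<and> tangential (\<eta> s) \<and> (vector_form (\<zeta> s) c ?W (?a s) \<and> (\<forall>y\<in>?W. ?a s y \<bullet> n = 1))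
    \<and> (vector_form (\<eta> s) c ?W (normal_form (\<eta> s) c n) \<and> (\<forall>y\<in>?W. normal_form (\<eta> s) c n y \<bullet> n = 1))"
  have G: "\<forall>\<^sub>F s in F. ?G s" by (intro eventually_conj T\<zeta> T\<eta> Z(1) E(1))
  have T': "tangential (\<zeta>' s)" if "?G s" for s
    unfolding tangential_def
  proof
    fix p assume "p \<in> points M"
    then show "\<zeta>' s p \<subseteq> tangent_space M p"
      using that by (auto simp: \<zeta>'_def interp_def tangential_def)
  qed
  have Cd: "Cinf ?W (dl s)" if "?G s" for s
    unfolding dl_def using that by (intro Cinf_scaleR Cinf_diff Cinf_subset[OF Cinf_cutoff]) (auto simp: vector_form_def)
  have plane: "in_chart c (\<zeta>' s (inv_ch c y)) = {v. (?a s y + dl s y) \<bullet> v = 0}" if g: "?G s" and y: "y \<in> ?W" for s y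
  proof -
    have yi: "y \<in> img_ch c" using y Wimg by blast
    have cp: "c \<in> charts_at M (inv_ch c y)" by (rule charts_atI[OF c inv_dom[OF c yi]])
    show ?thesis
    proof (cases "y \<in> ?K")
      case True
      then have "\<zeta>' s (inv_ch c y) = {v \<in> tangent_space M (inv_ch c y). (?a s y + dl s y) \<bullet> v c = 0}"
        unfolding \<zeta>'_def interp_def form map_inv[OF c yi] using memK[OF yi] by simp
      then show ?thesis using in_chart_kernel[OF cp, of "\<lambda>w. (?a s y + dl s y) \<bullet> w = 0"] by simp
    next
      case False
      then have "\<zeta>' s (inv_ch c y) = \<zeta> s (inv_ch c y)"
        unfolding \<zeta>'_def interp_def using memK[OF yi] by simp
      then show ?thesis using d0[OF False] g y by (simp add: vector_form_def)
    qed
  qed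
  have V': "vector_form (\<zeta>' s) c ?W (\<lambda>y. ?a s y + dl s y)" if g: "?G s" for s
    unfolding vector_form_def
  proof (intro conjI ballI Wimg)
    show "Cinf ?W (\<lambda>y. ?a s y + dl s y)"
      by (rule Cinf_add[OF _ Cd[OF g]]) (use g in \<open>simp add: vector_form_def\<close>)
    fix y assume y: "y \<in> ?W"
    have "(?a s y + dl s y) \<bullet> n = 1" using g y by (simp add: dl_def inner_add_left inner_diff_left)
    then show "?a s y + dl s y \<noteq> 0" by auto
    show "in_chart c (\<zeta>' s (inv_ch c y)) = {v. (?a s y + dl s y) \<bullet> v = 0}" by (rule plane[OF g y])
  qed
  have cl: "closedin (mtop M) (inv_ch c ` ?K)" by (rule closedin_inv_image(1)[OF c compact_cball Kimg])
  have outK: "\<zeta>' s p = \<zeta> s p" if "p \<notin> inv_ch c ` ?K" for s p using that by (simp add: \<zeta>'_def interp_def)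
  have limd: "C1lim F dl (\<lambda>y. cutoff x0 R y *\<^sub>R (normal_form \<xi>0 c n y - normal_form \<xi>0 c n y)) y" if y: "y \<in> cball x0 (3 * R)" for y
    unfolding dl_def by (intro C1lim_bilinear[OF bounded_bilinear_scaleR] C1lim_const[OF Cinf_cutoff] UNIV_I C1lim_diff Z(2) E(2) y)
  show "converges F \<zeta>' \<xi>0"
    unfolding converges_def
  proof (intro conjI ballI T0)
    show "\<forall>\<^sub>F s in F. tangential (\<zeta>' s)" using G by (rule eventually_mono) (rule T')
    fix p assume p: "p \<in> points M"
    show "converges_at F \<zeta>' \<xi>0 p"
    proof (cases "p \<in> inv_ch c ` ?K")
      case True
      then obtain x where x: "x \<in> ?K" "p = inv_ch c x" by blast
      then have xi: "x \<in> img_ch c" and xW: "x \<in> ?W" using Kimg KW by auto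
      have cp: "c \<in> charts_at M p" using x inv_dom[OF c xi] c by (auto intro: charts_atI)
      have "C1lim F (\<lambda>s y. ?a s y + dl s y) (normal_form \<xi>0 c n) y" if "y \<in> ?W" for y
        using C1lim_add[OF Z(2) limd, of y] that by simp
      moreover have "\<forall>\<^sub>F s in F. vector_form (\<zeta>' s) c ?W (\<lambda>y. ?a s y + dl s y)" using G by (rule eventually_mono) (rule V')
      moreover have "map_ch c p \<in> ?W" using xW x map_inv[OF c xi] by simp
      ultimately show ?thesis unfolding converges_at_def using cp Z(3) by (intro bexI[of _ c] exI conjI ballI) auto
    next
      case False
      have "converges_at F \<zeta> \<xi>0 p" using \<zeta> p by (simp add: converges_def)
      then obtain d W a a0 where d: "d \<in> charts_at M p" and pW: "map_ch d p \<in> W" and a0: "vector_form \<xi>0 d W a0"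
        and a: "\<forall>\<^sub>F s in F. vector_form (\<zeta> s) d W (a s)" and lim: "\<forall>x\<in>W. C1lim F a a0 x"
        unfolding converges_at_def by (elim exE bexE conjE)
      note dA = charts_atD[OF d]
      let ?V = "W \<inter> {x \<in> img_ch d. inv_ch d x \<in> points M - inv_ch c ` ?K}"
      have Wo: "open W" using a0 Cinf_open unfolding vector_form_def by blast
      have V: "open ?V"
        by (intro open_Int Wo open_inv_preimage[OF dA(1)] openin_diff[OF openin_topspace cl])
      have "map_ch d p \<in> ?V" using pW p False dA by simp
      moreover have "vector_form \<xi>0 d ?V a0" by (rule vector_form_subset[OF a0 V]) blast
      moreover have "\<forall>\<^sub>F s in F. vector_form (\<zeta>' s) d ?V (a s)"
        using a
      proof (rule eventually_mono)
        fix s assume "vector_form (\<zeta> s) d W (a s)"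
        then have "vector_form (\<zeta> s) d ?V (a s)" by (rule vector_form_subset[OF _ V]) blast
        then show "vector_form (\<zeta>' s) d ?V (a s)" unfolding vector_form_def using outK by auto
      qed
      ultimately show ?thesis unfolding converges_at_def using lim by (intro bexI[OF _ d] exI conjI ballI) auto
    qed
  qed
  \<comment> \<open>The second alternative says that agreement with the target field, reached on
    other balls, survives the step: interpolating between equal forms changes nothing.\<close>
  show "\<forall>\<^sub>F s in F. \<forall>p\<in>points M. p \<in> dom_ch c \<and> map_ch c p \<in> ball x0 R \<or> \<zeta> s p = \<eta> s p \<longrightarrow> \<zeta>' s p = \<eta> s p"
    using G
  proof (rule eventually_mono, intro ballI impI)
    fix s p assume g: "?G s" and p: "p \<in> points M" and h: "p \<in> dom_ch c \<and> map_ch c p \<in> ball x0 R \<or> \<zeta> s p = \<eta> s p"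
    show "\<zeta>' s p = \<eta> s p"
    proof (cases "p \<in> inv_ch c ` ?K")
      case True
      then obtain x where x: "x \<in> ?K" "p = inv_ch c x" by blast
      then have xi: "x \<in> img_ch c" and xW: "x \<in> ?W" using Kimg KW by auto
      have cp: "c \<in> charts_at M p" using x inv_dom[OF c xi] c by (auto intro: charts_atI)
      have mp: "map_ch c p = x" using x map_inv[OF c xi] by simp
      have "?a s x + dl s x = normal_form (\<eta> s) c n x"
      proof (cases "map_ch c p \<in> ball x0 R")
        case True
        then show ?thesis using cutoff_1[OF R] mp by (simp add: dl_def)
      next
        case False
        then have "\<zeta> s p = \<eta> s p" using h by blast
        then have "normal_form (\<zeta> s) c n x = normal_form (\<eta> s) c n x" using x by (simp add: normal_form_def)
        then show ?thesis by (simp add: dl_def)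
      qed
      then have "in_chart c (\<zeta>' s p) = in_chart c (\<eta> s p)" using plane[OF g xW] g xW x by (simp add: vector_form_def)
      then show ?thesis
        using T'[OF g] g p by (intro plane_eqI[OF _ _ cp]) (auto simp only: tangential_def)
    next
      case False
      have "map_ch c p \<notin> ball x0 R" if "p \<in> dom_ch c"
      proof
        assume "map_ch c p \<in> ball x0 R"
        then have "map_ch c p \<in> ?K" using R by auto
        from imageI[OF this, of "inv_ch c"] show False using False inv_map[OF c that] by simp
      qed
      then show ?thesis using outK[OF False] h by blast
    qed
  qed
  \<comment> \<open>A lower bound for a \<bullet> curl a at a + q dl, valid for all q in [0, 1] at
    once.\<close>
  let ?h = "\<lambda>z. wedge2 (?a (fst z)) (?a (fst z)) (snd z) / 2 - \<bar>wedge2 (?a (fst z)) (dl (fst z)) (snd z)\<bar> -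
      \<bar>wedge2 (dl (fst z)) (dl (fst z)) (snd z)\<bar>"
  have hev: "\<forall>\<^sub>F z in F \<times>\<^sub>F nhds y. ?h z > 0" if y: "y \<in> cball x0 (3 * R)" for y
  proof -
    let ?z = "\<lambda>y. cutoff x0 R y *\<^sub>R (normal_form \<xi>0 c n y - normal_form \<xi>0 c n y)"
    have z: "wedge2 u ?z y = 0" for u
    proof -
      have "?z = (\<lambda>y. 0)" by simp
      then show ?thesis by (simp add: wedge2_def curl_def curl_of_def vec_eq_iff frechet_derivative_const inner_3)
    qed
    have "(?h \<longlongrightarrow> wedge2 (normal_form \<xi>0 c n) (normal_form \<xi>0 c n) y / 2 - \<bar>wedge2 (normal_form \<xi>0 c n) ?z y\<bar> - \<bar>wedge2 ?z ?z y\<bar>) (F \<times>\<^sub>F nhds y)"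
      by (intro tendsto_diff tendsto_divide tendsto_rabs tendsto_wedge2 tendsto_const Z(2) limd y) simp
    then have "(?h \<longlongrightarrow> wedge2 (normal_form \<xi>0 c n) (normal_form \<xi>0 c n) y / 2) (F \<times>\<^sub>F nhds y)" unfolding z by simp
    then show ?thesis by (rule order_tendstoD(1)) (use pos[OF y] in simp)
  qed
  have "\<forall>\<^sub>F s in F. \<forall>y\<in>cball x0 (3 * R). ?h (s, y) > 0"
    by (rule eventually_on_compact[OF compact_cball hev])
  from eventually_conj[OF G this]
  show "\<forall>\<^sub>F s in F. isotopic_to (\<zeta> s) (\<zeta>' s) \<and> isotopic_to (\<zeta>' s) (\<zeta> s)"
  proof (rule eventually_mono, elim conjE, intro conjI)
    fix s assume "tangential (\<zeta> s)" "tangential (\<eta> s)" "vector_form (\<zeta> s) c ?W (?a s)" "\<forall>y\<in>?W. ?a s y \<bullet> n = 1"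
      "vector_form (\<eta> s) c ?W (normal_form (\<eta> s) c n)" "\<forall>y\<in>?W. normal_form (\<eta> s) c n y \<bullet> n = 1" and h: "\<forall>y\<in>cball x0 (3 * R). ?h (s, y) > 0"
    then have g: "?G s" by blast
    have Ca: "Cinf ?W (?a s)" using g by (simp add: vector_form_def)
    have P: "(?a s y + q *\<^sub>R dl s y) \<bullet> (curl (?a s) y + q *\<^sub>R curl (dl s) y) > 0" if y: "y \<in> ?W" and q: "0 \<le> q" "q \<le> 1" for y q
    proof -
      have "(?a s y + q *\<^sub>R dl s y) \<bullet> (curl (?a s) y + q *\<^sub>R curl (dl s) y) =
        wedge2 (?a s) (?a s) y / 2 + q * wedge2 (?a s) (dl s) y + (q * q) * (wedge2 (dl s) (dl s) y / 2)"
        by (simp add: wedge2_def inner_add_left inner_add_right algebra_simps)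
      moreover have "\<bar>q * wedge2 (?a s) (dl s) y\<bar> \<le> \<bar>wedge2 (?a s) (dl s) y\<bar>"
        using q by (simp add: abs_mult mult_left_le_one_le)
      moreover have "\<bar>(q * q) * (wedge2 (dl s) (dl s) y / 2)\<bar> \<le> \<bar>wedge2 (dl s) (dl s) y\<bar>"
      proof -
        have "(q * q) * (\<bar>wedge2 (dl s) (dl s) y\<bar> / 2) \<le> \<bar>wedge2 (dl s) (dl s) y\<bar> / 2"
          using q by (intro mult_left_le_one_le) (auto simp: mult_le_one)
        then show ?thesis by (simp add: abs_mult)
      qed
      moreover have "?h (s, y) > 0" using h y by auto
      ultimately show ?thesis unfolding fst_conv snd_conv by linarith
    qed
    show "isotopic_to (\<zeta> s) (\<zeta>' s)"
    proof (rule isotopic_to_local_step[OF c _ T'[OF g] compact_cball KW _ V'[OF g] Cd[OF g]])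
      show "tangential (\<zeta> s)" "vector_form (\<zeta> s) c ?W (?a s)" using g by auto
      show "\<zeta> s p = \<zeta>' s p" if "p \<notin> inv_ch c ` ?K" for p using outK[OF that] by simp
    qed (use d0 P in auto)
    have cu: "curl (\<lambda>y. - dl s y) y = - curl (dl s) y \<and> curl (\<lambda>y. ?a s y + dl s y) y = curl (?a s) y + curl (dl s) y" if y: "y \<in> ?W" for y
    proof -
      have da: "?a s differentiable (at y)" and dd: "dl s differentiable (at y)"
        using Cinf_has_derivative[OF Ca y] Cinf_has_derivative[OF Cd[OF g] y] by (auto intro: differentiableI)
      have c0: "curl (\<lambda>y. 0) y = 0" by (simp add: curl_def curl_of_def vec_eq_iff forall_3 frechet_derivative_const)
      show ?thesis
        using curl_add_scaleR[OF da dd, of 1] curl_add_scaleR[OF differentiable_const[of 0] dd, of "-1"] c0 by simp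
    qed
    \<comment> \<open>The same segment of forms run backwards, with 1 - q in place of q.\<close>
    show "isotopic_to (\<zeta>' s) (\<zeta> s)"
    proof (rule isotopic_to_local_step[OF c T'[OF g] _ compact_cball KW V'[OF g] _ Cinf_minus[OF Cd[OF g]]])
      show "tangential (\<zeta> s)" using g by blast
      show "vector_form (\<zeta> s) c ?W (\<lambda>x. ?a s x + dl s x + - dl s x)" using g by simp
      show "- dl s x = 0" if "x \<notin> ?K" for x using d0[OF that] by simp
      show "\<zeta>' s p = \<zeta> s p" if "p \<notin> inv_ch c ` ?K" for p by (rule outK[OF that])
      fix q :: real and x assume x: "x \<in> ?W" and q: "0 \<le> q" "q \<le> 1"
      have e1: "?a s x + dl s x + q *\<^sub>R - dl s x = ?a s x + (1 - q) *\<^sub>R dl s x" by (simp add: algebra_simps)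
      have e2: "curl (\<lambda>x. ?a s x + dl s x) x + q *\<^sub>R curl (\<lambda>x. - dl s x) x = curl (?a s) x + (1 - q) *\<^sub>R curl (dl s) x"
        using cu[OF x] by (simp add: algebra_simps)
      show "0 < (?a s x + dl s x + q *\<^sub>R - dl s x) \<bullet> (curl (\<lambda>x. ?a s x + dl s x) x + q *\<^sub>R curl (\<lambda>x. - dl s x) x)"
        unfolding e1 e2 using P[OF x, of "1 - q"] q by simp
    qed
  qed
qed

section \<open>Stability of contact structures by a finite cover\<close>

text \<open>Stated for every transverse \<open>n\<close>, so that it fits whichever normalisation a
  ball happens to use.\<close>

definition positive_field :: "'p field \<Rightarrow> bool" where
  "positive_field \<xi> \<longleftrightarrow> (\<forall>c\<in>atlas M. \<forall>y\<in>img_ch c. \<forall>n. n \<notin> in_chart c (\<xi> (inv_ch c y)) \<longrightarrow>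
    wedge2 (normal_form \<xi> c n) (normal_form \<xi> c n) y > 0)"

text \<open>The coefficient vector of a local form at the centre is itself transverse there, and
  remains so nearby.\<close>

lemma ball_chart_exists:
  assumes fc: "converges F \<eta> \<xi>0" and p: "p \<in> points M"
  shows "\<exists>c n R. ball_chart \<xi>0 c n (map_ch c p) R \<and> p \<in> dom_ch c"
proof -
  have "converges_at F \<eta> \<xi>0 p" using fc p by (simp add: converges_def)
  then obtain c W a a0 where cp: "c \<in> charts_at M p" and xW: "map_ch c p \<in> W" and a0: "vector_form \<xi>0 c W a0"
    unfolding converges_at_def by (elim exE bexE conjE)
  have Ca: "Cinf W a0" and Wi: "W \<subseteq> img_ch c" using a0 by (auto simp: vector_form_def)
  let ?x = "map_ch c p"
  let ?V = "W \<inter> (\<lambda>y. a0 y \<bullet> a0 ?x) -` {0<..}"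
  have V: "open ?V"
    by (rule continuous_open_preimage[OF Cinf_continuous[OF Cinf_inner[OF Ca Cinf_const[OF Cinf_open[OF Ca]]]] Cinf_open[OF Ca]]) simp
  have "?x \<in> ?V" using a0 xW by (auto simp: vector_form_def)
  then obtain r where r: "r > 0" "cball ?x r \<subseteq> ?V" using V open_contains_cball by blast
  have "ball_chart \<xi>0 c (a0 ?x) ?x (r / 3)"
    unfolding ball_chart_def
  proof (intro conjI ballI)
    show "c \<in> atlas M" by (rule charts_atD(1)[OF cp])
    show "r / 3 > 0" using r by simp
    show "cball ?x (3 * (r / 3)) \<subseteq> img_ch c" using r Wi by auto
    fix y assume "y \<in> cball ?x (3 * (r / 3))"
    then have "y \<in> ?V" using r by auto
    then show "a0 ?x \<notin> in_chart c (\<xi>0 (inv_ch c y))" using a0 by (auto simp: vector_form_def)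
  qed
  then show ?thesis using charts_atD(2)[OF cp] by blast
qed

lemma converges_const: "converges F \<eta> \<xi>0 \<Longrightarrow> converges F (\<lambda>s. \<xi>0) \<xi>0"
  unfolding converges_def
proof (elim conjE, intro conjI ballI)
  fix p assume "\<forall>p\<in>points M. converges_at F \<eta> \<xi>0 p" "p \<in> points M"
  then have "converges_at F \<eta> \<xi>0 p" by blast
  then obtain c W a a0 where cp: "c \<in> charts_at M p" and xW: "map_ch c p \<in> W" and a0: "vector_form \<xi>0 c W a0"
    unfolding converges_at_def by (elim exE bexE conjE)
  have Ca: "Cinf W a0" using a0 by (simp add: vector_form_def)
  show "converges_at F (\<lambda>s. \<xi>0) \<xi>0 p"
    unfolding converges_at_def using xW a0 C1lim_const[OF Ca]
    by (intro bexI[OF _ cp] exI[of _ W] exI[of _ "\<lambda>s. a0"] exI[of _ a0] conjI ballI) auto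
qed auto

text \<open>Fragmentation: finitely many balls cover the manifold, and the limit field is replaced
  by \<open>\<eta> s\<close> on one ball after another. Each replacement is a local Gray step, and
  after the last one the field is \<open>\<eta> s\<close> everywhere.\<close>

theorem contact_stability:
  assumes fc: "converges F \<eta> \<xi>0" and pos: "positive_field \<xi>0"
  shows "\<forall>\<^sub>F s in F. isotopic_to \<xi>0 (\<eta> s) \<and> isotopic_to (\<eta> s) \<xi>0"
proof -
  have T0: "tangential \<xi>0" and T: "\<forall>\<^sub>F s in F. tangential (\<eta> s)" using fc by (auto simp: converges_def)
  obtain c n R where B: "\<And>p. p \<in> points M \<Longrightarrow> ball_chart \<xi>0 (c p) (n p) (map_ch (c p) p) (R p) \<and> p \<in> dom_ch (c p)"
    using ball_chart_exists[OF fc] by metis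
  let ?O = "\<lambda>p. {q \<in> dom_ch (c p). map_ch (c p) q \<in> ball (map_ch (c p) p) (R p)}"
  have O: "openin (mtop M) (?O p)" and pO: "p \<in> ?O p" if "p \<in> points M" for p
    using B[OF that] openin_chart_preimage[OF _ open_ball] by (auto simp: ball_chart_def)
  have h1: "compactin (mtop M) (points M)" using compact_M by (simp add: compact_space_def)
  have h2: "points M \<subseteq> \<Union>(?O ` points M)" using pO by blast
  have h3: "openin (mtop M) U" if "U \<in> ?O ` points M" for U using O that by blast
  have "\<exists>\<F>. finite \<F> \<and> \<F> \<subseteq> ?O ` points M \<and> points M \<subseteq> \<Union>\<F>"
    by (rule compactinD[OF h1 _ h2]) (rule h3)
  then obtain \<F> where \<F>: "finite \<F>" "\<F> \<subseteq> ?O ` points M" and cov0: "points M \<subseteq> \<Union>\<F>"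
    by (elim exE conjE)
  from finite_subset_image[OF \<F>] obtain D where D: "D \<subseteq> points M" "finite D" "\<F> = ?O ` D"
    by (elim exE conjE)
  \<comment> \<open>The intermediate family must itself converge to \<xi>0, so that the next ball
    can again interpolate between two families with the same limit.\<close>
  have "\<exists>\<zeta>. converges F \<zeta> \<xi>0 \<and> (\<forall>\<^sub>F s in F. isotopic_to \<xi>0 (\<zeta> s) \<and> isotopic_to (\<zeta> s) \<xi>0) \<and>
      (\<forall>\<^sub>F s in F. \<forall>p\<in>\<Union>(?O ` D) \<inter> points M. \<zeta> s p = \<eta> s p)"
    using D(2,1)
  proof (induction D rule: finite_induct)
    case empty
    show ?case
      by (intro exI[of _ "\<lambda>s. \<xi>0"] conjI converges_const[OF fc]) (auto simp: isotopic_to_refl[OF T0])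
  next
    case (insert q D)
    then have q: "q \<in> points M" by blast
    obtain \<zeta> where \<zeta>: "converges F \<zeta> \<xi>0" and i: "\<forall>\<^sub>F s in F. isotopic_to \<xi>0 (\<zeta> s) \<and> isotopic_to (\<zeta> s) \<xi>0"
      and e: "\<forall>\<^sub>F s in F. \<forall>p\<in>\<Union>(?O ` D) \<inter> points M. \<zeta> s p = \<eta> s p"
      using insert.IH insert.prems by blast
    have b: "ball_chart \<xi>0 (c q) (n q) (map_ch (c q) q) (R q)" using B[OF q] by blast
    have w: "wedge2 (normal_form \<xi>0 (c q) (n q)) (normal_form \<xi>0 (c q) (n q)) y > 0" if "y \<in> cball (map_ch (c q) q) (3 * R q)" for y
      using pos b that unfolding positive_field_def ball_chart_def by blast
    let ?\<zeta>' = "\<lambda>s. interp (c q) (n q) (map_ch (c q) q) (R q) (\<zeta> s) (\<eta> s)"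
    have st: "converges F ?\<zeta>' \<xi>0" "\<forall>\<^sub>F s in F. isotopic_to (\<zeta> s) (?\<zeta>' s) \<and> isotopic_to (?\<zeta>' s) (\<zeta> s)"
      "\<forall>\<^sub>F s in F. \<forall>p\<in>points M. p \<in> dom_ch (c q) \<and> map_ch (c q) p \<in> ball (map_ch (c q) q) (R q) \<or> \<zeta> s p = \<eta> s p \<longrightarrow> ?\<zeta>' s p = \<eta> s p"
      by (rule interp_step[OF b \<zeta> fc], erule w)+
    have T': "\<forall>\<^sub>F s in F. tangential (?\<zeta>' s)" using st(1) by (simp add: converges_def)
    have "\<forall>\<^sub>F s in F. isotopic_to \<xi>0 (?\<zeta>' s) \<and> isotopic_to (?\<zeta>' s) \<xi>0"
      using eventually_conj[OF eventually_conj[OF i st(2)] T']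
    proof (rule eventually_mono, elim conjE, intro conjI)
      fix s assume a: "isotopic_to \<xi>0 (\<zeta> s)" "isotopic_to (\<zeta> s) \<xi>0" "isotopic_to (\<zeta> s) (?\<zeta>' s)" "isotopic_to (?\<zeta>' s) (\<zeta> s)" "tangential (?\<zeta>' s)"
      show "isotopic_to \<xi>0 (?\<zeta>' s)" by (rule isotopic_to_trans[OF a(1,3) T0])
      show "isotopic_to (?\<zeta>' s) \<xi>0" by (rule isotopic_to_trans[OF a(4,2,5)])
    qed
    moreover have "\<forall>\<^sub>F s in F. \<forall>p\<in>\<Union>(?O ` insert q D) \<inter> points M. ?\<zeta>' s p = \<eta> s p"
      using eventually_conj[OF e st(3)]
    proof (rule eventually_mono, elim conjE, intro ballI)
      fix s p assume a: "\<forall>p\<in>\<Union>(?O ` D) \<inter> points M. \<zeta> s p = \<eta> s p"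
        "\<forall>p\<in>points M. p \<in> dom_ch (c q) \<and> map_ch (c q) p \<in> ball (map_ch (c q) q) (R q) \<or> \<zeta> s p = \<eta> s p \<longrightarrow> ?\<zeta>' s p = \<eta> s p"
        and p: "p \<in> \<Union>(?O ` insert q D) \<inter> points M"
      have "p \<in> dom_ch (c q) \<and> map_ch (c q) p \<in> ball (map_ch (c q) q) (R q) \<or> \<zeta> s p = \<eta> s p"
        using a(1) p by blast
      then show "?\<zeta>' s p = \<eta> s p" using a(2) p by blast
    qed
    ultimately show ?case using st(1) by (intro exI[of _ ?\<zeta>'] conjI)
  qed
  then obtain \<zeta> where i: "\<forall>\<^sub>F s in F. isotopic_to \<xi>0 (\<zeta> s) \<and> isotopic_to (\<zeta> s) \<xi>0"
      and e: "\<forall>\<^sub>F s in F. \<forall>p\<in>\<Union>(?O ` D) \<inter> points M. \<zeta> s p = \<eta> s p"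
    by (elim exE conjE)
  from eventually_conj[OF i e] show ?thesis
  proof (rule eventually_mono)
    fix s assume s: "(isotopic_to \<xi>0 (\<zeta> s) \<and> isotopic_to (\<zeta> s) \<xi>0) \<and> (\<forall>p\<in>\<Union>(?O ` D) \<inter> points M. \<zeta> s p = \<eta> s p)"
    then have "\<zeta> s p = \<eta> s p" if "p \<in> points M" for p using that cov0 D(3) by blast
    then show "isotopic_to \<xi>0 (\<eta> s) \<and> isotopic_to (\<eta> s) \<xi>0"
      using s isotopic_to_cong[of \<xi>0 "\<zeta> s" \<xi>0 "\<eta> s"] isotopic_to_cong[of "\<zeta> s" \<xi>0 "\<eta> s" \<xi>0] by blast
  qed
qed

end

section \<open>Endomorphism fields\<close>

definition covector :: "('a \<Rightarrow> ((real^3) \<Rightarrow>\<^sub>L real)) \<Rightarrow> 'a \<Rightarrow> real^3" where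
  "covector \<alpha> x = (\<chi> i. blinfun_apply (\<alpha> x) (axis i 1))"

lemma covector_inner: "covector \<alpha> x \<bullet> v = blinfun_apply (\<alpha> x) v"
proof -
  have "linear (blinfun_apply (\<alpha> x))" by (rule bounded_linear.linear[OF blinfun.bounded_linear_right])
  from linear_axis3[OF this, of v] show ?thesis by (simp add: inner_3 covector_def mult.commute)
qed

lemma bounded_linear_vec_blinfun: "bounded_linear (\<lambda>\<phi> :: (real^3) \<Rightarrow>\<^sub>L real. (\<chi> i. blinfun_apply \<phi> (axis i 1)) :: real^3)"
proof -
  have "(\<lambda>\<phi> :: (real^3) \<Rightarrow>\<^sub>L real. (\<chi> i. blinfun_apply \<phi> (axis i 1)) :: real^3)
      = (\<lambda>\<phi>. \<Sum>i\<in>UNIV. blinfun_apply \<phi> (axis i 1) *\<^sub>R axis i (1::real))"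
    by (simp add: fun_eq_iff vec_eq_iff axis_def if_distrib cong: if_cong)
  then show ?thesis
    by (simp only:) (intro bounded_linear_sum bounded_linear_scaleR_left[THEN bounded_linear_compose]
      bounded_bilinear.bounded_linear_left[OF bounded_bilinear_blinfun_apply])
qed

lemma Cinf_covector: "Cinf U \<alpha> \<Longrightarrow> Cinf U (covector \<alpha>)"
  unfolding covector_def[abs_def] by (rule Cinf_linear_comp[OF bounded_linear_vec_blinfun])

lemma wedge_d_covector:
  assumes "Cinf U \<alpha>" "x \<in> U"
  shows "wedge2 (covector \<alpha>) (covector \<alpha>) x = 2 * wedge_d \<alpha> x"
proof -
  have "(covector \<alpha> has_derivative (\<lambda>u. \<chi> i. blinfun_apply (frechet_derivative \<alpha> (at x) u) (axis i 1))) (at x)"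
    unfolding covector_def[abs_def]
    by (rule bounded_linear.has_derivative[OF bounded_linear_vec_blinfun Cinf_has_derivative[OF assms]])
  from frechet_derivative_eq[OF this] show ?thesis
    by (simp add: wedge2_def curl_def curl_of_def wedge_d_def Let_def ext_deriv_def inner_3 covector_def)
qed

context closed_manifold3
begin

lemma plane_field_tangential: "plane_field M \<xi> \<Longrightarrow> tangential \<xi>"
  by (simp add: plane_field_def tangential_def)

lemma kernel_nonzero:
  assumes "plane_field M \<xi>" "c \<in> charts_at M p" "p \<in> points M" "in_chart c (\<xi> p) = {v. a \<bullet> v = 0}"
  shows "a \<noteq> 0"
proof
  assume "a = 0"
  then have "in_chart c (\<xi> p) = UNIV" using assms(4) by simp
  moreover have "dim (in_chart c (\<xi> p)) = 2" using assms(1-3) by (simp add: plane_field_def)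
  ultimately show False by simp
qed

lemma local_form_vector_form:
  assumes P: "plane_field M \<xi>" and c: "c \<in> atlas M" and l: "local_form \<xi> c W \<alpha>"
  shows "vector_form \<xi> c W (covector \<alpha>)" "\<And>x. x \<in> W \<Longrightarrow> wedge2 (covector \<alpha>) (covector \<alpha>) x = 2 * wedge_d \<alpha> x"
proof -
  have W: "open W" "W \<subseteq> img_ch c" and s: "smooth_on W \<alpha>"
    and k: "\<And>x. x \<in> W \<Longrightarrow> in_chart c (\<xi> (inv_ch c x)) = {v. covector \<alpha> x \<bullet> v = 0}"
    using l unfolding local_form_def covector_inner by auto
  have C: "Cinf W \<alpha>" using s smooth_on_open_iff[OF W(1)] by blast
  show "wedge2 (covector \<alpha>) (covector \<alpha>) x = 2 * wedge_d \<alpha> x" if "x \<in> W" for x by (rule wedge_d_covector[OF C that])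
  show "vector_form \<xi> c W (covector \<alpha>)"
    unfolding vector_form_def
  proof (intro conjI ballI W Cinf_covector[OF C])
    fix x assume x: "x \<in> W"
    then have xi: "x \<in> img_ch c" using W by blast
    show "in_chart c (\<xi> (inv_ch c x)) = {v. covector \<alpha> x \<bullet> v = 0}" by (rule k[OF x])
    have "inv_ch c x \<in> points M" using inv_dom[OF c xi] dom_sub[OF c] by blast
    then show "covector \<alpha> x \<noteq> 0" by (rule kernel_nonzero[OF P charts_atI[OF c inv_dom[OF c xi]] _ k[OF x]])
  qed
qed

section \<open>Comparing the local forms of one plane field\<close>

text \<open>Two forms with the same kernel are proportional; the factor is the quotient of their
  values on a common transverse vector, hence smooth and nowhere zero.\<close>

lemma form_compare:
  assumes T: "tangential \<xi>" and a: "vector_form \<xi> c W a" and b: "vector_form \<xi> d V b"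
    and cp: "c \<in> charts_at M p" and dp: "d \<in> charts_at M p" and pW: "map_ch c p \<in> W" and pV: "map_ch d p \<in> V"
  obtains U f where "open U" "map_ch c p \<in> U" "U \<subseteq> overlap c d" "U \<subseteq> W" "Cinf U f" "\<And>y. y \<in> U \<Longrightarrow> f y \<noteq> 0"
    "\<And>y. y \<in> U \<Longrightarrow> transition c d y \<in> V"
    "\<And>y. y \<in> U \<Longrightarrow> a y = f y *\<^sub>R pull_covector (DT c d y) (b (transition c d y))"
proof -
  note A = charts_atD[OF cp] charts_atD[OF dp]
  let ?x = "map_ch c p" and ?B = "\<lambda>x. pull_covector (DT c d x) (b (transition c d x))"
  let ?V = "{x \<in> overlap c d. transition c d x \<in> V}"
  have B: "vector_form \<xi> c ?V ?B" and Vo: "open ?V" by (rule vector_form_pull[OF b T A(1,3)])+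
  have xV: "?x \<in> ?V" using map_in_overlap[OF A(1,3,2,4)] pV by simp
  have Ca: "Cinf W a" and CB: "Cinf ?V ?B" using a B by (auto simp: vector_form_def)
  have Wo: "open W" by (rule Cinf_open[OF Ca])
  have ker: "{v. a y \<bullet> v = 0} = {v. ?B y \<bullet> v = 0}" if "y \<in> W" "y \<in> ?V" for y
    using a B that unfolding vector_form_def by blast
  \<comment> \<open>The form at the base point serves as the common transverse vector.\<close>
  let ?n = "a ?x"
  let ?U = "W \<inter> (?V \<inter> (\<lambda>y. ?B y \<bullet> ?n) -` (- {0}))"
  have "open (?V \<inter> (\<lambda>y. ?B y \<bullet> ?n) -` (- {0}))"
    by (rule continuous_open_preimage[OF Cinf_continuous[OF Cinf_inner[OF CB Cinf_const[OF Vo]]] Vo]) auto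
  then have U: "open ?U" using Wo by blast
  have an: "a y \<bullet> ?n \<noteq> 0" if "y \<in> ?U" for y
  proof
    assume "a y \<bullet> ?n = 0"
    then have "?n \<in> {v. ?B y \<bullet> v = 0}" using ker[of y] that by blast
    then show False using that by simp
  qed
  have nz: "?n \<noteq> 0" using a pW by (simp add: vector_form_def)
  have "?B ?x \<bullet> ?n \<noteq> 0"
  proof
    assume "?B ?x \<bullet> ?n = 0"
    then have "?n \<in> {v. a ?x \<bullet> v = 0}" using ker[OF pW xV] by blast
    then show False using nz by simp
  qed
  then have xU: "?x \<in> ?U" using pW xV by simp
  let ?f = "\<lambda>y. (a y \<bullet> ?n) / (?B y \<bullet> ?n)"
  show thesis
  proof (rule that[OF U xU])
    show "?U \<subseteq> overlap c d" "?U \<subseteq> W" by auto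
    show "Cinf ?U ?f"
      by (intro Cinf_divide Cinf_inner Cinf_const U Cinf_subset[OF Ca U] Cinf_subset[OF CB U]) auto
    fix y assume y: "y \<in> ?U"
    show "?f y \<noteq> 0" using y an[OF y] by simp
    show "transition c d y \<in> V" using y by simp
    have "a y /\<^sub>R (a y \<bullet> ?n) = ?B y /\<^sub>R (?B y \<bullet> ?n)"
    proof (rule covector_eq)
      show "{v. (a y /\<^sub>R (a y \<bullet> ?n)) \<bullet> v = 0} = {v. ?B y \<bullet> v = 0}"
        using ker[of y] y an[OF y] by auto
      show "(a y /\<^sub>R (a y \<bullet> ?n)) \<bullet> ?n = 1" using an[OF y] by simp
      show "?B y \<bullet> ?n \<noteq> 0" using y by simp
    qed
    then have "(a y \<bullet> ?n) *\<^sub>R (a y /\<^sub>R (a y \<bullet> ?n)) = (a y \<bullet> ?n) *\<^sub>R (?B y /\<^sub>R (?B y \<bullet> ?n))" by simp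
    then show "a y = ?f y *\<^sub>R ?B y" using an[OF y] by (simp add: divide_inverse)
  qed
qed

text \<open>\<open>E p c\<close> is the expression in the chart \<open>c\<close> of the endomorphism at \<open>p\<close>, and \<open>dual E c a\<close>
  represents the form \<open>\<alpha> \<circ> E\<close>.\<close>

definition endo :: "('p \<Rightarrow> 'p chart \<Rightarrow> real^3 \<Rightarrow> real^3) \<Rightarrow> bool" where
  "endo E \<longleftrightarrow> (\<forall>c\<in>atlas M. (\<forall>p\<in>dom_ch c. linear (E p c)) \<and> (\<forall>v. Cinf (img_ch c) (\<lambda>y. E (inv_ch c y) c v))) \<and>
    (\<forall>p\<in>points M. \<forall>c\<in>charts_at M p. \<forall>d\<in>charts_at M p. \<forall>v. E p d (DT c d (map_ch c p) v) = DT c d (map_ch c p) (E p c v))"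

definition dual :: "('p \<Rightarrow> 'p chart \<Rightarrow> real^3 \<Rightarrow> real^3) \<Rightarrow> 'p chart \<Rightarrow> (real^3 \<Rightarrow> real^3) \<Rightarrow> real^3 \<Rightarrow> real^3" where
  "dual E c a y = pull_covector (E (inv_ch c y) c) (a y)"

lemma endo_linear: "endo E \<Longrightarrow> c \<in> atlas M \<Longrightarrow> p \<in> dom_ch c \<Longrightarrow> linear (E p c)"
  and endo_Cinf: "endo E \<Longrightarrow> c \<in> atlas M \<Longrightarrow> Cinf (img_ch c) (\<lambda>y. E (inv_ch c y) c v)"
  and endo_DT: "endo E \<Longrightarrow> p \<in> points M \<Longrightarrow> c \<in> charts_at M p \<Longrightarrow> d \<in> charts_at M p \<Longrightarrow>
    E p d (DT c d (map_ch c p) v) = DT c d (map_ch c p) (E p c v)"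
  unfolding endo_def by blast+

lemma Cinf_dual: "endo E \<Longrightarrow> c \<in> atlas M \<Longrightarrow> U \<subseteq> img_ch c \<Longrightarrow> Cinf U a \<Longrightarrow> Cinf U (dual E c a)"
proof (rule Cinf_componentwise)
  assume E: "endo E" and c: "c \<in> atlas M" and U: "U \<subseteq> img_ch c" and a: "Cinf U a"
  show "open U" by (rule Cinf_open[OF a])
  show "Cinf U (\<lambda>x. dual E c a x $ i)" for i
    unfolding dual_def pull_covector_def vec_lambda_beta
    by (rule Cinf_inner[OF a Cinf_subset[OF endo_Cinf[OF E c] Cinf_open[OF a] U]])
qed

lemma dual_inner: "endo E \<Longrightarrow> c \<in> atlas M \<Longrightarrow> y \<in> img_ch c \<Longrightarrow> dual E c a y \<bullet> w = a y \<bullet> E (inv_ch c y) c w"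
  unfolding dual_def by (rule pull_covector_inner[OF endo_linear[OF _ _ inv_dom]])

text \<open>\<open>E\<close> commutes with changes of chart, so \<alpha> \<circ> E transforms
  exactly like \<alpha>, including the factor between local forms.\<close>

lemma dual_pull:
  assumes E: "endo E" and c: "c \<in> atlas M" and d: "d \<in> atlas M" and y: "y \<in> overlap c d"
    and a: "a y = r *\<^sub>R pull_covector (DT c d y) (b (transition c d y))"
  shows "dual E c a y = r *\<^sub>R pull_covector (DT c d y) (dual E d b (transition c d y))"
proof (rule vector_eq_rdot[THEN iffD1], rule allI)
  fix w
  have yi: "y \<in> img_ch c" using y by (simp add: overlap_def)
  let ?p = "inv_ch c y"
  have cp: "c \<in> charts_at M ?p" by (rule charts_atI[OF c inv_dom[OF c yi]])
  have dp: "d \<in> charts_at M ?p" using y d by (auto simp: overlap_def intro: charts_atI)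
  have pM: "?p \<in> points M" using inv_dom[OF c yi] dom_sub[OF c] by blast
  have m: "map_ch c ?p = y" by (rule map_inv[OF c yi])
  have Ti: "transition c d y \<in> img_ch d" using transition_in[OF c d y] by (simp add: overlap_def)
  have lin: "linear (DT c d y)" by (rule DT_linear[OF c d y])
  have "dual E c a y \<bullet> w = r * (b (transition c d y) \<bullet> DT c d y (E ?p c w))"
    using dual_inner[OF E c yi, of a w] a by (simp add: pull_covector_inner[OF lin])
  also have "DT c d y (E ?p c w) = E ?p d (DT c d y w)"
    using endo_DT[OF E pM cp dp, of w] m by simp
  also have "b (transition c d y) \<bullet> E ?p d (DT c d y w) = dual E d b (transition c d y) \<bullet> DT c d y w"
    using dual_inner[OF E d Ti, of b] inv_transition[OF c d y] by simp
  finally show "dual E c a y \<bullet> w = (r *\<^sub>R pull_covector (DT c d y) (dual E d b (transition c d y))) \<bullet> w"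
    by (simp add: pull_covector_inner[OF lin])
qed

text \<open>\<open>m\<close> is f^2 det from \<open>wedge2_pullback\<close>. One factor for all
  \<open>E\<close> is what later makes sums of endomorphisms comparable at a point.\<close>

lemma sign_compare:
  assumes T: "tangential \<xi>" and a: "vector_form \<xi> c W a" and b: "vector_form \<xi> d V b"
    and cp: "c \<in> charts_at M p" and dp: "d \<in> charts_at M p" and pW: "map_ch c p \<in> W" and pV: "map_ch d p \<in> V"
  obtains m where "m > 0" "wedge2 a a (map_ch c p) = m * wedge2 b b (map_ch d p)"
    "\<And>E. endo E \<Longrightarrow> wedge2 a (dual E c a) (map_ch c p) = m * wedge2 b (dual E d b) (map_ch d p)"
proof (rule form_compare[OF assms])
  fix U f assume U: "open U" "map_ch c p \<in> U" "U \<subseteq> overlap c d" "U \<subseteq> W" and f: "Cinf U f" "\<And>y. y \<in> U \<Longrightarrow> f y \<noteq> 0"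
    and TV: "\<And>y. y \<in> U \<Longrightarrow> transition c d y \<in> V"
    and ab: "\<And>y. y \<in> U \<Longrightarrow> a y = f y *\<^sub>R pull_covector (DT c d y) (b (transition c d y))"
  note A = charts_atD[OF cp] charts_atD[OF dp]
  let ?x = "map_ch c p"
  have Tx: "transition c d ?x = map_ch d p" using map_in_overlap[OF A(1,3,2,4)] by simp
  have CT: "Cinf U (transition c d)" by (rule Cinf_subset[OF Cinf_transition[OF A(1,3)] U(1,3)])
  have Cb: "Cinf V b" using b by (simp add: vector_form_def)
  have fd: "f differentiable (at ?x)" by (rule differentiableI[OF Cinf_has_derivative[OF f(1) U(2)]])
  have bd: "b differentiable (at (transition c d ?x))" unfolding Tx by (rule differentiableI[OF Cinf_has_derivative[OF Cb pV]])
  let ?m = "(f ?x)\<^sup>2 * det (matrix (DT c d ?x))"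
  have "?x \<in> overlap c d" using U by blast
  then have "?m > 0" using det_DT[OF A(1,3)] f(2)[OF U(2)] by simp
  moreover have "wedge2 a a ?x = ?m * wedge2 b b (map_ch d p)"
    using wedge2_pullback[OF CT U(2) fd bd bd ab ab] Tx by simp
  moreover have "wedge2 a (dual E c a) ?x = ?m * wedge2 b (dual E d b) (map_ch d p)" if E: "endo E" for E
  proof -
    have Vd: "V \<subseteq> img_ch d" using b by (simp add: vector_form_def)
    have Ed: "dual E d b differentiable (at (transition c d ?x))"
      unfolding Tx by (rule differentiableI[OF Cinf_has_derivative[OF Cinf_dual[OF E A(3) Vd Cb] pV]])
    have Ea: "dual E c a y = f y *\<^sub>R pull_covector (DT c d y) (dual E d b (transition c d y))" if "y \<in> U" for y
      using that U(3) ab[OF that] by (intro dual_pull[where y=y and a=a and b=b and r="f y" and c=c and d=d, OF E A(1,3)]) blast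
    show ?thesis using wedge2_pullback[OF CT U(2) fd bd Ed ab Ea] Tx by simp
  qed
  ultimately show thesis by (rule that)
qed

text \<open>The factor between two local forms enters \<open>\<alpha> \<and> d\<alpha>\<close> squared, so the sign does not depend on the
  form.\<close>

definition wedge_sign :: "'p field \<Rightarrow> 'p \<Rightarrow> real \<Rightarrow> bool" where
  "wedge_sign \<xi> p r \<longleftrightarrow> (\<exists>c\<in>charts_at M p. \<exists>W a. map_ch c p \<in> W \<and> vector_form \<xi> c W a \<and> sgn (wedge2 a a (map_ch c p)) = r)"

lemma wedge_sign_iff:
  assumes "tangential \<xi>" "c \<in> charts_at M p" "map_ch c p \<in> W" "vector_form \<xi> c W a"
  shows "wedge_sign \<xi> p r \<longleftrightarrow> sgn (wedge2 a a (map_ch c p)) = r"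
proof
  assume "wedge_sign \<xi> p r"
  then obtain d V b where b: "d \<in> charts_at M p" "map_ch d p \<in> V" "vector_form \<xi> d V b" "sgn (wedge2 b b (map_ch d p)) = r"
    unfolding wedge_sign_def by (elim bexE exE conjE)
  show "sgn (wedge2 a a (map_ch c p)) = r"
    by (rule sign_compare[OF assms(1,4) b(3) assms(2) b(1) assms(3) b(2)]) (use b(4) in \<open>simp add: sgn_mult\<close>)
next
  assume "sgn (wedge2 a a (map_ch c p)) = r"
  then show "wedge_sign \<xi> p r" unfolding wedge_sign_def using assms by blast
qed

lemma contact_at_wedge_sign:
  assumes "plane_field M \<xi>" "contact_at M \<xi> p"
  shows "wedge_sign \<xi> p 1"
proof -
  obtain c W \<alpha> where c: "c \<in> charts_at M p" "map_ch c p \<in> W" "local_form \<xi> c W \<alpha>" "wedge_d \<alpha> (map_ch c p) > 0"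
    using assms(2) unfolding contact_at_def by (elim bexE exE conjE)
  note l = local_form_vector_form[OF assms(1) charts_atD(1)[OF c(1)] c(3)]
  have "sgn (wedge2 (covector \<alpha>) (covector \<alpha>) (map_ch c p)) = 1" using l(2)[OF c(2)] c(4) by simp
  then show ?thesis unfolding wedge_sign_def using c l(1) by blast
qed

lemma confoliation_wedge_sign:
  assumes "confoliation M \<xi>" "p \<in> points M"
  shows "wedge_sign \<xi> p 1 \<or> wedge_sign \<xi> p 0"
proof -
  have P: "plane_field M \<xi>" using assms by (simp add: confoliation_def smooth_plane_field_def)
  obtain c W \<alpha> where c: "c \<in> charts_at M p" "map_ch c p \<in> W" "local_form \<xi> c W \<alpha>" "\<forall>x\<in>W. wedge_d \<alpha> x \<ge> 0"
    using assms unfolding confoliation_def by blast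
  note l = local_form_vector_form[OF P charts_atD(1)[OF c(1)] c(3)]
  have "wedge2 (covector \<alpha>) (covector \<alpha>) (map_ch c p) \<ge> 0" using l(2)[OF c(2)] c(2,4) by simp
  then have "sgn (wedge2 (covector \<alpha>) (covector \<alpha>) (map_ch c p)) = 1 \<or> sgn (wedge2 (covector \<alpha>) (covector \<alpha>) (map_ch c p)) = 0"
    by (auto simp: sgn_if)
  then show ?thesis unfolding wedge_sign_def using c l(1) by blast
qed

lemma contact_structure_wedge_sign:
  assumes "contact_structure M \<xi>" "p \<in> points M"
  shows "wedge_sign \<xi> p 1" "plane_field M \<xi>"
proof -
  show P: "plane_field M \<xi>" using assms by (simp add: contact_structure_def smooth_plane_field_def)
  have "contact_at M \<xi> p"
    using assms unfolding contact_structure_def contact_at_def by blast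
  then show "wedge_sign \<xi> p 1" by (rule contact_at_wedge_sign[OF P])
qed

lemma vector_form_exists_normal_form:
  assumes T: "tangential \<xi>" and p: "c \<in> charts_at M p" and v: "d \<in> charts_at M p" "map_ch d p \<in> V" "vector_form \<xi> d V b"
    and n: "n \<notin> in_chart c (\<xi> p)"
  obtains U where "map_ch c p \<in> U" "vector_form \<xi> c U (normal_form \<xi> c n)"
proof -
  \<comment> \<open>A constant family over a one-point filter turns the lemma on limits into one on
    a single plane field.\<close>
  have "converges_at (principal {()}) (\<lambda>_. \<xi>) \<xi> p"
  proof -
    have "Cinf V b" using v(3) by (simp add: vector_form_def)
    then show ?thesis
      unfolding converges_at_def using v C1lim_const[of V b]
      by (intro bexI[OF _ v(1)] exI[of _ V] exI[of _ "\<lambda>s. b"] exI[of _ b] conjI ballI) auto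
  qed
  moreover have "\<forall>\<^sub>F s in principal {()}. tangential \<xi>" using T by simp
  ultimately show thesis
  proof (rule converges_at_normal_form[OF _ _ T p n])
    fix U assume "map_ch c p \<in> U" "vector_form \<xi> c U (normal_form \<xi> c n)"
    then show thesis by (rule that)
  qed
qed

lemma wedge_sign_positive_field:
  assumes T: "tangential \<xi>" and w: "\<And>p. p \<in> points M \<Longrightarrow> wedge_sign \<xi> p 1"
  shows "positive_field \<xi>"
  unfolding positive_field_def
proof (intro ballI allI impI)
  fix c y n assume c: "c \<in> atlas M" and y: "y \<in> img_ch c" and n: "n \<notin> in_chart c (\<xi> (inv_ch c y))"
  let ?p = "inv_ch c y"
  have p: "?p \<in> points M" using inv_dom[OF c y] dom_sub[OF c] by blast
  have cp: "c \<in> charts_at M ?p" by (rule charts_atI[OF c inv_dom[OF c y]])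
  have m: "map_ch c ?p = y" by (rule map_inv[OF c y])
  obtain d V b where b: "d \<in> charts_at M ?p" "map_ch d ?p \<in> V" "vector_form \<xi> d V b"
    using w[OF p] unfolding wedge_sign_def by (elim bexE exE conjE)
  show "0 < wedge2 (normal_form \<xi> c n) (normal_form \<xi> c n) y"
  proof (rule vector_form_exists_normal_form[OF T cp b n])
    fix U assume U: "map_ch c ?p \<in> U" "vector_form \<xi> c U (normal_form \<xi> c n)"
    have "sgn (wedge2 (normal_form \<xi> c n) (normal_form \<xi> c n) (map_ch c ?p)) = 1"
      using wedge_sign_iff[OF T cp U] w[OF p] by blast
    then show ?thesis using m by (simp add: sgn_1_pos)
  qed
qed

end

lemma wedge2_add_scaleR:
  assumes "b1 differentiable (at x)" "b2 differentiable (at x)"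
  shows "wedge2 a (\<lambda>y. b1 y + r *\<^sub>R b2 y) x = wedge2 a b1 x + r * wedge2 a b2 x"
  by (simp add: wedge2_def curl_add_scaleR[OF assms] inner_add_left inner_add_right algebra_simps)

lemma wedge2_commute: "wedge2 a b x = wedge2 b a x"
  by (simp add: wedge2_def)

lemma wedge2_square:
  assumes "a differentiable (at x)" "b differentiable (at x)"
  shows "wedge2 (\<lambda>y. a y + r *\<^sub>R b y) (\<lambda>y. a y + r *\<^sub>R b y) x
    = wedge2 a a x + r * (2 * wedge2 a b x + r * wedge2 b b x)"
proof -
  let ?c = "\<lambda>y. a y + r *\<^sub>R b y"
  have "wedge2 ?c ?c x = wedge2 ?c a x + r * wedge2 ?c b x" by (rule wedge2_add_scaleR[OF assms])
  also have "wedge2 ?c a x = wedge2 a ?c x" by (rule wedge2_commute)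
  also have "\<dots> = wedge2 a a x + r * wedge2 a b x" by (rule wedge2_add_scaleR[OF assms])
  also have "wedge2 ?c b x = wedge2 b ?c x" by (rule wedge2_commute)
  also have "\<dots> = wedge2 b a x + r * wedge2 b b x" by (rule wedge2_add_scaleR[OF assms])
  also have "wedge2 b a x = wedge2 a b x" by (rule wedge2_commute)
  finally show ?thesis by (simp add: algebra_simps)
qed

lemma wedge2_cong:
  assumes "open U" "x \<in> U" "\<And>y. y \<in> U \<Longrightarrow> b y = b' y" "b differentiable (at x)"
  shows "wedge2 a b x = wedge2 a b' x"
proof -
  have "(b' has_derivative frechet_derivative b (at x)) (at x)"
    by (rule has_derivative_transform_within_open[OF assms(4)[unfolded frechet_derivative_works] assms(1-3)])
  from frechet_derivative_eq[OF this] show ?thesis using assms(2,3) by (simp add: wedge2_def curl_def)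
qed

context closed_manifold3
begin

text \<open>The counterpart of \<open>eventually_on_compact\<close> on the manifold, with
  neighbourhoods described in charts.\<close>

lemma points_eventually:
  assumes "\<And>p. p \<in> points M \<Longrightarrow> \<exists>c\<in>charts_at M p. \<forall>\<^sub>F z in F \<times>\<^sub>F nhds (map_ch c p). Q (fst z) (inv_ch c (snd z))"
  shows "\<forall>\<^sub>F s in F. \<forall>p\<in>points M. Q s p"
proof -
  let ?\<U> = "{U. openin (mtop M) U \<and> (\<forall>\<^sub>F s in F. \<forall>p\<in>U. Q s p)}"
  have "\<exists>U\<in>?\<U>. p \<in> U" if p: "p \<in> points M" for p
  proof -
    obtain c where c: "c \<in> charts_at M p" and e: "\<forall>\<^sub>F z in F \<times>\<^sub>F nhds (map_ch c p). Q (fst z) (inv_ch c (snd z))"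
      using assms[OF p] by blast
    note A = charts_atD[OF c]
    obtain P V where PV: "eventually P F" "open V" "map_ch c p \<in> V" "\<And>s y. P s \<Longrightarrow> y \<in> V \<Longrightarrow> Q (fst (s, y)) (inv_ch c (snd (s, y)))"
      using e by (rule eventually_prodE) auto
    let ?U = "{p' \<in> dom_ch c. map_ch c p' \<in> V}"
    have "\<forall>\<^sub>F s in F. \<forall>p\<in>?U. Q s p"
      using PV(1)
    proof (rule eventually_mono)
      fix s assume "P s"
      then show "\<forall>p\<in>?U. Q s p" using PV(4)[of s] inv_map[OF A(1)] by (metis (mono_tags, lifting) fst_conv snd_conv mem_Collect_eq)
    qed
    moreover have "openin (mtop M) ?U" by (rule openin_chart_preimage[OF A(1) PV(2)])
    ultimately show ?thesis using A PV(3) by (intro bexI[of _ ?U]) simp_all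
  qed
  then have "points M \<subseteq> \<Union>?\<U>" by blast
  then obtain \<F> where \<F>: "finite \<F>" "\<F> \<subseteq> ?\<U>" "points M \<subseteq> \<Union>\<F>"
    using compact_M[unfolded compact_space_alt, rule_format, of ?\<U>] by blast
  have "\<forall>\<^sub>F s in F. \<forall>U\<in>\<F>. \<forall>p\<in>U. Q s p"
    by (rule eventually_ball_finite[OF \<F>(1)]) (use \<F>(2) in blast)
  then show ?thesis
    by (rule eventually_mono) (use \<F>(3) in blast)
qed

section \<open>Pairing a plane field with an endomorphism field\<close>

definition smooth_field :: "'p field \<Rightarrow> bool" where
  "smooth_field \<xi> \<longleftrightarrow> tangential \<xi> \<and> (\<forall>p\<in>points M. \<exists>c\<in>charts_at M p. \<exists>W a. map_ch c p \<in> W \<and> vector_form \<xi> c W a)"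

lemma smooth_field_tangential: "smooth_field \<xi> \<Longrightarrow> tangential \<xi>"
  by (simp add: smooth_field_def)

text \<open>The definition provides a form in some chart; a transverse vector is carried to the
  chart \<open>c\<close>, where the normalised form for it exists.\<close>

lemma vector_form_exists:
  assumes \<xi>: "smooth_field \<xi>" and p: "p \<in> points M" and c: "c \<in> charts_at M p"
  obtains W a where "map_ch c p \<in> W" "vector_form \<xi> c W a"
proof -
  obtain d V b where b: "d \<in> charts_at M p" "map_ch d p \<in> V" "vector_form \<xi> d V b"
    using \<xi> p unfolding smooth_field_def by blast
  have T: "tangential \<xi>" by (rule smooth_field_tangential[OF \<xi>])
  let ?b = "b (map_ch d p)"
  have "?b \<noteq> 0" "in_chart d (\<xi> (inv_ch d (map_ch d p))) = {v. ?b \<bullet> v = 0}"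
    using b by (auto simp: vector_form_def)
  then have "?b \<notin> in_chart d (\<xi> p)" using inv_map[OF charts_atD[OF b(1)]] by simp
  moreover have "\<xi> p \<subseteq> tangent_space M p" using T p by (simp add: tangential_def)
  ultimately have "DT d c (map_ch d p) ?b \<notin> in_chart c (\<xi> p)"
    using mem_in_chart_change[OF _ b(1) c] by blast
  then show thesis
    by (rule vector_form_exists_normal_form[OF T c b]) (rule that)
qed

text \<open>The pairing is computed in an arbitrary but fixed local form, so it is only meaningful up to a
  positive factor that depends on the point, not on \<open>E\<close>.\<close>

definition pairing :: "'p field \<Rightarrow> ('p \<Rightarrow> 'p chart \<Rightarrow> real^3 \<Rightarrow> real^3) \<Rightarrow> 'p \<Rightarrow> real" where
  "pairing \<xi> E p = (let (c, W, a) = (SOME (c, W, a). c \<in> charts_at M p \<and> map_ch c p \<in> W \<and> vector_form \<xi> c W a)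
     in wedge2 a (dual E c a) (map_ch c p))"

lemma pairing_factor:
  assumes T: "tangential \<xi>" and c: "c \<in> charts_at M p" "map_ch c p \<in> W" "vector_form \<xi> c W a"
  obtains m where "m > 0" "\<And>E. endo E \<Longrightarrow> wedge2 a (dual E c a) (map_ch c p) = m * pairing \<xi> E p"
proof -
  let ?P = "\<lambda>(c, W, a). c \<in> charts_at M p \<and> map_ch c p \<in> W \<and> vector_form \<xi> c W a"
  obtain d V b where s: "Eps ?P = (d, V, b)" by (cases "Eps ?P") auto
  have "?P (Eps ?P)" by (rule someI[of ?P "(c, W, a)"]) (use c in simp)
  then have d: "d \<in> charts_at M p" "map_ch d p \<in> V" "vector_form \<xi> d V b" unfolding s by simp_all
  have e: "pairing \<xi> E p = wedge2 b (dual E d b) (map_ch d p)" for E unfolding pairing_def s by simp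
  show thesis
    by (rule sign_compare[OF T c(3) d(3) c(1) d(1) c(2) d(2)]) (use that e in simp)
qed

lemma pairing_sgn:
  assumes "tangential \<xi>" "c \<in> charts_at M p" "map_ch c p \<in> W" "vector_form \<xi> c W a" "endo E"
  shows "sgn (pairing \<xi> E p) = sgn (wedge2 a (dual E c a) (map_ch c p))"
  by (rule pairing_factor[OF assms(1-4)]) (use assms(5) in \<open>simp add: sgn_mult\<close>)

lemma dual_differentiable:
  assumes "endo E" "c \<in> charts_at M p" "map_ch c p \<in> W" "vector_form \<xi> c W a"
  shows "dual E c a differentiable (at (map_ch c p))" "a differentiable (at (map_ch c p))"
proof -
  have "Cinf W a" "W \<subseteq> img_ch c" using assms by (auto simp: vector_form_def)
  note C = this(1) Cinf_dual[OF assms(1) charts_atD(1)[OF assms(2)] this(2,1)]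
  show "dual E c a differentiable (at (map_ch c p))" "a differentiable (at (map_ch c p))"
    using Cinf_has_derivative[OF C(1) assms(3)] Cinf_has_derivative[OF C(2) assms(3)] by (auto intro: differentiableI)
qed

definition endo_sum :: "'i set \<Rightarrow> ('i \<Rightarrow> real) \<Rightarrow> ('i \<Rightarrow> 'p \<Rightarrow> 'p chart \<Rightarrow> real^3 \<Rightarrow> real^3) \<Rightarrow>
    'p \<Rightarrow> 'p chart \<Rightarrow> real^3 \<Rightarrow> real^3" where
  "endo_sum I r E = (\<lambda>p c v. \<Sum>i\<in>I. r i *\<^sub>R E i p c v)"

lemma endo_endo_sum:
  assumes "\<And>i. i \<in> I \<Longrightarrow> endo (E i)"
  shows "endo (endo_sum I r E)"
  unfolding endo_def endo_sum_def
proof (intro conjI ballI allI)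
  fix c v assume c: "c \<in> atlas M"
  show "linear (\<lambda>v. \<Sum>i\<in>I. r i *\<^sub>R E i p c v)" if "p \<in> dom_ch c" for p
    by (intro linear_compose_sum ballI linear_compose_scale_right endo_linear[OF assms c that])
  show "Cinf (img_ch c) (\<lambda>y. \<Sum>i\<in>I. r i *\<^sub>R E i (inv_ch c y) c v)"
    by (intro Cinf_sum Cinf_scaleR Cinf_const img_open[OF c] endo_Cinf[OF assms c])
next
  fix p c d v assume p: "p \<in> points M" "c \<in> charts_at M p" "d \<in> charts_at M p"
  note A = charts_atD[OF p(2)] charts_atD[OF p(3)]
  have "map_ch c p \<in> overlap c d" using map_in_overlap[OF A(1,3,2,4)] by simp
  from DT_linear[OF A(1,3) this]
  show "(\<Sum>i\<in>I. r i *\<^sub>R E i p d (DT c d (map_ch c p) v)) = DT c d (map_ch c p) (\<Sum>i\<in>I. r i *\<^sub>R E i p c v)"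
    using endo_DT[OF assms p] by (simp add: linear_sum linear_scale)
qed

lemma dual_endo_sum: "dual (endo_sum I r E) c a y = (\<Sum>i\<in>I. r i *\<^sub>R dual (E i) c a y)"
  by (simp add: dual_def endo_sum_def pull_covector_def vec_eq_iff inner_sum_right)

lemma dual_endo_sum_insert:
  "finite I \<Longrightarrow> i \<notin> I \<Longrightarrow> dual (endo_sum (insert i I) r E) c a = (\<lambda>y. dual (endo_sum I r E) c a y + r i *\<^sub>R dual (E i) c a y)"
  by (simp add: fun_eq_iff dual_endo_sum add.commute)

text \<open>Additivity is proved for one local form and transferred by the positive factor
  \<open>m\<close>, which is the same for all summands.\<close>

lemma pairing_endo_sum:
  assumes \<xi>: "smooth_field \<xi>" and p: "p \<in> points M" and "finite I" and E: "\<And>i. i \<in> I \<Longrightarrow> endo (E i)"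
  shows "pairing \<xi> (endo_sum I r E) p = (\<Sum>i\<in>I. r i * pairing \<xi> (E i) p)"
proof -
  obtain c where c: "c \<in> charts_at M p" using chart_exists[OF p] by blast
  obtain W a where a: "map_ch c p \<in> W" "vector_form \<xi> c W a" using vector_form_exists[OF \<xi> p c] .
  obtain m where m: "m > 0" "\<And>E. endo E \<Longrightarrow> wedge2 a (dual E c a) (map_ch c p) = m * pairing \<xi> E p"
    using pairing_factor[OF smooth_field_tangential[OF \<xi>] c a] by blast
  have "wedge2 a (dual (endo_sum I r E) c a) (map_ch c p) = (\<Sum>i\<in>I. r i * wedge2 a (dual (E i) c a) (map_ch c p))"
    using \<open>finite I\<close> E
  proof (induction I rule: finite_induct)
    case empty
    have "curl (\<lambda>y. 0) x = 0" for x
      using frechet_derivative_eq[OF has_derivative_const, of 0 x] by (simp add: curl_def curl_of_def vec_eq_iff forall_3)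
    then have "wedge2 a (\<lambda>y. 0) (map_ch c p) = 0" by (simp add: wedge2_def)
    moreover have "dual (endo_sum {} r E) c a = (\<lambda>y. 0)" by (simp add: fun_eq_iff dual_endo_sum)
    ultimately show ?case by simp
  next
    case (insert i I)
    have i: "endo (E i)" and I: "endo (endo_sum I r E)" using insert.prems by (auto intro: endo_endo_sum)
    show ?case
      using insert.IH insert.hyps insert.prems
      by (simp add: dual_endo_sum_insert wedge2_add_scaleR[OF dual_differentiable(1)[OF I c a] dual_differentiable(1)[OF i c a]])
  qed
  also have "\<dots> = (\<Sum>i\<in>I. m * (r i * pairing \<xi> (E i) p))"
    by (rule sum.cong) (simp_all add: m(2)[OF E])
  also have "\<dots> = m * (\<Sum>i\<in>I. r i * pairing \<xi> (E i) p)" by (simp add: sum_distrib_left)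
  finally have "m * pairing \<xi> (endo_sum I r E) p = m * (\<Sum>i\<in>I. r i * pairing \<xi> (E i) p)"
    using m(2)[OF endo_endo_sum[of I E r]] E by simp
  then show ?thesis using m(1) by simp
qed

text \<open>The endomorphism with matrix field \<open>B\<close> in \<open>c\<close>, conjugated into
  other charts and extended by 0.\<close>

definition local_endo :: "'p chart \<Rightarrow> (real^3 \<Rightarrow> real^3 \<Rightarrow> real^3) \<Rightarrow> 'p \<Rightarrow> 'p chart \<Rightarrow> real^3 \<Rightarrow> real^3" where
  "local_endo c B p d v = (if p \<in> dom_ch c then DT c d (map_ch c p) (B (map_ch c p) (DT d c (map_ch d p) v)) else 0)"

lemma local_endo_same: "c \<in> charts_at M p \<Longrightarrow> local_endo c B p c v = B (map_ch c p) v"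
  using charts_atD[of c p] by (simp add: local_endo_def DT_self)

lemma endo_local_endo:
  assumes c: "c \<in> atlas M" and K: "compact K" "K \<subseteq> img_ch c"
    and lin: "\<And>y. linear (B y)" and B: "\<And>v. Cinf (img_ch c) (\<lambda>y. B y v)" and B0: "\<And>y v. y \<in> img_ch c - K \<Longrightarrow> B y v = 0"
  shows "endo (local_endo c B)"
  unfolding endo_def
proof (intro conjI ballI allI)
  fix d v assume d: "d \<in> atlas M"
  have lin2: "linear (DT c d (map_ch c p))" "linear (DT d c (map_ch d p))" if "p \<in> dom_ch c" "p \<in> dom_ch d" for p
    using DT_linear[OF c d, of "map_ch c p"] DT_linear[OF d c, of "map_ch d p"] map_in_overlap[OF c d that] map_in_overlap[OF d c that(2,1)]
    by auto
  show "linear (\<lambda>v. local_endo c B p d v)" if p: "p \<in> dom_ch d" for p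
  proof (cases "p \<in> dom_ch c")
    case True
    from linear_compose[OF linear_compose[OF lin2(2)[OF True p] lin] lin2(1)[OF True p]] True
    show ?thesis by (simp add: local_endo_def o_def)
  qed (simp add: local_endo_def linear_zero)
  let ?T = "transition d c"
  let ?Z = "{y \<in> img_ch d. inv_ch d y \<in> points M - inv_ch c ` K}"
  note CT = Cinf_transition[OF d c]
  have oT: "open (overlap d c)" by (rule overlap_open[OF d c])
  have Tsub: "?T ` overlap d c \<subseteq> overlap c d" using transition_in[OF d c] by blast
  have inner: "Cinf (overlap d c) (\<lambda>y. B (?T y) (DT d c y v))"
  proof -
    have "Cinf (overlap d c) (\<lambda>y. \<Sum>i\<in>Basis. (DT d c y v \<bullet> i) *\<^sub>R B (?T y) i)"
      by (intro Cinf_sum Cinf_scaleR Cinf_inner Cinf_derivative CT Cinf_const oT Cinf_compose[OF CT B])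
        (use Tsub in \<open>auto simp: overlap_def\<close>)
    then show ?thesis by (rule Cinf_cong) (rule linear_basis_sum[OF lin, symmetric])
  qed
  have 1: "Cinf (overlap d c) (\<lambda>y. local_endo c B (inv_ch d y) d v)"
  proof (rule Cinf_cong[OF Cinf_derivative_varying[OF Cinf_transition[OF c d] CT inner Tsub]])
    fix y assume y: "y \<in> overlap d c"
    then have "inv_ch d y \<in> dom_ch c" "map_ch c (inv_ch d y) = ?T y" "map_ch d (inv_ch d y) = y"
      using map_inv[OF d] by (auto simp: overlap_def transition_eq)
    then show "DT c d (?T y) (B (?T y) (DT d c y v)) = local_endo c B (inv_ch d y) d v" by (simp add: local_endo_def)
  qed
  have "closedin (mtop M) (inv_ch c ` K)" by (rule closedin_inv_image[OF c K])
  then have oZ: "open ?Z" by (intro open_inv_preimage[OF d] openin_diff openin_topspace)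
  have 2: "Cinf ?Z (\<lambda>y. local_endo c B (inv_ch d y) d v)"
  proof (rule Cinf_cong[OF Cinf_const[OF oZ]])
    fix y assume y: "y \<in> ?Z"
    let ?p = "inv_ch d y"
    show "0 = local_endo c B ?p d v"
    proof (cases "?p \<in> dom_ch c")
      case True
      have "map_ch c ?p \<in> img_ch c - K" using True y inv_map[OF c True] by force
      then have "B (map_ch c ?p) (DT d c (map_ch d ?p) v) = 0" by (rule B0)
      moreover have "linear (DT c d (map_ch c ?p))" by (rule lin2[OF True]) (use y inv_dom[OF d] in auto)
      ultimately show ?thesis using True by (simp add: local_endo_def linear_0)
    qed (simp add: local_endo_def)
  qed
  show "Cinf (img_ch d) (\<lambda>y. local_endo c B (inv_ch d y) d v)"
  proof (rule Cinf_local[OF _ img_open[OF d]])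
    fix y assume y: "y \<in> img_ch d"
    show "\<exists>V. y \<in> V \<and> Cinf V (\<lambda>y. local_endo c B (inv_ch d y) d v)"
    proof (cases "y \<in> overlap d c")
      case True
      then show ?thesis using 1 by blast
    next
      case False
      have "inv_ch d y \<notin> inv_ch c ` K"
        using False y inv_dom[OF c] K(2) by (auto simp: overlap_def)
      then have "y \<in> ?Z" using y subsetD[OF dom_sub[OF d] inv_dom[OF d y]] by simp
      then show ?thesis using 2 by (intro exI conjI)
    qed
  qed
next
  fix p d e v assume p: "p \<in> points M" and d: "d \<in> charts_at M p" and e: "e \<in> charts_at M p"
  note A = charts_atD[OF d] charts_atD[OF e]
  show "local_endo c B p e (DT d e (map_ch d p) v) = DT d e (map_ch d p) (local_endo c B p d v)"
  proof (cases "p \<in> dom_ch c")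
    case True
    then have cp: "c \<in> charts_at M p" by (rule charts_atI[OF c])
    show ?thesis unfolding local_endo_def if_P[OF True] DT_chain[OF d e cp] DT_chain[OF cp d e] ..
  next
    case False
    have "map_ch d p \<in> overlap d e" using map_in_overlap[OF A(1,3,2,4)] by simp
    from linear_0[OF DT_linear[OF A(1,3) this]] show ?thesis unfolding local_endo_def if_not_P[OF False] by simp
  qed
qed

end

section \<open>Positivity along the integral surface\<close>

text \<open>Used at boundary points of the surface, where a curve lies on the surface for
  nonnegative parameters only.\<close>

lemma right_derivative_0:
  fixes f :: "real \<Rightarrow> real"
  assumes "(f has_real_derivative D) (at 0)" "r > 0" "\<And>t. 0 \<le> t \<Longrightarrow> t < r \<Longrightarrow> f t = 0"
  shows "D = 0"
proof (rule tendsto_unique[of "at_right 0"])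
  have "((\<lambda>h. (f (0 + h) - f 0) / h) \<longlongrightarrow> D) (at 0)" using assms(1) by (simp add: DERIV_def)
  then show "((\<lambda>h. (f (0 + h) - f 0) / h) \<longlongrightarrow> D) (at_right 0)" by (rule filterlim_mono[OF _ order_refl at_le]) simp
  have "\<forall>\<^sub>F h in at_right 0. h \<in> {0<..<r}" by (rule eventually_at_right_real[OF assms(2)])
  then have "\<forall>\<^sub>F h in at_right 0. 0 = (f (0 + h) - f 0) / h"
    by (rule eventually_mono) (use assms(2,3) in auto)
  then show "((\<lambda>h. (f (0 + h) - f 0) / h) \<longlongrightarrow> 0) (at_right 0)"
    by (rule Lim_transform_eventually[OF tendsto_const])
qed simp

section \<open>The local model: a bump times a rotation\<close>

text \<open>The form -r^2 d\<theta> around the vertical axis through \<open>q\<close>. With this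
  sign a radially decreasing factor contributes positively to the vertical component of the
  curl.\<close>

definition rotation_form :: "real^3 \<Rightarrow> real^3 \<Rightarrow> real^3" where
  "rotation_form q y = vector [y $ 2 - q $ 2, q $ 1 - y $ 1, 0]"

text \<open>Inside the ball this is exp(-L/m) with m = R^2 - |y - q|^2; a large L makes it
  steep.\<close>

definition bump_at :: "real^3 \<Rightarrow> real \<Rightarrow> real \<Rightarrow> real^3 \<Rightarrow> real" where
  "bump_at q R L y = bump ((R\<^sup>2 - (y - q) \<bullet> (y - q)) / L)"

lemma Cinf_rotation_form: "Cinf UNIV (rotation_form q)"
proof (rule Cinf_componentwise[OF open_UNIV])
  fix i :: 3
  have "Cinf UNIV (\<lambda>y :: real^3. y $ 2 - q $ 2)" "Cinf UNIV (\<lambda>y :: real^3. q $ 1 - y $ 1)" "Cinf UNIV (\<lambda>y :: real^3. 0 :: real)"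
    by (intro Cinf_diff Cinf_vec_nth Cinf_const Cinf_id open_UNIV)+
  then show "Cinf UNIV (\<lambda>x. rotation_form q x $ i)"
    using exhaust_3[of i] by (elim disjE) (simp_all add: rotation_form_def)
qed

lemma Cinf_bump_at: "L > 0 \<Longrightarrow> Cinf UNIV (bump_at q R L)"
  unfolding bump_at_def[abs_def]
  by (intro Cinf_compose_UNIV[OF Cinf_bump] Cinf_divide Cinf_diff Cinf_inner Cinf_const Cinf_id open_UNIV) simp

lemma rotation_form_deriv: "(rotation_form q has_derivative (\<lambda>u. vector [u $ 2, - u $ 1, 0])) (at x)"
proof (subst has_derivative_componentwise_within, rule ballI)
  fix j :: "real^3" assume "j \<in> Basis"
  then obtain i where j: "j = axis i 1" by (auto simp: Basis_vec_def)
  have 1: "((\<lambda>y :: real^3. y $ 2 - q $ 2) has_derivative (\<lambda>u. u $ 2)) (at x)"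
    by (auto intro!: derivative_eq_intros bounded_linear_imp_has_derivative bounded_linear_vec_nth)
  have 2: "((\<lambda>y :: real^3. q $ 1 - y $ 1) has_derivative (\<lambda>u. - u $ 1)) (at x)"
    by (auto intro!: derivative_eq_intros bounded_linear_imp_has_derivative bounded_linear_vec_nth)
  show "((\<lambda>y. rotation_form q y \<bullet> j) has_derivative (\<lambda>u. vector [u $ 2, - u $ 1, 0] \<bullet> j)) (at x)"
    using exhaust_3[of i] 1 2 by (elim disjE) (simp_all add: j inner_axis rotation_form_def)
qed

lemma bump_at_deriv:
  assumes "L > 0"
  shows "(bump_at q R L has_derivative (\<lambda>u. bump_power 2 ((R\<^sup>2 - (x - q) \<bullet> (x - q)) / L) * (- 2 * ((x - q) \<bullet> u) / L))) (at x)"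
proof -
  have "((\<lambda>y. (R\<^sup>2 - (y - q) \<bullet> (y - q)) / L) has_derivative (\<lambda>u. - 2 * ((x - q) \<bullet> u) / L)) (at x)"
    using assms by (auto intro!: derivative_eq_intros simp: inner_commute)
  from has_derivative_compose[OF this bump_deriv[unfolded has_field_derivative_def]]
  show ?thesis unfolding bump_at_def[abs_def] .
qed

text \<open>Where \<open>a\<close> is vertical only the third component of the curl matters. The
  derivative of the bump gives the first summand; \<open>h\<close> collects everything multiplied by
  the bump itself. The factor a $ 3 in the form makes the leading term a square, so the sign of
  \<open>a\<close> is irrelevant.\<close>

lemma rotation_wedge:
  fixes R :: real
  assumes a: "Cinf W a" and x: "x \<in> W" "a x $ 1 = 0" "a x $ 2 = 0" "x $ 3 = q $ 3" and L: "L > 0"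
  defines "m \<equiv> R\<^sup>2 - (x - q) \<bullet> (x - q)"
    and "h \<equiv> - (frechet_derivative a (at x) (axis 1 1) $ 3 * (x $ 1 - q $ 1) + frechet_derivative a (at x) (axis 2 1) $ 3 * (x $ 2 - q $ 2))
      - 2 * a x $ 3 + rotation_form q x \<bullet> curl a x"
  shows "wedge2 a (\<lambda>y. (bump_at q R L y * a y $ 3) *\<^sub>R rotation_form q y) x
    = a x $ 3 * (bump_power 2 (m / L) * (2 * a x $ 3 * ((x - q) \<bullet> (x - q)) / L) + bump (m / L) * h)"
proof -
  let ?D = "frechet_derivative a (at x)"
  let ?g' = "\<lambda>u. bump (m / L) * ?D u $ 3 + bump_power 2 (m / L) * (- 2 * ((x - q) \<bullet> u) / L) * a x $ 3"
  have g: "((\<lambda>y. bump_at q R L y * a y $ 3) has_derivative ?g') (at x)"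
    using has_derivative_mult[OF bump_at_deriv[OF L] bounded_linear.has_derivative[OF bounded_linear_vec_nth Cinf_has_derivative[OF a x(1)]]]
    by (simp add: bump_at_def m_def)
  have c: "curl (\<lambda>y. g y *\<^sub>R rotation_form q y) x $ 3 = - 2 * g x - g' (axis 1 1) * (x $ 1 - q $ 1) - g' (axis 2 1) * (x $ 2 - q $ 2)"
    if "(g has_derivative g') (at x)" for g g'
    unfolding curl_def frechet_derivative_eq[OF has_derivative_scaleR[OF that rotation_form_deriv]]
    by (simp add: curl_of_def rotation_form_def algebra_simps)
  have "wedge2 a (\<lambda>y. (bump_at q R L y * a y $ 3) *\<^sub>R rotation_form q y) x
      = a x $ 3 * curl (\<lambda>y. (bump_at q R L y * a y $ 3) *\<^sub>R rotation_form q y) x $ 3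
        + bump (m / L) * a x $ 3 * (rotation_form q x \<bullet> curl a x)"
    using x by (simp add: wedge2_def inner_3[of "a x"] bump_at_def m_def)
  also have "\<dots> = a x $ 3 * (bump_power 2 (m / L) * (2 * a x $ 3 * ((x $ 1 - q $ 1)\<^sup>2 + (x $ 2 - q $ 2)\<^sup>2) / L) + bump (m / L) * h)"
    unfolding c[OF g] h_def using L by (simp add: inner_axis bump_at_def m_def field_simps power2_eq_square)
  also have "(x $ 1 - q $ 1)\<^sup>2 + (x $ 2 - q $ 2)\<^sup>2 = (x - q) \<bullet> (x - q)"
    using x(4) by (simp add: inner_3 power2_eq_square)
  finally show ?thesis .
qed

text \<open>\<open>bump_power 2\<close> is (L/m)^2 times the bump, so the leading term carries 2 L n
  / m^2 with n = |x - q|^2, against a bounded \<open>h\<close>. It wins for large L as soon as n is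
  bounded below, hence the exclusion of a small ball around the centre.\<close>

lemma rotation_wedge_positive:
  assumes a: "Cinf W a" and S: "compact S" "S \<subseteq> W" and "\<epsilon> > 0" "R > 0"
    and SP: "\<And>x. x \<in> S \<Longrightarrow> a x \<noteq> 0 \<and> a x $ 1 = 0 \<and> a x $ 2 = 0 \<and> x $ 3 = q $ 3"
  obtains L where "L > 0"
    "\<And>x. x \<in> S \<Longrightarrow> \<epsilon> \<le> norm (x - q) \<Longrightarrow> 0 \<le> wedge2 a (\<lambda>y. (bump_at q R L y * a y $ 3) *\<^sub>R rotation_form q y) x"
    "\<And>x. x \<in> S \<Longrightarrow> \<epsilon> \<le> norm (x - q) \<Longrightarrow> norm (x - q) < R \<Longrightarrow>
      0 < wedge2 a (\<lambda>y. (bump_at q R L y * a y $ 3) *\<^sub>R rotation_form q y) x"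
proof -
  define h where "h x = - (frechet_derivative a (at x) (axis 1 1) $ 3 * (x $ 1 - q $ 1) + frechet_derivative a (at x) (axis 2 1) $ 3 * (x $ 2 - q $ 2))
      - 2 * a x $ 3 + rotation_form q x \<bullet> curl a x" for x
  have o: "open W" by (rule Cinf_open[OF a])
  have "Cinf W h"
    unfolding h_def[abs_def]
    by (intro Cinf_add Cinf_diff Cinf_minus Cinf_mult Cinf_inner Cinf_vec_nth Cinf_derivative a Cinf_const o Cinf_id Cinf_curl
        Cinf_subset[OF Cinf_rotation_form o]) simp
  then have "continuous_on S h" using Cinf_continuous S(2) continuous_on_subset by blast
  from compact_imp_bounded[OF compact_continuous_image[OF this S(1)]]
  obtain H where H: "H > 0" "\<And>x. x \<in> S \<Longrightarrow> \<bar>h x\<bar> \<le> H"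
    unfolding bounded_pos by auto
  have 3: "a x $ 3 \<noteq> 0" if "x \<in> S" for x using SP[OF that] by (auto simp: vec_eq_iff forall_3)
  obtain \<mu> where \<mu>: "\<mu> > 0" "\<And>x. x \<in> S \<Longrightarrow> \<mu> \<le> \<bar>a x $ 3\<bar>"
  proof (cases "S = {}")
    case True
    then show thesis using that[of 1] by simp
  next
    case False
    have "continuous_on S (\<lambda>x. \<bar>a x $ 3\<bar>)"
      by (intro continuous_on_rabs continuous_on_subset[OF Cinf_continuous[OF Cinf_vec_nth[OF a]] S(2)])
    from continuous_attains_inf[OF S(1) False this]
    obtain z where z: "z \<in> S" "\<forall>x\<in>S. \<bar>a z $ 3\<bar> \<le> \<bar>a x $ 3\<bar>" by (elim bexE)
    show thesis by (rule that[of "\<bar>a z $ 3\<bar>"]) (use z 3[OF z(1)] in auto)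
  qed
  \<comment> \<open>With n \<ge> \<epsilon>^2, |a $ 3| \<ge> \<mu> and m \<le> R^2 this gives L |a $
    3| n \<ge> H m^2; the factor 2 in the leading term then makes the inequality strict.\<close>
  define L where "L = H * R ^ 4 / (\<mu> * \<epsilon>\<^sup>2)"
  have L: "L > 0" using H \<mu> \<open>\<epsilon> > 0\<close> \<open>R > 0\<close> by (simp add: L_def)
  let ?w = "\<lambda>x. wedge2 a (\<lambda>y. (bump_at q R L y * a y $ 3) *\<^sub>R rotation_form q y) x"
  have W: "?w x = a x $ 3 * (bump_power 2 ((R\<^sup>2 - (x - q) \<bullet> (x - q)) / L) * (2 * a x $ 3 * ((x - q) \<bullet> (x - q)) / L)
      + bump ((R\<^sup>2 - (x - q) \<bullet> (x - q)) / L) * h x)" if "x \<in> S" for x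
    unfolding h_def using rotation_wedge[OF a _ _ _ _ L, of x q] SP[OF that] that S(2) by blast
  have in0: "?w x = 0" if "x \<in> S" "\<not> norm (x - q) < R" for x
  proof -
    have "R\<^sup>2 \<le> (norm (x - q))\<^sup>2" using that(2) \<open>R > 0\<close> by (intro power_mono) auto
    then have "(R\<^sup>2 - (x - q) \<bullet> (x - q)) / L \<le> 0" using L by (simp add: power2_norm_eq_inner divide_nonpos_pos)
    then show ?thesis unfolding W[OF that(1)] by (simp add: bump_0 bump_power_def)
  qed
  have pos: "?w x > 0" if x: "x \<in> S" "\<epsilon> \<le> norm (x - q)" "norm (x - q) < R" for x
  proof -
    define n where "n = (x - q) \<bullet> (x - q)"
    define m where "m = R\<^sup>2 - n"
    let ?a = "a x $ 3"
    have n: "\<epsilon>\<^sup>2 \<le> n" "n < R\<^sup>2"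
      using power_mono[OF x(2), of 2] power_strict_mono[OF x(3), of 2] \<open>\<epsilon> > 0\<close> by (simp_all add: n_def power2_norm_eq_inner)
    have n0: "n > 0" using n(1) zero_less_power[OF \<open>\<epsilon> > 0\<close>, of 2] by linarith
    have m: "0 < m" "m \<le> R\<^sup>2" using n n0 by (auto simp: m_def)
    have "m\<^sup>2 \<le> R ^ 4" using power_mono[OF m(2), of 2] m(1) by simp
    then have "H * m\<^sup>2 \<le> H * R ^ 4" using H(1) by simp
    also have "\<dots> = L * (\<mu> * \<epsilon>\<^sup>2)" using \<mu>(1) \<open>\<epsilon> > 0\<close> by (simp add: L_def)
    also have "\<dots> \<le> L * (\<bar>?a\<bar> * n)" using L \<mu>(2)[OF x(1)] \<mu>(1) n(1) n0 by (intro mult_left_mono mult_mono) auto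
    also have "\<dots> < 2 * L * (\<bar>?a\<bar> * n)" using L 3[OF x(1)] n0 by simp
    finally have "H < 2 * L * (\<bar>?a\<bar> * n) / m\<^sup>2" using m(1) by (simp add: pos_less_divide_eq)
    then have "\<bar>?a\<bar> * H < \<bar>?a\<bar> * (2 * L * (\<bar>?a\<bar> * n) / m\<^sup>2)" 
      using 3[OF x(1)] by (intro mult_strict_left_mono) auto
    moreover have "\<bar>?a * h x\<bar> \<le> \<bar>?a\<bar> * H" using H(2)[OF x(1)] by (simp add: abs_mult mult_left_mono)
    moreover have "\<bar>?a\<bar> * (2 * L * (\<bar>?a\<bar> * n) / m\<^sup>2) = ?a * ?a * (2 * L * n / m\<^sup>2)"
    proof -
      have "\<bar>?a\<bar> * (2 * L * (\<bar>?a\<bar> * n) / m\<^sup>2) = (\<bar>?a\<bar> * \<bar>?a\<bar>) * (2 * L * n / m\<^sup>2)" by simp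
      then show ?thesis by (simp only: abs_mult_self_eq)
    qed
    ultimately have p: "0 < ?a * ?a * (2 * L * n / m\<^sup>2) + ?a * h x" by linarith
    have bp: "bump_power 2 (m / L) = bump (m / L) * (L / m)\<^sup>2" using m(1) L by (simp add: bump_def bump_power_def)
    have "?w x = bump (m / L) * (?a * ?a * (2 * L * n / m\<^sup>2) + ?a * h x)"
      unfolding W[OF x(1)] n_def[symmetric] m_def[symmetric] bp using m(1) L
      by (simp add: field_simps power2_eq_square)
    then show ?thesis using p bump_pos[of "m / L"] m(1) L by simp
  qed
  show thesis
    by (rule that[OF L]) (use in0 pos in \<open>auto simp: le_less\<close>)
qed

context closed_manifold3
begin

section \<open>The plane field in slice charts of the surface\<close>

definition chart_image :: "'p chart \<Rightarrow> 'p set \<Rightarrow> (real^3) set" where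
  "chart_image c F = {x \<in> img_ch c. inv_ch c x \<in> F}"

lemma map_image_eq: "c \<in> atlas M \<Longrightarrow> map_ch c ` (dom_ch c \<inter> F) = chart_image c F"
proof
  assume c: "c \<in> atlas M"
  show "map_ch c ` (dom_ch c \<inter> F) \<subseteq> chart_image c F" using inv_map[OF c] by (auto simp: chart_image_def)
  show "chart_image c F \<subseteq> map_ch c ` (dom_ch c \<inter> F)"
  proof
    fix x assume x: "x \<in> chart_image c F"
    then have "x = map_ch c (inv_ch c x)" "inv_ch c x \<in> dom_ch c \<inter> F"
      using map_inv[OF c] inv_dom[OF c] by (auto simp: chart_image_def)
    then show "x \<in> map_ch c ` (dom_ch c \<inter> F)" by (rule image_eqI)
  qed
qed

lemma compact_chart_image:
  assumes c: "c \<in> atlas M" and F: "compactin (mtop M) F" and K: "compact K" "K \<subseteq> img_ch c"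
  shows "compact (chart_image c F \<inter> K)"
proof -
  have "closedin (mtop M) F" by (rule compactin_imp_closedin[OF Hausdorff F])
  then have "open {x \<in> img_ch c. inv_ch c x \<in> points M - F}"
    by (intro open_inv_preimage[OF c] openin_diff openin_topspace)
  moreover have "chart_image c F \<inter> K = K - {x \<in> img_ch c. inv_ch c x \<in> points M - F}"
    using K(2) inv_dom[OF c] dom_sub[OF c] by (auto simp: chart_image_def)
  ultimately show ?thesis using compact_diff[OF K(1)] by simp
qed

lemma slice_cases:
  assumes "compact_surface M F" "p \<in> F"
  obtains c where "c \<in> charts_at M p" "interior_slice M F p c" "chart_image c F = img_ch c \<inter> {x. x $ 3 = 0}"
  | c where "c \<in> charts_at M p" "boundary_slice M F p c" "map_ch c p $ 2 = 0" "chart_image c F = img_ch c \<inter> {x. x $ 3 = 0 \<and> x $ 2 \<ge> 0}"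
proof -
  obtain c where "interior_slice M F p c \<or> boundary_slice M F p c" using assms unfolding compact_surface_def by blast
  then show thesis
  proof
    assume a: "interior_slice M F p c"
    then have "c \<in> charts_at M p" by (simp add: interior_slice_def)
    then show thesis using a that(1) map_image_eq[OF charts_atD(1)] by (simp add: interior_slice_def)
  next
    assume a: "boundary_slice M F p c"
    then have "c \<in> charts_at M p" by (simp add: boundary_slice_def)
    then show thesis using a that(2) map_image_eq[OF charts_atD(1)] by (simp add: boundary_slice_def)
  qed
qed

text \<open>Only one-sided derivatives along \<open>F\<close> are used, so boundary points need no separate treatment.\<close>

lemma slice_tangent:
  assumes \<xi>: "smooth_field \<xi>" and F: "compact_surface M F" and p: "p \<in> F" and tp: "\<xi> p = surface_tangent_plane M F p"
    and c: "c \<in> charts_at M p" and S: "\<And>x. x \<in> chart_image c F \<Longrightarrow> x $ 3 = 0"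
    and a: "vector_form \<xi> c W a" "map_ch c p \<in> W"
  shows "a (map_ch c p) $ 1 = 0" "a (map_ch c p) $ 2 = 0"
proof -
  have T: "tangential \<xi>" by (rule smooth_field_tangential[OF \<xi>])
  have pM: "p \<in> points M" using c dom_sub charts_atD by blast
  have xt: "\<xi> p \<subseteq> tangent_space M p" using T pM by (simp add: tangential_def)
  \<comment> \<open>From a point of the surface, the positive first and second coordinate directions
    stay on it in either kind of slice chart.\<close>
  obtain d where d: "d \<in> charts_at M p" and sl: "interior_slice M F p d \<or> boundary_slice M F p d"
    and Sd: "\<And>i t. i \<in> {1, 2} \<Longrightarrow> 0 \<le> t \<Longrightarrow> map_ch d p + t *\<^sub>R axis i 1 \<in> img_ch d \<Longrightarrow> map_ch d p + t *\<^sub>R axis i 1 \<in> chart_image d F"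
  proof (rule slice_cases[OF F p])
    fix d assume d: "d \<in> charts_at M p" "interior_slice M F p d" "chart_image d F = img_ch d \<inter> {x. x $ 3 = 0}"
    have "map_ch d p \<in> chart_image d F" using charts_atD[OF d(1)] p inv_map by (simp add: chart_image_def)
    then show thesis using d(2,3) by (intro that[OF d(1)]) (auto simp: axis_def)
  next
    fix d assume d: "d \<in> charts_at M p" "boundary_slice M F p d" "map_ch d p $ 2 = 0"
      "chart_image d F = img_ch d \<inter> {x. x $ 3 = 0 \<and> x $ 2 \<ge> 0}"
    have "map_ch d p \<in> chart_image d F" using charts_atD[OF d(1)] p inv_map by (simp add: chart_image_def)
    then show thesis using d(2,3,4) by (intro that[OF d(1)]) (auto simp: axis_def)
  qed
  note A = charts_atD[OF c] charts_atD[OF d]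
  obtain V b where b: "map_ch d p \<in> V" "vector_form \<xi> d V b" using vector_form_exists[OF \<xi> pM d] .
  let ?x = "map_ch d p" let ?b = "b ?x" let ?a = "a (map_ch c p)"
  have b0: "?b \<noteq> 0" and bk: "in_chart d (\<xi> p) = {v. ?b \<bullet> v = 0}" using b inv_map[OF A(3,4)] by (auto simp: vector_form_def)
  have ak: "in_chart c (\<xi> p) = {v. ?a \<bullet> v = 0}" using a inv_map[OF A(1,2)] by (auto simp: vector_form_def)
  \<comment> \<open>In a slice chart the tangent plane is horizontal, so the form at this point is
    vertical.\<close>
  have v3: "v $ 3 = 0" if "?b \<bullet> v = 0" for v
  proof -
    have "v \<in> in_chart d (\<xi> p)" using that bk by simp
    then obtain w where w: "w \<in> \<xi> p" "v = w d" by (auto simp: in_chart_def)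
    then show ?thesis using sl unfolding tp surface_tangent_plane_def by blast
  qed
  have b12: "?b $ 1 = 0" "?b $ 2 = 0"
    using v3[of "vector [- ?b $ 3, 0, ?b $ 1]"] v3[of "vector [0, - ?b $ 3, ?b $ 2]"] by (simp_all add: inner_3)
  have xT: "?x \<in> overlap d c" and Tx: "transition d c ?x = map_ch c p" using map_in_overlap[OF A(3,1,4,2)] by auto
  have D3: "DT d c ?x (axis i 1) $ 3 = 0" if i: "i \<in> {1, 2}" for i
  proof -
    have e: "((\<lambda>t. transition d c (?x + t *\<^sub>R axis i 1) $ 3) has_real_derivative DT d c ?x (axis i 1) $ 3) (at 0)"
    proof -
      have "(transition d c has_derivative DT d c ?x) (at (?x + 0 *\<^sub>R axis i 1))" using DT_has_derivative[OF A(3,1) xT] by simp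
      from bounded_linear.has_vector_derivative[OF bounded_linear_vec_nth has_vector_derivative_along[OF this]]
      show ?thesis by (simp add: has_real_derivative_iff_has_vector_derivative)
    qed
    obtain r where r: "r > 0" "ball ?x r \<subseteq> overlap d c" using overlap_open[OF A(3,1)] xT open_contains_ball by blast
    show ?thesis
    proof (rule right_derivative_0[OF e r(1)])
      fix t :: real assume t: "0 \<le> t" "t < r"
      let ?y = "?x + t *\<^sub>R axis i 1"
      have yT: "?y \<in> overlap d c" using t by (intro subsetD[OF r(2)]) (simp add: dist_norm norm_axis_1)
      then have "?y \<in> chart_image d F" using Sd[OF i t(1)] by (simp add: overlap_def)
      then have "transition d c ?y \<in> chart_image c F"
        using transition_in[OF A(3,1) yT] inv_transition[OF A(3,1) yT] by (simp add: chart_image_def overlap_def)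
      then show "transition d c ?y $ 3 = 0" by (rule S)
    qed
  qed
  have Da: "?a \<bullet> DT d c ?x (axis i 1) = 0" if "i \<in> {1, 2}" for i
  proof -
    have "axis i 1 \<in> in_chart d (\<xi> p)" using that b12 by (auto simp: bk inner_3 axis_def)
    then have "DT d c ?x (axis i 1) \<in> in_chart c (\<xi> p)" using mem_in_chart_change[OF xt d c] by blast
    then show ?thesis by (simp add: ak)
  qed
  let ?u = "DT d c ?x (axis 1 1)" and ?w = "DT d c ?x (axis 2 1)" and ?z = "DT d c ?x (axis 3 1)"
  \<comment> \<open>The images of the two tangent directions are horizontal in \<open>c\<close> too,
    so invertibility makes their 2 by 2 minor nonzero; both are annihilated by
    \<open>?a\<close>.\<close>
  have "det (matrix (DT d c ?x)) = ?z $ 3 * (?u $ 1 * ?w $ 2 - ?u $ 2 * ?w $ 1)"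
    unfolding det_axis using D3[of 1] D3[of 2] by (simp add: inner_3 cross3_components algebra_simps)
  then have nz: "?u $ 1 * ?w $ 2 - ?u $ 2 * ?w $ 1 \<noteq> 0" using det_DT[OF A(3,1) xT] by auto
  have eq: "?a $ 1 * ?u $ 1 + ?a $ 2 * ?u $ 2 = 0" "?a $ 1 * ?w $ 1 + ?a $ 2 * ?w $ 2 = 0"
    using Da[of 1] Da[of 2] D3[of 1] D3[of 2] by (simp_all add: inner_3)
  have "?a $ 1 * (?u $ 1 * ?w $ 2 - ?u $ 2 * ?w $ 1) = 0" "?a $ 2 * (?u $ 1 * ?w $ 2 - ?u $ 2 * ?w $ 1) = 0"
    using eq by algebra+
  then show "?a $ 1 = 0" "?a $ 2 = 0" using nz by simp_all
qed

definition tangent_to :: "'p field \<Rightarrow> 'p set \<Rightarrow> bool" where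
  "tangent_to \<xi> F \<longleftrightarrow> smooth_field \<xi> \<and> compact_surface M F \<and> (\<forall>p\<in>F. \<xi> p = surface_tangent_plane M F p)"

definition nonneg_on :: "'p field \<Rightarrow> 'p set \<Rightarrow> ('p \<Rightarrow> 'p chart \<Rightarrow> real^3 \<Rightarrow> real^3) \<Rightarrow> bool" where
  "nonneg_on \<xi> F E \<longleftrightarrow> endo E \<and> (\<forall>p\<in>F. 0 \<le> pairing \<xi> E p)"

lemma pairing_zero:
  assumes \<xi>: "smooth_field \<xi>" and E: "endo E" and Z: "openin (mtop M) Z" "p \<in> Z"
    and 0: "\<And>p c v. p \<in> Z \<Longrightarrow> c \<in> charts_at M p \<Longrightarrow> E p c v = 0"
  shows "pairing \<xi> E p = 0"
proof -
  have p: "p \<in> points M" using openin_subset[OF Z(1)] Z(2) by blast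
  obtain c where c: "c \<in> charts_at M p" using chart_exists[OF p] by blast
  note A = charts_atD[OF c]
  obtain W a where a: "map_ch c p \<in> W" "vector_form \<xi> c W a" using vector_form_exists[OF \<xi> p c] .
  let ?U = "{y \<in> img_ch c. inv_ch c y \<in> Z}"
  have "open ?U" by (rule open_inv_preimage[OF A(1) Z(1)])
  moreover have "map_ch c p \<in> ?U" using A Z(2) inv_map[OF A] by simp
  moreover have "dual E c a y = 0" if "y \<in> ?U" for y
  proof -
    have "E (inv_ch c y) c = (\<lambda>v. 0)"
      by (rule ext, rule 0) (use that charts_atI[OF A(1) inv_dom[OF A(1)]] in auto)
    then show ?thesis by (simp add: dual_def pull_covector_def vec_eq_iff)
  qed
  ultimately have "wedge2 a (dual E c a) (map_ch c p) = wedge2 a (\<lambda>y. 0) (map_ch c p)"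
    by (rule wedge2_cong[OF _ _ _ dual_differentiable(1)[OF E c a]])
  moreover have "curl (\<lambda>y. 0) x = 0" for x
    using frechet_derivative_eq[OF has_derivative_const, of 0 x] by (simp add: curl_def curl_of_def vec_eq_iff forall_3)
  ultimately have "wedge2 a (dual E c a) (map_ch c p) = 0" by (simp add: wedge2_def)
  then show ?thesis using pairing_sgn[OF smooth_field_tangential[OF \<xi>] c a E] by (simp add: sgn_0_0)
qed

text \<open>The local model spread over the manifold. The centre \<open>q\<close> is any point of
  the plane x3 = 0 in the chart, on the surface or not; if it is off the surface, the excluded ball
  may miss the surface altogether.\<close>

lemma slice_endo:
  assumes F: "tangent_to \<xi> F" and c: "c \<in> atlas M" and S: "\<And>x. x \<in> chart_image c F \<Longrightarrow> x $ 3 = 0"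
    and a: "vector_form \<xi> c W a" and q: "cball q R \<subseteq> W" "q $ 3 = 0" and "\<epsilon> > 0" "R > 0"
  obtains E where "endo E"
    "\<And>p. p \<in> F \<Longrightarrow> \<not> (p \<in> dom_ch c \<and> dist q (map_ch c p) < \<epsilon>) \<Longrightarrow> 0 \<le> pairing \<xi> E p"
    "\<And>p. p \<in> F \<Longrightarrow> p \<in> dom_ch c \<Longrightarrow> \<epsilon> \<le> dist q (map_ch c p) \<Longrightarrow> dist q (map_ch c p) < R \<Longrightarrow> 0 < pairing \<xi> E p"
proof -
  have \<xi>: "smooth_field \<xi>" and cF: "compact_surface M F" and tp: "\<And>p. p \<in> F \<Longrightarrow> \<xi> p = surface_tangent_plane M F p"
    using F by (auto simp: tangent_to_def)
  have aW: "Cinf W a" and Wc: "W \<subseteq> img_ch c" using a by (auto simp: vector_form_def)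
  have K: "compact (cball q R)" "cball q R \<subseteq> img_ch c" using q Wc by auto
  let ?S = "chart_image c F \<inter> cball q R"
  have SP: "a x \<noteq> 0 \<and> a x $ 1 = 0 \<and> a x $ 2 = 0 \<and> x $ 3 = q $ 3" if x: "x \<in> ?S" for x
  proof -
    have xi: "x \<in> img_ch c" and p: "inv_ch c x \<in> F" and xW: "x \<in> W" using x q by (auto simp: chart_image_def)
    have m: "map_ch c (inv_ch c x) = x" by (rule map_inv[OF c xi])
    show ?thesis
      using slice_tangent[OF \<xi> cF p tp[OF p] charts_atI[OF c inv_dom[OF c xi]] S a] m xW a S[of x] x q(2)
      by (auto simp: vector_form_def)
  qed
  obtain L where L: "L > 0"
    "\<And>x. x \<in> ?S \<Longrightarrow> \<epsilon> \<le> norm (x - q) \<Longrightarrow> 0 \<le> wedge2 a (\<lambda>y. (bump_at q R L y * a y $ 3) *\<^sub>R rotation_form q y) x"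
    "\<And>x. x \<in> ?S \<Longrightarrow> \<epsilon> \<le> norm (x - q) \<Longrightarrow> norm (x - q) < R \<Longrightarrow>
      0 < wedge2 a (\<lambda>y. (bump_at q R L y * a y $ 3) *\<^sub>R rotation_form q y) x"
  proof (rule rotation_wedge_positive[OF aW _ _ \<open>\<epsilon> > 0\<close> \<open>R > 0\<close> SP])
    show "compact ?S" using cF by (intro compact_chart_image[OF c _ K]) (simp add: compact_surface_def)
    show "?S \<subseteq> W" using q by blast
  qed auto
  define B where "B y v = (bump_at q R L y * (rotation_form q y \<bullet> v)) *\<^sub>R (axis 3 1 :: real^3)" for y v :: "real^3"
  define E where "E = local_endo c B"
  have o: "open (img_ch c)" by (rule img_open[OF c])
  have E: "endo E"
    unfolding E_def
  proof (rule endo_local_endo[OF c K])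
    show "linear (B y)" for y
      unfolding B_def by (rule linearI) (simp_all add: inner_add_right algebra_simps)
    show "Cinf (img_ch c) (\<lambda>y. B y v)" for v
      unfolding B_def
      by (intro Cinf_scaleR Cinf_mult Cinf_inner Cinf_const o Cinf_subset[OF Cinf_bump_at[OF L(1)]] Cinf_subset[OF Cinf_rotation_form]) auto
    fix y v assume "y \<in> img_ch c - cball q R"
    then have "R \<le> norm (y - q)" by (simp add: dist_norm norm_minus_commute)
    then have "R\<^sup>2 \<le> (norm (y - q))\<^sup>2" using \<open>R > 0\<close> by (intro power_mono) auto
    then have "(R\<^sup>2 - (y - q) \<bullet> (y - q)) / L \<le> 0" using L by (simp add: power2_norm_eq_inner divide_nonpos_pos)
    then show "B y v = 0" by (simp add: B_def bump_at_def bump_0)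
  qed
  have dE: "dual E c a y = (bump_at q R L y * a y $ 3) *\<^sub>R rotation_form q y" if y: "y \<in> img_ch c" for y
  proof (rule vector_eq_rdot[THEN iffD1], rule allI)
    fix v
    show "dual E c a y \<bullet> v = ((bump_at q R L y * a y $ 3) *\<^sub>R rotation_form q y) \<bullet> v"
      using local_endo_same[OF charts_atI[OF c inv_dom[OF c y]], of B v] map_inv[OF c y]
      unfolding dual_inner[OF E c y] by (simp add: E_def B_def inner_axis)
  qed
  have in_dom: "sgn (pairing \<xi> E p) = sgn (wedge2 a (\<lambda>y. (bump_at q R L y * a y $ 3) *\<^sub>R rotation_form q y) (map_ch c p))"
    if p: "p \<in> dom_ch c" "map_ch c p \<in> cball q R" for p
  proof -
    have cp: "c \<in> charts_at M p" by (rule charts_atI[OF c p(1)])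
    have xW: "map_ch c p \<in> W" using p(2) q by blast
    have "wedge2 a (dual E c a) (map_ch c p) = wedge2 a (\<lambda>y. (bump_at q R L y * a y $ 3) *\<^sub>R rotation_form q y) (map_ch c p)"
      by (rule wedge2_cong[OF o _ dE dual_differentiable(1)[OF E cp xW a]]) (use p in auto)
    then show ?thesis using pairing_sgn[OF smooth_field_tangential[OF \<xi>] cp xW a E] by simp
  qed
  have inS: "map_ch c p \<in> ?S" if "p \<in> F" "p \<in> dom_ch c" "map_ch c p \<in> cball q R" for p
    using that inv_map[OF c] by (simp add: chart_image_def)
  show thesis
  proof (rule that[OF E])
    fix p assume p: "p \<in> F" "p \<in> dom_ch c" "\<epsilon> \<le> dist q (map_ch c p)" "dist q (map_ch c p) < R"
    have "map_ch c p \<in> cball q R" using p by simp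
    from in_dom[OF p(2) this] L(3)[OF inS[OF p(1,2) this]] p(3,4)
    show "0 < pairing \<xi> E p" by (simp add: dist_norm norm_minus_commute sgn_1_pos)
  next
    fix p assume p: "p \<in> F" "\<not> (p \<in> dom_ch c \<and> dist q (map_ch c p) < \<epsilon>)"
    show "0 \<le> pairing \<xi> E p"
    proof (cases "p \<in> inv_ch c ` cball q R")
      case True
      then obtain x where x: "x \<in> cball q R" "p = inv_ch c x" by blast
      then have xi: "x \<in> img_ch c" using K by blast
      have pd: "p \<in> dom_ch c" "map_ch c p = x" using x inv_dom[OF c xi] map_inv[OF c xi] by auto
      have "map_ch c p \<in> cball q R" using x pd by simp
      note s = in_dom[OF pd(1) this] and l = L(2)[OF inS[OF p(1) pd(1) this]]
      have "\<epsilon> \<le> norm (map_ch c p - q)" using p(2) pd(1) by (simp add: dist_norm norm_minus_commute)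
      from l[OF this] s show ?thesis by (simp add: sgn_if split: if_splits)
    next
      case False
      let ?Z = "points M - inv_ch c ` cball q R"
      have pM: "p \<in> points M"
        using p(1) cF compactin_subset_topspace unfolding compact_surface_def by blast
      have "pairing \<xi> E p = 0"
      proof (rule pairing_zero[OF \<xi> E])
        show "openin (mtop M) ?Z" by (intro openin_diff openin_topspace closedin_inv_image(1)[OF c K])
        show "p \<in> ?Z" using pM False by blast
        fix p' d v assume p': "p' \<in> ?Z" and d: "d \<in> charts_at M p'"
        show "E p' d v = 0"
        proof (cases "p' \<in> dom_ch c")
          case True
          have cp: "c \<in> charts_at M p'" by (rule charts_atI[OF c True])
          note A = charts_atD[OF d]
          have "map_ch c p' \<notin> cball q R" using p' inv_map[OF c True] by (metis DiffD2 image_eqI)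
          then have "R \<le> norm (map_ch c p' - q)" by (simp add: dist_norm norm_minus_commute)
          then have "R\<^sup>2 \<le> (norm (map_ch c p' - q))\<^sup>2" using \<open>R > 0\<close> by (intro power_mono) auto
          then have "(R\<^sup>2 - (map_ch c p' - q) \<bullet> (map_ch c p' - q)) / L \<le> 0" using L by (simp add: power2_norm_eq_inner divide_nonpos_pos)
          then have "B (map_ch c p') w = 0" for w by (simp add: B_def bump_at_def bump_0)
          moreover have "map_ch c p' \<in> overlap c d" using map_in_overlap[OF c A(1) True A(2)] by simp
          ultimately show ?thesis using linear_0[OF DT_linear[OF c A(1)]] by (simp add: E_def local_endo_def)
        qed (simp add: E_def local_endo_def)
      qed
      then show ?thesis by simp
    qed
  qed
qed

end

lemma open_half_plane_False:
  fixes U :: "(real^2) set"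
  assumes "open U" "y \<in> U" "y $ 2 = 0" "U \<subseteq> {x. x $ 2 \<ge> 0}"
  shows False
proof -
  obtain r where r: "r > 0" "cball y r \<subseteq> U" using assms(1,2) open_contains_cball by blast
  have "y - r *\<^sub>R axis 2 1 \<in> cball y r" using r(1) by (simp add: dist_norm norm_axis_1)
  then have "0 \<le> (y - r *\<^sub>R axis 2 1) $ 2" using r(2) assms(4) by blast
  then show False using assms(3) r(1) by (simp add: axis_def)
qed

context closed_manifold3
begin

section \<open>Spreading positivity from the boundary of the surface\<close>

text \<open>Invariance of domain: an interior slice would give an open plane region embedded in the
  half plane through a point of its edge. This links the topological boundary with the slice
  charts.\<close>

lemma boundary_not_interior:
  assumes p: "p \<in> surface_boundary (mtop M) F" and c: "c \<in> charts_at M p" and S: "chart_image c F = img_ch c \<inter> {x. x $ 3 = 0}"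
    and FM: "F \<subseteq> points M"
  shows False
proof -
  note A = charts_atD[OF c]
  obtain g :: "'p \<Rightarrow> real^2" where pF: "p \<in> F" and hp: "half_plane_chart (mtop M) F p g" and g0: "g p $ 2 = 0"
    using p by (auto simp: surface_boundary_def)
  obtain V where V: "p \<in> V" "openin (subtopology (mtop M) F) V" "openin (top_of_set {x. x $ 2 \<ge> 0}) (g ` V)"
    and hom: "homeomorphic_map (subtopology (mtop M) V) (top_of_set (g ` V)) g"
    using hp unfolding half_plane_chart_def by (elim exE conjE)
  obtain V' where V': "openin (mtop M) V'" "V = V' \<inter> F" using V(2) by (auto simp: openin_subtopology)
  have VM: "V \<subseteq> points M" using V' FM by blast
  have tV: "topspace (subtopology (mtop M) V) = V" by (rule topspace_subtopology_subset[OF VM])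
  have ginj: "inj_on g V" using homeomorphic_imp_injective_map[OF hom] by (simp only: tV)
  have gcont: "continuous_map (subtopology (mtop M) V) euclidean g"
    using homeomorphic_imp_continuous_map[OF hom] continuous_map_into_fulltopology by blast
  define \<iota> :: "real^2 \<Rightarrow> real^3" where "\<iota> u = vector [u $ 1, u $ 2, 0]" for u
  have \<iota>c: "continuous_on UNIV \<iota>"
    unfolding continuous_on_componentwise[where f=\<iota>]
  proof
    fix i :: "real^3" assume "i \<in> Basis"
    then obtain j where i: "i = axis j 1" by (auto simp: Basis_vec_def)
    show "continuous_on UNIV (\<lambda>x. \<iota> x \<bullet> i)"
      using exhaust_3[of j] by (elim disjE) (simp_all add: i inner_axis \<iota>_def continuous_intros)
  qed
  let ?O = "{x \<in> img_ch c. inv_ch c x \<in> V'}"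
  \<comment> \<open>The open plane region whose points correspond to points of the surface in the
    given half plane chart.\<close>
  define D where "D = \<iota> -` ?O"
  have oO: "open ?O" by (rule open_inv_preimage[OF A(1) V'(1)])
  have D: "open D" unfolding D_def by (rule open_vimage[OF oO \<iota>c])
  have im: "\<iota> u \<in> img_ch c" "inv_ch c (\<iota> u) \<in> V" if "u \<in> D" for u
  proof -
    show 1: "\<iota> u \<in> img_ch c" using that by (simp add: D_def)
    have "\<iota> u $ 3 = 0" by (simp add: \<iota>_def)
    then have "\<iota> u \<in> chart_image c F" using 1 S by blast
    then show "inv_ch c (\<iota> u) \<in> V" using that V'(2) by (simp add: D_def chart_image_def)
  qed
  have inj\<iota>: "inj \<iota>" by (rule injI) (simp add: \<iota>_def vec_eq_iff forall_3 forall_2)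
  let ?f = "\<lambda>u. g (inv_ch c (\<iota> u))"
  have "open (?f ` D)"
  proof (rule invariance_of_domain[OF _ D])
    have "continuous_map (top_of_set D) (top_of_set (img_ch c)) \<iota>"
      using im(1) continuous_on_subset[OF \<iota>c] by (auto simp: continuous_map_in_subtopology)
    from continuous_map_compose[OF this continuous_map_inv[OF A(1)]]
    have "continuous_map (top_of_set D) (subtopology (mtop M) V) (inv_ch c \<circ> \<iota>)"
      using im(2) by (auto simp: continuous_map_in_subtopology)
    from continuous_map_compose[OF this gcont] show "continuous_on D ?f" by (simp add: o_def)
    show "inj_on ?f D"
    proof (rule inj_onI)
      fix u w assume u: "u \<in> D" "w \<in> D" "?f u = ?f w"
      then have "inv_ch c (\<iota> u) = inv_ch c (\<iota> w)" using im(2) ginj by (auto dest: inj_onD)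
      then have "map_ch c (inv_ch c (\<iota> u)) = map_ch c (inv_ch c (\<iota> w))" by simp
      then have "\<iota> u = \<iota> w" using map_inv[OF A(1)] im(1) u by simp
      then show "u = w" using inj\<iota> by (auto dest: injD)
    qed
  qed
  moreover have "g p \<in> ?f ` D"
  proof
    let ?x = "map_ch c p" let ?u = "vector [?x $ 1, ?x $ 2] :: real^2"
    have ip: "inv_ch c ?x = p" by (rule inv_map[OF A])
    have "?x \<in> chart_image c F" using A pF ip by (simp add: chart_image_def)
    then have "?x $ 3 = 0" using S by blast
    then have e: "\<iota> ?u = ?x" by (simp add: \<iota>_def vec_eq_iff forall_3)
    show "g p = ?f ?u" by (simp only: e ip)
    have "p \<in> V'" using V V' by blast
    then show "?u \<in> D" using A by (simp add: D_def e ip)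
  qed
  moreover have "?f ` D \<subseteq> {x. x $ 2 \<ge> 0}" using im(2) openin_subset[OF V(3)] by auto
  ultimately show False using g0 open_half_plane_False by blast
qed

text \<open>Nonnegativity on the whole surface is demanded, so that adding such endomorphisms never
  destroys positivity already gained.\<close>

definition good :: "'p field \<Rightarrow> 'p set \<Rightarrow> 'p \<Rightarrow> bool" where
  "good \<xi> F p \<longleftrightarrow> (\<exists>E. nonneg_on \<xi> F E \<and> 0 < pairing \<xi> E p)"

text \<open>\<open>E\<close> from \<open>slice_endo\<close> is positive on the surface in the ball
  except perhaps near the centre \<open>q\<close>; \<open>E0\<close> is positive there by goodness
  of \<open>q\<close>. A large multiple of \<open>E0\<close> compensates.\<close>

lemma good_ball:
  assumes F: "tangent_to \<xi> F" and c: "c \<in> atlas M" and S: "\<And>x. x \<in> chart_image c F \<Longrightarrow> x $ 3 = 0"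
    and a: "vector_form \<xi> c W a" and q: "cball (map_ch c q) R \<subseteq> W" and "R > 0" and qF: "q \<in> F" "q \<in> dom_ch c"
    and g: "good \<xi> F q" and p: "p \<in> F" "p \<in> dom_ch c" "dist (map_ch c q) (map_ch c p) < R"
  shows "good \<xi> F p"
proof -
  have \<xi>: "smooth_field \<xi>" and cF: "compact_surface M F" using F by (auto simp: tangent_to_def)
  have FM: "F \<subseteq> points M" using cF compactin_subset_topspace unfolding compact_surface_def by blast
  have T: "tangential \<xi>" by (rule smooth_field_tangential[OF \<xi>])
  have aW: "Cinf W a" and Wc: "W \<subseteq> img_ch c" using a by (auto simp: vector_form_def)
  obtain E0 where E0: "endo E0" "\<And>p. p \<in> F \<Longrightarrow> 0 \<le> pairing \<xi> E0 p" "0 < pairing \<xi> E0 q"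
    using g unfolding good_def nonneg_on_def by blast
  let ?q = "map_ch c q"
  have cq: "c \<in> charts_at M q" by (rule charts_atI[OF c qF(2)])
  have qW: "?q \<in> W" using q \<open>R > 0\<close> by auto
  have q3: "?q $ 3 = 0" using S[of ?q] qF inv_map[OF c qF(2)] by (simp add: chart_image_def)
  have contw: "continuous_on W (\<lambda>y. wedge2 a (dual E c a) y)" if "endo E" for E
    unfolding wedge2_def
    by (intro Cinf_continuous[of W] Cinf_add Cinf_inner Cinf_curl aW Cinf_dual[OF that c Wc aW])
  let ?f = "wedge2 a (dual E0 c a)"
  have "?f ?q > 0" using pairing_sgn[OF T cq qW a E0(1)] E0(3) by (simp add: sgn_1_pos)
  then have "?q \<in> W \<inter> ?f -` {0<..}" using qW by simp
  moreover have "open (W \<inter> ?f -` {0<..})"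
    by (rule continuous_open_preimage[OF contw[OF E0(1)] Cinf_open[OF aW]]) auto
  ultimately obtain \<epsilon> where \<epsilon>: "\<epsilon> > 0" "cball ?q \<epsilon> \<subseteq> W \<inter> ?f -` {0<..}" using open_contains_cball by blast
  let ?B = "cball ?q \<epsilon>"
  have BW: "?B \<subseteq> W" using \<epsilon> by blast
  have "?B \<noteq> {}" using \<epsilon>(1) by simp
  from continuous_attains_inf[OF compact_cball this continuous_on_subset[OF contw[OF E0(1)] BW]]
  obtain z where z: "z \<in> ?B" "\<And>y. y \<in> ?B \<Longrightarrow> ?f z \<le> ?f y" by blast
  have fz: "?f z > 0" using \<epsilon>(2) z(1) by blast
  obtain E where E: "endo E"
    "\<And>p. p \<in> F \<Longrightarrow> \<not> (p \<in> dom_ch c \<and> dist ?q (map_ch c p) < \<epsilon>) \<Longrightarrow> 0 \<le> pairing \<xi> E p"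
    "\<And>p. p \<in> F \<Longrightarrow> p \<in> dom_ch c \<Longrightarrow> \<epsilon> \<le> dist ?q (map_ch c p) \<Longrightarrow> dist ?q (map_ch c p) < R \<Longrightarrow> 0 < pairing \<xi> E p"
    by (rule slice_endo[OF F c S a q q3 \<epsilon>(1) \<open>R > 0\<close>]) auto
  let ?k = "wedge2 a (dual E c a)"
  obtain k where k: "k > 0" "\<And>y. y \<in> ?B \<Longrightarrow> \<bar>?k y\<bar> \<le> k"
    using compact_imp_bounded[OF compact_continuous_image[OF continuous_on_subset[OF contw[OF E(1)] BW] compact_cball]]
    unfolding bounded_pos by (metis image_eqI real_norm_def)
  \<comment> \<open>Makes N times the minimum of the \<open>E0\<close> term on the small ball exceed
    the bound \<open>k\<close> for the \<open>E\<close> term.\<close>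
  define N where "N = k / ?f z + 1"
  have N: "N > 0" using k fz by (simp add: N_def add_pos_pos)
  define A where "A = endo_sum {True, False} (\<lambda>b. if b then N else 1) (\<lambda>b. if b then E0 else E)"
  have eA: "endo A" unfolding A_def by (rule endo_endo_sum) (use E E0 in auto)
  have pA: "pairing \<xi> A x = N * pairing \<xi> E0 x + pairing \<xi> E x" if "x \<in> points M" for x
    unfolding A_def using pairing_endo_sum[OF \<xi> that, of "{True, False}" "\<lambda>b. if b then E0 else E"] E(1) E0(1) by simp
  have near: "0 < N * pairing \<xi> E0 x + pairing \<xi> E x" if x: "x \<in> F" "x \<in> dom_ch c" "dist ?q (map_ch c x) < \<epsilon>" for x
  proof -
    have cx: "c \<in> charts_at M x" by (rule charts_atI[OF c x(2)])
    have xB: "map_ch c x \<in> ?B" using x(3) by simp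
    then have xW: "map_ch c x \<in> W" using BW by blast
    obtain m where m: "m > 0" "\<And>E. endo E \<Longrightarrow> wedge2 a (dual E c a) (map_ch c x) = m * pairing \<xi> E x"
      using pairing_factor[OF T cx xW a] by blast
    have "k < N * ?f z" using fz by (simp add: N_def field_simps)
    also have "\<dots> \<le> N * ?f (map_ch c x)" using z(2)[OF xB] N by simp
    finally have "0 < N * ?f (map_ch c x) + ?k (map_ch c x)" using k(2)[OF xB] by linarith
    then have "0 < m * (N * pairing \<xi> E0 x + pairing \<xi> E x)" by (simp add: m(2) E E0 algebra_simps)
    then show ?thesis using m(1) zero_less_mult_pos by blast
  qed
  show ?thesis
    unfolding good_def nonneg_on_def
  proof (intro exI conjI ballI)
    show "endo A" by (rule eA)
    fix x assume x: "x \<in> F"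
    show "0 \<le> pairing \<xi> A x"
    proof (cases "x \<in> dom_ch c \<and> dist ?q (map_ch c x) < \<epsilon>")
      case True
      then show ?thesis using near[OF x] pA FM x by (auto intro: less_imp_le)
    next
      case False
      from E(2)[OF x False] E0(2)[OF x] N show ?thesis using pA x FM by auto
    qed
  next
    show "0 < pairing \<xi> A p"
    proof (cases "dist ?q (map_ch c p) < \<epsilon>")
      case True
      then show ?thesis using near[OF p(1,2)] pA FM p by auto
    next
      case False
      then have "0 < pairing \<xi> E p" using E(3)[OF p(1,2)] p(3) by simp
      moreover have "0 \<le> N * pairing \<xi> E0 p" using E0(2)[OF p(1)] N by simp
      ultimately show ?thesis using pA p FM by auto
    qed
  qed
qed

text \<open>At a boundary point the centre can be pushed off the surface, so that the exceptional
  ball misses the surface.\<close>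

lemma good_boundary:
  assumes F: "tangent_to \<xi> F" and p: "p \<in> F" and c: "c \<in> charts_at M p" and p2: "map_ch c p $ 2 = 0"
    and S: "chart_image c F = img_ch c \<inter> {x. x $ 3 = 0 \<and> x $ 2 \<ge> 0}"
  shows "good \<xi> F p"
proof -
  note A = charts_atD[OF c]
  have \<xi>: "smooth_field \<xi>" and cF: "compact_surface M F" using F by (auto simp: tangent_to_def)
  have pM: "p \<in> points M" using A dom_sub by blast
  have S3: "\<And>x. x \<in> chart_image c F \<Longrightarrow> x $ 3 = 0" using S by blast
  let ?x = "map_ch c p"
  have xS: "?x \<in> chart_image c F" using A p inv_map[OF A] by (simp add: chart_image_def)
  obtain W a where a: "?x \<in> W" "vector_form \<xi> c W a" using vector_form_exists[OF \<xi> pM c] .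
  have "open W" using a(2) Cinf_open by (auto simp: vector_form_def)
  then obtain r where r: "r > 0" "cball ?x r \<subseteq> W" using a(1) open_contains_cball by blast
  \<comment> \<open>On the side where the second coordinate is negative: surface points have
    distance at least r/4, the excluded radius, while p has exactly this distance and lies within
    radius r/2.\<close>
  let ?q = "?x - (r / 4) *\<^sub>R axis 2 1"
  have qx: "dist ?q ?x = r / 4" using r(1) by (simp add: dist_norm norm_axis_1)
  have q: "cball ?q (r / 2) \<subseteq> W"
  proof
    fix y assume "y \<in> cball ?q (r / 2)"
    then have "dist ?x y \<le> r" using dist_triangle[of ?x y ?q] qx r(1) by (simp add: dist_commute)
    then show "y \<in> W" using r(2) by auto
  qed
  have q3: "?q $ 3 = 0" using S3[OF xS] by (simp add: axis_def)
  have far: "r / 4 \<le> dist ?q y" if "y \<in> chart_image c F" for y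
  proof -
    have "r / 4 \<le> \<bar>(y - ?q) $ 2\<bar>" using that S p2 r(1) by (simp add: axis_def)
    also have "\<dots> \<le> norm (y - ?q)" by (rule component_le_norm_cart)
    finally show ?thesis by (simp add: dist_norm norm_minus_commute)
  qed
  have farF: "r / 4 \<le> dist ?q (map_ch c x)" if "x \<in> F" "x \<in> dom_ch c" for x
    by (rule far) (use that inv_map[OF A(1)] in \<open>simp add: chart_image_def\<close>)
  have r4: "r / 4 > 0" "r / 2 > 0" using r by auto
  obtain E where E: "endo E"
    "\<And>p. p \<in> F \<Longrightarrow> \<not> (p \<in> dom_ch c \<and> dist ?q (map_ch c p) < r / 4) \<Longrightarrow> 0 \<le> pairing \<xi> E p"
    "\<And>p. p \<in> F \<Longrightarrow> p \<in> dom_ch c \<Longrightarrow> r / 4 \<le> dist ?q (map_ch c p) \<Longrightarrow> dist ?q (map_ch c p) < r / 2 \<Longrightarrow> 0 < pairing \<xi> E p"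
    by (rule slice_endo[OF F A(1) S3 a(2) q q3 r4]) auto
  have "0 < pairing \<xi> E p" by (rule E(3)[OF p A(2)]) (use qx r in auto)
  moreover have "nonneg_on \<xi> F E"
    unfolding nonneg_on_def using E(1) by (intro conjI ballI E(2)) (auto dest: farF)
  ultimately show ?thesis unfolding good_def by blast
qed

lemma good_locally_constant:
  assumes F: "tangent_to \<xi> F" and p: "p \<in> F"
  obtains U where "openin (mtop M) U" "p \<in> U"
    "\<And>q q'. q \<in> U \<inter> F \<Longrightarrow> q' \<in> U \<inter> F \<Longrightarrow> good \<xi> F q \<Longrightarrow> good \<xi> F q'"
proof -
  have \<xi>: "smooth_field \<xi>" and cF: "compact_surface M F" using F by (auto simp: tangent_to_def)
  have pM: "p \<in> points M" using p cF compactin_subset_topspace unfolding compact_surface_def by blast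
  obtain c where c: "c \<in> charts_at M p" and S3: "\<And>x. x \<in> chart_image c F \<Longrightarrow> x $ 3 = 0"
    by (rule slice_cases[OF cF p]) auto
  note A = charts_atD[OF c]
  let ?x = "map_ch c p"
  obtain W a where a: "?x \<in> W" "vector_form \<xi> c W a" using vector_form_exists[OF \<xi> pM c] .
  have "open W" using a(2) Cinf_open by (auto simp: vector_form_def)
  then obtain r where r: "r > 0" "cball ?x r \<subseteq> W" using a(1) open_contains_cball by blast
  \<comment> \<open>Radius r/4: two such points are less than r/2 apart, and the ball of radius r/2
    about either one stays in \<open>W\<close>.\<close>
  let ?U = "{p' \<in> dom_ch c. map_ch c p' \<in> ball ?x (r / 4)}"
  show thesis
  proof (rule that)
    show "openin (mtop M) ?U" by (rule openin_chart_preimage[OF A(1) open_ball])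
    show "p \<in> ?U" using A r by simp
    fix q q' assume q: "q \<in> ?U \<inter> F" "q' \<in> ?U \<inter> F" "good \<xi> F q"
    have sub: "cball (map_ch c q) (r / 2) \<subseteq> W"
    proof
      fix y assume "y \<in> cball (map_ch c q) (r / 2)"
      then have "dist ?x y \<le> r" using dist_triangle[of ?x y "map_ch c q"] q r(1) by simp
      then show "y \<in> W" using r(2) by auto
    qed
    have "dist (map_ch c q) (map_ch c q') < r / 2"
      using dist_triangle[of "map_ch c q" "map_ch c q'" ?x] q by (simp add: dist_commute)
    then show "good \<xi> F q'"
    proof (rule good_ball[OF F A(1) S3 a(2) sub, rotated -1])
      show "0 < r / 2" using r by simp
    qed (use q in auto)
  qed
qed

text \<open>Goodness is locally constant along the surface, so the good set is open and closed;
  every component meets the boundary, where points are good.\<close>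

lemma all_good:
  assumes F: "tangent_to \<xi> F"
    and comp: "\<And>C. C \<in> connected_components_of (subtopology (mtop M) F) \<Longrightarrow> C \<inter> surface_boundary (mtop M) F \<noteq> {}"
    and p: "p \<in> F"
  shows "good \<xi> F p"
proof -
  have cF: "compact_surface M F" using F by (auto simp: tangent_to_def)
  have FM: "F \<subseteq> points M" using cF compactin_subset_topspace unfolding compact_surface_def by blast
  let ?X = "subtopology (mtop M) F"
  have tX: "topspace ?X = F" by (rule topspace_subtopology_subset[OF FM])
  have lc: "\<exists>U. openin ?X U \<and> q \<in> U \<and> U \<subseteq> {q'\<in>F. good \<xi> F q' = good \<xi> F q}" if q: "q \<in> F" for q
  proof (rule good_locally_constant[OF F q])
    fix U assume U: "openin (mtop M) U" "q \<in> U" "\<And>q q'. q \<in> U \<inter> F \<Longrightarrow> q' \<in> U \<inter> F \<Longrightarrow> good \<xi> F q \<Longrightarrow> good \<xi> F q'"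
    have "openin ?X (U \<inter> F)" using U(1) by (rule openin_subtopology_Int)
    moreover have "U \<inter> F \<subseteq> {q'\<in>F. good \<xi> F q' = good \<xi> F q}" using U(2,3) q by blast
    ultimately show ?thesis using U(2) q by blast
  qed
  let ?G = "{q\<in>F. good \<xi> F q}"
  have 1: "openin ?X ?G"
    unfolding openin_subopen[of _ ?G]
  proof
    fix q assume "q \<in> ?G"
    then have q: "q \<in> F" "good \<xi> F q" by auto
    then show "\<exists>T. openin ?X T \<and> q \<in> T \<and> T \<subseteq> ?G" using lc[OF q(1)] by auto
  qed
  have "openin ?X (F - ?G)"
    unfolding openin_subopen[of _ "F - ?G"]
  proof
    fix q assume "q \<in> F - ?G"
    then have q: "q \<in> F" "\<not> good \<xi> F q" by auto
    then have "\<exists>T. openin ?X T \<and> q \<in> T \<and> T \<subseteq> {q'\<in>F. \<not> good \<xi> F q'}" using lc[OF q(1)] by simp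
    moreover have "F - ?G = {q'\<in>F. \<not> good \<xi> F q'}" by blast
    ultimately show "\<exists>T. openin ?X T \<and> q \<in> T \<and> T \<subseteq> F - ?G" by simp
  qed
  then have 2: "closedin ?X ?G" unfolding closedin_def tX by blast
  let ?C = "connected_component_of_set ?X p"
  have C: "?C \<in> connected_components_of ?X" using p tX by (auto simp: connected_components_of_def)
  then obtain b where b: "b \<in> ?C" "b \<in> surface_boundary (mtop M) F" using comp by blast
  have bF: "b \<in> F" using b(2) by (simp add: surface_boundary_def)
  have "good \<xi> F b"
  proof (rule slice_cases[OF cF bF])
    fix c assume "c \<in> charts_at M b" "chart_image c F = img_ch c \<inter> {x. x $ 3 = 0}"
    then show ?thesis using boundary_not_interior[OF b(2) _ _ FM] by blast
  next
    fix c assume "c \<in> charts_at M b" "map_ch c b $ 2 = 0" "chart_image c F = img_ch c \<inter> {x. x $ 3 = 0 \<and> x $ 2 \<ge> 0}"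
    then show ?thesis by (rule good_boundary[OF F bF])
  qed
  then have "\<not> disjnt ?C ?G" using b(1) bF by (auto simp: disjnt_iff)
  moreover have "connectedin ?X ?C" by (rule connectedin_connected_component_of)
  ultimately have "?C \<subseteq> ?G" using connectedin_clopen_cases[OF _ 2 1] by blast
  moreover have "p \<in> ?C" using p tX connected_component_of_refl[of ?X p] by simp
  ultimately show ?thesis by blast
qed

text \<open>Each good endomorphism is positive on a neighbourhood; finitely many cover the compact
  surface, and in their sum no term is negative on it.\<close>

lemma positive_endo_exists:
  assumes F: "tangent_to \<xi> F"
    and comp: "\<And>C. C \<in> connected_components_of (subtopology (mtop M) F) \<Longrightarrow> C \<inter> surface_boundary (mtop M) F \<noteq> {}"
  obtains E where "endo E" "\<And>p. p \<in> F \<Longrightarrow> 0 < pairing \<xi> E p"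
proof -
  have \<xi>: "smooth_field \<xi>" and cF: "compact_surface M F" using F by (auto simp: tangent_to_def)
  have T: "tangential \<xi>" by (rule smooth_field_tangential[OF \<xi>])
  have K: "compactin (mtop M) F" using cF by (simp add: compact_surface_def)
  have FM: "F \<subseteq> points M" by (rule compactin_subset_topspace[OF K])
  let ?\<U> = "{U. openin (mtop M) U \<and> (\<exists>E. nonneg_on \<xi> F E \<and> (\<forall>q\<in>U. 0 < pairing \<xi> E q))}"
  have "\<exists>U\<in>?\<U>. p \<in> U" if p: "p \<in> F" for p
  proof -
    obtain E where E: "nonneg_on \<xi> F E" "0 < pairing \<xi> E p" using all_good[OF F comp p] unfolding good_def by blast
    then have eE: "endo E" by (simp add: nonneg_on_def)
    have pM: "p \<in> points M" using p FM by blast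
    obtain c where c: "c \<in> charts_at M p" using chart_exists[OF pM] by blast
    note A = charts_atD[OF c]
    obtain W a where a: "map_ch c p \<in> W" "vector_form \<xi> c W a" using vector_form_exists[OF \<xi> pM c] .
    have aW: "Cinf W a" and Wc: "W \<subseteq> img_ch c" using a by (auto simp: vector_form_def)
    let ?f = "wedge2 a (dual E c a)"
    have "continuous_on W ?f"
      unfolding wedge2_def
      by (intro Cinf_continuous[of W] Cinf_add Cinf_inner Cinf_curl aW Cinf_dual[OF eE A(1) Wc aW])
    then have o: "open (W \<inter> ?f -` {0<..})" by (rule continuous_open_preimage[OF _ Cinf_open[OF aW]]) auto
    let ?U = "{q \<in> dom_ch c. map_ch c q \<in> W \<inter> ?f -` {0<..}}"
    have pos: "0 < pairing \<xi> E q \<longleftrightarrow> 0 < ?f (map_ch c q)" if "q \<in> dom_ch c" "map_ch c q \<in> W" for q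
      using pairing_sgn[OF T charts_atI[OF A(1) that(1)] that(2) a(2) eE] by (auto simp: sgn_if split: if_splits)
    have "openin (mtop M) ?U" by (rule openin_chart_preimage[OF A(1) o])
    moreover have "\<forall>q\<in>?U. 0 < pairing \<xi> E q" using pos by auto
    moreover have "p \<in> ?U" using A(2) a(1) pos[OF A(2) a(1)] E(2) by simp
    ultimately show ?thesis using E(1) by (intro bexI[of _ ?U]) blast+
  qed
  then have "F \<subseteq> \<Union>?\<U>" by blast
  then obtain \<F> where \<F>: "finite \<F>" "\<F> \<subseteq> ?\<U>" "F \<subseteq> \<Union>\<F>"
    using conjunct2[OF K[unfolded compactin_def], rule_format, of ?\<U>] by auto
  from \<F>(2) have "\<forall>U\<in>\<F>. \<exists>E. nonneg_on \<xi> F E \<and> (\<forall>q\<in>U. 0 < pairing \<xi> E q)" by blast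
  from bchoice[OF this] obtain e where "\<forall>U\<in>\<F>. nonneg_on \<xi> F (e U) \<and> (\<forall>q\<in>U. 0 < pairing \<xi> (e U) q)" ..
  then have e: "\<And>U. U \<in> \<F> \<Longrightarrow> nonneg_on \<xi> F (e U)" "\<And>U q. U \<in> \<F> \<Longrightarrow> q \<in> U \<Longrightarrow> 0 < pairing \<xi> (e U) q"
    by simp_all
  have ee: "\<And>U. U \<in> \<F> \<Longrightarrow> endo (e U)" using e(1) by (simp add: nonneg_on_def)
  show thesis
  proof (rule that)
    show "endo (endo_sum \<F> (\<lambda>_. 1) e)" by (rule endo_endo_sum[OF ee])
    fix p assume p: "p \<in> F"
    then obtain U where U: "U \<in> \<F>" "p \<in> U" using \<F>(3) by blast
    have "0 < (\<Sum>U\<in>\<F>. pairing \<xi> (e U) p)"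
      by (rule sum_pos2[where f="\<lambda>U. pairing \<xi> (e U) p", OF \<F>(1) U(1) e(2)[OF U]]) (use e(1) p in \<open>simp add: nonneg_on_def\<close>)
    then show "0 < pairing \<xi> (endo_sum \<F> (\<lambda>_. 1) e) p"
      using pairing_endo_sum[OF \<xi> subsetD[OF FM p] \<F>(1) ee, where r="\<lambda>_. 1"] by simp
  qed
qed

end

section \<open>Deforming a path of confoliations\<close>

lemma C1lim_filter:
  assumes a: "C1lim F a a0 x" and h: "filterlim h F G"
  shows "C1lim G (\<lambda>s. a (h s)) a0 x"
proof (rule C1limI)
  have m: "filterlim (\<lambda>z. (h (fst z), snd z)) (F \<times>\<^sub>F nhds x) (G \<times>\<^sub>F nhds x)"
    by (intro filterlim_Pair filterlim_snd filterlim_compose[OF h filterlim_fst])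
  show "\<forall>\<^sub>F z in G \<times>\<^sub>F nhds x. (a (h (fst z)) has_derivative frechet_derivative (a (h (fst z))) (at (snd z))) (at (snd z))"
    using eventually_compose_filterlim[OF C1limD(1)[OF a] m] by simp
  show "((\<lambda>z. a (h (fst z)) (snd z)) \<longlongrightarrow> a0 x) (G \<times>\<^sub>F nhds x)"
    using filterlim_compose[OF C1limD(3)[OF a] m] by simp
  show "((\<lambda>z. frechet_derivative (a (h (fst z))) (at (snd z)) v) \<longlongrightarrow> frechet_derivative a0 (at x) v) (G \<times>\<^sub>F nhds x)" for v
    using filterlim_compose[OF C1limD(4)[OF a] m] by simp
qed (rule C1limD(2)[OF a])

lemma C1lim_scalar:
  assumes "(r \<longlongrightarrow> r0) F"
  shows "C1lim F (\<lambda>s y. r s) (\<lambda>y. r0) x"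
proof (rule C1limI[where D="\<lambda>z v. 0" and ?D0.0="\<lambda>v. 0"])
  show "((\<lambda>z. r (fst z)) \<longlongrightarrow> r0) (F \<times>\<^sub>F nhds x)" by (rule filterlim_compose[OF assms filterlim_fst])
qed auto

lemma C1lim_joint:
  fixes g :: "real \<times> 'a::euclidean_space \<Rightarrow> 'b::real_normed_vector"
  assumes g: "Cinf U g" and U: "(t, x) \<in> U"
  shows "C1lim (nhds t) (\<lambda>t y. g (t, y)) (\<lambda>y. g (t, y)) x"
proof (rule C1limI)
  have o: "open U" by (rule Cinf_open[OF g])
  have d: "((\<lambda>y. g (s, y)) has_derivative (\<lambda>v. frechet_derivative g (at (s, y)) (0, v))) (at y)" if "(s, y) \<in> U" for s y
  proof -
    have "((\<lambda>y. (s, y)) has_derivative (\<lambda>v. (0, v))) (at y)" by (intro has_derivative_Pair has_derivative_const has_derivative_ident)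
    from has_derivative_compose[OF this Cinf_has_derivative[OF g that]] show ?thesis .
  qed
  have "\<forall>\<^sub>F z in nhds (t, x). z \<in> U" by (rule eventually_nhds_in_open[OF o U])
  then have "\<forall>\<^sub>F z in nhds (t, x). ((\<lambda>y. g (fst z, y)) has_derivative (\<lambda>v. frechet_derivative g (at z) (0, v))) (at (snd z))"
    by (rule eventually_mono) (use d in auto)
  then show "\<forall>\<^sub>F z in nhds t \<times>\<^sub>F nhds x. ((\<lambda>y. g (fst z, y)) has_derivative (\<lambda>v. frechet_derivative g (at z) (0, v))) (at (snd z))"
    by (simp add: nhds_prod)
  show "((\<lambda>y. g (t, y)) has_derivative (\<lambda>v. frechet_derivative g (at (t, x)) (0, v))) (at x)" by (rule d[OF U])
  have c: "(k \<longlongrightarrow> k (t, x)) (nhds t \<times>\<^sub>F nhds x)" if "Cinf U k" for k :: "real \<times> 'a \<Rightarrow> 'b"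
  proof -
    have "(k \<longlongrightarrow> k (t, x)) (at (t, x))"
      using Cinf_continuous[OF that] o U by (simp add: continuous_on_eq_continuous_at isCont_def)
    then show ?thesis by (simp add: tendsto_at_iff_tendsto_nhds nhds_prod)
  qed
  show "((\<lambda>z. g (fst z, snd z)) \<longlongrightarrow> g (t, x)) (nhds t \<times>\<^sub>F nhds x)" using c[OF g] by simp
  show "((\<lambda>z. frechet_derivative g (at z) (0, v)) \<longlongrightarrow> frechet_derivative g (at (t, x)) (0, v)) (nhds t \<times>\<^sub>F nhds x)" for v
    by (rule c[OF Cinf_derivative[OF g]])
qed

context closed_manifold3
begin

lemma smooth_plane_field_smooth_field: "smooth_plane_field M \<xi> \<Longrightarrow> smooth_field \<xi>"
  unfolding smooth_field_def
proof (intro conjI ballI)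
  assume \<xi>: "smooth_plane_field M \<xi>"
  then have P: "plane_field M \<xi>" by (simp add: smooth_plane_field_def)
  then show "tangential \<xi>" by (rule plane_field_tangential)
  fix p assume "p \<in> points M"
  then obtain c W \<alpha> where c: "c \<in> charts_at M p" "map_ch c p \<in> W" "local_form \<xi> c W \<alpha>"
    using \<xi> unfolding smooth_plane_field_def by blast
  from local_form_vector_form(1)[OF P charts_atD(1)[OF c(1)] c(3)] c(1,2)
  show "\<exists>c\<in>charts_at M p. \<exists>W a. map_ch c p \<in> W \<and> vector_form \<xi> c W a" by blast
qed

lemma C1lim_dual:
  assumes E: "endo E" and c: "c \<in> atlas M" and x: "x \<in> img_ch c" and a: "C1lim F a a0 x"
  shows "C1lim F (\<lambda>s. dual E c (a s)) (dual E c a0) x"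
proof -
  have "dual E c a = (\<lambda>y. \<Sum>i\<in>UNIV. (a y \<bullet> E (inv_ch c y) c (axis i 1)) *\<^sub>R axis i (1::real))" for a
    by (simp add: fun_eq_iff vec_eq_iff dual_def pull_covector_def axis_def if_distrib cong: if_cong)
  then show ?thesis
    by (simp only:) (intro C1lim_sum finite C1lim_linear[OF bounded_linear_scaleR_left] C1lim_bilinear[OF bounded_bilinear_inner]
      a C1lim_const[OF endo_Cinf[OF E c] x])
qed

text \<open>Smoothness on the closed time interval means local extension to an open set; convergence
  is proved for the extended form and restricted to times in {a..b}.\<close>

lemma family_converges_at:
  assumes motion: "smooth_family_of_plane_fields M a b \<xi>" and t0: "t0 \<in> {a..b}" and p: "p \<in> points M"
  obtains c W \<alpha> where "c \<in> charts_at M p" "map_ch c p \<in> W" "vector_form (\<xi> t0) c W (\<alpha> t0)"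
    "\<forall>\<^sub>F t in inf (nhds t0) (principal {a..b}). vector_form (\<xi> t) c W (\<alpha> t)"
    "\<And>x. x \<in> W \<Longrightarrow> C1lim (inf (nhds t0) (principal {a..b})) \<alpha> (\<alpha> t0) x"
proof -
  obtain c W' and A :: "real \<times> (real^3) \<Rightarrow> ((real^3) \<Rightarrow>\<^sub>L real)" where c: "c \<in> charts_at M p" and W': "(t0, map_ch c p) \<in> W'" "openin (top_of_set ({a..b} \<times> img_ch c)) W'"
    and A: "smooth_on W' A" and ker: "\<forall>(s, x)\<in>W'. in_chart c (\<xi> s (inv_ch c x)) = {v. blinfun_apply (A (s, x)) v = 0}"
    using bspec[OF bspec[OF conjunct2[OF motion[unfolded smooth_family_of_plane_fields_def]] t0] p] by (elim bexE exE conjE)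
  note cA = charts_atD[OF c]
  obtain U g where U: "open U" "(t0, map_ch c p) \<in> U" "\<forall>k. Ck_on k U g" "\<forall>y\<in>U \<inter> W'. g y = A y"
    using A W'(1) unfolding smooth_on_def by blast
  have g: "Cinf U g" using U by (simp add: Cinf_def)
  obtain O' where O': "open O'" "W' = ({a..b} \<times> img_ch c) \<inter> O'" using W'(2) by (auto simp: openin_open)
  have "open (U \<inter> O')" "(t0, map_ch c p) \<in> U \<inter> O'" using U O' W'(1) by auto
  \<comment> \<open>A product neighbourhood separates time from space, so that one domain
    \<open>W\<close> serves all nearby times.\<close>
  then obtain S V where SV: "open S" "open V" "(t0, map_ch c p) \<in> S \<times> V" "S \<times> V \<subseteq> U \<inter> O'" by (rule open_prod_elim)
  define W where "W = V \<inter> img_ch c"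
  define \<alpha> where "\<alpha> t = covector (\<lambda>x. g (t, x))" for t
  have W: "open W" "W \<subseteq> img_ch c" using SV(2) img_open[OF cA(1)] by (auto simp: W_def)
  have plane: "plane_field M (\<xi> t)" if "t \<in> {a..b}" for t using motion that by (simp add: smooth_family_of_plane_fields_def)
  have v: "vector_form (\<xi> t) c W (\<alpha> t)" if t: "t \<in> S" "t \<in> {a..b}" for t
    unfolding vector_form_def
  proof (intro conjI ballI)
    show "W \<subseteq> img_ch c" by (rule W)
    have "Cinf W (\<lambda>x. g (t, x))"
      by (rule Cinf_compose[OF Cinf_Pair[OF Cinf_const Cinf_id] g]) (use W SV t in \<open>auto simp: W_def\<close>)
    then show "Cinf W (\<alpha> t)" unfolding \<alpha>_def by (rule Cinf_covector)
    fix x assume x: "x \<in> W"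
    have "(t, x) \<in> U \<inter> W'" using x t SV(4) O'(2) by (auto simp: W_def)
    then have "in_chart c (\<xi> t (inv_ch c x)) = {v. blinfun_apply (g (t, x)) v = 0}" using ker U(4) by auto
    then show k: "in_chart c (\<xi> t (inv_ch c x)) = {v. \<alpha> t x \<bullet> v = 0}" by (simp add: \<alpha>_def covector_inner)
    have xi: "x \<in> img_ch c" using x W by blast
    have "inv_ch c x \<in> points M" using inv_dom[OF cA(1) xi] dom_sub[OF cA(1)] by blast
    then show "\<alpha> t x \<noteq> 0" by (rule kernel_nonzero[OF plane[OF t(2)] charts_atI[OF cA(1) inv_dom[OF cA(1) xi]] _ k])
  qed
  have ts: "t0 \<in> S" using SV(3) by simp
  show thesis
  proof (rule that[OF c])
    show "map_ch c p \<in> W" using SV(3) cA by (simp add: W_def)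
    show "vector_form (\<xi> t0) c W (\<alpha> t0)" by (rule v[OF ts t0])
    have "\<forall>\<^sub>F t in nhds t0. t \<in> S" by (rule eventually_nhds_in_open[OF SV(1) ts])
    then show "\<forall>\<^sub>F t in inf (nhds t0) (principal {a..b}). vector_form (\<xi> t) c W (\<alpha> t)"
      unfolding eventually_inf_principal by (rule eventually_mono) (use v in blast)
    fix x assume "x \<in> W"
    then have "(t0, x) \<in> U" using ts SV(4) by (auto simp: W_def)
    from C1lim_linear[OF bounded_linear_vec_blinfun C1lim_joint[OF g this]]
    have "C1lim (nhds t0) \<alpha> (\<alpha> t0) x" unfolding \<alpha>_def covector_def[abs_def] .
    from C1lim_filter[OF this, of "\<lambda>t. t" "inf (nhds t0) (principal {a..b})"]
    show "C1lim (inf (nhds t0) (principal {a..b})) \<alpha> (\<alpha> t0) x" by (simp add: filterlim_def)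
  qed
qed

section \<open>The deformed plane fields\<close>

text \<open>Demanding the condition in all charts avoids a choice; by \<open>deform_in_chart\<close>
  one chart suffices. The result need not be a plane where the deformed form vanishes.\<close>

definition deform :: "'p field \<Rightarrow> ('p \<Rightarrow> 'p chart \<Rightarrow> real^3 \<Rightarrow> real^3) \<Rightarrow> 'p field" where
  "deform \<xi> E p = {v \<in> tangent_space M p. \<forall>c\<in>charts_at M p. v c + E p c (v c) \<in> in_chart c (\<xi> p)}"

lemma tangential_deform: "tangential (deform \<xi> E)"
  by (auto simp: tangential_def deform_def)

lemma deform_in_chart:
  assumes T: "tangential \<xi>" and E: "endo E" and c: "c \<in> charts_at M p"
  shows "in_chart c (deform \<xi> E p) = {u. u + E p c u \<in> in_chart c (\<xi> p)}"
proof
  show "in_chart c (deform \<xi> E p) \<subseteq> {u. u + E p c u \<in> in_chart c (\<xi> p)}"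
  proof
    fix u assume "u \<in> in_chart c (deform \<xi> E p)"
    then obtain v where "v \<in> deform \<xi> E p" "u = v c" by (auto simp: in_chart_def)
    then show "u \<in> {u. u + E p c u \<in> in_chart c (\<xi> p)}" using c by (simp add: deform_def)
  qed
  have p: "p \<in> points M" using charts_atD[OF c] dom_sub by blast
  have xt: "\<xi> p \<subseteq> tangent_space M p" using T p by (simp add: tangential_def)
  show "{u. u + E p c u \<in> in_chart c (\<xi> p)} \<subseteq> in_chart c (deform \<xi> E p)"
  proof
    fix u assume u: "u \<in> {u. u + E p c u \<in> in_chart c (\<xi> p)}"
    have "extend c p u d + E p d (extend c p u d) \<in> in_chart d (\<xi> p)" if d: "d \<in> charts_at M p" for d
    proof -
      note A = charts_atD[OF c] charts_atD[OF d]
      have "map_ch c p \<in> overlap c d" using map_in_overlap[OF A(1,3,2,4)] by simp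
      note lin = DT_linear[OF A(1,3) this]
      have "extend c p u d + E p d (extend c p u d) = DT c d (map_ch c p) (u + E p c u)"
        using d endo_DT[OF E p c d] by (simp add: extend_def linear_add[OF lin])
      then show ?thesis using u mem_in_chart_change[OF xt c d] by simp
    qed
    then have "extend c p u \<in> deform \<xi> E p" using extend_tangent[OF c] by (simp add: deform_def)
    then have "extend c p u c \<in> in_chart c (deform \<xi> E p)" unfolding in_chart_def by (rule imageI)
    then show "u \<in> in_chart c (deform \<xi> E p)" by (simp only: extend_same[OF c])
  qed
qed

lemma deform_kernel:
  assumes T: "tangential \<xi>" and E: "endo E" and c: "c \<in> charts_at M p" and a: "vector_form \<xi> c W a" "map_ch c p \<in> W"
  shows "in_chart c (deform \<xi> E p) = {v. (a (map_ch c p) + dual E c a (map_ch c p)) \<bullet> v = 0}"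
proof -
  note A = charts_atD[OF c]
  have m: "map_ch c p \<in> img_ch c" using A by blast
  have "in_chart c (\<xi> p) = {v. a (map_ch c p) \<bullet> v = 0}" using a inv_map[OF A] by (auto simp: vector_form_def)
  moreover have "dual E c a (map_ch c p) \<bullet> w = a (map_ch c p) \<bullet> E p c w" for w
    using dual_inner[OF E A(1) m] inv_map[OF A] by simp
  ultimately show ?thesis unfolding deform_in_chart[OF T E c] by (simp add: inner_add_left inner_add_right)
qed

text \<open>The left side mentions no chart or form, so nondegeneracy established with one local
  form is available for every other.\<close>

lemma deform_degenerate_iff:
  assumes T: "tangential \<xi>" and E: "endo E" and c: "c \<in> charts_at M p" and a: "vector_form \<xi> c W a" "map_ch c p \<in> W"
  shows "deform \<xi> E p = tangent_space M p \<longleftrightarrow> a (map_ch c p) + dual E c a (map_ch c p) = 0"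
proof -
  have k: "in_chart c (tangent_space M p) = UNIV"
    using extend_tangent[OF c] extend_same[OF c] unfolding in_chart_def by (metis UNIV_eq_I image_eqI)
  show ?thesis
  proof
    assume "deform \<xi> E p = tangent_space M p"
    then have "(a (map_ch c p) + dual E c a (map_ch c p)) \<bullet> v = 0" for v
      using deform_kernel[OF assms] k by auto
    then show "a (map_ch c p) + dual E c a (map_ch c p) = 0" using inner_eq_zero_iff by blast
  next
    assume "a (map_ch c p) + dual E c a (map_ch c p) = 0"
    then have "in_chart c (deform \<xi> E p) = in_chart c (tangent_space M p)" using deform_kernel[OF assms] k by simp
    then show "deform \<xi> E p = tangent_space M p"
      by (intro plane_eqI[OF _ order_refl c]) (auto simp: deform_def)
  qed
qed

lemma deform_vector_form:
  assumes T: "tangential \<xi>" and E: "endo E" and c: "c \<in> atlas M" and a: "vector_form \<xi> c W a"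
    and nd: "\<And>p. p \<in> points M \<Longrightarrow> deform \<xi> E p \<noteq> tangent_space M p"
  shows "vector_form (deform \<xi> E) c W (\<lambda>y. a y + dual E c a y)"
  unfolding vector_form_def
proof (intro conjI ballI)
  have W: "W \<subseteq> img_ch c" and aW: "Cinf W a" using a by (auto simp: vector_form_def)
  show "W \<subseteq> img_ch c" by (rule W)
  show "Cinf W (\<lambda>y. a y + dual E c a y)" by (rule Cinf_add[OF aW Cinf_dual[OF E c W aW]])
  fix x assume x: "x \<in> W"
  then have xi: "x \<in> img_ch c" using W by blast
  have m: "map_ch c (inv_ch c x) = x" by (rule map_inv[OF c xi])
  have cp: "c \<in> charts_at M (inv_ch c x)" by (rule charts_atI[OF c inv_dom[OF c xi]])
  have "inv_ch c x \<in> points M" using inv_dom[OF c xi] dom_sub[OF c] by blast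
  note n = nd[OF this]
  have xW: "map_ch c (inv_ch c x) \<in> W" using x m by simp
  show "a x + dual E c a x \<noteq> 0" using deform_degenerate_iff[OF T E cp a xW] n m by simp
  show "in_chart c (deform \<xi> E (inv_ch c x)) = {v. (a x + dual E c a x) \<bullet> v = 0}"
    using deform_kernel[OF T E cp a xW] m by simp
qed

lemma wedge_sign_unique: "tangential \<xi> \<Longrightarrow> wedge_sign \<xi> p r \<Longrightarrow> wedge_sign \<xi> p r' \<Longrightarrow> r = r'"
proof -
  assume T: "tangential \<xi>" and r: "wedge_sign \<xi> p r" "wedge_sign \<xi> p r'"
  obtain c W a where c: "c \<in> charts_at M p" "map_ch c p \<in> W" "vector_form \<xi> c W a"
    using r(1) unfolding wedge_sign_def by (elim bexE exE conjE)
  show "r = r'" using r wedge_sign_iff[OF T c] by simp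
qed

lemma wedge_sign_cong:
  assumes "\<And>p. p \<in> points M \<Longrightarrow> \<xi> p = \<xi>' p" "wedge_sign \<xi> p r"
  shows "wedge_sign \<xi>' p r"
proof -
  obtain c W a where c: "c \<in> charts_at M p" "map_ch c p \<in> W" "vector_form \<xi> c W a" "sgn (wedge2 a a (map_ch c p)) = r"
    using assms(2) unfolding wedge_sign_def by (elim bexE exE conjE)
  have e: "\<xi> (inv_ch c x) = \<xi>' (inv_ch c x)" if "x \<in> img_ch c" for x
    using inv_dom[OF charts_atD(1)[OF c(1)] that] dom_sub[OF charts_atD(1)[OF c(1)]] by (intro assms(1)) blast
  have W: "W \<subseteq> img_ch c" using c(3) by (simp add: vector_form_def)
  have "\<xi>' (inv_ch c x) = \<xi> (inv_ch c x)" if "x \<in> W" for x using e[OF subsetD[OF W that]] by simp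
  then have v: "vector_form \<xi>' c W a" using c(3) by (simp add: vector_form_def)
  show ?thesis unfolding wedge_sign_def by (intro bexI[OF _ c(1)] exI conjI) (rule c(2), rule v, rule c(4))
qed

text \<open>Expressed by the sign of \<alpha> \<and> d\<alpha> instead of the surface, which may
  change abruptly along the path.\<close>

definition positive_at_zeros :: "'p field \<Rightarrow> ('p \<Rightarrow> 'p chart \<Rightarrow> real^3 \<Rightarrow> real^3) \<Rightarrow> bool" where
  "positive_at_zeros \<xi> E \<longleftrightarrow> (\<forall>p\<in>points M. wedge_sign \<xi> p 0 \<longrightarrow> 0 < pairing \<xi> E p)"

lemma sigma_confoliation_positive:
  assumes "sigma_confoliation M \<xi>"
  obtains E where "endo E" "positive_at_zeros \<xi> E"
proof -
  obtain F where F: "maximal_integral_surface M \<xi> F" and sp: "smooth_plane_field M \<xi>"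
    using assms by (auto simp: sigma_confoliation_def confoliation_def)
  have P: "plane_field M \<xi>" using sp by (simp add: smooth_plane_field_def)
  have "tangent_to \<xi> F"
    using F smooth_plane_field_smooth_field[OF sp] by (auto simp: tangent_to_def maximal_integral_surface_def)
  then show thesis
  proof (rule positive_endo_exists)
    show "C \<inter> surface_boundary (mtop M) F \<noteq> {}" if "C \<in> connected_components_of (subtopology (mtop M) F)" for C
      using F that by (simp add: maximal_integral_surface_def)
    fix E assume E: "endo E" "\<And>p. p \<in> F \<Longrightarrow> 0 < pairing \<xi> E p"
    show thesis
    proof (rule that[OF E(1)], unfold positive_at_zeros_def, intro ballI impI)
      fix p assume p: "p \<in> points M" "wedge_sign \<xi> p 0"
      have "p \<in> F"
      proof (rule ccontr)
        assume "p \<notin> F"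
        then have "contact_at M \<xi> p" using F p by (simp add: maximal_integral_surface_def)
        from wedge_sign_unique[OF plane_field_tangential[OF P] contact_at_wedge_sign[OF P this] p(2)] show False by simp
      qed
      then show "0 < pairing \<xi> E p" by (rule E(2))
    qed
  qed
qed

end

section \<open>Positivity along a path of confoliations\<close>

locale confoliation_path = closed_manifold3 M for M :: "'p manifold3" +
  fixes a b :: real and \<xi> :: "real \<Rightarrow> 'p field"
  assumes ab: "a < b" and family: "smooth_family_of_plane_fields M a b \<xi>"
    and sigma: "\<And>t. t \<in> {a..b} \<Longrightarrow> sigma_confoliation M (\<xi> t)"
begin

lemma conf: "t \<in> {a..b} \<Longrightarrow> confoliation M (\<xi> t)"
  using sigma by (simp add: sigma_confoliation_def)

lemma smooth: "t \<in> {a..b} \<Longrightarrow> smooth_field (\<xi> t)"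
  by (rule smooth_plane_field_smooth_field) (use conf in \<open>simp add: confoliation_def\<close>)

lemma tang: "t \<in> {a..b} \<Longrightarrow> tangential (\<xi> t)"
  by (rule smooth_field_tangential[OF smooth])

lemma wedge_nonneg:
  assumes t: "t \<in> {a..b}" and c: "c \<in> charts_at M p" and \<alpha>: "vector_form (\<xi> t) c W \<alpha>" "map_ch c p \<in> W"
  shows "0 \<le> wedge2 \<alpha> \<alpha> (map_ch c p)"
    and "wedge_sign (\<xi> t) p 0 \<longleftrightarrow> wedge2 \<alpha> \<alpha> (map_ch c p) = 0"
proof -
  have p: "p \<in> points M" using charts_atD[OF c] dom_sub by blast
  note i = wedge_sign_iff[OF tang[OF t] c \<alpha>(2,1)]
  show "0 \<le> wedge2 \<alpha> \<alpha> (map_ch c p)"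
    using confoliation_wedge_sign[OF conf[OF t] p] unfolding i by (auto simp: sgn_if split: if_splits)
  show "wedge_sign (\<xi> t) p 0 \<longleftrightarrow> wedge2 \<alpha> \<alpha> (map_ch c p) = 0" unfolding i by (simp add: sgn_0_0)
qed

text \<open>At each point either \<alpha> \<and> d\<alpha> is positive, so there are no zeros for
  nearby times and points, or the pairing is positive and stays so. Compactness of the manifold
  makes this uniform.\<close>

lemma positive_at_zeros_open:
  assumes t0: "t0 \<in> {a..b}" and E: "endo E" and pos: "positive_at_zeros (\<xi> t0) E"
  shows "\<forall>\<^sub>F t in inf (nhds t0) (principal {a..b}). positive_at_zeros (\<xi> t) E"
  unfolding positive_at_zeros_def
proof (rule points_eventually)
  fix p assume p: "p \<in> points M"
  let ?F = "inf (nhds t0) (principal {a..b})"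
  obtain c W \<alpha> where c: "c \<in> charts_at M p" and pW: "map_ch c p \<in> W" and \<alpha>0: "vector_form (\<xi> t0) c W (\<alpha> t0)"
    and \<alpha>: "\<forall>\<^sub>F t in ?F. vector_form (\<xi> t) c W (\<alpha> t)" and lim: "\<And>x. x \<in> W \<Longrightarrow> C1lim ?F \<alpha> (\<alpha> t0) x"
    by (rule family_converges_at[OF family t0 p]) auto
  note A = charts_atD[OF c]
  have W: "W \<subseteq> img_ch c" "open W" using \<alpha>0 Cinf_open by (auto simp: vector_form_def)
  let ?x = "map_ch c p"
  have xi: "?x \<in> img_ch c" using A by blast
  note l = lim[OF pW] C1lim_dual[OF E A(1) xi lim[OF pW]]
  have "wedge2 (\<alpha> t0) (\<alpha> t0) ?x > 0 \<or> wedge2 (\<alpha> t0) (dual E c (\<alpha> t0)) ?x > 0"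
  proof (cases "wedge_sign (\<xi> t0) p 0")
    case True
    then have "0 < pairing (\<xi> t0) E p" using pos p by (simp add: positive_at_zeros_def)
    then show ?thesis using pairing_sgn[OF tang[OF t0] c pW \<alpha>0 E] by (simp add: sgn_1_pos)
  next
    case False
    then show ?thesis using wedge_nonneg[OF t0 c \<alpha>0 pW] by simp
  qed
  then have "\<forall>\<^sub>F z in ?F \<times>\<^sub>F nhds ?x. wedge2 (\<alpha> (fst z)) (\<alpha> (fst z)) (snd z) > 0 \<or>
      wedge2 (\<alpha> (fst z)) (dual E c (\<alpha> (fst z))) (snd z) > 0"
  proof
    assume "wedge2 (\<alpha> t0) (\<alpha> t0) ?x > 0"
    from order_tendstoD(1)[OF tendsto_wedge2[OF l(1) l(1)] this] show ?thesis by (rule eventually_mono) simp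
  next
    assume "wedge2 (\<alpha> t0) (dual E c (\<alpha> t0)) ?x > 0"
    from order_tendstoD(1)[OF tendsto_wedge2[OF l(1) l(2)] this] show ?thesis by (rule eventually_mono) simp
  qed
  moreover have "\<forall>\<^sub>F z in ?F \<times>\<^sub>F nhds ?x. fst z \<in> {a..b} \<and> vector_form (\<xi> (fst z)) c W (\<alpha> (fst z)) \<and> snd z \<in> W"
  proof (rule eventually_prodI[OF eventually_conj[OF _ \<alpha>] W(2) pW])
    show "\<forall>\<^sub>F t in ?F. t \<in> {a..b}" by (simp add: eventually_inf_principal)
  qed auto
  ultimately have "\<forall>\<^sub>F z in ?F \<times>\<^sub>F nhds ?x. wedge_sign (\<xi> (fst z)) (inv_ch c (snd z)) 0 \<longrightarrow> 0 < pairing (\<xi> (fst z)) E (inv_ch c (snd z))"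
  proof eventually_elim
    case (elim z)
    let ?p = "inv_ch c (snd z)"
    have t: "fst z \<in> {a..b}" and v: "vector_form (\<xi> (fst z)) c W (\<alpha> (fst z))" and z: "snd z \<in> W" using elim by auto
    have zi: "snd z \<in> img_ch c" using z W by blast
    have cp: "c \<in> charts_at M ?p" by (rule charts_atI[OF A(1) inv_dom[OF A(1) zi]])
    have m: "map_ch c ?p = snd z" by (rule map_inv[OF A(1) zi])
    have zW: "map_ch c ?p \<in> W" using z m by simp
    show ?case
      using elim wedge_nonneg(2)[OF t cp v zW] pairing_sgn[OF tang[OF t] cp zW v E]
      by (auto simp: m sgn_1_pos)
  qed
  then show "\<exists>c\<in>charts_at M p. \<forall>\<^sub>F z in ?F \<times>\<^sub>F nhds (map_ch c p).
      wedge_sign (\<xi> (fst z)) (inv_ch c (snd z)) 0 \<longrightarrow> 0 < pairing (\<xi> (fst z)) E (inv_ch c (snd z))"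
    using c by blast
qed

text \<open>The pairing is linear in \<open>E\<close>, so nonnegative combinations preserve
  positivity; the constant choices valid near finitely many times are blended by continuous
  weights.\<close>

lemma positive_path:
  obtains D w E where "finite (D :: real set)" "\<And>i. i \<in> D \<Longrightarrow> endo (E i)" "\<And>i. continuous_on UNIV (w i :: real \<Rightarrow> real)"
    "\<And>t. t \<in> {a..b} \<Longrightarrow> positive_at_zeros (\<xi> t) (endo_sum D (\<lambda>i. w i t) E)"
proof -
  have "\<exists>E \<delta>. endo E \<and> \<delta> > 0 \<and> (\<forall>t\<in>{a..b}. \<bar>t - t0\<bar> < \<delta> \<longrightarrow> positive_at_zeros (\<xi> t) E)" if t0: "t0 \<in> {a..b}" for t0
  proof -
    obtain E where E: "endo E" "positive_at_zeros (\<xi> t0) E" by (rule sigma_confoliation_positive[OF sigma[OF t0]])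
    from positive_at_zeros_open[OF t0 E] obtain \<delta> where "\<delta> > 0" "\<forall>t. dist t t0 < \<delta> \<longrightarrow> t \<in> {a..b} \<longrightarrow> positive_at_zeros (\<xi> t) E"
      unfolding eventually_inf_principal eventually_nhds_metric by blast
    then show ?thesis using E(1) by (intro exI[of _ E] exI[of _ \<delta>]) (simp add: dist_real_def)
  qed
  then obtain E \<delta> where E: "\<And>t. t \<in> {a..b} \<Longrightarrow> endo (E t)" "\<And>t. t \<in> {a..b} \<Longrightarrow> \<delta> t > 0"
    "\<And>i t. i \<in> {a..b} \<Longrightarrow> t \<in> {a..b} \<Longrightarrow> \<bar>t - i\<bar> < \<delta> i \<Longrightarrow> positive_at_zeros (\<xi> t) (E i)"
    by metis
  obtain D where D: "D \<subseteq> {a..b}" "finite D" "{a..b} \<subseteq> (\<Union>i\<in>D. ball i (\<delta> i))"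
    by (rule compactE_image[OF compact_Icc[of a b], of "{a..b}" "\<lambda>i. ball i (\<delta> i)"]) (use E(2) in auto)
  \<comment> \<open>A hat function around time i: it is positive only where E i is known to work,
    and zero otherwise.\<close>
  define w where "w i t = max 0 (\<delta> i - \<bar>t - i\<bar>)" for i t :: real
  have eE: "\<And>i. i \<in> D \<Longrightarrow> endo (E i)" using D E(1) by blast
  show thesis
  proof (rule that[OF D(2) eE])
    show "continuous_on UNIV (w i)" for i unfolding w_def[abs_def] by (intro continuous_intros)
    fix t assume t: "t \<in> {a..b}"
    show "positive_at_zeros (\<xi> t) (endo_sum D (\<lambda>i. w i t) E)"
      unfolding positive_at_zeros_def
    proof (intro ballI impI)
      fix p assume p: "p \<in> points M" "wedge_sign (\<xi> t) p 0"
      have nn: "0 \<le> w i t * pairing (\<xi> t) (E i) p" and pp: "\<bar>t - i\<bar> < \<delta> i \<Longrightarrow> 0 < w i t * pairing (\<xi> t) (E i) p" if i: "i \<in> D" for i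
      proof -
        have iab: "i \<in> {a..b}" using D i by blast
        show 1: "0 < w i t * pairing (\<xi> t) (E i) p" if "\<bar>t - i\<bar> < \<delta> i"
          using E(3)[OF iab t that] p that by (simp add: positive_at_zeros_def w_def)
        show "0 \<le> w i t * pairing (\<xi> t) (E i) p"
          using 1 by (cases "\<bar>t - i\<bar> < \<delta> i") (auto simp: w_def intro: less_imp_le)
      qed
      obtain i where i: "i \<in> D" "t \<in> ball i (\<delta> i)" using D(3) t by blast
      then have "\<bar>t - i\<bar> < \<delta> i" by (simp add: dist_real_def abs_minus_commute)
      then have "0 < (\<Sum>i\<in>D. w i t * pairing (\<xi> t) (E i) p)"
        by (intro sum_pos2[where f="\<lambda>i. w i t * pairing (\<xi> t) (E i) p", OF D(2) i(1) pp[OF i(1)]] nn)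
      then show "0 < pairing (\<xi> t) (endo_sum D (\<lambda>i. w i t) E) p"
        using pairing_endo_sum[OF smooth[OF t] p(1) D(2) eE] by simp
    qed
  qed
qed

end

section \<open>Contact structures for small positive deformation\<close>

locale positive_deformation = confoliation_path M a b \<xi>
  for M :: "'p manifold3" and a b \<xi> +
  fixes D :: "real set" and w :: "real \<Rightarrow> real \<Rightarrow> real" and E :: "real \<Rightarrow> 'p \<Rightarrow> 'p chart \<Rightarrow> real^3 \<Rightarrow> real^3"
  assumes D: "finite D" and E: "\<And>i. i \<in> D \<Longrightarrow> endo (E i)" and w: "\<And>i. continuous_on UNIV (w i)"
    and pos: "\<And>t. t \<in> {a..b} \<Longrightarrow> positive_at_zeros (\<xi> t) (endo_sum D (\<lambda>i. w i t) E)"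
begin

definition weighted :: "real \<Rightarrow> 'p \<Rightarrow> 'p chart \<Rightarrow> real^3 \<Rightarrow> real^3" where
  "weighted t = endo_sum D (\<lambda>i. w i t) E"

definition scaled :: "real \<Rightarrow> real \<Rightarrow> 'p \<Rightarrow> 'p chart \<Rightarrow> real^3 \<Rightarrow> real^3" where
  "scaled t s = endo_sum D (\<lambda>i. s * w i t) E"

definition path_field :: "real \<times> real \<Rightarrow> 'p field" where
  "path_field z = deform (\<xi> (fst z)) (scaled (fst z) (snd z))"

lemma endo_weighted: "endo (weighted t)"
  unfolding weighted_def by (rule endo_endo_sum) (rule E)

lemma endo_scaled: "endo (scaled t s)"
  unfolding scaled_def by (rule endo_endo_sum) (rule E)

lemma dual_scaled: "dual (scaled t s) c \<alpha> = (\<lambda>y. s *\<^sub>R dual (weighted t) c \<alpha> y)"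
  by (simp add: fun_eq_iff scaled_def weighted_def dual_endo_sum scaleR_sum_right)

lemma C1lim_weighted:
  assumes c: "c \<in> atlas M" and x: "x \<in> img_ch c" and \<alpha>: "C1lim F \<alpha> \<alpha>0 x" and h: "(h \<longlongrightarrow> t0) F"
  shows "C1lim F (\<lambda>s. dual (weighted (h s)) c (\<alpha> s)) (dual (weighted t0) c \<alpha>0) x"
proof -
  have e: "dual (weighted t) c \<beta> = (\<lambda>y. \<Sum>i\<in>D. w i t *\<^sub>R dual (E i) c \<beta> y)" for t \<beta>
    by (simp add: fun_eq_iff weighted_def dual_endo_sum)
  show ?thesis
    unfolding e
  proof (intro C1lim_sum D C1lim_bilinear[OF bounded_bilinear_scaleR])
    show "C1lim F (\<lambda>s y. w i (h s)) (\<lambda>y. w i t0) x" for i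
      by (rule C1lim_scalar[OF continuous_on_tendsto_compose[OF w h]]) auto
    show "C1lim F (\<lambda>s. dual (E i) c (\<alpha> s)) (dual (E i) c \<alpha>0) x" if "i \<in> D" for i
      by (rule C1lim_dual[OF E[OF that] c x \<alpha>])
  qed
qed

text \<open>At s = 0 only nondegeneracy is recorded, since \<xi> t itself may fail to be
  contact.\<close>

definition contact_form_at :: "real \<Rightarrow> real \<Rightarrow> 'p \<Rightarrow> bool" where
  "contact_form_at t s p \<longleftrightarrow> (\<exists>c\<in>charts_at M p. \<exists>W \<alpha>. map_ch c p \<in> W \<and> vector_form (\<xi> t) c W \<alpha> \<and>
    \<alpha> (map_ch c p) + dual (scaled t s) c \<alpha> (map_ch c p) \<noteq> 0 \<and>
    (s > 0 \<longrightarrow> 0 < wedge2 (\<lambda>y. \<alpha> y + dual (scaled t s) c \<alpha> y) (\<lambda>y. \<alpha> y + dual (scaled t s) c \<alpha> y) (map_ch c p)))"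

text \<open>\<alpha> + s \<beta> has wedge square \<open>?aa\<close> + s \<open>?r\<close>. Near a
  contact point the sum is positive for small s; near any other point \<open>?r\<close> is positive,
  and \<open>?aa\<close> \<ge> 0 because \<xi> t is a confoliation.\<close>

lemma contact_form_at_local:
  assumes t0: "t0 \<in> {a..b}"
  shows "\<forall>\<^sub>F z in inf (nhds t0) (principal {a..b}) \<times>\<^sub>F inf (nhds 0) (principal {0..}).
    \<forall>p\<in>points M. contact_form_at (fst z) (snd z) p"
proof (rule points_eventually)
  fix p assume p: "p \<in> points M"
  let ?F = "inf (nhds t0) (principal {a..b})" and ?G = "inf (nhds (0::real)) (principal {0..})"
  let ?H = "?F \<times>\<^sub>F ?G"
  obtain c W \<alpha> where c: "c \<in> charts_at M p" and pW: "map_ch c p \<in> W" and \<alpha>0: "vector_form (\<xi> t0) c W (\<alpha> t0)"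
    and \<alpha>: "\<forall>\<^sub>F t in ?F. vector_form (\<xi> t) c W (\<alpha> t)" and lim: "\<And>x. x \<in> W \<Longrightarrow> C1lim ?F \<alpha> (\<alpha> t0) x"
    by (rule family_converges_at[OF family t0 p]) auto
  note A = charts_atD[OF c]
  have W: "W \<subseteq> img_ch c" "open W" using \<alpha>0 Cinf_open by (auto simp: vector_form_def)
  let ?x = "map_ch c p"
  have xi: "?x \<in> img_ch c" using A by blast
  have fst0: "(fst \<longlongrightarrow> t0) ?H"
  proof -
    have "filterlim fst ?F ?H" by (rule filterlim_fst)
    then show ?thesis by (rule filterlim_mono) auto
  qed
  have snd0: "(snd \<longlongrightarrow> 0) ?H"
  proof -
    have "filterlim snd ?G ?H" by (rule filterlim_snd)
    then show ?thesis by (rule filterlim_mono) auto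
  qed
  have l1: "C1lim ?H (\<lambda>z. \<alpha> (fst z)) (\<alpha> t0) ?x" by (rule C1lim_filter[OF lim[OF pW] filterlim_fst])
  have l2: "C1lim ?H (\<lambda>z. dual (weighted (fst z)) c (\<alpha> (fst z))) (dual (weighted t0) c (\<alpha> t0)) ?x"
    by (rule C1lim_weighted[OF A(1) xi l1 fst0])
  let ?\<beta> = "\<lambda>t. dual (weighted t) c (\<alpha> t)"
  let ?N = "?H \<times>\<^sub>F nhds ?x"
  have s0: "((\<lambda>z. snd (fst z)) \<longlongrightarrow> 0) ?N" by (rule filterlim_compose[OF snd0 filterlim_fst])
  let ?aa = "\<lambda>z. wedge2 (\<alpha> (fst (fst z))) (\<alpha> (fst (fst z))) (snd z)"
    and ?r = "\<lambda>z. 2 * wedge2 (\<alpha> (fst (fst z))) (?\<beta> (fst (fst z))) (snd z)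
      + snd (fst z) * wedge2 (?\<beta> (fst (fst z))) (?\<beta> (fst (fst z))) (snd z)"
  have lr: "(?r \<longlongrightarrow> 2 * wedge2 (\<alpha> t0) (?\<beta> t0) ?x + 0 * wedge2 (?\<beta> t0) (?\<beta> t0) ?x) ?N"
    by (intro tendsto_add tendsto_mult tendsto_const s0 tendsto_wedge2[OF l1 l2] tendsto_wedge2[OF l2 l2])
  have lt: "((\<lambda>z. ?aa z + snd (fst z) * ?r z) \<longlongrightarrow>
      wedge2 (\<alpha> t0) (\<alpha> t0) ?x + 0 * (2 * wedge2 (\<alpha> t0) (?\<beta> t0) ?x + 0 * wedge2 (?\<beta> t0) (?\<beta> t0) ?x)) ?N"
    by (intro tendsto_add[OF tendsto_wedge2[OF l1 l1]] tendsto_mult[OF s0 lr])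
  have base: "\<forall>\<^sub>F z in ?N. fst (fst z) \<in> {a..b} \<and> vector_form (\<xi> (fst (fst z))) c W (\<alpha> (fst (fst z))) \<and> 0 \<le> snd (fst z) \<and> snd z \<in> W"
  proof (rule eventually_prodI[OF _ W(2) pW])
    have "\<forall>\<^sub>F t in ?F. t \<in> {a..b}" by (simp add: eventually_inf_principal)
    from eventually_conj[OF this \<alpha>]
    have "\<forall>\<^sub>F z in ?H. fst z \<in> {a..b} \<and> vector_form (\<xi> (fst z)) c W (\<alpha> (fst z))"
      using eventually_compose_filterlim[OF _ filterlim_fst, of _ ?F ?G] by blast
    moreover have "\<forall>\<^sub>F s in ?G. 0 \<le> s" by (simp add: eventually_inf_principal)
    then have "\<forall>\<^sub>F z in ?H. 0 \<le> snd z"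
      using eventually_compose_filterlim[OF _ filterlim_snd, of _ ?G ?F] by blast
    ultimately show "\<forall>\<^sub>F z in ?H. (fst z \<in> {a..b} \<and> vector_form (\<xi> (fst z)) c W (\<alpha> (fst z))) \<and> 0 \<le> snd z"
      by (rule eventually_conj)
  qed auto
  have nz: "\<forall>\<^sub>F z in ?N. \<alpha> (fst (fst z)) (snd z) + snd (fst z) *\<^sub>R ?\<beta> (fst (fst z)) (snd z) \<noteq> 0"
  proof (rule tendsto_imp_eventually_ne)
    show "((\<lambda>z. \<alpha> (fst (fst z)) (snd z) + snd (fst z) *\<^sub>R ?\<beta> (fst (fst z)) (snd z)) \<longlongrightarrow>
        \<alpha> t0 ?x + 0 *\<^sub>R ?\<beta> t0 ?x) ?N"
      by (intro tendsto_add tendsto_scaleR s0 C1limD(3)[OF l1] C1limD(3)[OF l2])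
    show "\<alpha> t0 ?x + 0 *\<^sub>R ?\<beta> t0 ?x \<noteq> 0" using \<alpha>0 pW by (simp add: vector_form_def)
  qed
  \<comment> \<open>Only in the second case is s > 0 needed, which is why one neighbourhood of s = 0
    can serve despite zeros of \<open>?aa\<close>.\<close>
  have alt: "(\<forall>\<^sub>F z in ?N. 0 < ?r z) \<or> (\<forall>\<^sub>F z in ?N. 0 < ?aa z + snd (fst z) * ?r z)"
  proof (cases "wedge_sign (\<xi> t0) p 0")
    case True
    then have "0 < pairing (\<xi> t0) (weighted t0) p" using pos[OF t0] p by (simp add: positive_at_zeros_def weighted_def)
    then have "0 < wedge2 (\<alpha> t0) (?\<beta> t0) ?x"
      using pairing_sgn[OF tang[OF t0] c pW \<alpha>0 endo_weighted[of t0]] by (simp add: sgn_1_pos)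
    then have "\<forall>\<^sub>F z in ?N. 0 < ?r z" by (intro order_tendstoD(1)[OF lr]) simp
    then show ?thesis ..
  next
    case False
    then have "0 < wedge2 (\<alpha> t0) (\<alpha> t0) ?x" using wedge_nonneg[OF t0 c \<alpha>0 pW] by simp
    then have "\<forall>\<^sub>F z in ?N. 0 < ?aa z + snd (fst z) * ?r z" by (intro order_tendstoD(1)[OF lt]) simp
    then show ?thesis ..
  qed
  have "\<forall>\<^sub>F z in ?N. (0 < ?r z \<or> 0 < ?aa z + snd (fst z) * ?r z)"
    using alt by (elim disjE) (erule eventually_mono, simp)+
  with base nz have "\<forall>\<^sub>F z in ?N. contact_form_at (fst (fst z)) (snd (fst z)) (inv_ch c (snd z))"
  proof eventually_elim
    case (elim z)
    let ?t = "fst (fst z)" and ?s = "snd (fst z)" and ?p = "inv_ch c (snd z)"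
    have t: "?t \<in> {a..b}" and v: "vector_form (\<xi> ?t) c W (\<alpha> ?t)" and s: "0 \<le> ?s" and z: "snd z \<in> W" using elim by auto
    have zi: "snd z \<in> img_ch c" using z W by blast
    have cp: "c \<in> charts_at M ?p" by (rule charts_atI[OF A(1) inv_dom[OF A(1) zi]])
    have m: "map_ch c ?p = snd z" by (rule map_inv[OF A(1) zi])
    have zW: "map_ch c ?p \<in> W" using z m by simp
    have wn: "0 \<le> ?aa z" using wedge_nonneg(1)[OF t cp v zW] m by simp
    have ex: "wedge2 (\<lambda>y. \<alpha> ?t y + ?s *\<^sub>R ?\<beta> ?t y) (\<lambda>y. \<alpha> ?t y + ?s *\<^sub>R ?\<beta> ?t y) (snd z) = ?aa z + ?s * ?r z"
      using wedge2_square[OF dual_differentiable(2,1)[OF endo_weighted cp zW v], of ?s] m by simp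
    have "0 < ?aa z + ?s * ?r z" if "?s > 0"
      using elim(3)
    proof
      assume "0 < ?r z"
      then have "0 < ?s * ?r z" using that by (rule mult_pos_pos[rotated])
      then show ?thesis using wn by linarith
    qed
    then show ?case
      unfolding contact_form_at_def dual_scaled
      by (intro bexI[OF _ cp] exI[of _ W] exI[of _ "\<alpha> ?t"] conjI zW v) (use elim(2) ex m in auto)
  qed
  then show "\<exists>c\<in>charts_at M p. \<forall>\<^sub>F z in ?H \<times>\<^sub>F nhds (map_ch c p). contact_form_at (fst (fst z)) (snd (fst z)) (inv_ch c (snd z))"
    using c by blast
qed

text \<open>The time t takes the place of the space variable in
  \<open>eventually_on_compact\<close>, with s running along the filter at 0.\<close>

lemma contact_form_at_uniform:
  obtains s1 where "s1 > 0" "\<And>t s p. t \<in> {a..b} \<Longrightarrow> 0 \<le> s \<Longrightarrow> s \<le> s1 \<Longrightarrow> p \<in> points M \<Longrightarrow> contact_form_at t s p"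
proof -
  let ?G = "inf (nhds (0::real)) (principal {0..})"
  have "\<forall>\<^sub>F s in ?G. \<forall>t\<in>{a..b}. (\<lambda>(s, t). t \<in> {a..b} \<longrightarrow> (\<forall>p\<in>points M. contact_form_at t s p)) (s, t)"
  proof (rule eventually_on_compact[OF compact_Icc])
    fix t0 assume t0: "t0 \<in> {a..b}"
    obtain P R where PR: "eventually P (inf (nhds t0) (principal {a..b}))" "eventually R ?G"
      "\<And>t s. P t \<Longrightarrow> R s \<Longrightarrow> \<forall>p\<in>points M. contact_form_at t s p"
      using contact_form_at_local[OF t0] unfolding eventually_prod_filter by auto
    from PR(1) obtain U where U: "open U" "t0 \<in> U" "\<And>t. t \<in> U \<Longrightarrow> t \<in> {a..b} \<Longrightarrow> P t"
      unfolding eventually_inf_principal eventually_nhds by blast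
    show "\<forall>\<^sub>F z in ?G \<times>\<^sub>F nhds t0. (\<lambda>(s, t). t \<in> {a..b} \<longrightarrow> (\<forall>p\<in>points M. contact_form_at t s p)) z"
      by (rule eventually_prodI[OF PR(2) U(1,2)]) (use U(3) PR(3) in auto)
  qed
  then obtain d where d: "d > 0" "\<And>s. dist s 0 < d \<Longrightarrow> 0 \<le> s \<Longrightarrow> \<forall>t\<in>{a..b}. \<forall>p\<in>points M. contact_form_at t s p"
    unfolding eventually_inf_principal eventually_nhds_metric by auto
  show thesis
  proof (rule that[of "d / 2"])
    fix t s p assume "t \<in> {a..b}" "0 \<le> s" "s \<le> d / 2" "p \<in> points M"
    then show "contact_form_at t s p" using d(2)[of s] d(1) by (simp add: dist_real_def)
  qed (use d in simp)
qed

lemma path_field_nondegenerate: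
  assumes t: "t \<in> {a..b}" and p: "p \<in> points M" and cf: "contact_form_at t s p"
  shows "deform (\<xi> t) (scaled t s) p \<noteq> tangent_space M p"
proof -
  obtain c W \<alpha> where c: "c \<in> charts_at M p" "map_ch c p \<in> W" "vector_form (\<xi> t) c W \<alpha>"
    "\<alpha> (map_ch c p) + dual (scaled t s) c \<alpha> (map_ch c p) \<noteq> 0"
    using cf unfolding contact_form_at_def by (elim bexE exE conjE)
  then show ?thesis using deform_degenerate_iff[OF tang[OF t] endo_scaled c(1,3,2)] by blast
qed

lemma path_field_wedge_sign:
  assumes t: "t \<in> {a..b}" and p: "p \<in> points M" and s: "s > 0" and cf: "\<And>p. p \<in> points M \<Longrightarrow> contact_form_at t s p"
  shows "wedge_sign (path_field (t, s)) p 1"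
proof -
  obtain c W \<alpha> where c: "c \<in> charts_at M p" "map_ch c p \<in> W" "vector_form (\<xi> t) c W \<alpha>"
    "0 < wedge2 (\<lambda>y. \<alpha> y + dual (scaled t s) c \<alpha> y) (\<lambda>y. \<alpha> y + dual (scaled t s) c \<alpha> y) (map_ch c p)"
    using cf[OF p] s unfolding contact_form_at_def by blast
  have "vector_form (path_field (t, s)) c W (\<lambda>y. \<alpha> y + dual (scaled t s) c \<alpha> y)"
    unfolding path_field_def fst_conv snd_conv
    by (rule deform_vector_form[OF tang[OF t] endo_scaled charts_atD(1)[OF c(1)] c(3) path_field_nondegenerate[OF t _ cf]])
  then show ?thesis
    unfolding wedge_sign_def by (intro bexI[OF _ c(1)] exI conjI) (rule c(2), assumption, use c(4) in simp)
qed

lemma path_field_0: "t \<in> {a..b} \<Longrightarrow> p \<in> points M \<Longrightarrow> path_field (t, 0) p = \<xi> t p"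
proof -
  assume t: "t \<in> {a..b}" and p: "p \<in> points M"
  obtain c where c: "c \<in> charts_at M p" using chart_exists[OF p] by blast
  have "in_chart c (path_field (t, 0) p) = in_chart c (\<xi> t p)"
    unfolding path_field_def fst_conv snd_conv deform_in_chart[OF tang[OF t] endo_scaled c]
    by (simp add: scaled_def endo_sum_def)
  then show ?thesis
    using tang[OF t] tangential_deform p unfolding path_field_def
    by (intro plane_eqI[OF _ _ c]) (auto simp: tangential_def path_field_def)
qed

text \<open>\<open>C1lim\<close> asks for derivatives in space only, so weights that are merely
  continuous in t suffice.\<close>

lemma path_field_converges:
  assumes Q: "Q \<subseteq> {a..b} \<times> UNIV" and cf: "\<And>t s p. (t, s) \<in> Q \<Longrightarrow> p \<in> points M \<Longrightarrow> contact_form_at t s p"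
    and z0: "z0 \<in> Q"
  shows "converges (inf (nhds z0) (principal Q)) path_field (path_field z0)"
  unfolding converges_def
proof (intro conjI ballI)
  let ?F = "inf (nhds z0) (principal Q)"
  show "\<forall>\<^sub>F z in ?F. tangential (path_field z)" "tangential (path_field z0)"
    by (simp_all add: path_field_def tangential_deform)
  fix p assume p: "p \<in> points M"
  let ?t0 = "fst z0" and ?G = "inf (nhds (fst z0)) (principal {a..b})"
  have t0: "?t0 \<in> {a..b}" using Q z0 by auto
  have fG: "filterlim fst ?G ?F"
  proof (rule filterlim_inf[THEN iffD2], intro conjI)
    have "(fst \<longlongrightarrow> ?t0) (nhds z0)" by (rule tendsto_fst) (simp add: filterlim_ident)
    then show "(fst \<longlongrightarrow> ?t0) ?F" by (rule filterlim_mono) auto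
    show "filterlim fst (principal {a..b}) ?F"
      unfolding filterlim_principal eventually_inf_principal by (rule always_eventually) (use Q in auto)
  qed
  have f0: "(fst \<longlongrightarrow> ?t0) ?F" using fG by (rule filterlim_mono) auto
  have s0: "(snd \<longlongrightarrow> snd z0) ?F"
  proof -
    have "(snd \<longlongrightarrow> snd z0) (nhds z0)" by (rule tendsto_snd) (simp add: filterlim_ident)
    then show ?thesis by (rule filterlim_mono) auto
  qed
  obtain c W \<alpha> where c: "c \<in> charts_at M p" and pW: "map_ch c p \<in> W" and \<alpha>0: "vector_form (\<xi> ?t0) c W (\<alpha> ?t0)"
    and \<alpha>: "\<forall>\<^sub>F t in ?G. vector_form (\<xi> t) c W (\<alpha> t)" and lim: "\<And>x. x \<in> W \<Longrightarrow> C1lim ?G \<alpha> (\<alpha> ?t0) x"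
    by (rule family_converges_at[OF family t0 p]) auto
  note A = charts_atD[OF c]
  have W: "W \<subseteq> img_ch c" using \<alpha>0 by (auto simp: vector_form_def)
  let ?f = "\<lambda>z y. \<alpha> (fst z) y + snd z *\<^sub>R dual (weighted (fst z)) c (\<alpha> (fst z)) y"
  have v: "vector_form (path_field z) c W (?f z)" if z: "z \<in> Q" and a: "vector_form (\<xi> (fst z)) c W (\<alpha> (fst z))" for z
  proof -
    have t: "fst z \<in> {a..b}" using Q z by auto
    have "(fst z, snd z) \<in> Q" using z by simp
    note cf' = cf[OF this]
    show ?thesis
      using deform_vector_form[OF tang[OF t] endo_scaled A(1) a path_field_nondegenerate[OF t _ cf']]
      unfolding path_field_def dual_scaled .
  qed
  show "converges_at ?F path_field (path_field z0) p"
    unfolding converges_at_def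
  proof (intro bexI[OF _ c] exI conjI ballI)
    show "map_ch c p \<in> W" by (rule pW)
    show "vector_form (path_field z0) c W (?f z0)" by (rule v[OF z0 \<alpha>0])
    have "\<forall>\<^sub>F z in ?F. vector_form (\<xi> (fst z)) c W (\<alpha> (fst z))"
      by (rule eventually_compose_filterlim[OF \<alpha> fG])
    moreover have "\<forall>\<^sub>F z in ?F. z \<in> Q" by (simp add: eventually_inf_principal)
    ultimately show "\<forall>\<^sub>F z in ?F. vector_form (path_field z) c W (?f z)"
      by eventually_elim (rule v)
    fix x assume x: "x \<in> W"
    then have xi: "x \<in> img_ch c" using W by blast
    have l: "C1lim ?F (\<lambda>z. \<alpha> (fst z)) (\<alpha> ?t0) x" by (rule C1lim_filter[OF lim[OF x] fG])
    show "C1lim ?F ?f (?f z0) x"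
      by (intro C1lim_add l C1lim_bilinear[OF bounded_bilinear_scaleR] C1lim_scalar[OF s0] C1lim_weighted[OF A(1) xi l f0])
  qed
qed

end

context confoliation_path
begin

text \<open>Along \<open>Q\<close> every deformed field is contact: where s > 0 by the choice of s1,
  and s = 0 occurs only at the two endpoints, which are contact by assumption. By stability, isotopy
  classes are open in the connected set \<open>Q\<close>.\<close>

lemma endpoints_isotopic_to:
  assumes wa: "\<And>p. p \<in> points M \<Longrightarrow> wedge_sign (\<xi> a) p 1" and wb: "\<And>p. p \<in> points M \<Longrightarrow> wedge_sign (\<xi> b) p 1"
  shows "isotopic_to (\<xi> a) (\<xi> b)"
proof -
  obtain D w E where P: "finite (D :: real set)" "\<And>i. i \<in> D \<Longrightarrow> endo (E i)" "\<And>i. continuous_on UNIV (w i :: real \<Rightarrow> real)"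
    "\<And>t. t \<in> {a..b} \<Longrightarrow> positive_at_zeros (\<xi> t) (endo_sum D (\<lambda>i. w i t) E)"
    by (rule positive_path) auto
  interpret positive_deformation M a b \<xi> D w E by unfold_locales (fact P)+
  let ?\<eta> = path_field
  obtain s1 where s1: "s1 > 0"
    "\<And>t s p. t \<in> {a..b} \<Longrightarrow> 0 \<le> s \<Longrightarrow> s \<le> s1 \<Longrightarrow> p \<in> points M \<Longrightarrow> contact_form_at t s p"
    using contact_form_at_uniform by blast
  define Q where "Q = {a} \<times> {0..s1} \<union> {a..b} \<times> {s1} \<union> {b} \<times> {0..s1}"
  have Qab: "Q \<subseteq> {a..b} \<times> UNIV" using ab by (auto simp: Q_def)
  have cf: "contact_form_at t s p" if "(t, s) \<in> Q" "p \<in> points M" for t s p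
    by (rule s1(2)) (use that ab s1(1) in \<open>auto simp: Q_def\<close>)
  have Qc: "connected Q"
    unfolding Q_def
  proof (intro connected_Un connected_Times connected_Icc connected_sing)
    have "(a, s1) \<in> {a} \<times> {0..s1} \<inter> {a..b} \<times> {s1}" using ab s1(1) by auto
    then show "{a} \<times> {0..s1} \<inter> {a..b} \<times> {s1} \<noteq> {}" by blast
    have "(b, s1) \<in> ({a} \<times> {0..s1} \<union> {a..b} \<times> {s1}) \<inter> {b} \<times> {0..s1}" using ab s1(1) by auto
    then show "({a} \<times> {0..s1} \<union> {a..b} \<times> {s1}) \<inter> {b} \<times> {0..s1} \<noteq> {}" by blast
  qed
  have T: "tangential (?\<eta> z)" for z by (simp add: path_field_def tangential_deform)
  have "positive_field (?\<eta> z)" if z: "z \<in> Q" for z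
  proof (rule wedge_sign_positive_field[OF T])
    fix p assume p: "p \<in> points M"
    obtain t s where ts: "z = (t, s)" by (cases z)
    have t: "t \<in> {a..b}" using z Qab ts by auto
    show "wedge_sign (?\<eta> z) p 1"
    proof (cases "s > 0")
      case True
      show ?thesis unfolding ts by (rule path_field_wedge_sign[OF t p True]) (rule cf, use z ts in auto)
    next
      case False
      then have "s = 0" "t = a \<or> t = b" using z ts s1(1) by (auto simp: Q_def)
      then have "wedge_sign (\<xi> t) p 1" using wa[OF p] wb[OF p] by blast
      then have "wedge_sign (?\<eta> (t, 0)) p 1" by (rule wedge_sign_cong[rotated]) (simp add: path_field_0[OF t])
      then show ?thesis using ts \<open>s = 0\<close> by simp
    qed
  qed
  then have stab: "\<forall>\<^sub>F y in inf (nhds z) (principal Q). isotopic_to (?\<eta> z) (?\<eta> y) \<and> isotopic_to (?\<eta> y) (?\<eta> z)" if "z \<in> Q" for z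
    using contact_stability[OF path_field_converges[OF Qab cf that]] that by blast
  have aQ: "(a, 0) \<in> Q" "(b, 0) \<in> Q" using s1(1) by (auto simp: Q_def)
  have "isotopic_to (?\<eta> (a, 0)) (?\<eta> (b, 0)) \<and> isotopic_to (?\<eta> (b, 0)) (?\<eta> (a, 0))"
  \<comment> \<open>The relation is symmetrised because \<open>contact_stability\<close> yields both
    directions, which spares a separate symmetry proof for \<open>isotopic_to\<close>.\<close>
  proof (rule connected_equivalence_relation[OF Qc aQ, where R="\<lambda>y z. isotopic_to (?\<eta> y) (?\<eta> z) \<and> isotopic_to (?\<eta> z) (?\<eta> y)"])
    fix x y z assume "isotopic_to (?\<eta> x) (?\<eta> y) \<and> isotopic_to (?\<eta> y) (?\<eta> x)" "isotopic_to (?\<eta> y) (?\<eta> z) \<and> isotopic_to (?\<eta> z) (?\<eta> y)"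
    then show "isotopic_to (?\<eta> x) (?\<eta> z) \<and> isotopic_to (?\<eta> z) (?\<eta> x)" using isotopic_to_trans T by blast
  next
    fix z assume z: "z \<in> Q"
    obtain U where U: "open U" "z \<in> U" "\<And>y. y \<in> U \<Longrightarrow> y \<in> Q \<Longrightarrow> isotopic_to (?\<eta> z) (?\<eta> y) \<and> isotopic_to (?\<eta> y) (?\<eta> z)"
      using stab[OF z] unfolding eventually_inf_principal eventually_nhds by blast
    show "\<exists>T. openin (top_of_set Q) T \<and> z \<in> T \<and> (\<forall>y\<in>T. isotopic_to (?\<eta> z) (?\<eta> y) \<and> isotopic_to (?\<eta> y) (?\<eta> z))"
      using U z by (intro exI[of _ "Q \<inter> U"]) (auto simp: openin_open_Int)
  qed blast
  then have "isotopic_to (?\<eta> (a, 0)) (?\<eta> (b, 0))" ..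
  then show ?thesis
    by (rule isotopic_to_cong) (use path_field_0 ab in auto)
qed

end

theorem theorem1p4:
  fixes M :: "'p manifold3" and \<xi>0 \<xi>1 :: "'p field"
  assumes "closed_oriented_3manifold M"
    and "contact_structure M \<xi>0"
    and "contact_structure M \<xi>1"
    and "connected_by_sigma_deformation M \<xi>0 \<xi>1"
  shows "isotopic M \<xi>0 \<xi>1"
proof -
  obtain a b \<xi> where d: "sigma_deformation M a b \<xi>" and e: "\<And>p. p \<in> points M \<Longrightarrow> \<xi> a p = \<xi>0 p \<and> \<xi> b p = \<xi>1 p"
    using assms(4) unfolding connected_by_sigma_deformation_def by blast
  interpret confoliation_path M a b \<xi>
    by unfold_locales (use assms(1) d in \<open>auto simp: sigma_deformation_def\<close>)
  have "isotopic_to (\<xi> a) (\<xi> b)"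
  proof (rule endpoints_isotopic_to)
    fix p assume p: "p \<in> points M"
    show "wedge_sign (\<xi> a) p 1"
      by (rule wedge_sign_cong[OF _ contact_structure_wedge_sign(1)[OF assms(2) p]]) (simp add: e)
    show "wedge_sign (\<xi> b) p 1"
      by (rule wedge_sign_cong[OF _ contact_structure_wedge_sign(1)[OF assms(3) p]]) (simp add: e)
  qed
  then show ?thesis by (rule isotopic_to_isotopic) (simp_all add: e)
qed

end
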